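(* Let $\gamma\in C^3(\partial B_1,\mathbb{R}^3)$ satisfy $|\gamma|=|\gamma'|=1$, and suppose that (the image of) $\gamma$ does not lie in a plane. Then there exist constants $C_2,C_3$ depending only on $\gamma$ such that for all sufficiently small $h>0$, $$C_1\ln\frac1h - C_1\ln\Big(\ln\frac1h\Big) - C_2 \;\le\; \frac{1}{h^2}\min_{y\in V_\gamma}E_h(y)\;\le\; C_1\ln\frac1h + C_3,$$ where $$C_1=C_1(\gamma)=\frac{1}{\ln 2}\int_{B_1\setminus B_{1/2}}|\nabla^2\tilde y|^2\,dx.$$ (In particular the minimum of $E_h$ over $V_\gamma$ is attained.)
   Context: For $r>0$, $B_r=\{x\in\mathbb{R}^2:|x|<r\}$. For $y\in W^{2,2}(B_1,\mathbb{R}^3)$ and $h>0$ define the elastic energy $$E_h(y)=\int_{B_1}\big(|\nabla y^T\nabla y-\mathrm{Id}|^2+h^2|\nabla^2 y|^2\big)\,dx.$$ For a curve $\gamma\in C^3(\partial B_1,\mathbb{R}^3)$ with $|\gamma|=|\gamma'|=1$ (where $\gamma'$ is the derivative with respect to arclength on the unit circle), let $$V_\gamma=\{y\in W^{2,2}(B_1,\mathbb{R}^3): y|_{\partial B_1}=\gamma,\ y(0)=0\},$$ and let $\tilde y(x)=|x|\,\gamma(x/|x|)$ be the 1-homogeneous map (the exact developable cone) with boundary values $\gamma$. *)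

theory Defs
  imports "HOL-Analysis.Analysis"
begin

definition pdiff :: "(real^2 \<Rightarrow> 'b::real_normed_vector) \<Rightarrow> 2 \<Rightarrow> real^2 \<Rightarrow> 'b" where
  "pdiff f i x = frechet_derivative f (at x) (axis i 1)"

text \<open>Test functions: C^1 functions with compact support in the open set U.
  (Weak derivatives defined with C^1_c test functions coincide with the usual ones.)\<close>

definition test_fun :: "(real^2) set \<Rightarrow> (real^2 \<Rightarrow> real) \<Rightarrow> bool" where
  "test_fun U \<phi> \<longleftrightarrow> (\<forall>x. \<phi> differentiable (at x)) \<and>
     (\<forall>i. continuous_on UNIV (pdiff \<phi> i)) \<and>
     (\<exists>K. compact K \<and> K \<subseteq> U \<and> (\<forall>x. x \<notin> K \<longrightarrow> \<phi> x = 0))"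

definition L2_on :: "(real^2) set \<Rightarrow> (real^2 \<Rightarrow> 'b::{banach,second_countable_topology}) \<Rightarrow> bool" where
  "L2_on U f \<longleftrightarrow> set_borel_measurable lebesgue U f \<and>
     set_integrable lebesgue U (\<lambda>x. (norm (f x))\<^sup>2)"

definition weak_pdiff :: "(real^2) set \<Rightarrow> (real^2 \<Rightarrow> real^3) \<Rightarrow> 2 \<Rightarrow> (real^2 \<Rightarrow> real^3) \<Rightarrow> bool" where
  "weak_pdiff U f i g \<longleftrightarrow> (\<forall>\<phi>. test_fun U \<phi> \<longrightarrow>
     (LINT x:U|lebesgue. pdiff \<phi> i x *\<^sub>R f x) = - (LINT x:U|lebesgue. \<phi> x *\<^sub>R g x))"

definition W22 :: "(real^2) set \<Rightarrow> (real^2 \<Rightarrow> real^3) \<Rightarrow> (real^2 \<Rightarrow> 2 \<Rightarrow> real^3)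
     \<Rightarrow> (real^2 \<Rightarrow> 2 \<Rightarrow> 2 \<Rightarrow> real^3) \<Rightarrow> bool" where
  "W22 U y Dy D2y \<longleftrightarrow> L2_on U y \<and>
     (\<forall>i. L2_on U (\<lambda>x. Dy x i) \<and> weak_pdiff U y i (\<lambda>x. Dy x i)) \<and>
     (\<forall>i j. L2_on U (\<lambda>x. D2y x i j) \<and> weak_pdiff U (\<lambda>x. Dy x i) j (\<lambda>x. D2y x i j))"

definition energy :: "real \<Rightarrow> (real^2 \<Rightarrow> 2 \<Rightarrow> real^3) \<Rightarrow> (real^2 \<Rightarrow> 2 \<Rightarrow> 2 \<Rightarrow> real^3) \<Rightarrow> real" where
  "energy h Dy D2y = (LINT x:ball 0 1|lebesgue.
      (\<Sum>i\<in>UNIV. \<Sum>j\<in>UNIV. (Dy x i \<bullet> Dy x j - (if i = j then 1 else 0))\<^sup>2)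
      + h\<^sup>2 * (\<Sum>i\<in>UNIV. \<Sum>j\<in>UNIV. (norm (D2y x i j))\<^sup>2))"

text \<open>Admissible class V_gamma. A W^{2,2} map on the 2-dimensional disc has a (unique) continuous
  representative on the closed disc; we work with that representative, which gives the
  boundary values and the value at 0 their meaning.\<close>
definition admissible :: "(real^2 \<Rightarrow> real^3) \<Rightarrow> (real^2 \<Rightarrow> real^3) \<Rightarrow> (real^2 \<Rightarrow> 2 \<Rightarrow> real^3)
     \<Rightarrow> (real^2 \<Rightarrow> 2 \<Rightarrow> 2 \<Rightarrow> real^3) \<Rightarrow> bool" where
  "admissible \<gamma> y Dy D2y \<longleftrightarrow> W22 (ball 0 1) y Dy D2y \<and> continuous_on (cball 0 1) y \<and>
     (\<forall>x\<in>sphere 0 1. y x = \<gamma> x) \<and> y 0 = 0"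

definition circ :: "real \<Rightarrow> real^2" where
  "circ t = vector [cos t, sin t]"

definition C3_circle :: "(real^2 \<Rightarrow> real^3) \<Rightarrow> bool" where
  "C3_circle \<gamma> \<longleftrightarrow> (\<exists>g1 g2 g3. (\<forall>t. ((\<gamma> \<circ> circ) has_vector_derivative g1 t) (at t) \<and>
      (g1 has_vector_derivative g2 t) (at t) \<and> (g2 has_vector_derivative g3 t) (at t)) \<and>
      continuous_on UNIV g3)"

definition cone :: "(real^2 \<Rightarrow> real^3) \<Rightarrow> real^2 \<Rightarrow> real^3" where
  "cone \<gamma> x = norm x *\<^sub>R \<gamma> (x /\<^sub>R norm x)"

definition C1const :: "(real^2 \<Rightarrow> real^3) \<Rightarrow> real" where
  "C1const \<gamma> = (1 / ln 2) * (LINT x:(ball 0 1 - ball 0 (1/2))|lebesgue.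
      \<Sum>i\<in>UNIV. \<Sum>j\<in>UNIV. (norm (pdiff (pdiff (cone \<gamma>) i) j x))\<^sup>2)"

end

theory Submission
  imports Defs "HOL-Complex_Analysis.Great_Picard" "HOL-Real_Asymp.Real_Asymp"
begin

text \<open>
  Put \<open>L = ln (1/h)\<close>. For the lower bound let \<open>y\<close> be smooth with energy of order \<open>h\<^sup>2 L\<close> and write it in polar coordinates as
  \<open>p r t\<close>. The membrane term controls \<open>|p_r|\<^sup>2 - 1\<close>; as \<open>p 0 t = 0\<close> and \<open>p 1 t = g t\<close> is a unit vector, the integral of
  \<open>|p_r - g|\<^sup>2\<close> is at most a multiple of \<open>R = h L\<close>. Hence \<open>y\<close> is close to the cone for \<open>r > R\<close>. There its second angular
  derivative is \<open>(g + g'') / r\<close> plus a remainder whose product with the main term is integrated by parts in \<open>t\<close>; what is left is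
  \<open>C1 / r\<close> up to errors of bounded integral, and integrating over \<open>R < r < 1\<close> gives \<open>C1 ln (1/R) = C1 (L - ln L)\<close>. General \<open>y\<close> are
  mollified. For the upper bound the cone is smoothed at the vertex on the scale \<open>h\<close>.

  Minimizers exist although the membrane term is not convex: the inequality
  \<open>\<integral> |Dw|\<^sup>4 \<le> C (sup |w|)\<^sup>2 \<integral> |D\<^sup>2 w|\<^sup>2\<close> for \<open>w\<close> vanishing on the circle turns the uniform convergence of a minimizing
  sequence (Morrey, Arzela-Ascoli) into strong \<open>L\<^sup>4\<close> convergence of the gradients.
\<close>

section \<open>Mollification on the disc\<close>

text \<open>The cone has bending density \<open>norm (g + g'') ^ 2 / r\<^sup>2\<close>, so its
  bending energy diverges logarithmically at the vertex; C1 is the coefficient of this divergence. A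
  lower bound must exclude that some other shape saves bending over many scales. The two point
  conditions do this: each ray joins 0 to a unit vector over a unit length, so a ray that deviates
  from the straight one must be stretched, and stretching is expensive.

  Closeness is controlled by membrane energy over \<open>h\<close>, hence is of order
  \<open>h\<close> times the logarithm in the a priori energy bound; the polar weight
  \<open>r\<close>, which weakens the membrane term near the vertex, costs the same amount. Below
  that radius nothing is known about the map. Above it there is still no pointwise information on
  angular derivatives: only exact derivatives of periodic functions of the angle can be discarded,
  and one derivative then falls on \<open>g + g''\<close>, which is why three derivatives of the
  curve appear.

  The membrane term is quartic in the gradient, so fourth powers of gradients have to be integrable
  before the energy of a general map means anything.\<close>

abbreviation disc :: "(real^2) measure" where "disc \<equiv> lebesgue_on (ball 0 1)"

lemma sets_ball_lebesgue [simp]: "ball a r \<in> sets lebesgue" for a :: "real^2"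
  by (simp add: lmeasurable_ball fmeasurableD)

lemma LINT_disc: "(LINT x:ball 0 1|lebesgue. f x) = integral\<^sup>L disc f"
  for f :: "real^2 \<Rightarrow> 'b::{banach,second_countable_topology}"
  unfolding set_lebesgue_integral_def by (subst integral_restrict_space) simp_all

lemma set_integrable_disc: "set_integrable lebesgue (ball 0 1) f \<longleftrightarrow> integrable disc f"
  for f :: "real^2 \<Rightarrow> 'b::{banach,second_countable_topology}"
  unfolding set_integrable_def by (subst integrable_restrict_space) simp_all

lemma L2_on_disc: "L2_on (ball 0 1) f \<longleftrightarrow> f \<in> borel_measurable disc \<and> integrable disc (\<lambda>x. (norm (f x))\<^sup>2)"
  for f :: "real^2 \<Rightarrow> 'b::{banach,second_countable_topology}"
  unfolding L2_on_def set_borel_measurable_def set_integrable_disc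
  by (subst borel_measurable_restrict_space_iff) simp_all

lemma weak_pdiff_disc: "weak_pdiff (ball 0 1) f i g \<longleftrightarrow> (\<forall>\<phi>. test_fun (ball 0 1) \<phi> \<longrightarrow>
     (\<integral>x. pdiff \<phi> i x *\<^sub>R f x \<partial>disc) = - (\<integral>x. \<phi> x *\<^sub>R g x \<partial>disc))"
  unfolding weak_pdiff_def LINT_disc ..

lemma AE_disc_iff: "(AE x in disc. P x) \<longleftrightarrow> (AE x in lebesgue. x \<in> ball 0 1 \<longrightarrow> P x)"
  by (subst AE_restrict_space_iff) simp_all

lemma integral_disc_lborel:
  fixes f :: "real^2 \<Rightarrow> 'b::{banach,second_countable_topology}"
  assumes "f \<in> borel_measurable borel" "\<And>x. x \<notin> ball 0 1 \<Longrightarrow> f x = 0"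
  shows "integral\<^sup>L disc f = integral\<^sup>L lborel f" "integrable disc f \<longleftrightarrow> integrable lborel f"
proof -
  have e: "(\<lambda>x. indicator (ball 0 1) x *\<^sub>R f x) = f" using assms(2) by (auto simp: indicator_def fun_eq_iff)
  show "integral\<^sup>L disc f = integral\<^sup>L lborel f"
    by (subst integral_restrict_space) (simp_all only: e, simp_all add: integral_completion assms)
  show "integrable disc f \<longleftrightarrow> integrable lborel f"
    by (subst integrable_restrict_space) (simp_all only: e, simp_all add: integrable_completion assms)
qed

text \<open>Fubini and affine substitution are applied to \<open>lborel\<close>, while
  \<open>L2_on\<close> only gives Lebesgue measurability on the disc; a Borel version extended by
  zero bridges the two. The representative is assembled from the three real components.\<close>

lemma borel_rep:
  fixes f :: "real^2 \<Rightarrow> real^3"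
  assumes "f \<in> borel_measurable disc"
  obtains f' where "f' \<in> borel_measurable borel" "\<And>x. x \<notin> ball 0 1 \<Longrightarrow> f' x = 0" "AE x in disc. f x = f' x"
proof -
  let ?g = "\<lambda>x. indicator (ball 0 1) x *\<^sub>R f x"
  have g: "?g \<in> borel_measurable (completion lborel)"
    using assms by (subst (asm) borel_measurable_restrict_space_iff) simp_all
  have "\<exists>h\<in>borel_measurable lborel. AE x in lborel. ?g x $ c = h x" for c
    by (rule completion_ex_borel_measurable_real) (use g in \<open>intro measurable_compose[OF g] borel_measurable_continuous_onI continuous_intros\<close>)
  then have "\<forall>c. \<exists>h. h \<in> borel_measurable lborel \<and> (AE x in lborel. ?g x $ c = h x)" by blast
  then have "\<exists>h. \<forall>c. h c \<in> borel_measurable lborel \<and> (AE x in lborel. ?g x $ c = h c x)" by (rule choice)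
  then obtain h where h: "\<And>c. h c \<in> borel_measurable lborel" "\<And>c. AE x in lborel. ?g x $ c = h c x" by blast
  define f' where "f' = (\<lambda>x. indicator (ball 0 1) x *\<^sub>R (\<Sum>c\<in>UNIV. h c x *\<^sub>R axis c (1::real)))"
  have m: "f' \<in> borel_measurable borel"
    unfolding f'_def using h(1) by (intro borel_measurable_scaleR borel_measurable_sum borel_measurable_indicator) auto
  have "AE x in lborel. \<forall>c. ?g x $ c = h c x" using h(2) by (simp add: AE_all_countable)
  then have "AE x in lebesgue. \<forall>c. ?g x $ c = h c x" by (rule AE_completion)
  then have "AE x in lebesgue. x \<in> ball 0 1 \<longrightarrow> f x = f' x"
    by eventually_elim (auto simp: f'_def vec_eq_iff axis_def if_distrib cong: if_cong)
  then show ?thesis using that[of f'] m unfolding AE_disc_iff by (auto simp: f'_def)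
qed

lemma finite_measure_disc: "finite_measure disc" by (rule finite_measure_lebesgue_on) simp

section \<open>The averaging kernel and its first-order expansion\<close>

lemma nn_integral_affine:
  fixes f :: "real^2 \<Rightarrow> ennreal"
  assumes [measurable]: "f \<in> borel_measurable borel" and "c \<noteq> 0"
  shows "(\<integral>\<^sup>+x. f x \<partial>lborel) = ennreal (c\<^sup>2) * (\<integral>\<^sup>+x. f (t + c *\<^sub>R x) \<partial>lborel)"
  by (subst lborel_affine[OF \<open>c \<noteq> 0\<close>, of t])
     (simp add: nn_integral_density nn_integral_distr nn_integral_cmult)

text \<open>The kernel is only $C^1$, which suffices: smoothness of higher order is gained by
  mollifying the weak derivatives.\<close>

definition kern :: "real^2 \<Rightarrow> real" where "kern x = (max 0 (1 - x \<bullet> x))\<^sup>2"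
definition kgrad :: "real^2 \<Rightarrow> real^2" where "kgrad x = (- 4 * max 0 (1 - x \<bullet> x)) *\<^sub>R x"

text \<open>The square of the positive part has derivative \<open>2 * max 0 s\<close>, which is
  Lipschitz with constant 2, and this is the resulting second-order remainder. There is no second
  derivative at 0, so sign cases replace Taylor's theorem.\<close>

lemma max0_sq_taylor: "\<bar>(max 0 (s+t))\<^sup>2 - (max 0 s)\<^sup>2 - 2 * max 0 s * t\<bar> \<le> t\<^sup>2" for s t :: real
proof -
  consider "s \<ge> 0" "s + t \<ge> 0" | "s \<ge> 0" "s + t < 0" | "s < 0" "s + t \<ge> 0" | "s < 0" "s+t < 0" by linarith
  then show ?thesis
  proof cases
    case 1 then show ?thesis by (simp add: power2_eq_square algebra_simps)
  next
    case 2
    have "\<bar>- (s\<^sup>2) - 2 * s * t\<bar> \<le> t\<^sup>2"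
    proof -
      have "s * (s + t) \<le> 0" using 2 by (intro mult_nonneg_nonpos) auto
      then have "s * s + s * t \<le> 0" by (simp add: distrib_left)
      moreover have "0 \<le> s * s" by simp
      ultimately have "- (s * s) - 2 * (s * t) \<ge> 0" by linarith
      then have "- (s\<^sup>2) - 2 * s * t \<ge> 0" by (simp add: power2_eq_square mult.assoc)
      moreover have "0 \<le> (s+t)\<^sup>2" by simp
      ultimately show ?thesis by (simp add: power2_sum)
    qed
    then show ?thesis using 2 by (simp add: max_def)
  next
    case 3
    have "(s+t)\<^sup>2 \<le> t\<^sup>2" using 3 by (intro power_mono) auto
    then show ?thesis using 3 by (simp add: max_def)
  next
    case 4 then show ?thesis by (simp add: max_def)
  qed
qed

text \<open>The bound is uniform in \<open>a\<close>, which is what differentiation under the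
  integral sign needs. Within radius 2 the expansion of the squared positive part gives 25 and the
  term \<open>h \<bullet> h\<close> gives 2; beyond it both points lie where the kernel
  vanishes.\<close>

lemma kern_taylor:
  assumes "norm h \<le> 1"
  shows "\<bar>kern (a + h) - kern a - kgrad a \<bullet> h\<bar> \<le> 27 * (norm h)\<^sup>2"
proof (cases "norm a \<le> 2")
  case True
  define s t where "s = 1 - a \<bullet> a" and "t = - 2 * (a \<bullet> h) - h \<bullet> h"
  have st: "1 - (a+h) \<bullet> (a+h) = s + t" by (simp add: s_def t_def inner_simps inner_commute)
  have e: "kern (a + h) - kern a - kgrad a \<bullet> h = ((max 0 (s+t))\<^sup>2 - (max 0 s)\<^sup>2 - 2 * max 0 s * t) - 2 * max 0 s * (h \<bullet> h)"
    unfolding kern_def kgrad_def st by (simp add: s_def t_def algebra_simps)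
  have "\<bar>a \<bullet> h\<bar> \<le> 2 * norm h" using Cauchy_Schwarz_ineq2[of a h] True mult_right_mono[of "norm a" 2 "norm h"] by auto
  moreover have "h \<bullet> h \<le> norm h" using assms mult_left_mono[of "norm h" 1 "norm h"] by (simp add: dot_square_norm power2_eq_square)
  ultimately have "\<bar>t\<bar> \<le> 5 * norm h" unfolding t_def by (smt (verit) inner_ge_zero)
  then have "t\<^sup>2 \<le> (5 * norm h)\<^sup>2" by (intro abs_le_square_iff[THEN iffD1]) simp
  then have 1: "t\<^sup>2 \<le> 25 * (norm h)\<^sup>2" by (simp add: power_mult_distrib)
  have "max 0 s \<le> 1" by (simp add: s_def)
  then have "max 0 s * (h \<bullet> h) \<le> 1 * (h \<bullet> h)" by (intro mult_right_mono) auto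
  moreover have "0 \<le> max 0 s * (h \<bullet> h)" by (intro mult_nonneg_nonneg) auto
  ultimately have 2: "\<bar>2 * max 0 s * (h \<bullet> h)\<bar> \<le> 2 * (norm h)\<^sup>2" by (simp add: dot_square_norm)
  show ?thesis unfolding e using max0_sq_taylor[of s t] 1 2 by (smt (verit))
next
  case False
  then have "norm (a + h) \<ge> 1" using assms norm_triangle_ineq4[of "a + h" h] by simp
  then have "(a+h) \<bullet> (a+h) \<ge> 1" "a \<bullet> a \<ge> 1" using False by (simp_all add: dot_square_norm)
  then show ?thesis by (simp add: kern_def kgrad_def)
qed

lemma kern_cont [continuous_intros]: "continuous_on A kern" unfolding kern_def by (intro continuous_intros)
lemma kgrad_cont [continuous_intros]: "continuous_on A kgrad" unfolding kgrad_def by (intro continuous_intros)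
lemma kern_bd: "0 \<le> kern x" "kern x \<le> 1"
  unfolding kern_def by (auto intro!: power_le_one)
lemma kern_supp: "norm x \<ge> 1 \<Longrightarrow> kern x = 0"
  by (simp add: kern_def dot_square_norm)
lemma kgrad_supp: "norm x \<ge> 1 \<Longrightarrow> kgrad x = 0"
  by (simp add: kgrad_def dot_square_norm)
lemma kgrad_bd: "norm (kgrad x) \<le> 4"
proof (cases "norm x \<le> 1")
  case True
  have "norm (kgrad x) = 4 * (max 0 (1 - x \<bullet> x) * norm x)" by (simp add: kgrad_def)
  also have "\<dots> \<le> 4 * (1 * 1)" using True by (intro mult_left_mono mult_mono) auto
  finally show ?thesis by simp
qed (simp add: kgrad_supp)

lemma kern_has_derivative: "(kern has_derivative (\<lambda>h. kgrad a \<bullet> h)) (at a)"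
proof -
  have "((\<lambda>h. \<bar>kern (a + h) - kern a - kgrad a \<bullet> h\<bar> / norm h) \<longlongrightarrow> 0) (at 0)"
  proof (rule Lim_null_comparison)
    show "\<forall>\<^sub>F h in at 0. norm (\<bar>kern (a + h) - kern a - kgrad a \<bullet> h\<bar> / norm h) \<le> 27 * norm h"
      unfolding eventually_at
      using kern_taylor by (intro exI[of _ 1]) (auto simp: dist_norm field_simps power2_eq_square)
    show "((\<lambda>h. 27 * norm h) \<longlongrightarrow> 0) (at (0::real^2))" by (rule tendsto_eq_intros refl | simp)+
  qed
  then show ?thesis unfolding has_derivative_at by (simp add: bounded_linear_inner_right)
qed

text \<open>The value is pi / 3, but all computations go through positivity alone.\<close>

definition kmass :: real where "kmass = integral\<^sup>L lborel kern"

lemma kern_integrable: "integrable lborel kern"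
proof (rule integrableI_bounded_set[where A="cball 0 1" and B=1])
  show "emeasure lborel (cball (0::real^2) 1) < \<infinity>" by (rule emeasure_lborel_cball_finite)
  show "AE x\<in>cball 0 1 in lborel. norm (kern x) \<le> 1" using kern_bd by simp
  show "AE x in lborel. x \<notin> cball 0 1 \<longrightarrow> kern x = 0" using kern_supp by simp
qed (auto intro: borel_measurable_continuous_onI kern_cont)

lemma kmass_pos: "kmass > 0"
proof -
  have "kmass \<ge> 0" unfolding kmass_def by (simp add: kern_bd)
  moreover have "kmass \<noteq> 0"
  proof
    assume "kmass = 0"
    then have "AE x in lborel. kern x = 0"
      unfolding kmass_def by (subst (asm) integral_nonneg_eq_0_iff_AE) (auto simp: kern_bd kern_integrable)
    then have "AE x in lebesgue. x \<in> {x. kern x = 0}" by (auto dest: AE_completion)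
    moreover have "closed {x. kern x = 0}"
      by (intro closed_Collect_eq kern_cont continuous_on_const)
    ultimately have "0 \<in> {x. kern x = 0}" using mem_closed_if_AE_lebesgue by blast
    then show False by (simp add: kern_def)
  qed
  ultimately show ?thesis by simp
qed

lemma nn_kern: "(\<integral>\<^sup>+x. ennreal (kern x) \<partial>lborel) = ennreal kmass"
  unfolding kmass_def by (rule nn_integral_eq_integral[OF kern_integrable]) (simp add: kern_bd)

lemma kern_borel [measurable]: "kern \<in> borel_measurable borel"
  by (intro borel_measurable_continuous_onI kern_cont)
lemma kgrad_borel [measurable]: "kgrad \<in> borel_measurable borel"
  by (intro borel_measurable_continuous_onI kgrad_cont)

lemma nn_kern_affine:
  assumes "c \<noteq> 0"
  shows "(\<integral>\<^sup>+x. ennreal (kern (t + c *\<^sub>R x)) \<partial>lborel) = ennreal (kmass / c\<^sup>2)"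
proof -
  have "ennreal kmass = ennreal (c\<^sup>2) * (\<integral>\<^sup>+x. ennreal (kern (t + c *\<^sub>R x)) \<partial>lborel)"
    unfolding nn_kern[symmetric] using assms by (intro nn_integral_affine) auto
  then have "ennreal (1/c\<^sup>2) * ennreal kmass = ennreal (1/c\<^sup>2) * ennreal (c\<^sup>2) * (\<integral>\<^sup>+x. ennreal (kern (t + c *\<^sub>R x)) \<partial>lborel)"
    by (simp add: mult.assoc)
  then show ?thesis using assms kmass_pos by (simp add: ennreal_mult[symmetric])
qed

text \<open>A Taylor remainder that is uniform in the integration variable integrates to a multiple
  of \<open>(norm v)\<^sup>2\<close>, so the candidate derivative is checked straight from the
  definition. Only integrability of \<open>f\<close> enters, which lets mollifications of arbitrary
  L^1 functions be differentiated.\<close>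

lemma has_derivative_kernel_integral:
  fixes K :: "'a::euclidean_space \<Rightarrow> 'c \<Rightarrow> real" and G :: "'c \<Rightarrow> 'a"
    and f :: "'c \<Rightarrow> 'b::{banach,second_countable_topology}"
  assumes f: "integrable M f" and Km: "\<And>y. K y \<in> borel_measurable M" and Kb: "\<And>y z. \<bar>K y z\<bar> \<le> C"
    and Gm: "G \<in> borel_measurable M" and Gb: "\<And>z. norm (G z) \<le> C"
    and d: "d > 0" and T: "\<And>v z. norm v \<le> d \<Longrightarrow> \<bar>K (x + v) z - K x z - G z \<bullet> v\<bar> \<le> C' * (norm v)\<^sup>2"
  shows "((\<lambda>y. \<integral>z. K y z *\<^sub>R f z \<partial>M) has_derivative (\<lambda>v. \<integral>z. (G z \<bullet> v) *\<^sub>R f z \<partial>M)) (at x)"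
proof -
  have fm[measurable]: "f \<in> borel_measurable M" using f by auto
  note Km[measurable] Gm[measurable]
  have bi: "integrable M (\<lambda>z. b z *\<^sub>R f z)" if "b \<in> borel_measurable M" "\<And>z. \<bar>b z\<bar> \<le> B" for b B
  proof (rule Bochner_Integration.integrable_bound[where f="\<lambda>z. B *\<^sub>R f z"])
    show "integrable M (\<lambda>z. B *\<^sub>R f z)" using f by simp
    show "AE z in M. norm (b z *\<^sub>R f z) \<le> norm (B *\<^sub>R f z)"
      using order_trans[OF that(2) abs_ge_self] by (auto intro!: mult_right_mono)
  qed (use that(1) in measurable)
  have Ki: "integrable M (\<lambda>z. K y z *\<^sub>R f z)" for y by (rule bi[OF Km Kb])
  have Gi: "integrable M (\<lambda>z. (G z \<bullet> v) *\<^sub>R f z)" for v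
  proof (rule bi[where B="C * norm v"])
    show "\<bar>G z \<bullet> v\<bar> \<le> C * norm v" for z
      using Cauchy_Schwarz_ineq2[of "G z" v] mult_right_mono[OF Gb[of z], of "norm v"] by simp
  qed measurable
  define I where "I = (\<integral>z. norm (f z) \<partial>M)"
  let ?F = "\<lambda>y. \<integral>z. K y z *\<^sub>R f z \<partial>M" and ?D = "\<lambda>v. \<integral>z. (G z \<bullet> v) *\<^sub>R f z \<partial>M"
  have lin: "linear ?D"
    by (rule linearI) (simp_all add: inner_add_right scaleR_add_left Gi scaleR_scaleR[symmetric] del: scaleR_scaleR)
  have est: "norm (?F (x + v) - ?F x - ?D v) \<le> C' * (norm v)\<^sup>2 * I" if "norm v \<le> d" for v
  proof -
    have "?F (x + v) - ?F x - ?D v = (\<integral>z. (K (x+v) z - K x z - G z \<bullet> v) *\<^sub>R f z \<partial>M)"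
      using Ki Gi by (simp add: scaleR_diff_left)
    also have "norm \<dots> \<le> (\<integral>z. norm ((K (x+v) z - K x z - G z \<bullet> v) *\<^sub>R f z) \<partial>M)" by (rule integral_norm_bound)
    also have "\<dots> \<le> (\<integral>z. C' * (norm v)\<^sup>2 * norm (f z) \<partial>M)"
    proof (rule integral_mono)
      show "integrable M (\<lambda>z. norm ((K (x + v) z - K x z - G z \<bullet> v) *\<^sub>R f z))"
        using Ki Gi by (intro integrable_norm) (simp add: scaleR_diff_left)
      show "integrable M (\<lambda>z. C' * (norm v)\<^sup>2 * norm (f z))" using f by simp
      show "norm ((K (x+v) z - K x z - G z \<bullet> v) *\<^sub>R f z) \<le> C' * (norm v)\<^sup>2 * norm (f z)" for z
        using T[OF that, of z] by (auto intro!: mult_right_mono)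
    qed
    also have "\<dots> = C' * (norm v)\<^sup>2 * I" by (simp add: I_def)
    finally show ?thesis .
  qed
  have "((\<lambda>v. norm (?F (x + v) - ?F x - ?D v) / norm v) \<longlongrightarrow> 0) (at 0)"
  proof (rule Lim_null_comparison)
    show "\<forall>\<^sub>F v in at 0. norm (norm (?F (x + v) - ?F x - ?D v) / norm v) \<le> C' * I * norm v"
      unfolding eventually_at
      using est d by (intro exI[of _ d]) (auto simp: dist_norm field_simps power2_eq_square)
    show "((\<lambda>v. C' * I * norm v) \<longlongrightarrow> 0) (at 0)" by (rule tendsto_eq_intros refl | simp)+
  qed
  then show ?thesis unfolding has_derivative_at using lin linear_conv_bounded_linear by blast
qed

text \<open>Centred at \<open>l *\<^sub>R x\<close> instead of \<open>x\<close>. For suitable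
  \<open>l < 1\<close> the averaging ball belonging to a point of the closed disc stays inside the
  open disc, so functions known only on the disc acquire mollifications that are good past its
  boundary.\<close>

definition mollw :: "real \<Rightarrow> real \<Rightarrow> real^2 \<Rightarrow> real^2 \<Rightarrow> real" where
  "mollw l e x z = kern ((1/e) *\<^sub>R (l *\<^sub>R x - z)) / (kmass * e\<^sup>2)"

definition moll :: "real \<Rightarrow> real \<Rightarrow> (real^2 \<Rightarrow> 'b::{banach,second_countable_topology}) \<Rightarrow> real^2 \<Rightarrow> 'b" where
  "moll l e f x = (\<integral>z. mollw l e x z *\<^sub>R f z \<partial>lborel)"

lemma mollw_nonneg: "e > 0 \<Longrightarrow> 0 \<le> mollw l e x z"
  using kmass_pos by (simp add: mollw_def kern_bd)

lemma mollw_le: "e > 0 \<Longrightarrow> mollw l e x z \<le> 1 / (kmass * e\<^sup>2)"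
  using kmass_pos unfolding mollw_def by (intro divide_right_mono) (auto simp: kern_bd)

lemma mollw_eq_0: "e > 0 \<Longrightarrow> norm (l *\<^sub>R x - z) \<ge> e \<Longrightarrow> mollw l e x z = 0"
  using kern_supp[of "(1/e) *\<^sub>R (l *\<^sub>R x - z)"] by (simp add: mollw_def pos_le_divide_eq del: scaleR_diff_right)

lemma mollw_measurable [measurable]:
  "(\<lambda>(x,z). mollw l e x z) \<in> borel_measurable (lborel \<Otimes>\<^sub>M lborel)"
  "mollw l e x \<in> borel_measurable borel" "(\<lambda>x. mollw l e x z) \<in> borel_measurable borel"
  unfolding mollw_def by measurable

lemma mollw_affine_z: "mollw l e x z = 1 / (kmass * e\<^sup>2) * kern ((l/e) *\<^sub>R x + (-1/e) *\<^sub>R z)"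
  by (simp add: mollw_def scaleR_diff_right)

lemma mollw_affine_x: "mollw l e x z = 1 / (kmass * e\<^sup>2) * kern ((-1/e) *\<^sub>R z + (l/e) *\<^sub>R x)"
  by (simp add: mollw_def scaleR_diff_right)

lemma nn_kern_affine_cmult:
  assumes "c \<noteq> 0" "a \<ge> 0"
  shows "(\<integral>\<^sup>+x. ennreal (a * kern (t + c *\<^sub>R x)) \<partial>lborel) = ennreal (a * (kmass / c\<^sup>2))"
proof -
  have "(\<integral>\<^sup>+x. ennreal (a * kern (t + c *\<^sub>R x)) \<partial>lborel) = (\<integral>\<^sup>+x. ennreal a * ennreal (kern (t + c *\<^sub>R x)) \<partial>lborel)"
    by (intro nn_integral_cong ennreal_mult) (auto simp: assms kern_bd)
  also have "\<dots> = ennreal a * (\<integral>\<^sup>+x. ennreal (kern (t + c *\<^sub>R x)) \<partial>lborel)"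
    by (rule nn_integral_cmult) measurable
  also have "\<dots> = ennreal (a * (kmass / c\<^sup>2))"
    unfolding nn_kern_affine[OF assms(1)] using assms kmass_pos by (intro ennreal_mult[symmetric]) auto
  finally show ?thesis .
qed

lemma nn_mollw:
  assumes "e > 0"
  shows "(\<integral>\<^sup>+z. ennreal (mollw l e x z) \<partial>lborel) = 1"
  unfolding mollw_affine_z using assms kmass_pos
  by (subst nn_kern_affine_cmult) (auto simp: power_divide)

lemma nn_mollw_x:
  assumes "e > 0" "l > 0"
  shows "(\<integral>\<^sup>+x. ennreal (mollw l e x z) \<partial>lborel) = ennreal (1 / l\<^sup>2)"
  unfolding mollw_affine_x using assms kmass_pos
  by (subst nn_kern_affine_cmult) (auto simp: power_divide)

lemma mollw_integral:
  assumes "e > 0"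
  shows "integrable lborel (mollw l e x)" "(\<integral>z. mollw l e x z \<partial>lborel) = 1"
proof -
  show "integrable lborel (mollw l e x)"
    by (rule integrableI_nonneg) (auto simp: mollw_nonneg assms nn_mollw)
  show "(\<integral>z. mollw l e x z \<partial>lborel) = 1"
    by (rule integral_eq_nn_integral[THEN trans]) (auto simp: mollw_nonneg assms nn_mollw)
qed

lemma mollw_mult_integrable:
  fixes f :: "real^2 \<Rightarrow> 'b::{banach,second_countable_topology}"
  assumes "e > 0" "integrable lborel f"
  shows "integrable lborel (\<lambda>z. mollw l e x z *\<^sub>R f z)"
proof (rule Bochner_Integration.integrable_bound[where f="\<lambda>z. (1 / (kmass * e\<^sup>2)) *\<^sub>R f z"])
  show "integrable lborel (\<lambda>z. (1 / (kmass * e\<^sup>2)) *\<^sub>R f z)" using assms(2) by simp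
  show "AE z in lborel. norm (mollw l e x z *\<^sub>R f z) \<le> norm ((1 / (kmass * e\<^sup>2)) *\<^sub>R f z)"
    using mollw_nonneg[OF assms(1)] mollw_le[OF assms(1)] kmass_pos by (auto intro!: mult_right_mono simp del: times_divide_eq_left)
  have [measurable]: "f \<in> borel_measurable borel" using assms(2) by auto
  show "(\<lambda>z. mollw l e x z *\<^sub>R f z) \<in> borel_measurable lborel" by measurable
qed

text \<open>Expansion of the nonnegative variance of \<open>g\<close> under the probability weight
  \<open>W\<close>.\<close>

lemma weighted_jensen_square:
  fixes g :: "'a \<Rightarrow> real"
  assumes "\<And>z. W z \<ge> 0" "integrable M W" "integral\<^sup>L M W = 1"
    "integrable M (\<lambda>z. W z * g z)" "integrable M (\<lambda>z. W z * (g z)\<^sup>2)"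
  shows "(\<integral>z. W z * g z \<partial>M)\<^sup>2 \<le> (\<integral>z. W z * (g z)\<^sup>2 \<partial>M)"
proof -
  define m where "m = (\<integral>z. W z * g z \<partial>M)"
  have "0 \<le> (\<integral>z. W z * (g z - m)\<^sup>2 \<partial>M)" using assms(1) by simp
  also have "(\<lambda>z. W z * (g z - m)\<^sup>2) = (\<lambda>z. W z * (g z)\<^sup>2 - 2 * m * (W z * g z) + m\<^sup>2 * W z)"
    by (auto simp: fun_eq_iff power2_eq_square algebra_simps)
  also have "(\<integral>z. W z * (g z)\<^sup>2 - 2 * m * (W z * g z) + m\<^sup>2 * W z \<partial>M) = (\<integral>z. W z * (g z)\<^sup>2 \<partial>M) - m\<^sup>2"
    using assms by (simp add: m_def[symmetric] power2_eq_square)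
  finally show ?thesis by (simp add: m_def)
qed

text \<open>Jensen for the square, applied twice for the fourth power. The exponent 2 serves the
  second derivatives, the exponent 4 the gradients in the quartic membrane term.\<close>

lemma moll_norm_power:
  fixes f :: "real^2 \<Rightarrow> 'b::{banach,second_countable_topology}"
  assumes e: "e > 0" and p: "p = 2 \<or> p = 4" and f: "integrable lborel f"
    and i: "\<And>k. k \<le> p \<Longrightarrow> integrable lborel (\<lambda>z. norm (f z) ^ k) \<or> k = 0"
  shows "norm (moll l e f x) ^ p \<le> (\<integral>z. mollw l e x z * norm (f z) ^ p \<partial>lborel)"
proof -
  have mi: "integrable lborel (\<lambda>z. mollw l e x z * g z)" if "integrable lborel g" for g
    using mollw_mult_integrable[OF e that] by simp
  have i1: "integrable lborel (\<lambda>z. norm (f z))" using f by (rule integrable_norm)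
  have 1: "norm (moll l e f x) \<le> (\<integral>z. mollw l e x z * norm (f z) \<partial>lborel)"
    unfolding moll_def using integral_norm_bound[of lborel "\<lambda>z. mollw l e x z *\<^sub>R f z"] mollw_nonneg[OF e]
    by simp
  have "norm (moll l e f x) ^ 2 \<le> (\<integral>z. mollw l e x z * norm (f z) \<partial>lborel)\<^sup>2"
    using 1 by (intro power_mono) auto
  also have "\<dots> \<le> (\<integral>z. mollw l e x z * norm (f z) ^ 2 \<partial>lborel)"
    using mollw_nonneg[OF e] mollw_integral[OF e] mi i1 i[of 2] p by (intro weighted_jensen_square) auto
  finally have 2: "norm (moll l e f x) ^ 2 \<le> (\<integral>z. mollw l e x z * norm (f z) ^ 2 \<partial>lborel)" .
  show ?thesis
  proof (cases "p = 2")
    case False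
    then have p: "p = 4" using p by simp
    have sq: "norm (f z) ^ 4 = (norm (f z) ^ 2)\<^sup>2" for z by (simp flip: power_mult)
    have "norm (moll l e f x) ^ 4 = (norm (moll l e f x) ^ 2)\<^sup>2" by (simp flip: power_mult)
    also have "\<dots> \<le> (\<integral>z. mollw l e x z * norm (f z) ^ 2 \<partial>lborel)\<^sup>2" using 2 by (intro power_mono) auto
    also have "\<dots> \<le> (\<integral>z. mollw l e x z * norm (f z) ^ 4 \<partial>lborel)"
      unfolding sq using mollw_nonneg[OF e] mollw_integral[OF e] mi i[of 2] i[of 4] p by (intro weighted_jensen_square) (auto simp: sq[symmetric])
    finally show ?thesis using p by simp
  qed (use 2 in simp)
qed

text \<open>On the bounded support a lower power is at most 1 plus the higher one.\<close>

lemma integrable_lower_power: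
  fixes f :: "real^2 \<Rightarrow> 'b::{banach,second_countable_topology}"
  assumes [measurable]: "f \<in> borel_measurable borel" and s: "\<And>z. z \<notin> ball 0 R \<Longrightarrow> f z = 0"
    and i: "integrable lborel (\<lambda>z. norm (f z) ^ p)" and k: "0 < k" "k \<le> p"
  shows "integrable lborel (\<lambda>z. norm (f z) ^ k)"
proof (rule Bochner_Integration.integrable_bound[where f="\<lambda>z. indicator (ball 0 R) z + norm (f z) ^ p"])
  show "integrable lborel (\<lambda>z. indicator (ball 0 R) z + norm (f z) ^ p)"
    using i emeasure_lborel_ball_finite by (intro Bochner_Integration.integrable_add integrable_real_indicator) auto
  have "norm (f z) ^ k \<le> indicator (ball 0 R) z + norm (f z) ^ p" for z
  proof (cases "z \<in> ball 0 R")
    case True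
    show ?thesis
    proof (cases "norm (f z) \<le> 1")
      case True
      then have "norm (f z) ^ k \<le> 1" by (intro power_le_one) auto
      then show ?thesis using \<open>z \<in> ball 0 R\<close> by (simp add: add_increasing2)
    next
      case False
      then have "norm (f z) ^ k \<le> norm (f z) ^ p" using k by (intro power_increasing) auto
      then show ?thesis by (simp add: add_increasing)
    qed
  qed (use s k in \<open>auto simp: zero_power\<close>)
  then show "AE z in lborel. norm (norm (f z) ^ k) \<le> norm (indicator (ball 0 R) z + norm (f z) ^ p)"
    by (intro AE_I2) (simp add: abs_of_nonneg)
qed measurable

lemma moll_measurable [measurable]:
  fixes f :: "real^2 \<Rightarrow> 'b::{banach,second_countable_topology}"
  assumes [measurable]: "f \<in> borel_measurable borel"
  shows "moll l e f \<in> borel_measurable borel"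
  unfolding moll_def by measurable

text \<open>Jensen inside, then exchange of the integrals; integrating the weight over
  \<open>x\<close> rather than over \<open>z\<close> produces the Jacobian
  \<open>1 / l\<^sup>2\<close> of the dilation.\<close>

lemma moll_Lp_bound:
  fixes f :: "real^2 \<Rightarrow> 'b::{banach,second_countable_topology}"
  assumes e: "e > 0" and l: "l > 0" and p: "p = 2 \<or> p = 4" and m[measurable]: "f \<in> borel_measurable borel"
    and s: "\<And>z. z \<notin> ball 0 R \<Longrightarrow> f z = 0" and i: "integrable lborel (\<lambda>z. norm (f z) ^ p)"
  shows "(\<integral>\<^sup>+x. ennreal (norm (moll l e f x) ^ p) \<partial>lborel) \<le> ennreal (1 / l\<^sup>2) * (\<integral>\<^sup>+z. ennreal (norm (f z) ^ p) \<partial>lborel)"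
proof -
  have ii: "integrable lborel (\<lambda>z. norm (f z) ^ k) \<or> k = 0" if "k \<le> p" for k
    using integrable_lower_power[OF m s i, where k=k] that by auto
  have f: "integrable lborel f" using ii[of 1] p by (intro integrable_norm_cancel[of lborel f]) auto
  have "(\<integral>\<^sup>+x. ennreal (norm (moll l e f x) ^ p) \<partial>lborel) \<le> (\<integral>\<^sup>+x. (\<integral>\<^sup>+z. ennreal (mollw l e x z * norm (f z) ^ p) \<partial>lborel) \<partial>lborel)"
  proof (rule nn_integral_mono)
    fix x
    have "integrable lborel (\<lambda>z. mollw l e x z * norm (f z) ^ p)" using mollw_mult_integrable[OF e i] by simp
    then have "(\<integral>\<^sup>+z. ennreal (mollw l e x z * norm (f z) ^ p) \<partial>lborel) = ennreal (\<integral>z. mollw l e x z * norm (f z) ^ p \<partial>lborel)"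
      using mollw_nonneg[OF e] by (intro nn_integral_eq_integral) auto
    then show "ennreal (norm (moll l e f x) ^ p) \<le> (\<integral>\<^sup>+z. ennreal (mollw l e x z * norm (f z) ^ p) \<partial>lborel)"
      using moll_norm_power[OF e p f ii] by (simp add: ennreal_leI)
  qed
  also have "\<dots> = (\<integral>\<^sup>+z. (\<integral>\<^sup>+x. ennreal (mollw l e x z * norm (f z) ^ p) \<partial>lborel) \<partial>lborel)"
    by (rule lborel_pair.Fubini'[symmetric]) measurable
  also have "\<dots> = (\<integral>\<^sup>+z. ennreal (1 / l\<^sup>2) * ennreal (norm (f z) ^ p) \<partial>lborel)"
    using e l by (intro nn_integral_cong) (simp add: ennreal_mult mollw_nonneg nn_integral_multc nn_mollw_x)
  also have "\<dots> = ennreal (1 / l\<^sup>2) * (\<integral>\<^sup>+z. ennreal (norm (f z) ^ p) \<partial>lborel)"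
    by (rule nn_integral_cmult) measurable
  finally show ?thesis .
qed

lemma moll_diff:
  fixes f :: "real^2 \<Rightarrow> 'b::{banach,second_countable_topology}"
  assumes "e > 0" "integrable lborel f" "integrable lborel g"
  shows "moll l e (\<lambda>z. f z - g z) x = moll l e f x - moll l e g x"
  unfolding moll_def scaleR_diff_right using mollw_mult_integrable[OF assms(1)] assms(2,3) by (intro Bochner_Integration.integral_diff) auto

text \<open>A mollification is an average over one small ball. This gives uniform convergence for
  continuous functions, and with \<open>a = 0\<close>, \<open>d = 0\<close> the vanishing of the
  mollification away from the support.\<close>

lemma moll_const_dist:
  fixes f :: "real^2 \<Rightarrow> 'b::{banach,second_countable_topology}"
  assumes e: "e > 0" and f: "integrable lborel f" and b: "\<And>z. norm (l *\<^sub>R x - z) < e \<Longrightarrow> norm (f z - a) \<le> d"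
  shows "norm (moll l e f x - a) \<le> d"
proof -
  have i: "integrable lborel (\<lambda>z. mollw l e x z *\<^sub>R f z)" "integrable lborel (\<lambda>z. mollw l e x z *\<^sub>R a)"
    using mollw_mult_integrable[OF e f] mollw_integral[OF e] by auto
  have "moll l e f x - a = (\<integral>z. mollw l e x z *\<^sub>R (f z - a) \<partial>lborel)"
    unfolding moll_def using i mollw_integral[OF e, of l x] by (simp add: scaleR_diff_right)
  also have "norm \<dots> \<le> (\<integral>z. norm (mollw l e x z *\<^sub>R (f z - a)) \<partial>lborel)" by (rule integral_norm_bound)
  also have "\<dots> \<le> (\<integral>z. mollw l e x z * d \<partial>lborel)"
  proof (rule integral_mono)
    show "integrable lborel (\<lambda>z. norm (mollw l e x z *\<^sub>R (f z - a)))" using i by (intro integrable_norm) (simp add: scaleR_diff_right)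
    show "integrable lborel (\<lambda>z. mollw l e x z * d)" using mollw_integral[OF e] by simp
    show "norm (mollw l e x z *\<^sub>R (f z - a)) \<le> mollw l e x z * d" for z
      using b[of z] mollw_eq_0[OF e, of l x z] mollw_nonneg[OF e, of l x z]
      by (cases "norm (l *\<^sub>R x - z) < e") (auto intro!: mult_left_mono)
  qed
  also have "\<dots> = d" using mollw_integral[OF e] by simp
  finally show ?thesis .
qed

text \<open>A rescaling of \<open>kern_taylor\<close>: the normalisation contributes
  \<open>1 / (kmass * e\<^sup>2)\<close> and every derivative one more factor \<open>l / e\<close>.
  The increment bound \<open>e / l\<close> is the one for which the rescaled increment has norm at
  most 1.\<close>

lemma moll_has_derivative:
  fixes f :: "real^2 \<Rightarrow> 'b::{banach,second_countable_topology}"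
  assumes e: "e > 0" and l: "l > 0" and f: "integrable lborel f"
  shows "(moll l e f has_derivative (\<lambda>v. \<integral>z. ((l / (kmass * e ^ 3)) *\<^sub>R kgrad ((1/e) *\<^sub>R (l *\<^sub>R x - z)) \<bullet> v) *\<^sub>R f z \<partial>lborel)) (at x)"
  unfolding moll_def
proof (rule has_derivative_kernel_integral[where C="1/(kmass*e\<^sup>2) + 4*l/(kmass*e^3)" and d="e/l" and C'="27 * l\<^sup>2 / (kmass * e^4)"])
  show "\<bar>mollw l e y z\<bar> \<le> 1/(kmass*e\<^sup>2) + 4*l/(kmass*e^3)" for y z
    using mollw_nonneg[OF e, of l y z] mollw_le[OF e, of l y z] e l kmass_pos by (simp add: add_increasing2)
  show "norm ((l / (kmass * e ^ 3)) *\<^sub>R kgrad ((1/e) *\<^sub>R (l *\<^sub>R x - z))) \<le> 1/(kmass*e\<^sup>2) + 4*l/(kmass*e^3)" for z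
  proof -
    have "norm ((l / (kmass * e ^ 3)) *\<^sub>R kgrad ((1/e) *\<^sub>R (l *\<^sub>R x - z))) \<le> (l / (kmass * e ^ 3)) * 4"
      using e l kmass_pos by (simp add: mult_left_mono[OF kgrad_bd] divide_right_mono)
    also have "\<dots> \<le> 1/(kmass*e\<^sup>2) + 4*l/(kmass*e^3)" using e l kmass_pos by (simp add: mult.commute)
    finally show ?thesis .
  qed
  show "\<bar>mollw l e (x + v) z - mollw l e x z - (l / (kmass * e ^ 3)) *\<^sub>R kgrad ((1/e) *\<^sub>R (l *\<^sub>R x - z)) \<bullet> v\<bar> \<le> 27 * l\<^sup>2 / (kmass * e^4) * (norm v)\<^sup>2"
    if "norm v \<le> e / l" for v z
  proof -
    let ?a = "(1/e) *\<^sub>R (l *\<^sub>R x - z)" and ?h = "(l/e) *\<^sub>R v"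
    have h: "norm ?h \<le> 1" using that e l by (simp add: field_simps)
    have 1: "(1/e) *\<^sub>R (l *\<^sub>R (x + v) - z) = ?a + ?h" by (simp add: algebra_simps)
    have 2: "(l / (kmass * e ^ 3)) *\<^sub>R kgrad ?a \<bullet> v = (kgrad ?a \<bullet> ?h) / (kmass * e\<^sup>2)"
      using e by (simp add: power3_eq_cube power2_eq_square field_simps)
    have "mollw l e (x + v) z - mollw l e x z - (l / (kmass * e ^ 3)) *\<^sub>R kgrad ?a \<bullet> v
        = (kern (?a + ?h) - kern ?a - kgrad ?a \<bullet> ?h) / (kmass * e\<^sup>2)"
      unfolding 2 mollw_def 1 by (simp add: diff_divide_distrib)
    also have "\<bar>\<dots>\<bar> = \<bar>kern (?a + ?h) - kern ?a - kgrad ?a \<bullet> ?h\<bar> / (kmass * e\<^sup>2)"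
      using kmass_pos e by (simp add: abs_divide)
    also have "\<dots> \<le> 27 * (norm ?h)\<^sup>2 / (kmass * e\<^sup>2)"
      using kmass_pos e by (intro divide_right_mono kern_taylor h) auto
    also have "\<dots> = 27 * l\<^sup>2 / (kmass * e^4) * (norm v)\<^sup>2"
      using e l by (simp add: power_mult_distrib power_divide power4_eq_xxxx power2_eq_square field_simps)
    finally show ?thesis .
  qed
  show "e / l > 0" using e l by simp
qed (use f in measurable)

text \<open>A relation and not an operator, since a Borel version is determined only up to null
  sets. It packages what every transfer from \<open>disc\<close> to \<open>lborel\<close>
  uses.\<close>

definition zero_ext :: "(real^2 \<Rightarrow> real^3) \<Rightarrow> (real^2 \<Rightarrow> real^3) \<Rightarrow> bool" where
  "zero_ext f0 f \<longleftrightarrow> f0 \<in> borel_measurable disc \<and> f \<in> borel_measurable borel \<and>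
     (\<forall>x. x \<notin> ball 0 1 \<longrightarrow> f x = 0) \<and> (AE x in disc. f0 x = f x)"

lemma zero_ext_exists: "f0 \<in> borel_measurable disc \<Longrightarrow> \<exists>f. zero_ext f0 f"
  by (rule borel_rep[of f0]) (auto simp: zero_ext_def)

lemma zero_ext_integral:
  assumes z: "zero_ext f0 f" and c: "continuous_on UNIV \<phi>"
  shows "(\<integral>x. \<phi> x *\<^sub>R f0 x \<partial>disc) = (\<integral>x. \<phi> x *\<^sub>R f x \<partial>lborel)"
proof -
  have [measurable]: "f0 \<in> borel_measurable disc" "f \<in> borel_measurable borel" using z by (auto simp: zero_ext_def)
  have p[measurable]: "\<phi> \<in> borel_measurable borel" using c by (rule borel_measurable_continuous_onI)
  have pd[measurable]: "\<phi> \<in> borel_measurable disc" "f \<in> borel_measurable disc"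
    by (auto intro!: measurable_restrict_space1 measurable_completion)
  have "(\<integral>x. \<phi> x *\<^sub>R f0 x \<partial>disc) = (\<integral>x. \<phi> x *\<^sub>R f x \<partial>disc)"
    by (rule integral_cong_AE) (use z in \<open>auto simp: zero_ext_def elim: AE_mp\<close>)
  also have "\<dots> = (\<integral>x. \<phi> x *\<^sub>R f x \<partial>lborel)"
    by (rule integral_disc_lborel) (use z in \<open>auto simp: zero_ext_def\<close>)
  finally show ?thesis .
qed

text \<open>For fixed \<open>x\<close> the weight, as a function of \<open>z\<close>, is itself a
  C^1 test function as soon as its ball lies in the disc. Inserting it into the definition of the
  weak derivative moves the derivative from the kernel onto \<open>g0\<close>; the factor
  \<open>l\<close> is the inner derivative.\<close>

lemma moll_weak_derivative:
  assumes e: "e > 0" and l: "l > 0" and w: "weak_pdiff (ball 0 1) f0 i g0" and f: "zero_ext f0 f" and g: "zero_ext g0 g"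
    and fi: "integrable lborel f" and x: "norm (l *\<^sub>R x) + e < 1"
  shows "(\<integral>z. ((l / (kmass * e ^ 3)) *\<^sub>R kgrad ((1/e) *\<^sub>R (l *\<^sub>R x - z)) $ i) *\<^sub>R f z \<partial>lborel) = l *\<^sub>R moll l e g x"
proof -
  let ?c = "\<lambda>z. (1/e) *\<^sub>R (l *\<^sub>R x - z)"
  define \<phi> where "\<phi> = mollw l e x"
  have der: "(\<phi> has_derivative (\<lambda>v. (-1/(kmass * e^3)) * (kgrad (?c z) \<bullet> v))) (at z)" for z
  proof -
    have 1: "(?c has_derivative (\<lambda>v. (-1/e) *\<^sub>R v)) (at z)"
      by (auto intro!: derivative_eq_intros simp: scaleR_diff_right)
    have "((\<lambda>z. kern (?c z) / (kmass * e\<^sup>2)) has_derivative (\<lambda>v. (kgrad (?c z) \<bullet> ((-1/e) *\<^sub>R v)) / (kmass * e\<^sup>2))) (at z)"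
      using has_derivative_compose[OF 1 kern_has_derivative] kmass_pos e
      by (auto intro!: derivative_eq_intros simp: divide_inverse)
    then show ?thesis unfolding \<phi>_def mollw_def using e by (simp add: power2_eq_square power3_eq_cube field_simps)
  qed
  have pd: "pdiff \<phi> j z = (-1/(kmass * e^3)) * kgrad (?c z) $ j" for j z
    unfolding pdiff_def frechet_derivative_at[OF der, symmetric] by (simp add: inner_axis)
  have cpd: "continuous_on UNIV (pdiff \<phi> j)" for j
    unfolding pd[abs_def] by (intro continuous_intros continuous_on_compose2[OF kgrad_cont]) auto
  have cphi: "continuous_on UNIV \<phi>" by (rule has_derivative_continuous_on[OF der])
  have "test_fun (ball 0 1) \<phi>" unfolding test_fun_def
  proof (intro conjI allI)
    show "\<phi> differentiable (at z)" for z using der by (auto simp: differentiable_def)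
    show "continuous_on UNIV (pdiff \<phi> j)" for j by (rule cpd)
    show "\<exists>K. compact K \<and> K \<subseteq> ball 0 1 \<and> (\<forall>z. z \<notin> K \<longrightarrow> \<phi> z = 0)"
    proof (intro exI[of _ "cball (l *\<^sub>R x) e"] conjI allI impI)
      show "cball (l *\<^sub>R x) e \<subseteq> ball 0 1"
      proof
        fix z assume "z \<in> cball (l *\<^sub>R x) e"
        then have "norm (l *\<^sub>R x - z) \<le> e" by (simp add: dist_norm)
        then show "z \<in> ball 0 1" using x norm_triangle_sub[of z "l *\<^sub>R x"] by (simp add: norm_minus_commute)
      qed
      show "\<phi> z = 0" if "z \<notin> cball (l *\<^sub>R x) e" for z
        unfolding \<phi>_def by (rule mollw_eq_0[OF e]) (use that in \<open>simp add: dist_norm\<close>)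
    qed simp
  qed
  then have "(\<integral>x. pdiff \<phi> i x *\<^sub>R f0 x \<partial>disc) = - (\<integral>x. \<phi> x *\<^sub>R g0 x \<partial>disc)"
    using w by (simp add: weak_pdiff_disc)
  then have "(\<integral>z. pdiff \<phi> i z *\<^sub>R f z \<partial>lborel) = - (\<integral>z. \<phi> z *\<^sub>R g z \<partial>lborel)"
    by (simp add: zero_ext_integral[OF f cpd] zero_ext_integral[OF g cphi])
  moreover have "(\<integral>z. ((l / (kmass * e ^ 3)) *\<^sub>R kgrad (?c z) $ i) *\<^sub>R f z \<partial>lborel) = (\<integral>z. (-l) *\<^sub>R (pdiff \<phi> i z *\<^sub>R f z) \<partial>lborel)"
    by (intro Bochner_Integration.integral_cong) (auto simp: pd)
  ultimately show ?thesis by (simp add: moll_def \<phi>_def del: scaleR_scaleR)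
qed

lemma moll_has_derivative_weak:
  assumes e: "e > 0" and l: "l > 0" and w: "\<And>i. weak_pdiff (ball 0 1) f0 i (g0 i)" and f: "zero_ext f0 f" and g: "\<And>i. zero_ext (g0 i) (g i)"
    and fi: "integrable lborel f" and x: "norm (l *\<^sub>R x) + e < 1"
  shows "(moll l e f has_derivative (\<lambda>v. \<Sum>i\<in>UNIV. v $ i *\<^sub>R (l *\<^sub>R moll l e (g i) x))) (at x)"
proof -
  define D where "D = (\<lambda>v. \<integral>z. ((l / (kmass * e ^ 3)) *\<^sub>R kgrad ((1/e) *\<^sub>R (l *\<^sub>R x - z)) \<bullet> v) *\<^sub>R f z \<partial>lborel)"
  have hd: "(moll l e f has_derivative D) (at x)" unfolding D_def by (rule moll_has_derivative[OF e l fi])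
  have lin: "linear D" using hd by (rule has_derivative_linear)
  have ax: "D (axis i 1) = l *\<^sub>R moll l e (g i) x" for i
    using moll_weak_derivative[OF e l w f g fi x, of i] unfolding D_def by (simp add: inner_axis)
  have "D v = (\<Sum>i\<in>UNIV. v $ i *\<^sub>R (l *\<^sub>R moll l e (g i) x))" for v
  proof -
    have "v = (\<Sum>i\<in>UNIV. v $ i *\<^sub>R axis i 1)" using basis_expansion[of v] by (simp add: scalar_mult_eq_scaleR)
    then have "D v = D (\<Sum>i\<in>UNIV. v $ i *\<^sub>R axis i 1)" by simp
    also have "\<dots> = (\<Sum>i\<in>UNIV. v $ i *\<^sub>R D (axis i 1))" by (simp add: linear_sum[OF lin] linear_cmul[OF lin])
    finally show ?thesis by (simp add: ax)
  qed
  then have "D = (\<lambda>v. \<Sum>i\<in>UNIV. v $ i *\<^sub>R (l *\<^sub>R moll l e (g i) x))" by auto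
  then show ?thesis using hd by simp
qed

section \<open>Density of continuous functions and convergence of mollifications in L^p\<close>

lemma norm_add3_power: "norm (a + b + c) ^ p \<le> 3 ^ p * (norm a ^ p + norm b ^ p + norm c ^ p)" for a b c :: "'a::real_normed_vector"
proof -
  define m where "m = max (norm a) (max (norm b) (norm c))"
  have m0: "0 \<le> m" by (simp add: m_def le_max_iff_disj)
  have "norm (a + b + c) \<le> norm a + norm b + norm c" by (meson norm_triangle_ineq order_trans add_right_mono)
  also have "\<dots> \<le> 3 * m" by (simp add: m_def max_def)
  finally have "norm (a + b + c) ^ p \<le> (3 * m) ^ p" by (intro power_mono) auto
  also have "\<dots> = 3 ^ p * m ^ p" by (simp add: power_mult_distrib)
  also have "m ^ p \<le> norm a ^ p + norm b ^ p + norm c ^ p"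
    using zero_le_power[of "norm a" p] zero_le_power[of "norm b" p] zero_le_power[of "norm c" p]
    unfolding m_def max_def by auto
  finally show ?thesis by simp
qed

lemma norm_add2_power: "norm (a + b) ^ p \<le> 3 ^ p * (norm a ^ p + norm b ^ p)" if "p > 0" for a b :: "'a::real_normed_vector"
  using norm_add3_power[of a b 0 p] that by (simp add: zero_power)

text \<open>Radial truncation onto the ball of radius \<open>m\<close>. It is continuous and
  bounded, so it supplies majorants for dominated convergence without destroying continuity.\<close>

definition clamp_ball :: "real \<Rightarrow> 'a::real_normed_vector \<Rightarrow> 'a" where
  "clamp_ball m v = (m / max m (norm v)) *\<^sub>R v"

lemma clamp_ball:
  assumes "m > 0"
  shows "norm (clamp_ball m v) \<le> m" "norm v \<le> m \<Longrightarrow> clamp_ball m v = v" "clamp_ball m 0 = 0" "norm (v - clamp_ball m v) \<le> norm v"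
proof -
  have m: "max m (norm v) > 0" using assms by auto
  show "norm (clamp_ball m v) \<le> m"
  proof -
    have "norm (clamp_ball m v) = m * norm v / max m (norm v)" using assms m by (simp add: clamp_ball_def abs_divide)
    also have "\<dots> \<le> m" using assms m by (simp add: pos_divide_le_eq mult_left_mono)
    finally show ?thesis .
  qed
  show "norm v \<le> m \<Longrightarrow> clamp_ball m v = v" using assms by (simp add: clamp_ball_def max_def)
  show "clamp_ball m 0 = 0" by (simp add: clamp_ball_def)
  have "v - clamp_ball m v = (1 - m / max m (norm v)) *\<^sub>R v" by (simp add: clamp_ball_def scaleR_diff_left)
  moreover have "0 \<le> 1 - m / max m (norm v)" "1 - m / max m (norm v) \<le> 1" using assms m by (auto simp: divide_le_eq)
  ultimately show "norm (v - clamp_ball m v) \<le> norm v" using mult_right_mono[of "1 - m / max m (norm v)" 1 "norm v"] by simp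
qed

lemma continuous_clamp_ball:
  assumes "m > 0" "continuous_on A f"
  shows "continuous_on A (\<lambda>x. clamp_ball m (f x))"
  unfolding clamp_ball_def using assms
  by (intro continuous_intros) (auto simp: max_def split: if_splits)

text \<open>Truncation makes the function bounded at a small cost in L^p. A measurable function is
  an almost everywhere limit of continuous ones, and once these are truncated and cut off as well,
  dominated convergence turns this into closeness in L^p.\<close>

lemma Lp_cont_approx:
  fixes f :: "real^2 \<Rightarrow> real^3"
  assumes [measurable]: "f \<in> borel_measurable borel" and s: "\<And>z. z \<notin> ball 0 1 \<Longrightarrow> f z = 0"
    and p: "p > 0" and i: "integrable lborel (\<lambda>z. norm (f z) ^ p)" and d: "d > 0"
  obtains g where "continuous_on UNIV g" "\<And>x. norm x \<ge> 2 \<Longrightarrow> g x = 0"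
    "(\<integral>\<^sup>+x. ennreal (norm (f x - g x) ^ p) \<partial>lborel) < ennreal d"
proof -
  define d' where "d' = d / (2 * 3 ^ p)"
  have d': "d' > 0" using d by (simp add: d'_def)
  have clm[measurable]: "(\<lambda>x. clamp_ball m (f x)) \<in> borel_measurable borel" for m unfolding clamp_ball_def by measurable
  have "(\<lambda>m. \<integral>x. norm (f x - clamp_ball (real (Suc m)) (f x)) ^ p \<partial>lborel) \<longlonglongrightarrow> (\<integral>x. (0::real) \<partial>(lborel :: (real^2) measure))"
  proof (rule integral_dominated_convergence[where w="\<lambda>x. norm (f x) ^ p" and f="\<lambda>_. 0" and s="\<lambda>m x. norm (f x - clamp_ball (real (Suc m)) (f x)) ^ p"])
    show "AE x in lborel. (\<lambda>m. norm (f x - clamp_ball (real (Suc m)) (f x)) ^ p) \<longlonglongrightarrow> 0"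
    proof (intro AE_I2 tendsto_eventually)
      fix x
      obtain N where "norm (f x) \<le> real N" using real_arch_simple by blast
      then show "\<forall>\<^sub>F m in sequentially. norm (f x - clamp_ball (real (Suc m)) (f x)) ^ p = 0"
        using p by (intro eventually_sequentiallyI[of N]) (simp add: clamp_ball(2))
    qed
    show "AE x in lborel. norm (norm (f x - clamp_ball (real (Suc m)) (f x)) ^ p) \<le> norm (f x) ^ p" for m
      by (intro AE_I2) (simp add: power_mono clamp_ball(4))
  qed (use i in auto)
  then have "\<forall>\<^sub>F m in sequentially. (\<integral>x. norm (f x - clamp_ball (real (Suc m)) (f x)) ^ p \<partial>lborel) < d'"
    using d' by (simp add: order_tendstoD(2))
  then obtain m where m: "(\<integral>x. norm (f x - clamp_ball (real (Suc m)) (f x)) ^ p \<partial>lborel) < d'"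
    by (meson eventually_happens' sequentially_bot)
  define M where "M = real (Suc m)"
  have M: "M > 0" by (simp add: M_def)
  have cl0: "clamp_ball M (0::real^3) = 0" by (simp add: clamp_ball_def)
  have "f measurable_on UNIV"
    by (rule lebesgue_measurable_imp_measurable_on) (auto intro!: measurable_completion)
  then obtain N g where N: "negligible N" and gc: "\<And>n. continuous_on UNIV (g n)"
    and gl: "\<And>x. x \<notin> N \<Longrightarrow> (\<lambda>n. g n x) \<longlonglongrightarrow> f x"
    unfolding measurable_on_def by auto
  \<comment> \<open>Equal to 1 on the unit disc, where \<open>f\<close> lives, and 0 from radius 2
    on; this makes the majorant integrable.\<close>
  define cf where "cf = (\<lambda>x::real^2. max 0 (min 1 (2 - norm x)))"
  define G where "G = (\<lambda>n x. cf x *\<^sub>R clamp_ball M (g n x))"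
  have Gc: "continuous_on UNIV (G n)" for n
    unfolding G_def cf_def by (intro continuous_intros continuous_clamp_ball M gc)
  have [measurable]: "G n \<in> borel_measurable borel" for n by (rule borel_measurable_continuous_onI[OF Gc])
  have G0: "G n x = 0" if "norm x \<ge> 2" for n x using that by (simp add: G_def cf_def)
  have cf: "0 \<le> cf x" "cf x \<le> 1" for x by (auto simp: cf_def)
  have Gb: "norm (G n x) \<le> M" for n x
    using mult_mono[OF cf(2)[of x] clamp_ball(1)[OF M, of "g n x"]] cf(1)[of x] by (simp add: G_def)
  have AEN: "AE x in lborel. x \<notin> N"
    using N unfolding negligible_iff_null_sets by (auto dest!: AE_not_in simp: AE_completion_iff)
  have "(\<lambda>n. \<integral>x. norm (clamp_ball M (f x) - G n x) ^ p \<partial>lborel) \<longlonglongrightarrow> (\<integral>x. (0::real) \<partial>(lborel :: (real^2) measure))"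
  proof (rule integral_dominated_convergence[where w="\<lambda>x. indicator (ball 0 2) x * (2 * M) ^ p"])
    show "AE x in lborel. (\<lambda>n. norm (clamp_ball M (f x) - G n x) ^ p) \<longlonglongrightarrow> 0"
      using AEN
    proof eventually_elim
      case (elim x)
      have "continuous_on UNIV (clamp_ball M :: real^3 \<Rightarrow> real^3)" using continuous_clamp_ball[OF M continuous_on_id] by simp
      then have "(\<lambda>n. clamp_ball M (g n x)) \<longlonglongrightarrow> clamp_ball M (f x)"
        using gl[OF elim] by (intro isCont_tendsto_compose[of _ "clamp_ball M"]) (auto simp: continuous_on_eq_continuous_at)
      then have "(\<lambda>n. G n x) \<longlonglongrightarrow> cf x *\<^sub>R clamp_ball M (f x)" unfolding G_def by (intro tendsto_intros)
      moreover have "cf x *\<^sub>R clamp_ball M (f x) = clamp_ball M (f x)"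
      proof (cases "x \<in> ball 0 1")
        case True then show ?thesis by (simp add: cf_def)
      next
        case False then show ?thesis using s[OF False] cl0 by simp
      qed
      ultimately have "(\<lambda>n. norm (clamp_ball M (f x) - G n x) ^ p) \<longlonglongrightarrow> norm (clamp_ball M (f x) - clamp_ball M (f x)) ^ p"
        by (intro tendsto_intros) simp
      then show ?case using p by (simp add: zero_power)
    qed
    show "AE x in lborel. norm (norm (clamp_ball M (f x) - G n x) ^ p) \<le> indicator (ball 0 2) x * (2 * M) ^ p" for n
    proof (intro AE_I2)
      fix x
      show "norm (norm (clamp_ball M (f x) - G n x) ^ p) \<le> indicator (ball 0 2) x * (2 * M) ^ p"
      proof (cases "x \<in> ball 0 2")
        case True
        have "norm (clamp_ball M (f x) - G n x) \<le> 2 * M"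
          using norm_triangle_ineq4[of "clamp_ball M (f x)" "G n x"] Gb[of n x] clamp_ball(1)[OF M, of "f x"] by simp
        from power_mono[OF this, of p] show ?thesis using True by simp
      next
        case False
        then show ?thesis using s[of x] G0[of x n] cl0 p by (simp add: zero_power)
      qed
    qed
    show "integrable lborel (\<lambda>x::real^2. indicator (ball 0 2) x * (2 * M) ^ p :: real)"
      using emeasure_lborel_ball_finite[of "0::real^2" 2] by (intro integrable_mult_left) (auto intro!: integrable_real_indicator)
  qed measurable
  then have "\<forall>\<^sub>F n in sequentially. (\<integral>x. norm (clamp_ball M (f x) - G n x) ^ p \<partial>lborel) < d'"
    using d' by (simp add: order_tendstoD(2))
  then obtain n where n: "(\<integral>x. norm (clamp_ball M (f x) - G n x) ^ p \<partial>lborel) < d'"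
    by (meson eventually_happens' sequentially_bot)
  have i1: "integrable lborel (\<lambda>x. norm (f x - clamp_ball M (f x)) ^ p)"
    by (rule Bochner_Integration.integrable_bound[OF i]) (auto simp: power_mono clamp_ball(4)[OF M])
  have i2: "integrable lborel (\<lambda>x. norm (clamp_ball M (f x) - G n x) ^ p)"
  proof (rule Bochner_Integration.integrable_bound[where f="\<lambda>x. indicator (ball 0 2) x * (2 * M) ^ p"])
    show "integrable lborel (\<lambda>x::real^2. indicator (ball 0 2) x * (2 * M) ^ p :: real)"
      using emeasure_lborel_ball_finite[of "0::real^2" 2] by (intro integrable_mult_left) (auto intro!: integrable_real_indicator)
    have "norm (norm (clamp_ball M (f x) - G n x) ^ p) \<le> norm (indicator (ball 0 2) x * (2 * M) ^ p :: real)" for x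
    proof (cases "x \<in> ball 0 2")
      case True
      have "norm (clamp_ball M (f x) - G n x) \<le> 2 * M"
        using norm_triangle_ineq4[of "clamp_ball M (f x)" "G n x"] Gb[of n x] clamp_ball(1)[OF M, of "f x"] by simp
      from power_mono[OF this, of p] show ?thesis using True M by simp
    next
      case False
      then show ?thesis using s[of x] G0[of x n] cl0 p by (simp add: zero_power)
    qed
    then show "AE x in lborel. norm (norm (clamp_ball M (f x) - G n x) ^ p) \<le> norm (indicator (ball 0 2) x * (2 * M) ^ p :: real)" by simp
  qed measurable
  let ?R = "\<lambda>x. 3 ^ p * (norm (f x - clamp_ball M (f x)) ^ p + norm (clamp_ball M (f x) - G n x) ^ p)"
  have iR: "integrable lborel ?R" using i1 i2 by simp
  have "(\<integral>\<^sup>+x. ennreal (norm (f x - G n x) ^ p) \<partial>lborel) \<le> (\<integral>\<^sup>+x. ennreal (?R x) \<partial>lborel)"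
  proof (intro nn_integral_mono ennreal_leI)
    fix x
    show "norm (f x - G n x) ^ p \<le> ?R x"
      using norm_add2_power[OF p, of "f x - clamp_ball M (f x)" "clamp_ball M (f x) - G n x"] by simp
  qed
  also have "\<dots> = ennreal (\<integral>x. ?R x \<partial>lborel)" by (rule nn_integral_eq_integral[OF iR]) simp
  also have "(\<integral>x. ?R x \<partial>lborel) < d"
  proof -
    have "(\<integral>x. ?R x \<partial>lborel) = 3 ^ p * ((\<integral>x. norm (f x - clamp_ball M (f x)) ^ p \<partial>lborel) + (\<integral>x. norm (clamp_ball M (f x) - G n x) ^ p \<partial>lborel))"
      using i1 i2 by simp
    also have "\<dots> < 3 ^ p * (d' + d')" using m n unfolding M_def[symmetric] by (intro mult_strict_left_mono add_strict_mono) auto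
    also have "\<dots> = d" by (simp add: d'_def)
    finally show ?thesis .
  qed
  then have "ennreal (\<integral>x. ?R x \<partial>lborel) < ennreal d" using d by (intro ennreal_lessI)
  finally show ?thesis using that[OF Gc G0] by blast
qed

text \<open>Mollification is bounded on L^p uniformly in \<open>n\<close>, so it suffices to treat a
  continuous \<open>g\<close> near \<open>f\<close>. For such \<open>g\<close> the convergence is
  uniform on a fixed disc, and outside it both \<open>g\<close> and its mollification
  vanish.\<close>

lemma moll_Lp_tendsto:
  fixes f :: "real^2 \<Rightarrow> real^3"
  assumes fm[measurable]: "f \<in> borel_measurable borel" and s: "\<And>z. z \<notin> ball 0 1 \<Longrightarrow> f z = 0"
    and p: "p = 2 \<or> p = 4" and i: "integrable lborel (\<lambda>z. norm (f z) ^ p)"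
    and l: "\<And>n. l n \<ge> 1/2" "\<And>n. l n \<le> 1" "l \<longlonglongrightarrow> 1" and e: "\<And>n. e n > 0" "\<And>n. e n \<le> 1" "e \<longlonglongrightarrow> 0"
  shows "(\<lambda>n. \<integral>\<^sup>+x. ennreal (norm (moll (l n) (e n) f x - f x) ^ p) \<partial>lborel) \<longlonglongrightarrow> 0"
proof (rule order_tendstoI)
  fix a :: ennreal assume "a > 0"
  have p0: "p > 0" using p by auto
  have p2: "p \<ge> 1" using p by auto
  obtain c where c: "c > 0" "ennreal c < a"
    using \<open>a > 0\<close> by (metis dense ennreal_cases ennreal_less_zero_iff less_top order.strict_trans)
  \<comment> \<open>The three errors below are at most \<open>4 * d\<close>, \<open>d\<close> and
    \<open>d\<close>, and splitting the norm costs \<open>3 ^ p\<close>. The 4 bounds the Jacobian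
    \<open>1 / (l n)\<^sup>2\<close>.\<close>
  define d where "d = c / (3 ^ p * 6)"
  have d: "d > 0" using c by (simp add: d_def)
  obtain g where gc: "continuous_on UNIV g" and g0: "\<And>x. norm x \<ge> 2 \<Longrightarrow> g x = 0"
    and gd: "(\<integral>\<^sup>+x. ennreal (norm (f x - g x) ^ p) \<partial>lborel) < ennreal d"
    using Lp_cont_approx[OF fm s p0 i d] by blast
  have [measurable]: "g \<in> borel_measurable borel" by (rule borel_measurable_continuous_onI[OF gc])
  \<comment> \<open>Since \<open>l n \<ge> 1/2\<close> and \<open>e n \<le> 1\<close>, for
    \<open>x\<close> outside this ball the averaging ball avoids the support of \<open>g\<close>,
    which lies within radius 2.\<close>
  define V where "V = measure lborel (cball (0::real^2) 6)"
  have V: "emeasure lborel (cball (0::real^2) 6) = ennreal V" unfolding V_def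
    by (rule emeasure_eq_ennreal_measure) (use emeasure_lborel_cball_finite[of "0::real^2" 6] in auto)
  define t where "t = min 1 (d / (V + 1))"
  have V0: "V \<ge> 0" by (simp add: V_def)
  have t: "t > 0" "t \<le> 1" "t * V \<le> d"
  proof -
    show "t > 0" "t \<le> 1" using d V0 by (auto simp: t_def)
    have "t * V \<le> d / (V+1) * (V+1)" using V0 d by (intro mult_mono) (auto simp: t_def)
    then show "t * V \<le> d" using V0 by simp
  qed
  have "compact (g ` cball 0 2)" using gc by (intro compact_continuous_image) (auto intro: continuous_on_subset)
  have "uniformly_continuous_on (cball 0 12) g" using gc by (intro compact_uniformly_continuous) (auto intro: continuous_on_subset)
  then obtain r where r: "r > 0" "\<And>x x'. x \<in> cball 0 12 \<Longrightarrow> x' \<in> cball 0 12 \<Longrightarrow> dist x' x < r \<Longrightarrow> dist (g x') (g x) < t"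
    unfolding uniformly_continuous_on_def using t by metis
  have gi: "integrable lborel (\<lambda>x. norm (g x) ^ p)" "integrable lborel g"
  proof -
    have "integrable lborel (\<lambda>x. indicator (cball 0 2) x *\<^sub>R g x)"
      by (rule borel_integrable_compact) (auto intro: continuous_on_subset[OF gc])
    then show "integrable lborel g" by (rule back_subst[of "integrable lborel"]) (auto simp: fun_eq_iff indicator_def g0)
    have "integrable lborel (\<lambda>x. indicator (cball 0 2) x *\<^sub>R norm (g x) ^ p)"
      by (rule borel_integrable_compact) (auto intro!: continuous_intros continuous_on_subset[OF gc])
    then show "integrable lborel (\<lambda>x. norm (g x) ^ p)" by (rule back_subst[of "integrable lborel"]) (use p0 in \<open>auto simp: fun_eq_iff indicator_def g0 zero_power\<close>)
  qed
  have fi: "integrable lborel f" using integrable_lower_power[OF fm s i, where k=1] p by (intro integrable_norm_cancel[of lborel f]) auto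
  have fgi: "integrable lborel (\<lambda>z. norm (f z - g z) ^ p)"
    by (rule integrableI_nonneg) (use gd in \<open>auto intro: order.strict_trans\<close>)
  have s': "f z - g z = 0" if "z \<notin> ball 0 2" for z using that s[of z] g0[of z] by auto
  \<comment> \<open>Half of the modulus \<open>r\<close> is reserved for the kernel radius, the
    other half for the shift \<open>(1 - l n) * norm x\<close> with \<open>norm x \<le> 6\<close>;
    hence the 12 in the next bound.\<close>
  have "\<forall>\<^sub>F n in sequentially. e n < r/2" using e(3) r(1) by (intro order_tendstoD(2)) auto
  moreover have "\<forall>\<^sub>F n in sequentially. l n > 1 - r/12" using l(3) r(1) by (intro order_tendstoD(1)) auto
  ultimately show "\<forall>\<^sub>F n in sequentially. (\<integral>\<^sup>+x. ennreal (norm (moll (l n) (e n) f x - f x) ^ p) \<partial>lborel) < a"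
  proof eventually_elim
    case (elim n)
    have ln: "l n > 0" using l(1)[of n] by linarith
    let ?A = "\<lambda>x. norm (moll (l n) (e n) (\<lambda>z. f z - g z) x) ^ p"
    let ?B = "\<lambda>x. norm (moll (l n) (e n) g x - g x) ^ p"
    let ?C = "\<lambda>x. norm (f x - g x) ^ p"
    have B: "?B x \<le> t * indicator (cball 0 6) x" for x
    proof (cases "norm x \<le> 6")
      case True
      have "norm (moll (l n) (e n) g x - g x) \<le> t"
      proof (rule moll_const_dist[OF e(1) gi(2)])
        fix z assume z: "norm (l n *\<^sub>R x - z) < e n"
        have a: "norm (x - l n *\<^sub>R x) = (1 - l n) * norm x"
        proof -
          have "x - l n *\<^sub>R x = (1 - l n) *\<^sub>R x" by (simp add: scaleR_diff_left)
          then show ?thesis using l(2)[of n] by simp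
        qed
        have "(1 - l n) * norm x \<le> (r/12) * 6" using elim True l(2)[of n] by (intro mult_mono) auto
        then have "norm (z - x) < r" using a z elim norm_triangle_ineq4[of "x - l n *\<^sub>R x" "z - l n *\<^sub>R x"] by (simp add: norm_minus_commute)
        moreover have "norm z \<le> 12"
        proof -
          have "norm (l n *\<^sub>R x) \<le> 6" using True l(2)[of n] ln mult_mono[of "l n" 1 "norm x" 6] by simp
          then show ?thesis using z e(2)[of n] norm_triangle_ineq4[of "l n *\<^sub>R x" "l n *\<^sub>R x - z"] by simp
        qed
        ultimately have "dist (g z) (g x) < t" using True by (intro r(2)) (auto simp: dist_norm)
        then show "norm (g z - g x) \<le> t" by (simp add: dist_norm)
      qed
      then have "?B x \<le> t ^ p" by (intro power_mono) auto
      also have "\<dots> \<le> t" using t p0 power_decreasing[of 1 p t] by simp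
      finally show ?thesis using True by simp
    next
      case False
      have "norm (moll (l n) (e n) g x - 0) \<le> 0"
      proof (rule moll_const_dist[OF e(1) gi(2)])
        fix z assume z: "norm (l n *\<^sub>R x - z) < e n"
        have "norm (l n *\<^sub>R x) \<ge> 3" using False l(1)[of n] mult_mono[of "1/2" "l n" 6 "norm x"] by simp
        then have "norm z \<ge> 2" using z e(2)[of n] norm_triangle_ineq[of z "l n *\<^sub>R x - z"] by simp
        then show "norm (g z - 0) \<le> 0" by (simp add: g0)
      qed
      then show ?thesis using False g0[of x] p0 by (simp add: zero_power)
    qed
    have "(\<integral>\<^sup>+x. ennreal (norm (moll (l n) (e n) f x - f x) ^ p) \<partial>lborel) \<le> (\<integral>\<^sup>+x. ennreal (3^p) * (ennreal (?A x) + ennreal (?B x) + ennreal (?C x)) \<partial>lborel)"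
    proof (rule nn_integral_mono)
      fix x
      have "moll (l n) (e n) f x - f x = moll (l n) (e n) (\<lambda>z. f z - g z) x + (moll (l n) (e n) g x - g x) + (g x - f x)"
        using moll_diff[OF e(1)[of n] fi gi(2), of "l n" x] by simp
      then have "norm (moll (l n) (e n) f x - f x) ^ p \<le> 3 ^ p * (?A x + ?B x + norm (g x - f x) ^ p)"
        by (simp only: norm_add3_power)
      then have "norm (moll (l n) (e n) f x - f x) ^ p \<le> 3 ^ p * (?A x + ?B x + ?C x)"
        by (simp only: norm_minus_commute[of "g x" "f x"])
      then have "ennreal (norm (moll (l n) (e n) f x - f x) ^ p) \<le> ennreal (3 ^ p * (?A x + ?B x + ?C x))" by (rule ennreal_leI)
      also have "\<dots> = ennreal (3^p) * (ennreal (?A x) + ennreal (?B x) + ennreal (?C x))" by (simp add: ennreal_mult ennreal_plus)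
      finally show "ennreal (norm (moll (l n) (e n) f x - f x) ^ p) \<le> \<dots>" .
    qed
    also have "\<dots> = ennreal (3^p) * ((\<integral>\<^sup>+x. ennreal (?A x) \<partial>lborel) + (\<integral>\<^sup>+x. ennreal (?B x) \<partial>lborel) + (\<integral>\<^sup>+x. ennreal (?C x) \<partial>lborel))"
      by (subst nn_integral_cmult, measurable, subst nn_integral_add, measurable, subst nn_integral_add, measurable)
    also have "\<dots> \<le> ennreal (3^p) * (ennreal (4 * d) + ennreal d + ennreal d)"
    proof (intro mult_left_mono add_mono)
      have "(\<integral>\<^sup>+x. ennreal (?A x) \<partial>lborel) \<le> ennreal (1 / (l n)\<^sup>2) * (\<integral>\<^sup>+x. ennreal (?C x) \<partial>lborel)"
        by (rule moll_Lp_bound[OF e(1) ln p _ s' fgi]) measurable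
      also have "\<dots> \<le> ennreal 4 * ennreal d"
      proof (rule mult_mono)
        have "(1/2)\<^sup>2 \<le> (l n)\<^sup>2" using l(1)[of n] by (intro power_mono) auto
        then have "1 / (l n)\<^sup>2 \<le> 4" using ln by (simp add: divide_le_eq power2_eq_square)
        then show "ennreal (1 / (l n)\<^sup>2) \<le> ennreal 4" by (rule ennreal_leI)
      qed (use gd in auto)
      also have "\<dots> = ennreal (4 * d)" using d by (simp add: ennreal_mult)
      finally show "(\<integral>\<^sup>+x. ennreal (?A x) \<partial>lborel) \<le> ennreal (4 * d)" .
      have "(\<integral>\<^sup>+x. ennreal (?B x) \<partial>lborel) \<le> (\<integral>\<^sup>+x. ennreal t * indicator (cball (0::real^2) 6) x \<partial>lborel)"
      proof (rule nn_integral_mono)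
        fix x
        have "ennreal (?B x) \<le> ennreal (t * indicator (cball 0 6) x)" by (rule ennreal_leI[OF B])
        also have "\<dots> = ennreal t * indicator (cball 0 6) x" by (simp split: split_indicator)
        finally show "ennreal (?B x) \<le> ennreal t * indicator (cball 0 6) x" .
      qed
      also have "\<dots> = ennreal t * ennreal V" by (subst nn_integral_cmult_indicator) (auto simp: V)
      also have "\<dots> \<le> ennreal d" using t V0 by (simp add: ennreal_mult[symmetric] ennreal_leI)
      finally show "(\<integral>\<^sup>+x. ennreal (?B x) \<partial>lborel) \<le> ennreal d" .
      show "(\<integral>\<^sup>+x. ennreal (?C x) \<partial>lborel) \<le> ennreal d" using gd by simp
    qed simp
    also have "\<dots> = ennreal (3 ^ p * (4 * d + d + d))" using d by (simp only: ennreal_mult ennreal_plus zero_le_power zero_le_numeral mult_nonneg_nonneg less_imp_le add_nonneg_nonneg)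
    also have "3 ^ p * (4 * d + d + d) = c" by (simp add: d_def)
    finally show ?case using c(2) by (rule order.strict_trans1)
  qed
qed simp

text \<open>Each derivative of a mollification produces a factor \<open>l n\<close>; the sequence
  \<open>c n\<close> stands for these factors, \<open>l n\<close> for gradients and
  \<open>(l n)\<^sup>2\<close> for second derivatives.\<close>

lemma moll_scaled_Lp_tendsto:
  fixes f :: "real^2 \<Rightarrow> real^3"
  assumes fm[measurable]: "f \<in> borel_measurable borel" and s: "\<And>z. z \<notin> ball 0 1 \<Longrightarrow> f z = 0"
    and p: "p = 2 \<or> p = 4" and i: "integrable lborel (\<lambda>z. norm (f z) ^ p)"
    and l: "\<And>n. l n \<ge> 1/2" "\<And>n. l n \<le> 1" "l \<longlonglongrightarrow> 1" and e: "\<And>n. e n > 0" "\<And>n. e n \<le> 1" "e \<longlonglongrightarrow> 0"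
    and c: "\<And>n. 0 \<le> c n" "\<And>n. c n \<le> 1" "c \<longlonglongrightarrow> 1"
  shows "(\<lambda>n. \<integral>\<^sup>+x. ennreal (norm (c n *\<^sub>R moll (l n) (e n) f x - f x) ^ p) \<partial>lborel) \<longlonglongrightarrow> 0"
proof (rule tendsto_sandwich[OF _ _ tendsto_const])
  have p0: "p > 0" using p by auto
  define I where "I = (\<integral>x. norm (f x) ^ p \<partial>lborel)"
  have I: "(\<integral>\<^sup>+x. ennreal (norm (f x) ^ p) \<partial>lborel) = ennreal I" unfolding I_def
    by (rule nn_integral_eq_integral[OF i]) simp
  let ?J = "\<lambda>n. \<integral>\<^sup>+x. ennreal (norm (moll (l n) (e n) f x - f x) ^ p) \<partial>lborel"
  show "\<forall>\<^sub>F n in sequentially. (\<integral>\<^sup>+x. ennreal (norm (c n *\<^sub>R moll (l n) (e n) f x - f x) ^ p) \<partial>lborel)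
      \<le> ennreal (3^p) * (?J n + ennreal ((1 - c n) ^ p * I))"
  proof (intro always_eventually allI)
    fix n
    have "(\<integral>\<^sup>+x. ennreal (norm (c n *\<^sub>R moll (l n) (e n) f x - f x) ^ p) \<partial>lborel)
      \<le> (\<integral>\<^sup>+x. ennreal (3^p) * (ennreal (norm (moll (l n) (e n) f x - f x) ^ p) + ennreal ((1 - c n) ^ p) * ennreal (norm (f x) ^ p)) \<partial>lborel)"
    proof (rule nn_integral_mono)
      fix x
      let ?m = "moll (l n) (e n) f x"
      have "norm (c n *\<^sub>R ?m - f x) ^ p = norm (c n *\<^sub>R (?m - f x) + (c n - 1) *\<^sub>R f x) ^ p" by (simp add: algebra_simps)
      also have "\<dots> \<le> 3 ^ p * (norm (c n *\<^sub>R (?m - f x)) ^ p + norm ((c n - 1) *\<^sub>R f x) ^ p)" by (rule norm_add2_power[OF p0])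
      also have "\<dots> \<le> 3 ^ p * (norm (?m - f x) ^ p + (1 - c n) ^ p * norm (f x) ^ p)"
      proof (intro mult_left_mono add_mono)
        show "norm (c n *\<^sub>R (?m - f x)) ^ p \<le> norm (?m - f x) ^ p"
          using c(1,2)[of n] by (intro power_mono) (auto intro: mult_left_le_one_le)
        show "norm ((c n - 1) *\<^sub>R f x) ^ p \<le> (1 - c n) ^ p * norm (f x) ^ p"
          using c(2)[of n] by (simp add: power_mult_distrib)
      qed simp
      finally have "ennreal (norm (c n *\<^sub>R ?m - f x) ^ p) \<le> ennreal (3 ^ p * (norm (?m - f x) ^ p + (1 - c n) ^ p * norm (f x) ^ p))" by (rule ennreal_leI)
      also have "\<dots> = ennreal (3^p) * (ennreal (norm (?m - f x) ^ p) + ennreal ((1 - c n) ^ p) * ennreal (norm (f x) ^ p))"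
        using c(2)[of n] by (simp add: ennreal_mult ennreal_plus)
      finally show "ennreal (norm (c n *\<^sub>R ?m - f x) ^ p) \<le> \<dots>" .
    qed
    also have "\<dots> = ennreal (3^p) * (?J n + ennreal ((1 - c n) ^ p) * ennreal I)"
      by (subst nn_integral_cmult, measurable, subst nn_integral_add, measurable, subst nn_integral_cmult, measurable) (simp add: I)
    also have "ennreal ((1 - c n) ^ p) * ennreal I = ennreal ((1 - c n) ^ p * I)"
      using c(2)[of n] by (intro ennreal_mult[symmetric]) (auto simp: I_def)
    finally show "(\<integral>\<^sup>+x. ennreal (norm (c n *\<^sub>R moll (l n) (e n) f x - f x) ^ p) \<partial>lborel)
      \<le> ennreal (3^p) * (?J n + ennreal ((1 - c n) ^ p * I))" .
  qed
  have "(\<lambda>n. (1 - c n) ^ p * I) \<longlonglongrightarrow> (1 - 1) ^ p * I" by (intro tendsto_intros c)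
  then have "(\<lambda>n. ennreal ((1 - c n) ^ p * I)) \<longlonglongrightarrow> ennreal 0" using p0 by (intro tendsto_ennrealI) (simp add: zero_power)
  then have "(\<lambda>n. ?J n + ennreal ((1 - c n) ^ p * I)) \<longlonglongrightarrow> 0 + 0"
    using moll_Lp_tendsto[OF fm s p i l e] by (intro tendsto_add) auto
  then have "(\<lambda>n. ennreal (3^p) * (?J n + ennreal ((1 - c n) ^ p * I))) \<longlonglongrightarrow> ennreal (3^p) * 0"
    by (intro ennreal_tendsto_cmult) auto
  then show "(\<lambda>n. ennreal (3^p) * (?J n + ennreal ((1 - c n) ^ p * I))) \<longlonglongrightarrow> 0" by simp
qed auto

text \<open>Classical C^2 regularity, with the derivatives carried along as functions of the same
  curried shape as the weak derivatives in \<open>W22\<close>, so that one energy expression applies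
  to both.\<close>

definition C2on :: "real \<Rightarrow> (real^2 \<Rightarrow> real^3) \<Rightarrow> (real^2 \<Rightarrow> 2 \<Rightarrow> real^3) \<Rightarrow> (real^2 \<Rightarrow> 2 \<Rightarrow> 2 \<Rightarrow> real^3) \<Rightarrow> bool" where
  "C2on r y D D2 \<longleftrightarrow>
    (\<forall>x\<in>ball 0 r. (y has_derivative (\<lambda>v. \<Sum>i\<in>UNIV. v $ i *\<^sub>R D x i)) (at x)) \<and>
    (\<forall>i. \<forall>x\<in>ball 0 r. ((\<lambda>x. D x i) has_derivative (\<lambda>v. \<Sum>j\<in>UNIV. v $ j *\<^sub>R D2 x i j)) (at x)) \<and>
    (\<forall>i j. continuous_on (ball 0 r) (\<lambda>x. D2 x i j))"

lemma nn_integral_disc_le: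
  assumes f: "zero_ext f0 f"
  shows "(\<integral>\<^sup>+x. ennreal (norm (g x - f0 x) ^ p) \<partial>disc) \<le> (\<integral>\<^sup>+x. ennreal (norm (g x - f x) ^ p) \<partial>lborel)"
proof -
  have "(\<integral>\<^sup>+x. ennreal (norm (g x - f0 x) ^ p) \<partial>disc) = (\<integral>\<^sup>+x. ennreal (norm (g x - f x) ^ p) \<partial>disc)"
    by (rule nn_integral_cong_AE) (use f in \<open>auto simp: zero_ext_def elim!: AE_mp\<close>)
  also have "\<dots> = (\<integral>\<^sup>+x. ennreal (norm (g x - f x) ^ p) * indicator (ball 0 1) x \<partial>lebesgue)"
    by (subst nn_integral_restrict_space) simp_all
  also have "\<dots> \<le> (\<integral>\<^sup>+x. ennreal (norm (g x - f x) ^ p) \<partial>lebesgue)"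
    by (intro nn_integral_mono) (simp split: split_indicator)
  also have "\<dots> = (\<integral>\<^sup>+x. ennreal (norm (g x - f x) ^ p) \<partial>lborel)" by (rule nn_integral_completion)
  finally show ?thesis .
qed

lemma zero_ext_integrable_power:
  assumes f: "zero_ext f0 f" and i: "integrable disc (\<lambda>x. norm (f0 x) ^ p)" and p: "p > 0"
  shows "integrable lborel (\<lambda>x. norm (f x) ^ p)"
proof -
  have [measurable]: "f \<in> borel_measurable borel" using f by (simp add: zero_ext_def)
  have fd: "f \<in> borel_measurable disc" "(\<lambda>x. norm (f x) ^ p) \<in> borel_measurable disc"
    by (auto intro!: measurable_restrict_space1 measurable_completion)
  have "integrable disc (\<lambda>x. norm (f x) ^ p)"
    using i by (rule integrable_cong_AE_imp) (use f fd in \<open>auto simp: zero_ext_def elim!: AE_mp\<close>)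
  then show ?thesis using f p by (subst (asm) integral_disc_lborel(2)) (auto simp: zero_ext_def zero_power)
qed

text \<open>One family of mollifications serves all later limits. Radii above 1 make the
  approximations classical up to the boundary circle. Convergence of gradients in L^4 is
  conditional, because integrability of the fourth power is itself established only afterwards, from
  this approximation, in \<open>gn_weak\<close>.\<close>

lemma W22_approx:
  assumes w: "W22 (ball 0 1) y Dy D2y" and yc: "continuous_on (cball 0 1) y"
  obtains r Y D D2 where "\<And>n::nat. r n > 1" "\<And>n. C2on (r n) (Y n) (D n) (D2 n)"
    "uniform_limit (cball 0 1) Y y sequentially"
    "\<And>i. (\<lambda>n. \<integral>\<^sup>+x. ennreal (norm (D n x i - Dy x i) ^ 2) \<partial>disc) \<longlonglongrightarrow> 0"
    "\<And>i j. (\<lambda>n. \<integral>\<^sup>+x. ennreal (norm (D2 n x i j - D2y x i j) ^ 2) \<partial>disc) \<longlonglongrightarrow> 0"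
    "\<And>i. integrable disc (\<lambda>x. norm (Dy x i) ^ 4) \<Longrightarrow> (\<lambda>n. \<integral>\<^sup>+x. ennreal (norm (D n x i - Dy x i) ^ 4) \<partial>disc) \<longlonglongrightarrow> 0"
proof -
  have L2: "Dym \<in> borel_measurable disc \<and> integrable disc (\<lambda>x. norm (Dym x) ^ 2)" if "L2_on (ball 0 1) Dym" for Dym :: "real^2 \<Rightarrow> real^3"
    using that by (simp add: L2_on_disc)
  define f where "f = (\<lambda>x. if x \<in> ball 0 1 then y x else 0)"
  have fz: "zero_ext y f" unfolding zero_ext_def
  proof (intro conjI)
    show "y \<in> borel_measurable disc" using w by (simp add: W22_def L2_on_disc)
    show "f \<in> borel_measurable borel" unfolding f_def
      by (rule borel_measurable_continuous_on_if) (auto intro: continuous_on_subset[OF yc])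
  qed (auto simp: f_def AE_disc_iff)
  have "\<forall>i. \<exists>g. zero_ext (\<lambda>x. Dy x i) g" using w L2 by (auto simp: W22_def intro!: zero_ext_exists)
  then have "\<exists>g. \<forall>i. zero_ext (\<lambda>x. Dy x i) (g i)" by (rule choice)
  then obtain g where g: "\<And>i. zero_ext (\<lambda>x. Dy x i) (g i)" by blast
  have "\<forall>i. \<forall>j. \<exists>k. zero_ext (\<lambda>x. D2y x i j) k" using w L2 by (auto simp: W22_def intro!: zero_ext_exists)
  then have "\<forall>i. \<exists>k. \<forall>j. zero_ext (\<lambda>x. D2y x i j) (k j)" by (intro allI choice) blast
  then have "\<exists>k. \<forall>i. \<forall>j. zero_ext (\<lambda>x. D2y x i j) (k i j)" by (rule choice)
  then obtain k where k: "\<And>i j. zero_ext (\<lambda>x. D2y x i j) (k i j)" by blast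
  have f2: "integrable lborel (\<lambda>x. norm (f x) ^ 2)" using w by (intro zero_ext_integrable_power[OF fz]) (auto simp: W22_def L2_on_disc)
  have g2: "integrable lborel (\<lambda>x. norm (g i x) ^ 2)" for i using w by (intro zero_ext_integrable_power[OF g]) (auto simp: W22_def L2_on_disc)
  have k2: "integrable lborel (\<lambda>x. norm (k i j x) ^ 2)" for i j using w by (intro zero_ext_integrable_power[OF k]) (auto simp: W22_def L2_on_disc)
  have L1: "integrable lborel h" if "zero_ext h0 h" "integrable lborel (\<lambda>x. norm (h x) ^ 2)" for h h0
    using integrable_lower_power[of h 1 2 1] that by (intro integrable_norm_cancel[of lborel h]) (auto simp: zero_ext_def)
  \<comment> \<open>With the dilation \<open>l n = 1 - 2 * e n\<close> the averaging ball of radius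
    \<open>e n\<close> stays in the disc for all \<open>x\<close> of norm below
    \<open>r n = (1 - e n) / l n\<close>, and \<open>r n > 1\<close> because
    \<open>l n < 1 - e n\<close>. The 4 ensures \<open>l n \<ge> 1/2\<close>.\<close>
  define e where "e = (\<lambda>n. 1 / (real n + 4))"
  define l where "l = (\<lambda>n. 1 - 2 * e n)"
  define r where "r = (\<lambda>n. (1 - e n) / l n)"
  have e: "e n > 0" "e n \<le> 1/4" for n by (auto simp: e_def field_simps)
  have e1: "e n \<le> 1" for n using e[of n] by simp
  have elim: "e \<longlonglongrightarrow> 0" unfolding e_def by real_asymp
  have l: "l n \<ge> 1/2" "l n \<le> 1" "l n > 0" for n using e[of n] by (auto simp: l_def)
  have "(\<lambda>n. 1 - 2 * e n) \<longlonglongrightarrow> 1 - 2 * 0" by (intro tendsto_intros elim)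
  then have llim: "l \<longlonglongrightarrow> 1" by (simp add: l_def[abs_def])
  have in_r: "norm (l n *\<^sub>R x) + e n < 1" if "x \<in> ball 0 (r n)" for x n
    using that l[of n] by (simp add: r_def field_simps)
  define Y where "Y = (\<lambda>n. moll (l n) (e n) f)"
  define D where "D = (\<lambda>n x i. l n *\<^sub>R moll (l n) (e n) (g i) x)"
  define D2 where "D2 = (\<lambda>n x i j. (l n)\<^sup>2 *\<^sub>R moll (l n) (e n) (k i j) x)"
  show ?thesis
  proof (rule that[of r Y D D2])
    show "r n > 1" for n using l[of n] e[of n] by (simp add: r_def field_simps) (simp add: l_def)
    show "C2on (r n) (Y n) (D n) (D2 n)" for n unfolding C2on_def
    proof (intro conjI allI ballI)
      fix x :: "real^2" assume x: "x \<in> ball 0 (r n)"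
      show "(Y n has_derivative (\<lambda>v. \<Sum>i\<in>UNIV. v $ i *\<^sub>R D n x i)) (at x)" unfolding Y_def D_def
        by (rule moll_has_derivative_weak[OF e(1) l(3) _ fz g L1[OF fz f2] in_r[OF x]]) (use w in \<open>auto simp: W22_def\<close>)
    next
      fix i and x :: "real^2" assume x: "x \<in> ball 0 (r n)"
      have "(moll (l n) (e n) (g i) has_derivative (\<lambda>v. \<Sum>j\<in>UNIV. v $ j *\<^sub>R (l n *\<^sub>R moll (l n) (e n) (k i j) x))) (at x)"
        by (rule moll_has_derivative_weak[OF e(1) l(3) _ g k L1[OF g g2] in_r[OF x]]) (use w in \<open>auto simp: W22_def\<close>)
      from has_derivative_scaleR_right[OF this, of "l n"]
      show "((\<lambda>x. D n x i) has_derivative (\<lambda>v. \<Sum>j\<in>UNIV. v $ j *\<^sub>R D2 n x i j)) (at x)" unfolding D_def D2_def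
        by (simp add: scaleR_sum_right power2_eq_square mult_ac)
    next
      fix i j
      have "continuous_on (ball 0 (r n)) (moll (l n) (e n) (k i j))"
        by (rule has_derivative_continuous_on, rule has_derivative_at_withinI, rule moll_has_derivative[OF e(1) l(3) L1[OF k k2]])
      then show "continuous_on (ball 0 (r n)) (\<lambda>x. D2 n x i j)" unfolding D2_def by (intro continuous_intros)
    qed
    show "uniform_limit (cball 0 1) Y y sequentially"
    proof (rule uniform_limitI)
      fix t :: real assume t: "t > 0"
      have "uniformly_continuous_on (cball 0 1) y" using yc by (intro compact_uniformly_continuous) auto
      then obtain d where d: "d > 0" "\<And>x x'. x \<in> cball 0 1 \<Longrightarrow> x' \<in> cball 0 1 \<Longrightarrow> dist x' x < d \<Longrightarrow> dist (y x') (y x) < t/2"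
        unfolding uniformly_continuous_on_def using t by (metis half_gt_zero)
      have "\<forall>\<^sub>F n in sequentially. e n < d/3" using elim d(1) by (intro order_tendstoD(2)) auto
      then show "\<forall>\<^sub>F n in sequentially. \<forall>x\<in>cball 0 1. dist (Y n x) (y x) < t"
      proof eventually_elim
        case (elim n)
        show ?case
        proof
          fix x :: "real^2" assume x: "x \<in> cball 0 1"
          have "norm (Y n x - y x) \<le> t/2" unfolding Y_def
          proof (rule moll_const_dist[OF e(1) L1[OF fz f2]])
            fix z assume z: "norm (l n *\<^sub>R x - z) < e n"
            have "norm (l n *\<^sub>R x) \<le> l n" using x l[of n] by (simp add: mult_left_le)
            moreover have "norm z \<le> norm (l n *\<^sub>R x) + norm (l n *\<^sub>R x - z)" using norm_triangle_ineq4[of "l n *\<^sub>R x" "l n *\<^sub>R x - z"] by simp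
            ultimately have zb: "norm z < 1" using z e[of n] fun_cong[OF l_def, of n] by linarith
            have "x - l n *\<^sub>R x = (2 * e n) *\<^sub>R x" by (simp add: l_def algebra_simps)
            then have "norm (x - l n *\<^sub>R x) = 2 * e n * norm x" using e[of n] by simp
            then have "norm (x - l n *\<^sub>R x) \<le> 2 * e n" using x e[of n] by (simp add: mult_left_le)
            then have "norm (z - x) < 3 * e n" using z norm_triangle_ineq4[of "x - l n *\<^sub>R x" "z - l n *\<^sub>R x"] by (simp add: norm_minus_commute)
            then have "dist (y z) (y x) < t/2" using x zb elim by (intro d(2)) (auto simp: dist_norm)
            then show "norm (f z - y x) \<le> t/2" using zb by (simp add: f_def dist_norm)
          qed
          then show "dist (Y n x) (y x) < t" using t by (simp add: dist_norm)
        qed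
      qed
    qed
    have conv: "(\<lambda>n. \<integral>\<^sup>+x. ennreal (norm (c n *\<^sub>R moll (l n) (e n) h x - h0 x) ^ p) \<partial>disc) \<longlonglongrightarrow> 0"
      if h: "zero_ext h0 h" and p: "p = 2 \<or> p = 4" and i: "integrable lborel (\<lambda>z. norm (h z) ^ p)"
        and c: "\<And>n. 0 \<le> c n" "\<And>n. c n \<le> 1" "c \<longlonglongrightarrow> 1" for h h0 p c
    proof (rule tendsto_sandwich[OF _ _ tendsto_const])
      show "(\<lambda>n. \<integral>\<^sup>+x. ennreal (norm (c n *\<^sub>R moll (l n) (e n) h x - h x) ^ p) \<partial>lborel) \<longlonglongrightarrow> 0"
        by (rule moll_scaled_Lp_tendsto[OF _ _ p i l(1,2) llim e(1) e1 elim c]) (use h in \<open>auto simp: zero_ext_def\<close>)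
    qed (auto intro!: always_eventually nn_integral_disc_le[OF h])
    show "(\<lambda>n. \<integral>\<^sup>+x. ennreal (norm (D n x i - Dy x i) ^ 2) \<partial>disc) \<longlonglongrightarrow> 0" for i
      unfolding D_def by (rule conv[OF g _ g2]) (use l llim in \<open>auto simp: less_imp_le\<close>)
    show "(\<lambda>n. \<integral>\<^sup>+x. ennreal (norm (D2 n x i j - D2y x i j) ^ 2) \<partial>disc) \<longlonglongrightarrow> 0" for i j
      unfolding D2_def
    proof (rule conv[OF k _ k2])
      have "(\<lambda>n. (l n)\<^sup>2) \<longlonglongrightarrow> 1\<^sup>2" by (intro tendsto_intros llim)
      then show "(\<lambda>n. (l n)\<^sup>2) \<longlonglongrightarrow> 1" by simp
      show "(l n)\<^sup>2 \<le> 1" for n using l[of n] by (intro power_le_one) auto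
    qed auto
    show "(\<lambda>n. \<integral>\<^sup>+x. ennreal (norm (D n x i - Dy x i) ^ 4) \<partial>disc) \<longlonglongrightarrow> 0"
      if "integrable disc (\<lambda>x. norm (Dy x i) ^ 4)" for i
      unfolding D_def by (rule conv[OF g _ zero_ext_integrable_power[OF g that]]) (use l llim in \<open>auto simp: less_imp_le\<close>)
  qed
qed

section \<open>A Gagliardo-Nirenberg inequality\<close>

text \<open>Cartesian coordinates with a distinguished index: \<open>s\<close> is the coordinate
  \<open>i\<close>, \<open>t\<close> the other one. Arguments along chords then cover both
  directions at once.\<close>

definition pt :: "2 \<Rightarrow> real \<Rightarrow> real \<Rightarrow> real^2" where
  "pt i s t = (\<chi> k. if k = i then s else t)"

lemma pt_nth: "pt i s t $ k = (if k = i then s else t)" by (simp add: pt_def)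

lemma other_index:
  fixes i :: 2
  obtains j where "j \<noteq> i" "UNIV = {i, j}"
proof (cases "i = 1")
  case True
  show thesis by (rule that[of 2]) (use True UNIV_2 in auto)
next
  case False
  then have "i = 2" using exhaust_2[of i] by simp
  show thesis by (rule that[of 1]) (use \<open>i = 2\<close> UNIV_2 in auto)
qed

lemma pt_measurable [measurable]: "(\<lambda>x. pt i (fst x) (snd x)) \<in> borel_measurable borel"
proof (intro borel_measurable_continuous_onI)
  have "continuous_on UNIV (\<lambda>x::real\<times>real. if k = i then fst x else snd x)" for k
    by (cases "k = i") (auto intro!: continuous_intros)
  then show "continuous_on UNIV (\<lambda>x. pt i (fst x) (snd x))" unfolding pt_def by (rule continuous_on_vec_lambda)
qed

lemma norm_pt: "(norm (pt i s t))\<^sup>2 = s\<^sup>2 + t\<^sup>2"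
proof -
  obtain j where j: "j \<noteq> i" "UNIV = {i, j}" by (rule other_index)
  have "(\<Sum>k\<in>UNIV. (pt i s t $ k)\<^sup>2) = s\<^sup>2 + t\<^sup>2" unfolding j(2) using j(1) by (simp add: pt_nth)
  then show ?thesis unfolding norm_vec_def L2_set_def by simp
qed

text \<open>Agreement on boxes suffices. The point is the free choice of the inner coordinate when
  Fubini is applied.\<close>

lemma lborel_pt: "lborel = distr (lborel \<Otimes>\<^sub>M lborel) borel (\<lambda>x. pt i (fst x) (snd x))"
proof (rule lborel_eqI)
  fix l u :: "real^2" assume lu: "\<And>b. b \<in> Basis \<Longrightarrow> l \<bullet> b \<le> u \<bullet> b"
  obtain j where j: "j \<noteq> i" "UNIV = {i, j}" by (rule other_index)
  have B: "(Basis :: (real^2) set) = {axis i 1, axis j 1}" using j by (auto simp: Basis_vec_def)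
  have ne: "axis i (1::real) \<noteq> axis j 1" using j by (simp add: axis_eq_axis)
  have le: "l $ k \<le> u $ k" for k using lu[of "axis k 1"] by (simp add: inner_axis axis_in_Basis_iff)
  have all2: "(\<forall>k. P k) \<longleftrightarrow> P i \<and> P j" for P using j(2) by (metis UNIV_I insertE singletonD)
  have "(\<lambda>x. pt i (fst x) (snd x)) -` box l u \<inter> space (lborel \<Otimes>\<^sub>M lborel) = box (l $ i) (u $ i) \<times> box (l $ j) (u $ j)"
    using j(1) by (auto simp: mem_box_cart pt_nth space_pair_measure box_real all2)
  moreover have "(\<lambda>x. pt i (fst x) (snd x)) \<in> measurable (lborel \<Otimes>\<^sub>M lborel) borel" by (simp add: lborel_prod)
  ultimately have "emeasure (distr (lborel \<Otimes>\<^sub>M lborel) borel (\<lambda>x. pt i (fst x) (snd x))) (box l u)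
      = emeasure (lborel \<Otimes>\<^sub>M lborel) (box (l $ i) (u $ i) \<times> box (l $ j) (u $ j))"
    by (subst emeasure_distr) auto
  also have "\<dots> = ennreal (u $ i - l $ i) * ennreal (u $ j - l $ j)"
    using le by (subst lborel.emeasure_pair_measure_Times) (auto simp: box_real)
  also have "\<dots> = ennreal (\<Prod>b\<in>Basis. (u - l) \<bullet> b)"
    using le by (simp add: B ne inner_axis ennreal_mult inner_diff_left)
  finally show "emeasure (distr (lborel \<Otimes>\<^sub>M lborel) borel (\<lambda>x. pt i (fst x) (snd x))) (box l u) = ennreal (\<Prod>b\<in>Basis. (u - l) \<bullet> b)" .
qed simp

lemma nn_integral_pt:
  fixes f :: "real^2 \<Rightarrow> ennreal"
  assumes [measurable]: "f \<in> borel_measurable borel"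
  shows "(\<integral>\<^sup>+x. f x \<partial>lborel) = (\<integral>\<^sup>+t. (\<integral>\<^sup>+s. f (pt i s t) \<partial>lborel) \<partial>lborel)"
proof -
  have "(\<integral>\<^sup>+x. f x \<partial>lborel) = (\<integral>\<^sup>+x. f (pt i (fst x) (snd x)) \<partial>(lborel \<Otimes>\<^sub>M lborel))"
    by (subst lborel_pt[of i], subst nn_integral_distr) (auto simp: lborel_prod)
  also have "\<dots> = (\<integral>\<^sup>+t. (\<integral>\<^sup>+s. f (pt i s t) \<partial>lborel) \<partial>lborel)"
    by (subst lborel_pair.nn_integral_snd[symmetric]) (auto simp: lborel_prod)
  finally show ?thesis .
qed

text \<open>The function \<open>(v' s \<bullet> v' s) * (v s \<bullet> v' s)\<close> vanishes at
  both ends, so its derivative integrates to 0. That derivative contains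
  \<open>norm (v' s) ^ 4\<close>, and its other terms are at most
  \<open>3 * N * norm (v' s) ^ 2 * norm (v'' s)\<close>. Young's inequality absorbs half of the
  fourth power and squares the 3 to the factor 9.\<close>

lemma gn_interval_zero:
  fixes v v' v'' :: "real \<Rightarrow> 'a::euclidean_space"
  assumes ab: "a \<le> b" and d1: "\<And>s. s \<in> {a..b} \<Longrightarrow> (v has_vector_derivative v' s) (at s within {a..b})"
    and d2: "\<And>s. s \<in> {a..b} \<Longrightarrow> (v' has_vector_derivative v'' s) (at s within {a..b})"
    and c: "continuous_on {a..b} v''" and z: "v a = 0" "v b = 0" and N: "\<And>s. s \<in> {a..b} \<Longrightarrow> norm (v s) \<le> N"
  shows "integral {a..b} (\<lambda>s. norm (v' s) ^ 4) \<le> 9 * N\<^sup>2 * integral {a..b} (\<lambda>s. norm (v'' s) ^ 2)"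
proof -
  have cv: "continuous_on {a..b} v" "continuous_on {a..b} v'"
    by (rule continuous_on_vector_derivative[OF d1] continuous_on_vector_derivative[OF d2], assumption)+
  define G where "G = (\<lambda>s. 2 * (v' s \<bullet> v'' s) * (v s \<bullet> v' s) + (v' s \<bullet> v' s) * (v' s \<bullet> v' s) + (v' s \<bullet> v' s) * (v s \<bullet> v'' s))"
  have "(G has_integral ((v' b \<bullet> v' b) * (v b \<bullet> v' b) - (v' a \<bullet> v' a) * (v a \<bullet> v' a))) {a..b}"
  proof (rule fundamental_theorem_of_calculus[OF ab])
    fix s assume s: "s \<in> {a..b}"
    note d = d1[OF s, unfolded has_vector_derivative_def] d2[OF s, unfolded has_vector_derivative_def]
    show "((\<lambda>s. (v' s \<bullet> v' s) * (v s \<bullet> v' s)) has_vector_derivative G s) (at s within {a..b})"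
      unfolding has_vector_derivative_def G_def
      by (rule derivative_eq_intros d refl | simp)+ (simp add: fun_eq_iff inner_simps algebra_simps inner_commute)
  qed
  then have G: "(G has_integral 0) {a..b}" using z by simp
  have pw: "norm (v' s) ^ 4 \<le> 2 * G s + 9 * N\<^sup>2 * norm (v'' s) ^ 2" if s: "s \<in> {a..b}" for s
  proof -
    let ?p = "norm (v' s)" and ?q = "norm (v'' s)"
    have N0: "0 \<le> N" using N[OF s] norm_ge_zero order_trans by blast
    have 1: "\<bar>v' s \<bullet> v'' s\<bar> \<le> ?p * ?q" by (rule Cauchy_Schwarz_ineq2)
    have 2: "\<bar>v s \<bullet> v' s\<bar> \<le> N * ?p" using Cauchy_Schwarz_ineq2[of "v s" "v' s"] mult_right_mono[OF N[OF s], of ?p] by simp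
    have 3: "\<bar>v s \<bullet> v'' s\<bar> \<le> N * ?q" using Cauchy_Schwarz_ineq2[of "v s" "v'' s"] mult_right_mono[OF N[OF s], of ?q] by simp
    have a: "\<bar>(v' s \<bullet> v'' s) * (v s \<bullet> v' s)\<bar> \<le> (?p * ?q) * (N * ?p)" unfolding abs_mult by (intro mult_mono 1 2) (auto simp: N0)
    have b: "\<bar>(v' s \<bullet> v' s) * (v s \<bullet> v'' s)\<bar> \<le> ?p\<^sup>2 * (N * ?q)" unfolding abs_mult by (intro mult_mono 3) (auto simp: N0 dot_square_norm)
    have e: "(v' s \<bullet> v' s) * (v' s \<bullet> v' s) = ?p ^ 4" by (simp add: dot_square_norm flip: power_add)
    have "?p ^ 4 \<le> G s + 3 * N * ?p\<^sup>2 * ?q"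
      using a b unfolding G_def e by (simp add: power2_eq_square algebra_simps abs_le_iff)
    moreover have "3 * N * ?p\<^sup>2 * ?q \<le> (?p ^ 4 + 9 * N\<^sup>2 * ?q\<^sup>2) / 2"
      using sum_squares_bound[of "?p\<^sup>2" "3 * N * ?q"] by (simp add: power_mult_distrib algebra_simps flip: power_mult)
    ultimately show ?thesis by simp
  qed
  have i2: "(\<lambda>s. norm (v'' s) ^ 2) integrable_on {a..b}" by (intro integrable_continuous_real continuous_intros c)
  have "((\<lambda>s. 2 * G s + 9 * N\<^sup>2 * norm (v'' s) ^ 2) has_integral (2 * 0 + 9 * N\<^sup>2 * integral {a..b} (\<lambda>s. norm (v'' s) ^ 2))) {a..b}"
    by (intro has_integral_add has_integral_mult_right G integrable_integral i2)
  note up = this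
  have "((\<lambda>s. norm (v' s) ^ 4) has_integral (integral {a..b} (\<lambda>s. norm (v' s) ^ 4))) {a..b}"
    by (intro integrable_integral integrable_continuous_real continuous_intros cv)
  from has_integral_le[OF this up pw] show ?thesis by simp
qed

lemma norm_sum_power4: "norm (x + y) ^ 4 \<le> 8 * norm x ^ 4 + 8 * norm y ^ 4" for x y :: "'a::real_normed_vector"
proof -
  have sq: "(p + q)\<^sup>2 \<le> 2 * p\<^sup>2 + 2 * q\<^sup>2" for p q :: real
    using sum_squares_bound[of p q] by (simp add: power2_sum)
  have "norm (x + y) ^ 4 \<le> (norm x + norm y) ^ 4" by (intro power_mono norm_triangle_ineq) simp
  also have "\<dots> = ((norm x + norm y)\<^sup>2)\<^sup>2" by (simp flip: power_mult)
  also have "\<dots> \<le> (2 * (norm x)\<^sup>2 + 2 * (norm y)\<^sup>2)\<^sup>2" by (intro power_mono sq) simp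
  also have "\<dots> \<le> 2 * (2 * (norm x)\<^sup>2)\<^sup>2 + 2 * (2 * (norm y)\<^sup>2)\<^sup>2" by (rule sq)
  also have "\<dots> = 8 * norm x ^ 4 + 8 * norm y ^ 4" by (simp add: power_mult_distrib flip: power_mult)
  finally show ?thesis .
qed

text \<open>Subtract the linear interpolant of the boundary values; mollified maps vanish on the circle only up to \<open>\<epsilon>\<close>.\<close>

lemma gn_interval:
  fixes u u' u'' :: "real \<Rightarrow> 'a::euclidean_space"
  assumes ab: "a < b" and d1: "\<And>s. s \<in> {a..b} \<Longrightarrow> (u has_vector_derivative u' s) (at s within {a..b})"
    and d2: "\<And>s. s \<in> {a..b} \<Longrightarrow> (u' has_vector_derivative u'' s) (at s within {a..b})"
    and c: "continuous_on {a..b} u''" and z: "norm (u a) \<le> \<epsilon>" "norm (u b) \<le> \<epsilon>" and M: "\<And>s. s \<in> {a..b} \<Longrightarrow> norm (u s) \<le> M"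
  shows "integral {a..b} (\<lambda>s. norm (u' s) ^ 4) \<le> 72 * (M + \<epsilon>)\<^sup>2 * integral {a..b} (\<lambda>s. norm (u'' s) ^ 2) + 128 * \<epsilon> ^ 4 / (b - a) ^ 3"
proof -
  define \<sigma> where "\<sigma> = (1 / (b - a)) *\<^sub>R (u b - u a)"
  define v where "v = (\<lambda>s. u s - u a - (s - a) *\<^sub>R \<sigma>)"
  have \<epsilon>0: "\<epsilon> \<ge> 0" using z(1) norm_ge_zero order_trans by blast
  have cu: "continuous_on {a..b} u'" by (rule continuous_on_vector_derivative[OF d2])
  have dv: "(v has_vector_derivative (u' s - \<sigma>)) (at s within {a..b})" if "s \<in> {a..b}" for s
    unfolding v_def by (rule derivative_eq_intros d1[OF that] refl | simp)+
  have dv': "((\<lambda>s. u' s - \<sigma>) has_vector_derivative u'' s) (at s within {a..b})" if "s \<in> {a..b}" for s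
    using d2[OF that] by (auto intro!: derivative_eq_intros)
  have v0: "v a = 0" "v b = 0" using ab by (auto simp: v_def \<sigma>_def)
  have vN: "norm (v s) \<le> M + \<epsilon>" if s: "s \<in> {a..b}" for s
  proof -
    define \<theta> where "\<theta> = (s - a) / (b - a)"
    have th: "0 \<le> \<theta>" "\<theta> \<le> 1" using s ab by (auto simp: \<theta>_def)
    have e: "v s = u s - ((1 - \<theta>) *\<^sub>R u a + \<theta> *\<^sub>R u b)" by (simp add: v_def \<sigma>_def \<theta>_def algebra_simps)
    have "norm ((1 - \<theta>) *\<^sub>R u a + \<theta> *\<^sub>R u b) \<le> (1 - \<theta>) * \<epsilon> + \<theta> * \<epsilon>"
      using th z by (intro order_trans[OF norm_triangle_ineq] add_mono) (auto intro: mult_left_mono)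
    then have "norm ((1 - \<theta>) *\<^sub>R u a + \<theta> *\<^sub>R u b) \<le> \<epsilon>" by (simp add: algebra_simps)
    then show ?thesis unfolding e using M[OF s] norm_triangle_ineq4 add_mono order_trans by blast
  qed
  have \<sigma>: "norm \<sigma> ^ 4 \<le> 16 * \<epsilon> ^ 4 / (b - a) ^ 4"
  proof -
    have "norm \<sigma> \<le> (2 * \<epsilon>) / (b - a)" using ab z norm_triangle_ineq4[of "u b" "u a"] by (auto simp: \<sigma>_def divide_right_mono)
    then have "norm \<sigma> ^ 4 \<le> ((2 * \<epsilon>) / (b - a)) ^ 4" by (intro power_mono) auto
    then show ?thesis by (simp add: power_divide power_mult_distrib)
  qed
  have "integral {a..b} (\<lambda>s. norm (u' s) ^ 4) \<le> integral {a..b} (\<lambda>s. 8 * norm (u' s - \<sigma>) ^ 4 + 8 * norm \<sigma> ^ 4)"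
  proof (rule integral_le)
    show "norm (u' s) ^ 4 \<le> 8 * norm (u' s - \<sigma>) ^ 4 + 8 * norm \<sigma> ^ 4" for s using norm_sum_power4[of "u' s - \<sigma>" \<sigma>] by simp
  qed (intro integrable_continuous_real continuous_intros cu)+
  also have "\<dots> = 8 * integral {a..b} (\<lambda>s. norm (u' s - \<sigma>) ^ 4) + (b - a) * (8 * norm \<sigma> ^ 4)"
    using ab by (subst Henstock_Kurzweil_Integration.integral_add) (auto intro!: integrable_continuous_real continuous_intros cu)
  also have "\<dots> \<le> 8 * (9 * (M + \<epsilon>)\<^sup>2 * integral {a..b} (\<lambda>s. norm (u'' s) ^ 2)) + (b - a) * (8 * (16 * \<epsilon> ^ 4 / (b - a) ^ 4))"
    using gn_interval_zero[OF less_imp_le[OF ab] dv dv' c v0 vN] \<sigma> ab by (intro add_mono mult_left_mono) auto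
  also have "(b - a) * (8 * (16 * \<epsilon> ^ 4 / (b - a) ^ 4)) = 128 * \<epsilon> ^ 4 / (b - a) ^ 3"
    using ab by (simp add: power3_eq_cube power4_eq_xxxx)
  finally show ?thesis by simp
qed

lemma C2on_continuous:
  assumes "C2on r y D D2"
  shows "continuous_on (ball 0 r) y" "continuous_on (ball 0 r) (\<lambda>x. D x i)" "continuous_on (ball 0 r) (\<lambda>x. D2 x i j)"
proof -
  show "continuous_on (ball 0 r) y"
    using assms unfolding C2on_def by (intro has_derivative_continuous_on[OF has_derivative_at_withinI]) blast
  show "continuous_on (ball 0 r) (\<lambda>x. D x i)"
    using assms unfolding C2on_def by (intro has_derivative_continuous_on[OF has_derivative_at_withinI]) blast
  show "continuous_on (ball 0 r) (\<lambda>x. D2 x i j)" using assms unfolding C2on_def by blast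
qed

lemma sum_scaleR_axis:
  fixes F :: "2 \<Rightarrow> 'a::real_vector"
  shows "(\<Sum>k\<in>UNIV. axis i c $ k *\<^sub>R F k) = c *\<^sub>R F i"
proof -
  have "(\<Sum>k\<in>UNIV. axis i c $ k *\<^sub>R F k) = (\<Sum>k\<in>UNIV. if k = i then c *\<^sub>R F i else 0)"
    by (rule sum.cong) (auto simp: axis_def)
  then show ?thesis by simp
qed

lemma C2on_line:
  assumes C: "C2on r y D D2" and s: "norm (pt i s t) < r"
  shows "((\<lambda>s. y (pt i s t)) has_vector_derivative D (pt i s t) i) (at s)"
    "((\<lambda>s. D (pt i s t) k) has_vector_derivative D2 (pt i s t) k i) (at s)"
proof -
  have p: "((\<lambda>s. pt i s t) has_derivative (\<lambda>h. axis i h)) (at s)"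
  proof -
    have "(\<lambda>s. pt i s t) = (\<lambda>s. axis i s + pt i 0 t)" by (auto simp: fun_eq_iff vec_eq_iff pt_nth axis_def)
    moreover have "((\<lambda>s. axis i s + pt i 0 t) has_derivative (\<lambda>h. axis i h + 0)) (at s)"
    proof (intro derivative_intros bounded_linear_imp_has_derivative)
      show "bounded_linear (axis i :: real \<Rightarrow> real^2)"
        unfolding linear_conv_bounded_linear[symmetric] by (rule linearI) (auto simp: vec_eq_iff axis_def)
    qed
    ultimately show ?thesis by simp
  qed
  have a: "(y has_derivative (\<lambda>v. \<Sum>k\<in>UNIV. v $ k *\<^sub>R D (pt i s t) k)) (at (pt i s t))"
    and b: "((\<lambda>x. D x k) has_derivative (\<lambda>v. \<Sum>j\<in>UNIV. v $ j *\<^sub>R D2 (pt i s t) k j)) (at (pt i s t))"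
    using C s by (auto simp: C2on_def)
  show "((\<lambda>s. y (pt i s t)) has_vector_derivative D (pt i s t) i) (at s)"
    using has_derivative_compose[OF p a] by (simp add: has_vector_derivative_def sum_scaleR_axis)
  show "((\<lambda>s. D (pt i s t) k) has_vector_derivative D2 (pt i s t) k i) (at s)"
    using has_derivative_compose[OF p b] by (simp add: has_vector_derivative_def sum_scaleR_axis)
qed

text \<open>Chords near the two poles are short, so there the boundary error \<open>\<epsilon> ^ 4 / length ^ 3\<close> is not small; the strip cuts them off.\<close>

definition strip :: "2 \<Rightarrow> real \<Rightarrow> (real^2) set" where
  "strip i \<delta> = {x \<in> ball 0 1. \<forall>k. k \<noteq> i \<longrightarrow> \<bar>x $ k\<bar> \<le> 1 - \<delta>}"

lemma strip_borel [measurable]: "strip i \<delta> \<in> sets borel"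
proof -
  have "closed {x::real^2. \<forall>k. k \<noteq> i \<longrightarrow> \<bar>x $ k\<bar> \<le> 1 - \<delta>}"
    by (intro closed_Collect_all closed_Collect_imp open_Collect_const closed_Collect_le continuous_intros)
  moreover have "strip i \<delta> = ball 0 1 \<inter> {x. \<forall>k. k \<noteq> i \<longrightarrow> \<bar>x $ k\<bar> \<le> 1 - \<delta>}" by (auto simp: strip_def)
  ultimately show ?thesis by (auto intro!: borel_closed borel_open sets.Int)
qed

text \<open>The interval estimate on every chord parallel to the axis \<open>i\<close>, integrated
  over the chords. Only the pure second derivative \<open>D2 x i i\<close> enters, because the map
  is differentiated along the chord alone.\<close>

lemma gn_smooth:
  assumes C: "C2on r Y D D2" and r: "r > 1" and M: "\<And>x. x \<in> cball 0 1 \<Longrightarrow> norm (Y x) \<le> M"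
    and \<epsilon>: "\<And>x. x \<in> sphere 0 1 \<Longrightarrow> norm (Y x) \<le> \<epsilon>" and \<delta>: "0 < \<delta>" "\<delta> < 1"
  shows "(\<integral>\<^sup>+x. ennreal (indicator (strip i \<delta>) x * norm (D x i) ^ 4) \<partial>lborel)
     \<le> ennreal (72 * (M + \<epsilon>)\<^sup>2) * (\<integral>\<^sup>+x. ennreal (indicator (ball 0 1) x * norm (D2 x i i) ^ 2) \<partial>lborel) + ennreal (32 * \<epsilon> ^ 4 / \<delta>\<^sup>2)"
proof -
  have sub: "ball 0 1 \<subseteq> ball (0::real^2) r" "cball 0 1 \<subseteq> ball (0::real^2) r" using r by auto
  note cD = continuous_on_subset[OF C2on_continuous(2)[OF C] sub(1)]
  note cD2 = continuous_on_subset[OF C2on_continuous(3)[OF C] sub(1)]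
  have m1': "(\<lambda>x. indicator (ball 0 1) x *\<^sub>R (norm (D x i) ^ 4)) \<in> borel_measurable borel"
    by (intro borel_measurable_continuous_on_indicator continuous_intros cD) auto
  have "(\<lambda>x. indicator (strip i \<delta>) x * (indicator (ball 0 1) x *\<^sub>R (norm (D x i) ^ 4))) \<in> borel_measurable borel"
    using m1' by measurable
  also have "(\<lambda>x. indicator (strip i \<delta>) x * (indicator (ball 0 1) x *\<^sub>R (norm (D x i) ^ 4))) = (\<lambda>x. indicator (strip i \<delta>) x * norm (D x i) ^ 4)"
    by (auto simp: fun_eq_iff strip_def indicator_def)
  finally have m1: "(\<lambda>x. indicator (strip i \<delta>) x * norm (D x i) ^ 4) \<in> borel_measurable borel" .
  have m2: "(\<lambda>x. indicator (ball 0 1) x * norm (D2 x i i) ^ 2) \<in> borel_measurable borel"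
    unfolding real_scaleR_def[symmetric] by (intro borel_measurable_continuous_on_indicator continuous_intros cD2) auto
  obtain x1 :: "real^2" where "x1 \<in> sphere 0 1" using vector_choose_size[of 1] by auto
  then have \<epsilon>0: "\<epsilon> \<ge> 0" using \<epsilon> norm_ge_zero order_trans by blast
  have slice: "(\<integral>\<^sup>+s. ennreal (indicator (strip i \<delta>) (pt i s t) * norm (D (pt i s t) i) ^ 4) \<partial>lborel)
      \<le> ennreal (72 * (M + \<epsilon>)\<^sup>2) * (\<integral>\<^sup>+s. ennreal (indicator (ball 0 1) (pt i s t) * norm (D2 (pt i s t) i i) ^ 2) \<partial>lborel)
         + ennreal (16 * \<epsilon> ^ 4 / \<delta>\<^sup>2) * indicator {-1..1} t" for t
  proof (cases "\<bar>t\<bar> \<le> 1 - \<delta>")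
    case False
    obtain j where j: "j \<noteq> i" "UNIV = {i, j}" by (rule other_index)
    have "pt i s t \<notin> strip i \<delta>" for s using False j by (auto simp: strip_def pt_nth)
    then show ?thesis by simp
  next
    case True
    have "t\<^sup>2 \<le> (1 - \<delta>)\<^sup>2" using True by (intro abs_le_square_iff[THEN iffD1]) (use \<delta> in auto)
    also have "\<dots> = 1 - \<delta> - \<delta> * (1 - \<delta>)" by (simp add: power2_eq_square algebra_simps)
    also have "\<dots> \<le> 1 - \<delta>" using \<delta> by simp
    finally have t2: "\<delta> \<le> 1 - t\<^sup>2" by simp
    define b where "b = sqrt (1 - t\<^sup>2)"
    have b: "b > 0" "b\<^sup>2 = 1 - t\<^sup>2" using t2 \<delta> by (auto simp: b_def)
    have inb: "pt i s t \<in> ball 0 1 \<longleftrightarrow> s \<in> {-b<..<b}" for s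
    proof -
      have "pt i s t \<in> ball 0 1 \<longleftrightarrow> (norm (pt i s t))\<^sup>2 < 1\<^sup>2" by (simp add: power_less_one_iff abs_square_less_1)
      also have "\<dots> \<longleftrightarrow> s\<^sup>2 < b\<^sup>2" by (auto simp: norm_pt b)
      also have "\<dots> \<longleftrightarrow> \<bar>s\<bar> < \<bar>b\<bar>" by (metis abs_le_square_iff not_less)
      also have "\<dots> \<longleftrightarrow> s \<in> {-b<..<b}" using b by auto
      finally show ?thesis .
    qed
    have inc: "norm (pt i s t) \<le> 1" if "s \<in> {-b..b}" for s
    proof -
      have "s\<^sup>2 \<le> b\<^sup>2" using that by (intro abs_le_square_iff[THEN iffD1]) auto
      then have "(norm (pt i s t))\<^sup>2 \<le> 1\<^sup>2" by (simp add: norm_pt b)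
      then show ?thesis by (rule power2_le_imp_le) simp
    qed
    have ins: "norm (pt i s t) = 1" if "s = b \<or> s = -b" for s
    proof -
      have "(norm (pt i s t))\<^sup>2 = 1\<^sup>2" using that b by (auto simp: norm_pt)
      then show ?thesis by (rule power2_eq_imp_eq) auto
    qed
    have inr: "norm (pt i s t) < r" if "s \<in> {-b..b}" for s using inc[OF that] r by simp
    have c0: "continuous_on {-b..b} (\<lambda>s. pt i s t)"
    proof -
      have "continuous_on {-b..b} (\<lambda>s. if k = i then s else t)" for k
        by (cases "k = i") (auto intro!: continuous_intros)
      then show ?thesis unfolding pt_def by (rule continuous_on_vec_lambda)
    qed
    have cc: "continuous_on {-b..b} (\<lambda>s. D2 (pt i s t) i i)" "continuous_on {-b..b} (\<lambda>s. D (pt i s t) i)"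
      by (rule continuous_on_compose2[OF C2on_continuous(3)[OF C] c0] continuous_on_compose2[OF C2on_continuous(2)[OF C] c0], use inr in auto)+
    let ?I4 = "integral {-b..b} (\<lambda>s. norm (D (pt i s t) i) ^ 4)"
    let ?I2 = "integral {-b..b} (\<lambda>s. norm (D2 (pt i s t) i i) ^ 2)"
    have main: "?I4 \<le> 72 * (M + \<epsilon>)\<^sup>2 * ?I2 + 128 * \<epsilon> ^ 4 / (b - (-b)) ^ 3"
    proof (rule gn_interval)
      show "- b < b" using b by simp
      show "((\<lambda>s. Y (pt i s t)) has_vector_derivative D (pt i s t) i) (at s within {- b..b})" if "s \<in> {- b..b}" for s
        using C2on_line(1)[OF C inr[OF that]] by (rule has_vector_derivative_at_within)
      show "((\<lambda>s. D (pt i s t) i) has_vector_derivative D2 (pt i s t) i i) (at s within {- b..b})" if "s \<in> {- b..b}" for s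
        using C2on_line(2)[OF C inr[OF that]] by (rule has_vector_derivative_at_within)
      show "norm (Y (pt i (-b) t)) \<le> \<epsilon>" "norm (Y (pt i b t)) \<le> \<epsilon>" using ins by (auto intro!: \<epsilon>)
      show "norm (Y (pt i s t)) \<le> M" if "s \<in> {- b..b}" for s using inc[OF that] by (intro M) auto
    qed (rule cc)
    have "128 * \<epsilon> ^ 4 / (b - (-b)) ^ 3 \<le> 16 * \<epsilon> ^ 4 / \<delta>\<^sup>2"
    proof -
      \<comment> \<open>The half-length \<open>b\<close> of a chord in the strip satisfies both
        \<open>\<delta> \<le> b\<^sup>2\<close> and \<open>\<delta> \<le> b\<close>; the product of
        the two bounds controls the cubed length in the boundary error.\<close>
      have "\<delta>\<^sup>2 \<le> b ^ 3"
      proof -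
        have "\<delta> \<le> b\<^sup>2" using t2 b by simp
        moreover have "\<delta> \<le> b"
        proof -
          have "\<delta>\<^sup>2 \<le> \<delta>" using \<delta> by (simp add: power2_eq_square)
          then have "\<delta>\<^sup>2 \<le> b\<^sup>2" using t2 b by simp
          then show ?thesis by (rule power2_le_imp_le) (use b in simp)
        qed
        ultimately have "\<delta> * \<delta> \<le> b\<^sup>2 * b" using \<delta> b by (intro mult_mono) auto
        then show ?thesis by (simp add: power2_eq_square power3_eq_cube)
      qed
      then have "\<epsilon> ^ 4 / b ^ 3 \<le> \<epsilon> ^ 4 / \<delta>\<^sup>2" using \<delta> \<epsilon>0 by (intro divide_left_mono) (auto intro!: mult_pos_pos b)
      moreover have "128 * \<epsilon> ^ 4 / (b - (-b)) ^ 3 = 16 * (\<epsilon> ^ 4 / b ^ 3)" using b by (simp add: power3_eq_cube field_simps)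
      ultimately show ?thesis by simp
    qed
    with main have main: "?I4 \<le> 72 * (M + \<epsilon>)\<^sup>2 * ?I2 + 16 * \<epsilon> ^ 4 / \<delta>\<^sup>2" by linarith
    have h4: "((\<lambda>s. norm (D (pt i s t) i) ^ 4) has_integral ?I4) {-b<..<b}"
      by (subst has_integral_Icc_iff_Ioo[symmetric]) (intro integrable_integral integrable_continuous_real continuous_intros cc)
    have h2: "((\<lambda>s. norm (D2 (pt i s t) i i) ^ 2) has_integral ?I2) {-b<..<b}"
      by (subst has_integral_Icc_iff_Ioo[symmetric]) (intro integrable_integral integrable_continuous_real continuous_intros cc)
    have I2: "?I2 \<ge> 0" by (rule Henstock_Kurzweil_Integration.integral_nonneg) (intro integrable_continuous_real continuous_intros cc, simp)
    have "(\<integral>\<^sup>+s. ennreal (indicator (strip i \<delta>) (pt i s t) * norm (D (pt i s t) i) ^ 4) \<partial>lborel)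
       \<le> (\<integral>\<^sup>+s. ennreal (indicator {-b<..<b} s * norm (D (pt i s t) i) ^ 4) \<partial>lborel)"
      by (intro nn_integral_mono ennreal_leI mult_right_mono) (use inb in \<open>auto simp: strip_def indicator_def\<close>)
    also have "\<dots> = ennreal ?I4" by (rule nn_integral_has_integral_lebesgue[OF _ h4]) simp
    also have "\<dots> \<le> ennreal (72 * (M + \<epsilon>)\<^sup>2 * ?I2 + 16 * \<epsilon> ^ 4 / \<delta>\<^sup>2)" by (rule ennreal_leI[OF main])
    also have "\<dots> = ennreal (72 * (M + \<epsilon>)\<^sup>2) * ennreal ?I2 + ennreal (16 * \<epsilon> ^ 4 / \<delta>\<^sup>2)"
      using I2 \<epsilon>0 by (simp add: ennreal_mult ennreal_plus)
    also have "ennreal ?I2 = (\<integral>\<^sup>+s. ennreal (indicator {-b<..<b} s * norm (D2 (pt i s t) i i) ^ 2) \<partial>lborel)"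
      by (rule nn_integral_has_integral_lebesgue[OF _ h2, symmetric]) simp
    also have "\<dots> = (\<integral>\<^sup>+s. ennreal (indicator (ball 0 1) (pt i s t) * norm (D2 (pt i s t) i i) ^ 2) \<partial>lborel)"
      using inb by (intro nn_integral_cong) (simp add: indicator_def)
    also have "ennreal (16 * \<epsilon> ^ 4 / \<delta>\<^sup>2) = ennreal (16 * \<epsilon> ^ 4 / \<delta>\<^sup>2) * indicator {-1..1} t"
      using True \<delta> by (auto simp: indicator_def)
    finally show ?thesis .
  qed
  have mm: "(\<lambda>t. \<integral>\<^sup>+s. ennreal (indicator (ball 0 1) (pt i s t) * norm (D2 (pt i s t) i i) ^ 2) \<partial>lborel) \<in> borel_measurable lborel"
  proof -
    have "(\<lambda>x. ennreal (indicator (ball 0 1) (pt i (fst x) (snd x)) * norm (D2 (pt i (fst x) (snd x)) i i) ^ 2)) \<in> borel_measurable borel"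
      using measurable_compose[OF pt_measurable[of i] m2] by measurable
    then have "(\<lambda>(t,s). ennreal (indicator (ball 0 1) (pt i s t) * norm (D2 (pt i s t) i i) ^ 2)) \<in> borel_measurable (lborel \<Otimes>\<^sub>M lborel)"
      using measurable_compose[of "\<lambda>x::real\<times>real. (snd x, fst x)" borel borel "\<lambda>x. ennreal (indicator (ball 0 1) (pt i (fst x) (snd x)) * norm (D2 (pt i (fst x) (snd x)) i i) ^ 2)" borel]
      by (simp add: lborel_prod case_prod_beta' borel_measurable_continuous_onI continuous_on_swap[unfolded prod.swap_def])
    then show ?thesis by (rule lborel.borel_measurable_nn_integral)
  qed
  have "(\<integral>\<^sup>+x. ennreal (indicator (strip i \<delta>) x * norm (D x i) ^ 4) \<partial>lborel) = (\<integral>\<^sup>+t. (\<integral>\<^sup>+s. ennreal (indicator (strip i \<delta>) (pt i s t) * norm (D (pt i s t) i) ^ 4) \<partial>lborel) \<partial>lborel)"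
    by (rule nn_integral_pt) (use m1 in measurable)
  also have "\<dots> \<le> (\<integral>\<^sup>+t. (ennreal (72 * (M + \<epsilon>)\<^sup>2) * (\<integral>\<^sup>+s. ennreal (indicator (ball 0 1) (pt i s t) * norm (D2 (pt i s t) i i) ^ 2) \<partial>lborel)
         + ennreal (16 * \<epsilon> ^ 4 / \<delta>\<^sup>2) * indicator {-1..1} t) \<partial>lborel)"
    by (intro nn_integral_mono slice)
  also have "\<dots> = ennreal (72 * (M + \<epsilon>)\<^sup>2) * (\<integral>\<^sup>+t. (\<integral>\<^sup>+s. ennreal (indicator (ball 0 1) (pt i s t) * norm (D2 (pt i s t) i i) ^ 2) \<partial>lborel) \<partial>lborel)
      + ennreal (16 * \<epsilon> ^ 4 / \<delta>\<^sup>2) * ennreal 2"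
    using mm by (subst nn_integral_add) (auto simp: nn_integral_cmult nn_integral_cmult_indicator)
  also have "(\<integral>\<^sup>+t. (\<integral>\<^sup>+s. ennreal (indicator (ball 0 1) (pt i s t) * norm (D2 (pt i s t) i i) ^ 2) \<partial>lborel) \<partial>lborel) = (\<integral>\<^sup>+x. ennreal (indicator (ball 0 1) x * norm (D2 x i i) ^ 2) \<partial>lborel)"
    by (rule nn_integral_pt[symmetric]) (use m2 in measurable)
  also have "ennreal (16 * \<epsilon> ^ 4 / \<delta>\<^sup>2) * ennreal 2 = ennreal (32 * \<epsilon> ^ 4 / \<delta>\<^sup>2)" using \<epsilon>0 by (subst ennreal_mult[symmetric]) auto
  finally show ?thesis .
qed

lemma nn_integral_disc: "(\<integral>\<^sup>+x. ennreal (f x) \<partial>disc) = (\<integral>\<^sup>+x. ennreal (indicator (ball 0 1) x * f x) \<partial>lborel)"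
proof -
  have "(\<integral>\<^sup>+x. ennreal (f x) \<partial>disc) = (\<integral>\<^sup>+x. ennreal (f x) * indicator (ball 0 1) x \<partial>lebesgue)"
    by (subst nn_integral_restrict_space) simp_all
  also have "\<dots> = (\<integral>\<^sup>+x. ennreal (indicator (ball 0 1) x * f x) \<partial>lebesgue)"
    by (intro nn_integral_cong) (simp split: split_indicator)
  also have "\<dots> = (\<integral>\<^sup>+x. ennreal (indicator (ball 0 1) x * f x) \<partial>lborel)" by (rule nn_integral_completion)
  finally show ?thesis .
qed

lemma borel_disc: "f \<in> borel_measurable borel \<Longrightarrow> f \<in> borel_measurable disc"
  for f :: "real^2 \<Rightarrow> 'b::topological_space"
  by (intro measurable_restrict_space1 measurable_completion) simp

lemma nn_tendsto_0_AE_subseq: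
  fixes f :: "nat \<Rightarrow> 'a \<Rightarrow> 'b::{banach,second_countable_topology}"
  assumes m[measurable]: "\<And>n. f n \<in> borel_measurable M" "g \<in> borel_measurable M"
    and l: "(\<lambda>n. \<integral>\<^sup>+x. ennreal (norm (f n x - g x) ^ 2) \<partial>M) \<longlonglongrightarrow> 0"
  obtains r :: "nat \<Rightarrow> nat" where "strict_mono r" "AE x in M. (\<lambda>n. f (r n) x) \<longlonglongrightarrow> g x"
proof -
  have "\<forall>\<^sub>F n in sequentially. (\<integral>\<^sup>+x. ennreal (norm (f n x - g x) ^ 2) \<partial>M) < 1" using l by (intro order_tendstoD(2)) auto
  then obtain N where N: "\<And>n. n \<ge> N \<Longrightarrow> (\<integral>\<^sup>+x. ennreal (norm (f n x - g x) ^ 2) \<partial>M) < 1"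
    unfolding eventually_sequentially by blast
  \<comment> \<open>Finitely many of the integrals may be infinite; the shift by \<open>N\<close>
    leaves integrable functions.\<close>
  define u where "u = (\<lambda>n x. norm (f (n + N) x - g x) ^ 2)"
  have u: "integrable M (u n)" for n unfolding u_def
    by (rule integrableI_nonneg) (use N[of "n + N"] in \<open>auto intro: order.strict_trans\<close>)
  have eq: "ennreal (\<integral>x. norm (u n x) \<partial>M) = (\<integral>\<^sup>+x. ennreal (norm (f (n + N) x - g x) ^ 2) \<partial>M)" for n
  proof -
    have "(\<integral>\<^sup>+x. ennreal (u n x) \<partial>M) = ennreal (\<integral>x. u n x \<partial>M)" by (rule nn_integral_eq_integral[OF u]) (simp add: u_def)
    then show ?thesis by (simp add: u_def)
  qed
  have "(\<lambda>n. \<integral>\<^sup>+x. ennreal (norm (f (n + N) x - g x) ^ 2) \<partial>M) \<longlonglongrightarrow> 0" using LIMSEQ_ignore_initial_segment[OF l] .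
  then have "(\<lambda>n. ennreal (\<integral>x. norm (u n x) \<partial>M)) \<longlonglongrightarrow> ennreal 0" unfolding eq by simp
  then have "(\<lambda>n. \<integral>x. norm (u n x) \<partial>M) \<longlonglongrightarrow> 0" by (subst (asm) tendsto_ennreal_iff) auto
  from tendsto_L1_AE_subseq[OF u this] obtain r :: "nat \<Rightarrow> nat" where r: "strict_mono r" "AE x in M. (\<lambda>n. u (r n) x) \<longlonglongrightarrow> 0" by blast
  show ?thesis
  proof (rule that[of "\<lambda>n. r n + N"])
    show "strict_mono (\<lambda>n. r n + N)" using r(1) by (simp add: strict_mono_def)
    show "AE x in M. (\<lambda>n. f (r n + N) x) \<longlonglongrightarrow> g x"
      using r(2)
    proof eventually_elim
      case (elim x)
      have "(\<lambda>n. sqrt (u (r n) x)) \<longlonglongrightarrow> sqrt 0" by (intro tendsto_real_sqrt elim)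
      then have "(\<lambda>n. norm (f (r n + N) x - g x)) \<longlonglongrightarrow> 0" by (simp add: u_def)
      then show ?case using LIM_zero_iff tendsto_norm_zero_iff by blast
    qed
  qed
qed

lemma C2on_disc_measurable:
  assumes "C2on r y D D2" "r > 1"
  shows "y \<in> borel_measurable disc" "(\<lambda>x. D x i) \<in> borel_measurable disc" "(\<lambda>x. D2 x i j) \<in> borel_measurable disc"
proof -
  have s: "ball 0 1 \<subseteq> ball (0::real^2) r" using assms(2) by auto
  note c = C2on_continuous[OF assms(1), THEN continuous_on_subset, OF s]
  show "y \<in> borel_measurable disc" "(\<lambda>x. D x i) \<in> borel_measurable disc" "(\<lambda>x. D2 x i j) \<in> borel_measurable disc"
    by (rule continuous_imp_measurable_on_sets_lebesgue[OF c(1)] continuous_imp_measurable_on_sets_lebesgue[OF c(2)]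
      continuous_imp_measurable_on_sets_lebesgue[OF c(3)], simp)+
qed

lemma nn_integral_Fatou_bound:
  fixes f :: "nat \<Rightarrow> 'a \<Rightarrow> real"
  assumes m: "\<And>n. f n \<in> borel_measurable M" and l: "AE x in M. (\<lambda>n. f n x) \<longlonglongrightarrow> g x"
    and b: "\<forall>\<^sub>F n in sequentially. (\<integral>\<^sup>+x. ennreal (f n x) \<partial>M) \<le> C"
  shows "(\<integral>\<^sup>+x. ennreal (g x) \<partial>M) \<le> C"
proof -
  have "(\<integral>\<^sup>+x. ennreal (g x) \<partial>M) = (\<integral>\<^sup>+x. liminf (\<lambda>n. ennreal (f n x)) \<partial>M)"
  proof (rule nn_integral_cong_AE)
    show "AE x in M. ennreal (g x) = liminf (\<lambda>n. ennreal (f n x))"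
      using l by eventually_elim (auto intro!: lim_imp_Liminf[symmetric] tendsto_ennrealI)
  qed
  also have "\<dots> \<le> liminf (\<lambda>n. \<integral>\<^sup>+x. ennreal (f n x) \<partial>M)" by (rule nn_integral_liminf) (use m in measurable)
  also have "\<dots> \<le> limsup (\<lambda>n. \<integral>\<^sup>+x. ennreal (f n x) \<partial>M)" by (rule Liminf_le_Limsup) simp
  also have "\<dots> \<le> C" using b by (rule Limsup_bounded)
  finally show ?thesis .
qed

lemma power2_norm_add_le: "norm (a + b) ^ 2 \<le> 2 * norm a ^ 2 + 2 * norm b ^ 2" for a b :: "'a::real_normed_vector"
proof -
  have "norm (a + b) ^ 2 \<le> (norm a + norm b)\<^sup>2" by (intro power_mono norm_triangle_ineq) simp
  also have "\<dots> \<le> 2 * norm a ^ 2 + 2 * norm b ^ 2" using sum_squares_bound[of "norm a" "norm b"] by (simp add: power2_sum)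
  finally show ?thesis .
qed

lemma nn_integral_square_add_le:
  fixes f g :: "'a \<Rightarrow> 'b::{banach,second_countable_topology}"
  assumes [measurable]: "f \<in> borel_measurable M" "g \<in> borel_measurable M"
  shows "(\<integral>\<^sup>+x. ennreal (norm (f x) ^ 2) \<partial>M) \<le> 2 * (\<integral>\<^sup>+x. ennreal (norm (g x) ^ 2) \<partial>M) + 2 * (\<integral>\<^sup>+x. ennreal (norm (f x - g x) ^ 2) \<partial>M)"
proof -
  have "(\<integral>\<^sup>+x. ennreal (norm (f x) ^ 2) \<partial>M) \<le> (\<integral>\<^sup>+x. 2 * ennreal (norm (g x) ^ 2) + 2 * ennreal (norm (f x - g x) ^ 2) \<partial>M)"
  proof (rule nn_integral_mono)
    fix x
    have "ennreal (norm (f x) ^ 2) \<le> ennreal (2 * norm (g x) ^ 2 + 2 * norm (f x - g x) ^ 2)"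
      using power2_norm_add_le[of "g x" "f x - g x"] by (intro ennreal_leI) simp
    also have "\<dots> = 2 * ennreal (norm (g x) ^ 2) + 2 * ennreal (norm (f x - g x) ^ 2)" by (simp add: ennreal_plus ennreal_mult)
    finally show "ennreal (norm (f x) ^ 2) \<le> \<dots>" .
  qed
  also have "\<dots> = 2 * (\<integral>\<^sup>+x. ennreal (norm (g x) ^ 2) \<partial>M) + 2 * (\<integral>\<^sup>+x. ennreal (norm (f x - g x) ^ 2) \<partial>M)"
    by (simp add: nn_integral_add nn_integral_cmult)
  finally show ?thesis .
qed

text \<open>Three limits in this order: mollification for a fixed strip and tolerance \<eta>, then
  \<eta> to 0, which removes the boundary error, then \<delta> to 0, which exhausts the disc. The
  left-hand sides are handled by Fatou's lemma, so integrability of the fourth power is a conclusion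
  and not a hypothesis. The factor 144 is twice 72 because \<open>nn_integral_square_add_le\<close>
  compares mollified and weak second derivatives with constant 2.\<close>

lemma gn_weak:
  assumes w: "W22 (ball 0 1) w Dw D2w" and wc: "continuous_on (cball 0 1) w"
    and z: "\<And>x. x \<in> sphere 0 1 \<Longrightarrow> w x = 0" and M: "\<And>x. x \<in> cball 0 1 \<Longrightarrow> norm (w x) \<le> M"
  shows "(\<integral>\<^sup>+x. ennreal (norm (Dw x i) ^ 4) \<partial>disc) \<le> ennreal (144 * M\<^sup>2) * (\<integral>\<^sup>+x. ennreal (norm (D2w x i i) ^ 2) \<partial>disc)"
proof -
  obtain r Y D D2 where r: "\<And>n::nat. r n > 1" and C: "\<And>n. C2on (r n) (Y n) (D n) (D2 n)"
    and U: "uniform_limit (cball 0 1) Y w sequentially"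
    and L1: "\<And>i. (\<lambda>n. \<integral>\<^sup>+x. ennreal (norm (D n x i - Dw x i) ^ 2) \<partial>disc) \<longlonglongrightarrow> 0"
    and L2: "\<And>i j. (\<lambda>n. \<integral>\<^sup>+x. ennreal (norm (D2 n x i j - D2w x i j) ^ 2) \<partial>disc) \<longlonglongrightarrow> 0"
    by (rule W22_approx[OF w wc]) blast
  have M0: "M \<ge> 0" using order_trans[OF norm_ge_zero M[of 0]] by simp
  have wm: "(\<lambda>x. Dw x i) \<in> borel_measurable disc" "(\<lambda>x. D2w x i j) \<in> borel_measurable disc"
    "integrable disc (\<lambda>x. norm (D2w x i j) ^ 2)" for i j
    using w by (auto simp: W22_def L2_on_disc)
  note dm = C2on_disc_measurable[OF C r]
  define \<beta> where "\<beta> = (\<integral>x. norm (D2w x i i) ^ 2 \<partial>disc)"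
  have \<beta>: "(\<integral>\<^sup>+x. ennreal (norm (D2w x i i) ^ 2) \<partial>disc) = ennreal \<beta>" "\<beta> \<ge> 0"
    unfolding \<beta>_def by (auto intro!: nn_integral_eq_integral wm)
  \<comment> \<open>Fatou's lemma needs pointwise convergence of the gradients, which is available
    along a subsequence.\<close>
  obtain s where s: "strict_mono (s :: nat \<Rightarrow> nat)" "AE x in disc. (\<lambda>n. D (s n) x i) \<longlonglongrightarrow> Dw x i"
    by (rule nn_tendsto_0_AE_subseq[of "\<lambda>n x. D n x i" disc "\<lambda>x. Dw x i", OF dm(2) wm(1) L1]) blast
  have sm: "strip i \<delta> \<in> sets disc" if "\<delta> > 0" for \<delta>
    using strip_borel by (subst sets_restrict_space_iff) (auto simp: strip_def)
  have imm: "(\<lambda>x. indicator (strip i \<delta>) x * norm (f x) ^ 4 :: real) \<in> borel_measurable disc"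
    if "f \<in> borel_measurable disc" for \<delta> and f :: "real^2 \<Rightarrow> real^3"
    using that borel_disc[of "indicator (strip i \<delta>) :: real^2 \<Rightarrow> real"] by (intro borel_measurable_times borel_measurable_power borel_measurable_norm) auto
  have st: "(\<integral>\<^sup>+x. ennreal (indicator (strip i \<delta>) x * norm (Dw x i) ^ 4) \<partial>disc) \<le> ennreal (144 * M\<^sup>2 * \<beta>)"
    if \<delta>: "0 < \<delta>" "\<delta> < 1" for \<delta>
  proof -
    have eta: "(\<integral>\<^sup>+x. ennreal (indicator (strip i \<delta>) x * norm (Dw x i) ^ 4) \<partial>disc)
       \<le> ennreal (72 * (M + 2 * \<eta>)\<^sup>2 * (2 * \<beta> + 2 * \<eta>) + 32 * \<eta> ^ 4 / \<delta>\<^sup>2)" if \<eta>: "\<eta> > 0" for \<eta>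
    proof (rule nn_integral_Fatou_bound[where f="\<lambda>n x. indicator (strip i \<delta>) x * norm (D (s n) x i) ^ 4"])
      show "(\<lambda>x. indicator (strip i \<delta>) x * norm (D (s n) x i) ^ 4 :: real) \<in> borel_measurable disc" for n
        by (rule imm[OF dm(2)])
      show "AE x in disc. (\<lambda>n. indicator (strip i \<delta>) x * norm (D (s n) x i) ^ 4) \<longlonglongrightarrow> indicator (strip i \<delta>) x * norm (Dw x i) ^ 4"
        using s(2) by eventually_elim (intro tendsto_intros)
      have "\<forall>\<^sub>F n in sequentially. \<forall>x\<in>cball 0 1. dist (Y n x) (w x) < \<eta>" using uniform_limitD[OF U \<eta>] .
      moreover have "\<forall>\<^sub>F n in sequentially. (\<integral>\<^sup>+x. ennreal (norm (D2 n x i i - D2w x i i) ^ 2) \<partial>disc) < ennreal \<eta>"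
        using L2 \<eta> by (intro order_tendstoD(2)) auto
      ultimately have "\<forall>\<^sub>F n in sequentially. (\<integral>\<^sup>+x. ennreal (indicator (strip i \<delta>) x * norm (D n x i) ^ 4) \<partial>disc)
         \<le> ennreal (72 * (M + 2 * \<eta>)\<^sup>2 * (2 * \<beta> + 2 * \<eta>) + 32 * \<eta> ^ 4 / \<delta>\<^sup>2)"
      proof eventually_elim
        case (elim n)
        have c1: "norm (Y n x) \<le> M + \<eta>" if "x \<in> cball 0 1" for x
          using elim(1)[rule_format, OF that] M[OF that] norm_triangle_ineq[of "w x" "Y n x - w x"] by (simp add: dist_norm)
        have c2: "norm (Y n x) \<le> \<eta>" if "x \<in> sphere 0 1" for x
          using elim(1)[rule_format, of x] z[OF that] that by (simp add: dist_norm)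
        have "(\<integral>\<^sup>+x. ennreal (indicator (strip i \<delta>) x * norm (D n x i) ^ 4) \<partial>disc) = (\<integral>\<^sup>+x. ennreal (indicator (strip i \<delta>) x * norm (D n x i) ^ 4) \<partial>lborel)"
          unfolding nn_integral_disc by (intro nn_integral_cong) (auto simp: strip_def indicator_def)
        also have "\<dots> \<le> ennreal (72 * (M + \<eta> + \<eta>)\<^sup>2) * (\<integral>\<^sup>+x. ennreal (indicator (ball 0 1) x * norm (D2 n x i i) ^ 2) \<partial>lborel) + ennreal (32 * \<eta> ^ 4 / \<delta>\<^sup>2)"
          by (rule gn_smooth[OF C r c1 c2 \<delta>])
        also have "(\<integral>\<^sup>+x. ennreal (indicator (ball 0 1) x * norm (D2 n x i i) ^ 2) \<partial>lborel) = (\<integral>\<^sup>+x. ennreal (norm (D2 n x i i) ^ 2) \<partial>disc)"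
          by (rule nn_integral_disc[symmetric])
        also have "\<dots> \<le> 2 * (\<integral>\<^sup>+x. ennreal (norm (D2w x i i) ^ 2) \<partial>disc) + 2 * (\<integral>\<^sup>+x. ennreal (norm (D2 n x i i - D2w x i i) ^ 2) \<partial>disc)"
          by (rule nn_integral_square_add_le[OF dm(3) wm(2)])
        also have "\<dots> \<le> 2 * ennreal \<beta> + 2 * ennreal \<eta>" using elim(2) unfolding \<beta> by (intro add_mono mult_left_mono) auto
        also have "\<dots> = ennreal (2 * \<beta> + 2 * \<eta>)" using \<beta>(2) \<eta> by (simp add: ennreal_plus ennreal_mult)
        also have "ennreal (72 * (M + \<eta> + \<eta>)\<^sup>2) * ennreal (2 * \<beta> + 2 * \<eta>) + ennreal (32 * \<eta> ^ 4 / \<delta>\<^sup>2)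
            = ennreal (72 * (M + 2 * \<eta>)\<^sup>2 * (2 * \<beta> + 2 * \<eta>) + 32 * \<eta> ^ 4 / \<delta>\<^sup>2)"
        proof -
          have e: "M + \<eta> + \<eta> = M + 2 * \<eta>" by simp
          show ?thesis unfolding e using \<beta>(2) \<eta> by (subst ennreal_mult[symmetric], simp, simp, subst ennreal_plus[symmetric], auto)
        qed
        finally show ?case by (simp add: mult_left_mono add_right_mono)
      qed
      then show "\<forall>\<^sub>F n in sequentially. (\<integral>\<^sup>+x. ennreal (indicator (strip i \<delta>) x * norm (D (s n) x i) ^ 4) \<partial>disc)
         \<le> ennreal (72 * (M + 2 * \<eta>)\<^sup>2 * (2 * \<beta> + 2 * \<eta>) + 32 * \<eta> ^ 4 / \<delta>\<^sup>2)"
        using s(1) by (rule eventually_subseq[rotated])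
    qed
    define G where "G = (\<lambda>\<eta>. 72 * (M + 2 * \<eta>)\<^sup>2 * (2 * \<beta> + 2 * \<eta>) + 32 * \<eta> ^ 4 / \<delta>\<^sup>2)"
    have l0: "(\<lambda>n. 1 / real (Suc n)) \<longlonglongrightarrow> 0" by real_asymp
    have "(\<lambda>n. G (1 / real (Suc n))) \<longlonglongrightarrow> G 0" unfolding G_def
      by (intro tendsto_intros l0) (use \<delta> in auto)
    then have "(\<lambda>n. ennreal (G (1 / real (Suc n)))) \<longlonglongrightarrow> ennreal (G 0)" by (rule tendsto_ennrealI)
    then have "(\<integral>\<^sup>+x. ennreal (indicator (strip i \<delta>) x * norm (Dw x i) ^ 4) \<partial>disc) \<le> ennreal (G 0)"
    proof (rule LIMSEQ_le_const, intro exI allI impI)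
      show "(\<integral>\<^sup>+x. ennreal (indicator (strip i \<delta>) x * norm (Dw x i) ^ 4) \<partial>disc) \<le> ennreal (G (1 / real (Suc n)))" for n
        unfolding G_def by (rule eta) simp
    qed
    then show ?thesis by (simp add: G_def mult.assoc)
  qed
  have "(\<integral>\<^sup>+x. ennreal (norm (Dw x i) ^ 4) \<partial>disc) \<le> ennreal (144 * M\<^sup>2 * \<beta>)"
  proof (rule nn_integral_Fatou_bound[where f="\<lambda>n x. indicator (strip i (1 / (real n + 2))) x * norm (Dw x i) ^ 4"])
    show "(\<lambda>x. indicator (strip i (1 / (real n + 2))) x * norm (Dw x i) ^ 4 :: real) \<in> borel_measurable disc" for n
      by (rule imm[OF wm(1)])
    show "AE x in disc. (\<lambda>n. indicator (strip i (1 / (real n + 2))) x * norm (Dw x i) ^ 4) \<longlonglongrightarrow> norm (Dw x i) ^ 4"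
      unfolding AE_disc_iff
    proof (intro AE_I2 impI)
      fix x :: "real^2" assume x: "x \<in> ball 0 1"
      have "(\<lambda>n. 1 / (real n + 2)) \<longlonglongrightarrow> 0" by real_asymp
      then have "\<forall>\<^sub>F n in sequentially. 1 / (real n + 2) < 1 - norm x" using x by (intro order_tendstoD(2)) auto
      then have "\<forall>\<^sub>F n in sequentially. x \<in> strip i (1 / (real n + 2))"
      proof eventually_elim
        case (elim n)
        have "\<bar>x $ k\<bar> \<le> 1 - 1 / (real n + 2)" for k using component_le_norm_cart[of x k] elim by simp
        then show ?case using x by (simp add: strip_def)
      qed
      then have "\<forall>\<^sub>F n in sequentially. indicator (strip i (1 / (real n + 2))) x * norm (Dw x i) ^ 4 = norm (Dw x i) ^ 4"
        by eventually_elim simp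
      then show "(\<lambda>n. indicator (strip i (1 / (real n + 2))) x * norm (Dw x i) ^ 4) \<longlonglongrightarrow> norm (Dw x i) ^ 4"
        by (rule tendsto_eventually)
    qed
    show "\<forall>\<^sub>F n in sequentially. (\<integral>\<^sup>+x. ennreal (indicator (strip i (1 / (real n + 2))) x * norm (Dw x i) ^ 4) \<partial>disc) \<le> ennreal (144 * M\<^sup>2 * \<beta>)"
      by (intro always_eventually allI st) (auto simp: field_simps)
  qed
  then show ?thesis unfolding \<beta> using \<beta>(2) by (simp add: ennreal_mult)
qed

section \<open>Morrey's inequality\<close>

definition gsum :: "(real^2 \<Rightarrow> 2 \<Rightarrow> real^3) \<Rightarrow> real^2 \<Rightarrow> real" where
  "gsum D x = (\<Sum>i\<in>UNIV. norm (D x i))"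

lemma gsum_nonneg: "0 \<le> gsum D x" by (simp add: gsum_def sum_nonneg)

lemma gsum_pow4: "gsum D x ^ 4 \<le> 8 * (\<Sum>i\<in>UNIV. norm (D x i) ^ 4)"
  using norm_sum_power4[of "norm (D x 1)" "norm (D x 2)"] by (simp add: gsum_def sum_2)

text \<open>Young's inequality \<open>v \<le> \<mu> + v ^ 4 / \<mu> ^ 3\<close> with \<open>\<mu> = m t powr (-1/2)\<close>; with the weight
  \<open>t powr (3/2)\<close>, the Jacobian \<open>1 / t\<^sup>2\<close> of the contraction towards an endpoint leaves an integrable singularity.\<close>

lemma young4:
  fixes v m t :: real
  assumes v: "v \<ge> 0" and m: "m > 0" and t: "t > 0"
  shows "v \<le> m * t powr (-1/2) + m powr (-3) * t powr (3/2) * v ^ 4"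
proof -
  define \<mu> where "\<mu> = m * t powr (-1/2)"
  have mu: "\<mu> > 0" using m t by (simp add: \<mu>_def)
  have e: "m powr (-3) * t powr (3/2) = 1 / \<mu> ^ 3"
  proof -
    have "\<mu> ^ 3 = \<mu> powr 3" using mu by (simp add: powr_numeral)
    also have "\<dots> = m powr 3 * t powr (-3/2)" using m t unfolding \<mu>_def by (subst powr_mult) (auto simp: powr_powr)
    finally have "\<mu> ^ 3 = m powr 3 * t powr (-3/2)" .
    moreover have "m powr (-3) = 1 / m powr 3" "t powr (-3/2) = 1 / t powr (3/2)"
      using powr_minus_divide[of m 3] powr_minus_divide[of t "3/2"] by simp_all
    ultimately show ?thesis by simp
  qed
  show ?thesis
  proof (cases "v \<le> \<mu>")
    case True then show ?thesis using v m t by (simp add: \<mu>_def add_increasing2)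
  next
    case False
    then have "\<mu> ^ 3 \<le> v ^ 3" using mu by (intro power_mono) auto
    then have "v * \<mu> ^ 3 \<le> v * v ^ 3" using v by (rule mult_left_mono)
    then have "v \<le> 1 / \<mu> ^ 3 * v ^ 4" using mu by (simp add: field_simps eval_nat_numeral)
    moreover have "0 \<le> m * t powr (-1/2)" using m by simp
    ultimately show ?thesis unfolding e by linarith
  qed
qed

lemma C2on_segment:
  assumes C: "C2on r Y D D2" and s: "x + t *\<^sub>R v \<in> ball 0 r"
  shows "((\<lambda>t. Y (x + t *\<^sub>R v)) has_vector_derivative (\<Sum>i\<in>UNIV. v $ i *\<^sub>R D (x + t *\<^sub>R v) i)) (at t)"
proof -
  have p: "((\<lambda>t. x + t *\<^sub>R v) has_derivative (\<lambda>h. h *\<^sub>R v)) (at t)" by (auto intro!: derivative_eq_intros)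
  have a: "(Y has_derivative (\<lambda>w. \<Sum>k\<in>UNIV. w $ k *\<^sub>R D (x + t *\<^sub>R v) k)) (at (x + t *\<^sub>R v))"
    using C s by (auto simp: C2on_def)
  show ?thesis using has_derivative_compose[OF p a] by (simp add: has_vector_derivative_def scaleR_sum_right)
qed

text \<open>The increment is the integral of the gradient along the segment from \<open>x\<close> to
  \<open>z\<close>, with Young's inequality applied at every time \<open>t\<close>. The function
  \<open>h\<close> is cut off to the open disc and \<open>x\<close> may lie on the circle, hence the
  open interval of times.\<close>

lemma C2on_segment_bound:
  assumes C: "C2on r Y D D2" and r: "r > 1" and x: "norm x \<le> 1" and z: "norm z < 1" and s: "norm (z - x) \<le> s" and m: "m > 0"
    and h: "h = (\<lambda>y. indicator (ball 0 1) y * gsum D y ^ 4)"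
  shows "ennreal (norm (Y z - Y x)) \<le> (\<integral>\<^sup>+t. ennreal (indicator {0<..<1} t * (s * (m * t powr (-1/2) + m powr (-3) * t powr (3/2) * h (x + t *\<^sub>R (z - x))))) \<partial>lborel)"
proof -
  let ?p = "\<lambda>t. x + t *\<^sub>R (z - x)"
  have pc: "norm (?p t) \<le> 1" if "t \<in> {0..1}" for t
  proof -
    have "?p t = (1 - t) *\<^sub>R x + t *\<^sub>R z" by (simp add: algebra_simps)
    also have "norm \<dots> \<le> (1 - t) * norm x + t * norm z" using that by (intro order_trans[OF norm_triangle_ineq]) auto
    also have "\<dots> \<le> (1 - t) * 1 + t * 1" using that x z by (intro add_mono mult_left_mono) auto
    finally show ?thesis by simp
  qed
  have pb: "norm (?p t) < 1" if "t \<in> {0<..<1}" for t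
  proof -
    have "?p t = (1 - t) *\<^sub>R x + t *\<^sub>R z" by (simp add: algebra_simps)
    also have "norm \<dots> \<le> (1 - t) * norm x + t * norm z" using that by (intro order_trans[OF norm_triangle_ineq]) auto
    also have "\<dots> < (1 - t) * 1 + t * 1" using that x z by (intro add_le_less_mono mult_left_mono mult_strict_left_mono) auto
    finally show ?thesis by simp
  qed
  have pr: "?p t \<in> ball 0 r" if "t \<in> {0..1}" for t using pc[OF that] r by simp
  let ?d = "\<lambda>t. \<Sum>i\<in>UNIV. (z - x) $ i *\<^sub>R D (?p t) i"
  have s0: "s \<ge> 0" using s norm_ge_zero order_trans by blast
  have cp: "continuous_on {0..1} ?p" by (intro continuous_intros)
  have cD: "continuous_on {0..1} (\<lambda>t. D (?p t) i)" for i
    by (rule continuous_on_compose2[OF C2on_continuous(2)[OF C] cp]) (use pr in auto)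
  have cg: "continuous_on {0..1} (\<lambda>t. s * gsum D (?p t))" unfolding gsum_def by (intro continuous_intros cD)
  have "(?d has_integral (Y (?p 1) - Y (?p 0))) {0..1}"
    using has_vector_derivative_at_within[OF C2on_segment[OF C pr]] by (intro fundamental_theorem_of_calculus) auto
  then have "Y z - Y x = integral {0..1} ?d" by (simp add: integral_unique)
  also have "norm \<dots> \<le> integral {0..1} (\<lambda>t. s * gsum D (?p t))"
  proof (rule integral_norm_bound_integral)
    show "?d integrable_on {0..1}" by (intro integrable_continuous_real continuous_intros cD)
    show "(\<lambda>t. s * gsum D (?p t)) integrable_on {0..1}" by (intro integrable_continuous_real cg)
    show "norm (?d t) \<le> s * gsum D (?p t)" for t
    proof -
      have "norm (?d t) \<le> (\<Sum>i\<in>UNIV. \<bar>(z - x) $ i\<bar> * norm (D (?p t) i))" by (rule order_trans[OF norm_sum]) simp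
      also have "\<dots> \<le> (\<Sum>i\<in>UNIV. s * norm (D (?p t) i))"
        by (intro sum_mono mult_right_mono order_trans[OF component_le_norm_cart s]) simp
      finally show ?thesis by (simp add: gsum_def sum_distrib_left)
    qed
  qed
  finally have "ennreal (norm (Y z - Y x)) \<le> ennreal (integral {0..1} (\<lambda>t. s * gsum D (?p t)))" by (rule ennreal_leI)
  also have "\<dots> = (\<integral>\<^sup>+t. ennreal (indicator {0<..<1} t * (s * gsum D (?p t))) \<partial>lborel)"
  proof (rule nn_integral_has_integral_lebesgue[symmetric])
    show "((\<lambda>t. s * gsum D (?p t)) has_integral (integral {0..1} (\<lambda>t. s * gsum D (?p t)))) {0<..<1}"
      by (subst has_integral_Icc_iff_Ioo[symmetric]) (intro integrable_integral integrable_continuous_real cg)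
  qed (simp add: s0 gsum_nonneg)
  also have "\<dots> \<le> (\<integral>\<^sup>+t. ennreal (indicator {0<..<1} t * (s * (m * t powr (-1/2) + m powr (-3) * t powr (3/2) * h (?p t)))) \<partial>lborel)"
  proof (intro nn_integral_mono ennreal_leI)
    fix t :: real
    show "indicator {0<..<1} t * (s * gsum D (?p t)) \<le> indicator {0<..<1} t * (s * (m * t powr (-1/2) + m powr (-3) * t powr (3/2) * h (?p t)))"
    proof (cases "t \<in> {0<..<1}")
      case True
      then have "h (?p t) = gsum D (?p t) ^ 4" using pb[OF True] by (simp add: h)
      then show ?thesis using True young4[OF gsum_nonneg m, of t D "?p t"] s0 by (simp add: mult_left_mono)
    qed simp
  qed
  finally show ?thesis .
qed

lemma nn_powr_half: "(\<integral>\<^sup>+t. ennreal (indicator {0<..<1} t * t powr (-1/2)) \<partial>lborel) = ennreal 2"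
proof -
  have "((\<lambda>t::real. t powr (-1/2)) has_integral (1 powr (-1/2 + 1) / (-1/2 + 1))) {0..1}"
    by (rule has_integral_powr_from_0) auto
  then have "((\<lambda>t::real. t powr (-1/2)) has_integral 2) {0<..<1}" by (simp add: has_integral_Icc_iff_Ioo)
  then show ?thesis by (intro nn_integral_has_integral_lebesgue) auto
qed

text \<open>After the integrals are exchanged, the substitution of
  \<open>x + t *\<^sub>R (z - x)\<close> for \<open>z\<close> costs \<open>1 / t\<^sup>2\<close> and
  turns the weight \<open>t powr (3/2)\<close> into \<open>t powr (-1/2)\<close>. Both parts of
  Young's inequality then carry the same integrable factor, whose integral is the 2 in the
  bound.\<close>

lemma morrey_average:
  assumes C: "C2on r Y D D2" and r: "r > 1" and x: "norm x \<le> 1" and S: "S \<subseteq> ball 0 1" "S \<in> sets borel" "emeasure lborel S = ennreal V" "V \<ge> 0"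
    and s: "\<And>z. z \<in> S \<Longrightarrow> norm (z - x) \<le> s" "s \<ge> 0" and m: "m > 0"
    and I: "(\<integral>\<^sup>+y. ennreal (indicator (ball 0 1) y * gsum D y ^ 4) \<partial>lborel) \<le> ennreal I" "I \<ge> 0"
  shows "(\<integral>\<^sup>+z. ennreal (indicator S z * norm (Y z - Y x)) \<partial>lborel) \<le> ennreal (2 * s * (m * V + m powr (-3) * I))"
proof -
  define h where "h = (\<lambda>y. indicator (ball 0 1) y * gsum D y ^ 4)"
  have sub: "ball 0 1 \<subseteq> ball (0::real^2) r" using r by auto
  note cD = continuous_on_subset[OF C2on_continuous(2)[OF C] sub]
  have hm[measurable]: "h \<in> borel_measurable borel" unfolding h_def gsum_def
    unfolding real_scaleR_def[symmetric] by (intro borel_measurable_continuous_on_indicator continuous_intros cD) auto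
  have [measurable]: "S \<in> sets borel" by fact
  have h0: "h y \<ge> 0" for y by (simp add: h_def gsum_nonneg)
  let ?k = "\<lambda>t z. s * (m * t powr (-1/2) + m powr (-3) * t powr (3/2) * h (x + t *\<^sub>R (z - x)))"
  have "(\<integral>\<^sup>+z. ennreal (indicator S z * norm (Y z - Y x)) \<partial>lborel)
     \<le> (\<integral>\<^sup>+z. (\<integral>\<^sup>+t. ennreal (indicator S z * (indicator {0<..<1} t * ?k t z)) \<partial>lborel) \<partial>lborel)"
  proof (rule nn_integral_mono)
    fix z
    show "ennreal (indicator S z * norm (Y z - Y x)) \<le> (\<integral>\<^sup>+t. ennreal (indicator S z * (indicator {0<..<1} t * ?k t z)) \<partial>lborel)"
    proof (cases "z \<in> S")
      case True
      have "norm z < 1" using S(1) True by auto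
      from C2on_segment_bound[OF C r x this s(1)[OF True] m h_def] show ?thesis using True by simp
    qed simp
  qed
  also have "\<dots> = (\<integral>\<^sup>+t. (\<integral>\<^sup>+z. ennreal (indicator S z * (indicator {0<..<1} t * ?k t z)) \<partial>lborel) \<partial>lborel)"
    by (rule lborel_pair.Fubini') measurable
  also have "\<dots> \<le> (\<integral>\<^sup>+t. ennreal (s * (m * V + m powr (-3) * I)) * ennreal (indicator {0<..<1} t * t powr (-1/2)) \<partial>lborel)"
  proof (rule nn_integral_mono)
    fix t :: real
    show "(\<integral>\<^sup>+z. ennreal (indicator S z * (indicator {0<..<1} t * ?k t z)) \<partial>lborel) \<le> ennreal (s * (m * V + m powr (-3) * I)) * ennreal (indicator {0<..<1} t * t powr (-1/2))"
    proof (cases "t \<in> {0<..<1}")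
      case True
      then have t: "t > 0" by simp
      define a b where "a = s * (m * t powr (-1/2))" and "b = s * (m powr (-3) * t powr (3/2))"
      have ab: "a \<ge> 0" "b \<ge> 0" using s(2) m t by (auto simp: a_def b_def)
      have "(\<integral>\<^sup>+z. ennreal (indicator S z * (indicator {0<..<1} t * ?k t z)) \<partial>lborel)
        \<le> (\<integral>\<^sup>+z. ennreal a * indicator S z + ennreal b * ennreal (h ((x - t *\<^sub>R x) + t *\<^sub>R z)) \<partial>lborel)"
      proof (rule nn_integral_mono)
        fix z
        have e: "x + t *\<^sub>R (z - x) = (x - t *\<^sub>R x) + t *\<^sub>R z" by (simp add: algebra_simps)
        have "indicator S z * (indicator {0<..<1} t * ?k t z) \<le> a * indicator S z + b * h ((x - t *\<^sub>R x) + t *\<^sub>R z)"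
        proof -
          have k: "?k t z = a + b * h ((x - t *\<^sub>R x) + t *\<^sub>R z)" unfolding e a_def b_def by (simp add: distrib_left mult.assoc)
          have "0 \<le> b * h ((x - t *\<^sub>R x) + t *\<^sub>R z)" using ab h0 by simp
          then show ?thesis unfolding k using True by (auto simp: indicator_def)
        qed
        then have "ennreal (indicator S z * (indicator {0<..<1} t * ?k t z)) \<le> ennreal (a * indicator S z + b * h ((x - t *\<^sub>R x) + t *\<^sub>R z))" by (rule ennreal_leI)
        also have "\<dots> = ennreal (a * indicator S z) + ennreal (b * h ((x - t *\<^sub>R x) + t *\<^sub>R z))" using ab h0 by (intro ennreal_plus) auto
        also have "\<dots> = ennreal a * indicator S z + ennreal b * ennreal (h ((x - t *\<^sub>R x) + t *\<^sub>R z))"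
          using ab h0 by (simp add: ennreal_mult split: split_indicator)
        finally show "ennreal (indicator S z * (indicator {0<..<1} t * ?k t z)) \<le> \<dots>" .
      qed
      also have "\<dots> = ennreal a * ennreal V + ennreal b * (\<integral>\<^sup>+z. ennreal (h ((x - t *\<^sub>R x) + t *\<^sub>R z)) \<partial>lborel)"
        by (subst nn_integral_add, measurable, subst nn_integral_cmult, measurable, subst nn_integral_cmult, measurable) (simp add: S)
      also have "\<dots> \<le> ennreal a * ennreal V + ennreal b * ennreal (I / t\<^sup>2)"
      proof (intro add_mono mult_left_mono order_refl)
        have "ennreal (t\<^sup>2) * (\<integral>\<^sup>+z. ennreal (h ((x - t *\<^sub>R x) + t *\<^sub>R z)) \<partial>lborel) = (\<integral>\<^sup>+y. ennreal (h y) \<partial>lborel)"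
          using t by (intro nn_integral_affine[symmetric]) auto
        also have "\<dots> \<le> ennreal I" using I(1) by (simp add: h_def)
        finally have "ennreal (1/t\<^sup>2) * (ennreal (t\<^sup>2) * (\<integral>\<^sup>+z. ennreal (h ((x - t *\<^sub>R x) + t *\<^sub>R z)) \<partial>lborel)) \<le> ennreal (1/t\<^sup>2) * ennreal I"
          by (intro mult_left_mono) auto
        then show "(\<integral>\<^sup>+z. ennreal (h ((x - t *\<^sub>R x) + t *\<^sub>R z)) \<partial>lborel) \<le> ennreal (I / t\<^sup>2)"
          using t I(2) by (simp add: mult.assoc[symmetric] ennreal_mult[symmetric])
      qed auto
      also have "\<dots> = ennreal (a * V + b * (I / t\<^sup>2))" using ab S(4) divide_nonneg_nonneg[OF I(2) zero_le_power2[of t]]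
        by (simp only: ennreal_mult ennreal_plus mult_nonneg_nonneg)
      also have "a * V + b * (I / t\<^sup>2) = (s * (m * V + m powr (-3) * I)) * t powr (-1/2)"
      proof -
        have "t powr (3/2) / t\<^sup>2 = t powr (-1/2)"
          using t powr_diff[of t "3/2" 2] by (simp add: powr_numeral)
        moreover have "b * (I / t\<^sup>2) = s * (m powr (-3) * (t powr (3/2) / t\<^sup>2)) * I" by (simp add: b_def)
        ultimately have "b * (I / t\<^sup>2) = s * (m powr (-3) * t powr (-1/2)) * I" by simp
        then show ?thesis by (simp add: a_def algebra_simps)
      qed
      also have "ennreal ((s * (m * V + m powr (-3) * I)) * t powr (-1/2)) = ennreal (s * (m * V + m powr (-3) * I)) * ennreal (indicator {0<..<1} t * t powr (-1/2))"
        using True s(2) m S(4) I(2) by (simp add: ennreal_mult)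
      finally show ?thesis .
    qed simp
  qed
  also have "\<dots> = ennreal (s * (m * V + m powr (-3) * I)) * ennreal 2"
    using nn_powr_half by (subst nn_integral_cmult) simp_all
  also have "\<dots> = ennreal (2 * s * (m * V + m powr (-3) * I))"
    using s(2) m S(4) I(2) by (subst ennreal_mult[symmetric]) (auto simp: mult_ac)
  finally show ?thesis .
qed

text \<open>Both points are compared with the values on a common small ball. The parameter
  \<open>m = s powr (-1/2)\<close> makes the two terms of \<open>morrey_average\<close> scale alike:
  \<open>s * m\<close> and \<open>s * m powr (-3) / s\<^sup>2\<close> are both
  \<open>sqrt s\<close>.\<close>

lemma morrey:
  assumes C: "C2on r Y D D2" and r: "r > 1" and x: "norm x \<le> 1" "norm x' \<le> 1"
    and I: "(\<integral>\<^sup>+y. ennreal (indicator (ball 0 1) y * gsum D y ^ 4) \<partial>lborel) \<le> ennreal I" "I \<ge> 0"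
  shows "norm (Y x - Y x') \<le> (4 + 64 * I / pi) * sqrt (norm (x - x'))"
proof (cases "x = x'")
  case False
  define s where "s = norm (x - x')"
  have s: "s > 0" "s \<le> 2" using False norm_triangle_ineq4[of x x'] x by (auto simp: s_def)
  define c where "c = (1/2) *\<^sub>R (x + x')"
  \<comment> \<open>The midpoint is pulled inward by at most \<open>s / 4\<close>, so that the ball
    lies in the unit disc even for points on the circle, while all its points stay within
    \<open>s / 4 + s / 4 + s / 2 = s\<close> of \<open>x\<close> and of \<open>x'\<close>.\<close>
  define S where "S = ball ((1 - s/4) *\<^sub>R c) (s/4)"
  define V where "V = pi * (s/4)\<^sup>2"
  have V: "emeasure lborel S = ennreal V" "V > 0" unfolding S_def V_def using s by (auto simp: emeasure_ball unit_ball_vol_2)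
  have c: "norm c \<le> 1" using norm_triangle_ineq[of x x'] x by (simp add: c_def)
  have S1: "S \<subseteq> ball 0 1"
  proof
    fix z assume "z \<in> S"
    then have "norm (z - (1 - s/4) *\<^sub>R c) < s/4" by (simp add: S_def dist_norm norm_minus_commute)
    moreover have "norm ((1 - s/4) *\<^sub>R c) \<le> 1 - s/4" using s c by (simp add: mult_left_le)
    ultimately show "z \<in> ball 0 1" using norm_triangle_ineq[of "z - (1 - s/4) *\<^sub>R c" "(1 - s/4) *\<^sub>R c"] by simp
  qed
  have near: "norm (z - u) \<le> s" if z: "z \<in> S" and u: "norm (c - u) = s/2" for z u
  proof -
    have 1: "norm (z - (1 - s/4) *\<^sub>R c) < s/4" using z by (simp add: S_def dist_norm norm_minus_commute)
    have "(1 - s/4) *\<^sub>R c - c = (-(s/4)) *\<^sub>R c" by (simp add: algebra_simps)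
    then have 2: "norm ((1 - s/4) *\<^sub>R c - c) \<le> s/4" using s c by (simp add: mult_left_le)
    have "z - u = (z - (1 - s/4) *\<^sub>R c) + ((1 - s/4) *\<^sub>R c - c) + (c - u)" by simp
    then have "norm (z - u) \<le> norm (z - (1 - s/4) *\<^sub>R c) + norm ((1 - s/4) *\<^sub>R c - c) + norm (c - u)"
      using norm_triangle_ineq[of "(z - (1 - s/4) *\<^sub>R c) + ((1 - s/4) *\<^sub>R c - c)" "c - u"]
        norm_triangle_ineq[of "z - (1 - s/4) *\<^sub>R c" "(1 - s/4) *\<^sub>R c - c"] by simp
    then show ?thesis using 1 2 u by linarith
  qed
  have cu: "norm (c - x) = s/2" "norm (c - x') = s/2"
  proof -
    have "c - x = (1/2) *\<^sub>R (x' - x)" "c - x' = (1/2) *\<^sub>R (x - x')" unfolding c_def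
      by (simp_all add: vec_eq_iff field_simps)
    then show "norm (c - x) = s/2" "norm (c - x') = s/2" by (simp_all add: s_def norm_minus_commute)
  qed
  define m where "m = s powr (-1/2)"
  have m: "m > 0" using s by (simp add: m_def)
  have Sb[measurable]: "S \<in> sets borel" by (simp add: S_def)
  note av = morrey_average[OF C r _ S1 Sb V(1) less_imp_le[OF V(2)] _ less_imp_le[OF s(1)] m I]
  have sub: "ball 0 1 \<subseteq> ball (0::real^2) r" using r by auto
  have Ym: "(\<lambda>z. indicator S z * norm (Y z - u)) \<in> borel_measurable borel" for u
    unfolding real_scaleR_def[symmetric]
    by (intro borel_measurable_continuous_on_indicator continuous_intros continuous_on_subset[OF C2on_continuous(1)[OF C]])
       (use S1 sub in auto)
  have "ennreal (V * norm (Y x - Y x')) = (\<integral>\<^sup>+z. ennreal (norm (Y x - Y x')) * indicator S z \<partial>lborel)"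
    using V by (subst nn_integral_cmult_indicator) (simp_all add: ennreal_mult mult.commute)
  also have "\<dots> \<le> (\<integral>\<^sup>+z. ennreal (indicator S z * norm (Y z - Y x)) + ennreal (indicator S z * norm (Y z - Y x')) \<partial>lborel)"
  proof (rule nn_integral_mono)
    fix z
    have "norm (Y x - Y x') \<le> norm (Y z - Y x) + norm (Y z - Y x')" using norm_triangle_ineq4[of "Y z - Y x'" "Y z - Y x"] by simp
    then have "ennreal (norm (Y x - Y x')) \<le> ennreal (norm (Y z - Y x)) + ennreal (norm (Y z - Y x'))"
      by (simp add: ennreal_leI flip: ennreal_plus)
    then show "ennreal (norm (Y x - Y x')) * indicator S z \<le> ennreal (indicator S z * norm (Y z - Y x)) + ennreal (indicator S z * norm (Y z - Y x'))"
      by (simp split: split_indicator)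
  qed
  also have "\<dots> = (\<integral>\<^sup>+z. ennreal (indicator S z * norm (Y z - Y x)) \<partial>lborel) + (\<integral>\<^sup>+z. ennreal (indicator S z * norm (Y z - Y x')) \<partial>lborel)"
    using Ym by (intro nn_integral_add) auto
  also have "\<dots> \<le> ennreal (2 * s * (m * V + m powr (-3) * I)) + ennreal (2 * s * (m * V + m powr (-3) * I))"
    by (intro add_mono av near cu x)
  also have "\<dots> = ennreal (4 * s * (m * V + m powr (-3) * I))"
    using s m V I(2) by (subst ennreal_plus[symmetric]) (auto simp: algebra_simps)
  finally have "V * norm (Y x - Y x') \<le> 4 * s * (m * V + m powr (-3) * I)"
    using s m V I(2) by (subst (asm) ennreal_le_iff) auto
  then have "norm (Y x - Y x') \<le> 4 * s * (m * V + m powr (-3) * I) / V" using V(2) by (simp add: pos_le_divide_eq mult.commute)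
  also have "\<dots> = 4 * (s * m) + 4 * (s * m powr (-3) / V) * I" using V(2) by (simp add: field_simps)
  also have "s * m = sqrt s"
    using s powr_add[of s 1 "-1/2"] by (simp add: m_def powr_half_sqrt)
  also have "s * m powr (-3) / V = 16 / pi * sqrt s"
  proof -
    have "m powr (-3) = s powr (3/2)" by (simp add: m_def powr_powr)
    also have "\<dots> = s * sqrt s" using s powr_add[of s 1 "1/2"] by (simp add: powr_half_sqrt)
    finally have "m powr (-3) = s * sqrt s" .
    then show ?thesis using s by (simp add: V_def power2_eq_square)
  qed
  finally show ?thesis by (simp add: s_def algebra_simps)
qed simp

section \<open>Polar coordinates\<close>

definition circ' :: "real \<Rightarrow> real^2" where "circ' t = vector [- sin t, cos t]"

lemma circ_nth [simp]: "circ t $ 1 = cos t" "circ t $ 2 = sin t" "circ' t $ 1 = - sin t" "circ' t $ 2 = cos t"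
  by (simp_all add: circ_def circ'_def)

lemma circ_has_derivative:
  "(circ has_vector_derivative circ' t) (at t within A)" "(circ' has_vector_derivative (- circ t)) (at t within A)"
proof -
  have v: "(f has_vector_derivative f') (at t within A)"
    if "\<And>i. ((\<lambda>t. f t $ i) has_vector_derivative f' $ i) (at t within A)" for f :: "real \<Rightarrow> real^2" and f'
  proof -
    have f: "f = (\<lambda>t. \<Sum>i\<in>UNIV. f t $ i *\<^sub>R axis i 1)"
      using basis_expansion[where 'a=real and 'n=2] by (simp add: scalar_mult_eq_scaleR fun_eq_iff)
    have f': "f' = (\<Sum>i\<in>UNIV. f' $ i *\<^sub>R axis i 1)"
      using basis_expansion[of f'] by (simp add: scalar_mult_eq_scaleR)
    show ?thesis
      by (subst f, subst f') (intro has_vector_derivative_sum has_vector_derivative_scaleR[OF _ has_vector_derivative_const, simplified] that[unfolded has_real_derivative_iff_has_vector_derivative[symmetric]])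
  qed
  have 2: "i = 1 \<or> i = 2" for i :: 2 by (rule exhaust_2)
  show "(circ has_vector_derivative circ' t) (at t within A)"
  proof (rule v)
    fix i :: 2
    show "((\<lambda>t. circ t $ i) has_vector_derivative circ' t $ i) (at t within A)"
      using 2[of i] by (auto simp: has_real_derivative_iff_has_vector_derivative[symmetric] intro!: derivative_eq_intros)
  qed
  show "(circ' has_vector_derivative (- circ t)) (at t within A)"
  proof (rule v)
    fix i :: 2
    show "((\<lambda>t. circ' t $ i) has_vector_derivative (- circ t) $ i) (at t within A)"
      using 2[of i] by (auto simp: has_real_derivative_iff_has_vector_derivative[symmetric] intro!: derivative_eq_intros)
  qed
qed

lemma circ_continuous [continuous_intros]:
  "continuous_on A f \<Longrightarrow> continuous_on A (\<lambda>x. circ (f x))" "continuous_on A f \<Longrightarrow> continuous_on A (\<lambda>x. circ' (f x))"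
  by (rule continuous_on_compose2[OF continuous_on_vector_derivative[OF circ_has_derivative(1), of UNIV]], simp_all)
     (rule continuous_on_compose2[OF continuous_on_vector_derivative[OF circ_has_derivative(2), of UNIV]], simp_all)

lemma norm_circ [simp]: "norm (circ t) = 1" "norm (circ' t) = 1"
  by (simp_all add: norm_vec_def L2_set_def sum_2)

lemma inner_circ [simp]: "circ t \<bullet> circ t = 1" "circ' t \<bullet> circ' t = 1" "circ t \<bullet> circ' t = 0" "circ' t \<bullet> circ t = 0"
  by (simp_all add: inner_vec_def sum_2 power2_eq_square[symmetric])

lemma circ_periodic: "circ (t + 2 * pi) = circ t" "circ (2 * pi) = circ 0" "circ' (2 * pi) = circ' 0"
  by (simp_all add: circ_def circ'_def)

lemma unit_is_circ:
  assumes "norm (x :: real^2) = 1"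
  obtains t where "0 \<le> t" "t < 2 * pi" "x = circ t"
proof -
  have "(x $ 1)\<^sup>2 + (x $ 2)\<^sup>2 = 1" using assms by (simp add: norm_vec_def L2_set_def sum_2)
  then obtain t where "0 \<le> t" "t < 2 * pi" "x $ 1 = cos t" "x $ 2 = sin t" using sincos_total_2pi by metis
  then show ?thesis using that[of t] exhaust_2 by (auto simp: vec_eq_iff forall_2)
qed

definition polar :: "real^2 \<Rightarrow> real^2" where "polar v = (v $ 1) *\<^sub>R circ (v $ 2)"

definition annulus :: "real \<Rightarrow> real \<Rightarrow> (real^2) set" where "annulus a b = {x. a < norm x \<and> norm x < b}"

lemma open_annulus: "open (annulus a b)"
  unfolding annulus_def by (intro open_Collect_conj open_Collect_less continuous_intros)

lemma polar_has_derivative: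
  "(polar has_derivative (\<lambda>h. h $ 1 *\<^sub>R circ (v $ 2) + (v $ 1 * h $ 2) *\<^sub>R circ' (v $ 2))) (at v within A)"
proof -
  have nth: "((\<lambda>v::real^2. v $ k) has_derivative (\<lambda>h. h $ k)) (at v within A)" for k
    by (rule bounded_linear_imp_has_derivative) (rule bounded_linear_vec_nth)
  have c: "((\<lambda>v::real^2. circ (v $ 2)) has_derivative (\<lambda>h. h $ 2 *\<^sub>R circ' (v $ 2))) (at v within A)"
    using has_derivative_compose[OF nth circ_has_derivative(1)[of "v $ 2" UNIV, unfolded has_vector_derivative_def]] by simp
  show ?thesis unfolding polar_def
    using has_derivative_scaleR[OF nth[of 1] c] by (simp add: add.commute)
qed

lemma polar_det: "det (matrix (\<lambda>h. h $ 1 *\<^sub>R circ t + (r * h $ 2) *\<^sub>R circ' t)) = r"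
  by (simp add: det_2 matrix_def axis_def power2_eq_square[symmetric] algebra_simps)
     (simp add: distrib_left[symmetric] power2_eq_square[symmetric])

definition prect :: "real \<Rightarrow> real \<Rightarrow> (real^2) set" where
  "prect a b = {v. a < v $ 1 \<and> v $ 1 < b \<and> 0 < v $ 2 \<and> v $ 2 < 2 * pi}"

lemma open_prect: "open (prect a b)"
  unfolding prect_def by (intro open_Collect_conj open_Collect_less continuous_intros)

lemma inj_on_polar: "a \<ge> 0 \<Longrightarrow> inj_on polar (prect a b)"
proof (rule inj_onI)
  fix v w assume a: "a \<ge> 0" and v: "v \<in> prect a b" and w: "w \<in> prect a b" and e: "polar v = polar w"
  have "norm (polar v) = v $ 1" "norm (polar w) = w $ 1" using v w a by (auto simp: polar_def prect_def)
  then have r: "v $ 1 = w $ 1" using e by simp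
  have "v $ 1 > 0" using v a by (auto simp: prect_def)
  then have "circ (v $ 2) = circ (w $ 2)" using e r by (simp add: polar_def)
  then have "sin (v $ 2) = sin (w $ 2) \<and> cos (v $ 2) = cos (w $ 2)" using circ_nth by metis
  then obtain n :: int where n: "v $ 2 = w $ 2 + 2 * pi * n" using sin_cos_eq_iff by blast
  have "\<bar>2 * pi * n\<bar> < 2 * pi" using v w n by (auto simp: prect_def)
  then have "\<bar>real_of_int n\<bar> < 1" using pi_gt_zero by (simp add: abs_mult)
  then have "n = 0" by linarith
  then have "v $ 2 = w $ 2" using n by simp
  with r show "v = w" by (auto simp: vec_eq_iff forall_2)
qed

lemma polar_image:
  assumes "a \<ge> 0"
  shows "polar ` prect a b \<subseteq> annulus a b" "annulus a b - polar ` prect a b \<subseteq> {x. x $ 2 = 0}"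
proof -
  show "polar ` prect a b \<subseteq> annulus a b" using assms by (auto simp: polar_def prect_def annulus_def)
  show "annulus a b - polar ` prect a b \<subseteq> {x. x $ 2 = 0}"
  proof (rule subsetI, rule ccontr)
    fix x :: "real^2" assume x: "x \<in> annulus a b - polar ` prect a b" and n: "x \<notin> {x. x $ 2 = 0}"
    have x0: "norm x > 0" using x assms by (auto simp: annulus_def)
    have "norm ((1 / norm x) *\<^sub>R x) = 1" using x0 by simp
    then obtain t where t: "0 \<le> t" "t < 2 * pi" "(1 / norm x) *\<^sub>R x = circ t" by (rule unit_is_circ)
    have xe: "x = norm x *\<^sub>R circ t" using x0 t(3)[symmetric] by simp
    have "t \<noteq> 0"
    proof
      assume "t = 0" then have "x $ 2 = 0" using arg_cong[OF xe, of "\<lambda>z. z $ 2"] by simp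
      then show False using n by simp
    qed
    then have "vector [norm x, t] \<in> prect a b" using t x by (auto simp: prect_def annulus_def)
    moreover have "polar (vector [norm x, t]) = x" using xe by (simp add: polar_def)
    ultimately show False using x by (metis DiffD2 imageI)
  qed
qed

text \<open>The polar map is injective on the open rectangle and covers the annulus up to a piece of
  the first axis, which is a null set. Values in \<open>real^1\<close> fit the multidimensional
  change of variables formula.\<close>

lemma polar_integral_vec:
  fixes f :: "real^2 \<Rightarrow> real^1"
  assumes a: "a \<ge> 0" and f: "f absolutely_integrable_on annulus a b"
  shows "(\<lambda>v. \<bar>v $ 1\<bar> *\<^sub>R f (polar v)) absolutely_integrable_on prect a b"
    "integral (prect a b) (\<lambda>v. \<bar>v $ 1\<bar> *\<^sub>R f (polar v)) = integral (annulus a b) f"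
proof -
  have neg: "negligible {x. x \<in> polar ` prect a b - annulus a b \<and> f x \<noteq> 0}" using polar_image(1)[OF a, of b] by (auto intro: negligible_subset[OF negligible_empty])
  have neg2: "negligible {x. x \<in> annulus a b - polar ` prect a b \<and> f x \<noteq> 0}"
    by (rule negligible_subset[OF negligible_standard_hyperplane_cart[of 2]]) (use polar_image(2)[OF a, of b] in auto)
  have f1: "f absolutely_integrable_on (polar ` prect a b)"
    using absolutely_integrable_spike_set_eq[OF neg2 neg] f by (metis absolutely_integrable_spike_set_eq neg neg2)
  have f2: "integral (polar ` prect a b) f = integral (annulus a b) f"
    by (rule integral_spike_set[OF neg neg2])
  have "(\<lambda>x. \<bar>det (matrix (\<lambda>h. h $ 1 *\<^sub>R circ (x $ 2) + (x $ 1 * h $ 2) *\<^sub>R circ' (x $ 2)))\<bar> *\<^sub>R f (polar x)) absolutely_integrable_on prect a b \<and>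
      integral (prect a b) (\<lambda>x. \<bar>det (matrix (\<lambda>h. h $ 1 *\<^sub>R circ (x $ 2) + (x $ 1 * h $ 2) *\<^sub>R circ' (x $ 2)))\<bar> *\<^sub>R f (polar x)) = integral (annulus a b) f"
    by (subst has_absolute_integral_change_of_variables[OF _ polar_has_derivative inj_on_polar[OF a]])
       (use open_prect f1 f2 in auto)
  then show "(\<lambda>v. \<bar>v $ 1\<bar> *\<^sub>R f (polar v)) absolutely_integrable_on prect a b"
    "integral (prect a b) (\<lambda>v. \<bar>v $ 1\<bar> *\<^sub>R f (polar v)) = integral (annulus a b) f"
    unfolding polar_det by auto
qed

text \<open>Continuity on the closed annulus turns the integral over the open rectangle into an
  iterated integral over closed intervals. For \<open>a = 0\<close> the continuity condition is on
  the whole closed disc, and the result covers the punctured disc.\<close>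

lemma polar_integral:
  fixes F :: "real^2 \<Rightarrow> real"
  assumes a: "a \<ge> 0" and c: "continuous_on {x. a \<le> norm x \<and> norm x \<le> b} F"
  shows "integrable lborel (\<lambda>x. indicator (annulus a b) x *\<^sub>R F x)" (is ?A)
    "(\<integral>x. indicator (annulus a b) x *\<^sub>R F x \<partial>lborel) = integral {a..b} (\<lambda>r. integral {0..2*pi} (\<lambda>t. r * F (r *\<^sub>R circ t)))" (is ?B)
proof -
  have comp: "compact {x::real^2. a \<le> norm x \<and> norm x \<le> b}"
  proof -
    have "{x::real^2. a \<le> norm x \<and> norm x \<le> b} = cball 0 b \<inter> {x. a \<le> norm x}" by auto
    moreover have "closed {x::real^2. a \<le> norm x}" by (intro closed_Collect_le continuous_intros)
    ultimately show ?thesis by (simp add: closed_Int_compact Int_commute compact_Int_closed)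
  qed
  have ann[measurable]: "annulus a b \<in> sets borel" using open_annulus by auto
  have "integrable lborel (\<lambda>x. indicator {x::real^2. a \<le> norm x \<and> norm x \<le> b} x *\<^sub>R F x)"
    by (rule borel_integrable_compact[OF comp c])
  then have "integrable lborel (\<lambda>x. indicator (annulus a b) x *\<^sub>R (indicator {x::real^2. a \<le> norm x \<and> norm x \<le> b} x *\<^sub>R F x))"
    by (rule integrable_mult_indicator[rotated]) auto
  then show A: ?A by (rule back_subst[of "integrable lborel"]) (auto simp: fun_eq_iff annulus_def indicator_def)
  have fm: "(\<lambda>x. indicator (annulus a b) x *\<^sub>R F x) \<in> borel_measurable borel" using A by auto
  have Aleb: "F absolutely_integrable_on annulus a b"
    unfolding set_integrable_def using A by (subst integrable_completion) auto
  have B0: "(\<integral>x. indicator (annulus a b) x *\<^sub>R F x \<partial>lborel) = integral (annulus a b) F"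
    using set_lebesgue_integral_eq_integral(2)[OF Aleb] unfolding set_lebesgue_integral_def
    by (subst (asm) integral_completion) (use fm in auto)
  define f where "f = (\<lambda>x. (vec (F x) :: real^1))"
  have fai: "f absolutely_integrable_on annulus a b" unfolding f_def
    by (subst absolutely_integrable_componentwise_iff) (auto simp: Basis_vec_def inner_axis Aleb)
  have int_f: "integral (annulus a b) f $ 1 = integral (annulus a b) F"
  proof -
    have "f integrable_on annulus a b" using fai by (rule set_lebesgue_integral_eq_integral(1))
    then show ?thesis unfolding f_def by (simp add: integral_component_eq_cart[symmetric])
  qed
  note P = polar_integral_vec[OF a fai]
  have "integral (prect a b) (\<lambda>v. \<bar>v $ 1\<bar> *\<^sub>R f (polar v)) $ 1 = integral (prect a b) (\<lambda>v. \<bar>v $ 1\<bar> * F (polar v))"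
  proof -
    have "(\<lambda>v. \<bar>v $ 1\<bar> *\<^sub>R f (polar v)) integrable_on prect a b" using P(1) by (rule set_lebesgue_integral_eq_integral(1))
    then show ?thesis unfolding f_def by (simp add: integral_component_eq_cart[symmetric])
  qed
  then have B1: "integral (prect a b) (\<lambda>v. \<bar>v $ 1\<bar> * F (polar v)) = integral (annulus a b) F" using P(2) int_f by simp
  have P1: "(\<lambda>v. \<bar>v $ 1\<bar> * F (polar v)) absolutely_integrable_on prect a b"
  proof -
    have "(\<lambda>v. (\<bar>v $ 1\<bar> *\<^sub>R f (polar v)) \<bullet> axis 1 1) absolutely_integrable_on prect a b"
      using P(1) by (subst (asm) absolutely_integrable_componentwise_iff) (auto simp: Basis_vec_def)
    then show ?thesis by (simp add: f_def inner_axis)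
  qed
  define H where "H = (\<lambda>p::real\<times>real. fst p * F (fst p *\<^sub>R circ (snd p)))"
  have cH: "continuous_on (cbox (a,0) (b,2*pi)) H" unfolding H_def
    by (intro continuous_intros continuous_on_compose2[OF c]) (use a in \<open>auto simp: cbox_Pair_eq\<close>)
  have iH: "integrable lborel (\<lambda>p. indicator (cbox (a,0) (b,2*pi)) p *\<^sub>R H p)" by (rule borel_integrable_compact[OF _ cH]) simp
  have bm: "(\<lambda>p. indicator (box (a,0) (b,2*pi)) p *\<^sub>R H p) \<in> borel_measurable borel"
    by (intro borel_measurable_continuous_on_indicator continuous_on_subset[OF cH] box_subset_cbox) auto
  have bx: "(x, y) \<in> box (a,0) (b,2*pi) \<longleftrightarrow> a < x \<and> x < b \<and> 0 < y \<and> y < 2*pi" for x y :: real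
    by (auto simp: mem_box Basis_prod_def)
  have inprect: "pt 1 (fst p) (snd p) \<in> prect a b \<longleftrightarrow> p \<in> box (a,0) (b,2*pi)" for p
    by (cases p) (auto simp: prect_def pt_nth bx)
  have prb[measurable]: "prect a b \<in> sets borel" using open_prect by auto
  have c': "continuous_on (prect a b) (\<lambda>v. \<bar>v $ 1\<bar> * F (polar v))" unfolding polar_def
    by (intro continuous_intros continuous_on_compose2[OF c]) (use a in \<open>auto simp: prect_def\<close>)
  have pm: "(\<lambda>v. indicator (prect a b) v *\<^sub>R (\<bar>v $ 1\<bar> * F (polar v))) \<in> borel_measurable borel"
    by (rule borel_measurable_continuous_on_indicator[OF _ c']) simp
  have "integral (prect a b) (\<lambda>v. \<bar>v $ 1\<bar> * F (polar v)) = (\<integral>v. indicator (prect a b) v *\<^sub>R (\<bar>v $ 1\<bar> * F (polar v)) \<partial>lborel)"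
    using set_lebesgue_integral_eq_integral(2)[OF P1] unfolding set_lebesgue_integral_def
    by (subst (asm) integral_completion) (use pm in auto)
  also have "\<dots> = (\<integral>p. indicator (prect a b) (pt 1 (fst p) (snd p)) *\<^sub>R (\<bar>pt 1 (fst p) (snd p) $ 1\<bar> * F (polar (pt 1 (fst p) (snd p)))) \<partial>(lborel \<Otimes>\<^sub>M lborel))"
    by (subst lborel_pt[of 1], subst integral_distr) (use pm in \<open>auto simp: lborel_prod\<close>)
  also have "\<dots> = (\<integral>p. indicator (box (a,0) (b,2*pi)) p *\<^sub>R H p \<partial>(lborel \<Otimes>\<^sub>M lborel))"
  proof (rule Bochner_Integration.integral_cong[OF refl])
    fix p :: "real \<times> real"
    show "indicator (prect a b) (pt 1 (fst p) (snd p)) *\<^sub>R (\<bar>pt 1 (fst p) (snd p) $ 1\<bar> * F (polar (pt 1 (fst p) (snd p)))) = indicator (box (a,0) (b,2*pi)) p *\<^sub>R H p"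
    proof (cases "p \<in> box (a,0) (b,2*pi)")
      case True
      then have "fst p \<ge> 0" using a by (cases p) (auto simp: bx)
      then show ?thesis using True inprect[of p] by (simp add: H_def polar_def pt_nth)
    qed (simp add: inprect)
  qed
  also have "\<dots> = integral (box (a,0) (b,2*pi)) H"
  proof -
    have "integrable lborel (\<lambda>p. indicator (box (a,0) (b,2*pi)) p *\<^sub>R (indicator (cbox (a,0) (b,2*pi)) p *\<^sub>R H p))"
      by (rule integrable_mult_indicator[OF _ iH]) auto
    then have "integrable lborel (\<lambda>p. indicator (box (a,0) (b,2*pi)) p *\<^sub>R H p)"
      by (rule back_subst[of "integrable lborel"]) (auto simp: fun_eq_iff indicator_def bx)
    then have "H absolutely_integrable_on box (a,0) (b,2*pi)" unfolding set_integrable_def by (subst integrable_completion) (use bm in auto)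
    from set_lebesgue_integral_eq_integral(2)[OF this] show ?thesis unfolding set_lebesgue_integral_def lborel_prod
      by (subst (asm) integral_completion) (use bm in auto)
  qed
  also have "\<dots> = integral (cbox (a,0) (b,2*pi)) H" by (rule integral_open_interval)
  also have "\<dots> = integral {a..b} (\<lambda>r. integral {0..2*pi} (\<lambda>t. H (r, t)))"
    using integral_prod_continuous[OF cH] by simp
  finally show ?B unfolding B0 using B1 by (simp add: H_def)
qed

section \<open>The lower bound for smooth maps\<close>

text \<open>The boundary curve unrolled to a periodic function of arclength, with its derivatives as
  explicit functions.\<close>

locale unit_curve =
  fixes g g1 g2 g3 :: "real \<Rightarrow> real^3"
  assumes gd: "(g has_vector_derivative g1 t) (at t)" "(g1 has_vector_derivative g2 t) (at t)" "(g2 has_vector_derivative g3 t) (at t)"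
    and g3c: "continuous_on UNIV g3" and gper: "g (t + 2 * pi) = g t"
    and gu: "norm (g t) = 1" "norm (g1 t) = 1"
begin

lemma vector_derivative_periodic:
  fixes f f' :: "real \<Rightarrow> real^3"
  assumes d: "\<And>t. (f has_vector_derivative f' t) (at t)" and p: "\<And>t. f (t + 2 * pi) = f t"
  shows "f' (t + 2 * pi) = f' t"
proof -
  have "((\<lambda>t. f (t + 2 * pi)) has_vector_derivative f' (t + 2 * pi)) (at t)"
  proof -
    have "((\<lambda>t. t + 2 * pi) has_vector_derivative 1) (at t)"
      by (auto intro!: derivative_eq_intros simp: has_real_derivative_iff_has_vector_derivative[symmetric])
    from vector_diff_chain_at[OF this d] show ?thesis by (simp add: o_def)
  qed
  then have "(f has_vector_derivative f' (t + 2 * pi)) (at t)" using p by simp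
  then show ?thesis using d vector_derivative_unique_at by blast
qed

lemma per: "g1 (t + 2 * pi) = g1 t" "g2 (t + 2 * pi) = g2 t" "g3 (t + 2 * pi) = g3 t"
proof -
  show 1: "g1 (t + 2 * pi) = g1 t" for t by (rule vector_derivative_periodic[OF gd(1) gper])
  show 2: "g2 (t + 2 * pi) = g2 t" for t by (rule vector_derivative_periodic[OF gd(2) 1])
  show "g3 (t + 2 * pi) = g3 t" for t by (rule vector_derivative_periodic[OF gd(3) 2])
qed

lemma per0: "g (2 * pi) = g 0" "g1 (2 * pi) = g1 0" "g2 (2 * pi) = g2 0" "g3 (2 * pi) = g3 0"
  using gper[of 0] per[of 0] by simp_all

lemma gc: "continuous_on A g" "continuous_on A g1" "continuous_on A g2" "continuous_on A g3"
  by (rule continuous_on_vector_derivative, rule has_vector_derivative_at_within, rule gd)+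
     (rule continuous_on_subset[OF g3c], simp)

lemma gc_comp [continuous_intros]:
  assumes "continuous_on A f"
  shows "continuous_on A (\<lambda>x. g (f x))" "continuous_on A (\<lambda>x. g1 (f x))" "continuous_on A (\<lambda>x. g2 (f x))" "continuous_on A (\<lambda>x. g3 (f x))"
  by (rule continuous_on_compose2[OF gc(1)[of UNIV] assms], simp, rule continuous_on_compose2[OF gc(2)[of UNIV] assms], simp,
      rule continuous_on_compose2[OF gc(3)[of UNIV] assms], simp, rule continuous_on_compose2[OF gc(4)[of UNIV] assms], simp)

text \<open>Since \<open>g\<close> and \<open>g1\<close> are unit vectors,
  \<open>g t \<bullet> g2 t = -1\<close>, so this is the part of \<open>g2\<close> tangent to the
  sphere: the geodesic curvature vector of the curve. The second derivative of the cone in the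
  tangential direction is \<open>kap t\<close> divided by \<open>r\<close>.\<close>

definition kap :: "real \<Rightarrow> real^3" where "kap t = g2 t + g t"

text \<open>The coefficient of the logarithm in both bounds; \<open>C1const_eq\<close> identifies it
  with \<open>C1const\<close>.\<close>

definition kk :: real where "kk = integral {0..2*pi} (\<lambda>t. norm (kap t) ^ 2)"

lemma kap_bound: obtains N where "N \<ge> 0" "\<And>t. t \<in> {0..2*pi} \<Longrightarrow> norm (kap t) \<le> N" "\<And>t. t \<in> {0..2*pi} \<Longrightarrow> norm (g3 t + g1 t) \<le> N"
proof -
  have "compact (kap ` {0..2*pi})" "compact ((\<lambda>t. g3 t + g1 t) ` {0..2*pi})" unfolding kap_def
    by (rule compact_continuous_image, intro continuous_intros, simp)+
  then obtain a b where "\<And>x. x \<in> kap ` {0..2*pi} \<Longrightarrow> norm x \<le> a" "\<And>x. x \<in> (\<lambda>t. g3 t + g1 t) ` {0..2*pi} \<Longrightarrow> norm x \<le> b"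
    using compact_imp_bounded bounded_iff by metis
  then show ?thesis using that[of "max 0 (max a b)"] by (fastforce simp: le_max_iff_disj)
qed

lemma kk_nonneg: "kk \<ge> 0"
  unfolding kk_def by (rule integral_nonneg) (auto intro!: integrable_continuous_real continuous_intros simp: kap_def)

end

section \<open>Membrane and bending densities in polar coordinates\<close>

definition memb :: "(2 \<Rightarrow> real^3) \<Rightarrow> real" where
  "memb d = (\<Sum>i\<in>UNIV. \<Sum>j\<in>UNIV. (d i \<bullet> d j - (if i = j then 1 else 0))\<^sup>2)"

definition bend :: "(2 \<Rightarrow> 2 \<Rightarrow> real^3) \<Rightarrow> real" where
  "bend d = (\<Sum>i\<in>UNIV. \<Sum>j\<in>UNIV. (norm (d i j))\<^sup>2)"

lemma memb_nonneg: "0 \<le> memb d" by (simp add: memb_def sum_nonneg)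
lemma bend_nonneg: "0 \<le> bend d" by (simp add: bend_def sum_nonneg)

text \<open>The quadratic form of the array \<open>V\<close> at \<open>c\<close>. Applied to second
  derivatives it is the second derivative in direction \<open>c\<close>; applied to the metric
  defect it is the defect of the squared stretch in direction \<open>c\<close>.\<close>

definition dir2 :: "real^2 \<Rightarrow> (2 \<Rightarrow> 2 \<Rightarrow> 'a::real_vector) \<Rightarrow> 'a" where
  "dir2 c V = (\<Sum>i\<in>UNIV. \<Sum>j\<in>UNIV. (c $ i * c $ j) *\<^sub>R V i j)"

text \<open>Cauchy-Schwarz in the four entries: the rank one matrix with entries
  \<open>c $ i * c $ j\<close> has Frobenius norm 1.\<close>

lemma dir2_norm:
  fixes V :: "2 \<Rightarrow> 2 \<Rightarrow> 'a::real_normed_vector"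
  assumes "norm c = 1"
  shows "norm (dir2 c V) ^ 2 \<le> (\<Sum>i\<in>UNIV. \<Sum>j\<in>UNIV. norm (V i j) ^ 2)"
proof -
  have "norm (dir2 c V) \<le> (\<Sum>i\<in>UNIV. \<Sum>j\<in>UNIV. \<bar>c $ i * c $ j\<bar> * norm (V i j))"
    unfolding dir2_def by (intro order_trans[OF norm_sum] sum_mono) (auto intro: order_trans[OF norm_sum])
  also have "\<dots> = (\<Sum>p\<in>UNIV \<times> UNIV. \<bar>c $ fst p * c $ snd p\<bar> * norm (V (fst p) (snd p)))" by (simp add: sum.cartesian_product case_prod_beta')
  finally have "norm (dir2 c V) ^ 2 \<le> (\<Sum>p\<in>UNIV \<times> UNIV. \<bar>c $ fst p * c $ snd p\<bar> * norm (V (fst p) (snd p)))\<^sup>2"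
    by (intro power_mono) auto
  also have "\<dots> \<le> (\<Sum>p\<in>UNIV \<times> UNIV. \<bar>c $ fst p * c $ snd p\<bar>\<^sup>2) * (\<Sum>p\<in>UNIV \<times> UNIV. (norm (V (fst p) (snd p)))\<^sup>2)"
    by (rule Cauchy_Schwarz_ineq_sum)
  also have "(\<Sum>p\<in>UNIV \<times> UNIV. \<bar>c $ fst p * c $ snd p\<bar>\<^sup>2) = (\<Sum>i\<in>UNIV. (c $ i)\<^sup>2) * (\<Sum>j\<in>UNIV. (c $ j)\<^sup>2)"
    by (simp add: sum_product sum.cartesian_product case_prod_beta' power_mult_distrib)
  also have "(\<Sum>i\<in>UNIV. (c $ i)\<^sup>2) = 1" using assms by (simp add: norm_vec_def L2_set_def)
  finally show ?thesis by (simp add: sum.cartesian_product case_prod_beta')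
qed

text \<open>The defect of the squared stretch is the quadratic form \<open>dir2\<close> of the
  metric defect at the unit vector \<open>c\<close>. The radial direction alone is what the lower
  bound extracts from the membrane term.\<close>

lemma memb_radial:
  assumes "norm (c :: real^2) = 1"
  shows "((norm (\<Sum>i\<in>UNIV. c $ i *\<^sub>R d i))\<^sup>2 - 1)\<^sup>2 \<le> memb d"
proof -
  have c2: "(c $ 1)\<^sup>2 + (c $ 2)\<^sup>2 = 1" using assms by (simp add: norm_vec_def L2_set_def sum_2)
  have "(norm (\<Sum>i\<in>UNIV. c $ i *\<^sub>R d i))\<^sup>2 - ((c $ 1)\<^sup>2 + (c $ 2)\<^sup>2) = dir2 c (\<lambda>i j. d i \<bullet> d j - (if i = j then 1 else 0))"
    unfolding dir2_def power2_norm_eq_inner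
    by (simp add: sum_2 inner_simps inner_commute algebra_simps power2_eq_square)
  then have "((norm (\<Sum>i\<in>UNIV. c $ i *\<^sub>R d i))\<^sup>2 - 1)\<^sup>2 = norm (dir2 c (\<lambda>i j. d i \<bullet> d j - (if i = j then 1 else 0))) ^ 2"
    unfolding c2 by simp
  also have "\<dots> \<le> memb d" unfolding memb_def using dir2_norm[OF assms, of "\<lambda>i j. d i \<bullet> d j - (if i = j then 1 else 0)"] by simp
  finally show ?thesis .
qed

text \<open>Cauchy-Schwarz, obtained by pairing the integrand with the integral itself and absorbing
  half of the square.\<close>

lemma integral_norm_square_le:
  fixes v :: "real \<Rightarrow> 'a::euclidean_space"
  assumes r: "r \<ge> 0" and c: "continuous_on {0..r} v"
  shows "norm (integral {0..r} v) ^ 2 \<le> r * integral {0..r} (\<lambda>s. norm (v s) ^ 2)"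
proof (cases "r = 0")
  case False
  then have r: "r > 0" using r by simp
  define V where "V = integral {0..r} v"
  have vi: "v integrable_on {0..r}" using c by (rule integrable_continuous_real)
  have "norm V ^ 2 = V \<bullet> integral {0..r} v" by (simp add: V_def dot_square_norm)
  also have "\<dots> = integral {0..r} (\<lambda>s. V \<bullet> v s)" using integral_linear[OF vi bounded_linear_inner_right[of V]] by (simp add: o_def)
  also have "\<dots> \<le> integral {0..r} (\<lambda>s. norm V ^ 2 / (2 * r) + r / 2 * norm (v s) ^ 2)"
  proof (rule integral_le)
    show "V \<bullet> v s \<le> norm V ^ 2 / (2 * r) + r / 2 * norm (v s) ^ 2" for s
    proof -
      have am: "x * y \<le> (x\<^sup>2 + y\<^sup>2) / 2" for x y :: real using sum_squares_bound[of x y] by simp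
      have "V \<bullet> v s \<le> norm V * norm (v s)" by (rule norm_cauchy_schwarz)
      also have "\<dots> = (norm V / sqrt r) * (sqrt r * norm (v s))" using r by simp
      also have "\<dots> \<le> ((norm V / sqrt r)\<^sup>2 + (sqrt r * norm (v s))\<^sup>2) / 2" by (rule am)
      also have "\<dots> = norm V ^ 2 / (2 * r) + r / 2 * norm (v s) ^ 2" using r by (simp add: power_divide power_mult_distrib add_divide_distrib)
      finally show ?thesis .
    qed
  qed (intro integrable_continuous_real continuous_intros c)+
  also have "\<dots> = norm V ^ 2 / 2 + r / 2 * integral {0..r} (\<lambda>s. norm (v s) ^ 2)"
    using r by (subst Henstock_Kurzweil_Integration.integral_add) (auto intro!: integrable_continuous_real continuous_intros c)
  finally show ?thesis by (simp add: V_def)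
qed simp

text \<open>The function \<open>r * (h - r) * (q r \<bullet> q r)\<close> vanishes at both ends, so
  its derivative integrates to 0. The inequality introduces the weight \<open>r\<close> that polar
  coordinates put into the energy, at the price of one derivative; below the scale \<open>h\<close>
  the bending term can pay for it.\<close>

lemma hardy_interval:
  fixes q :: "real \<Rightarrow> 'a::euclidean_space"
  assumes h: "h > 0" and d: "\<And>r. r \<in> {0..h} \<Longrightarrow> (q has_vector_derivative q' r) (at r within {0..h})" and c: "continuous_on {0..h} q'"
  shows "integral {0..h} (\<lambda>r. norm (q r) ^ 2) \<le> 3 / h * integral {0..h} (\<lambda>r. r * norm (q r) ^ 2) + h * integral {0..h} (\<lambda>r. r * norm (q' r) ^ 2)"
proof -
  have cq: "continuous_on {0..h} q" by (rule continuous_on_vector_derivative[OF d])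
  define G where "G = (\<lambda>r. (h - 2 * r) * (q r \<bullet> q r) + r * (h - r) * (2 * (q r \<bullet> q' r)))"
  have "(G has_integral (h * (h - h) * (q h \<bullet> q h) - 0 * (h - 0) * (q 0 \<bullet> q 0))) {0..h}"
  proof (rule fundamental_theorem_of_calculus)
    fix r assume r: "r \<in> {0..h}"
    note dd = d[OF r, unfolded has_vector_derivative_def]
    show "((\<lambda>r. r * (h - r) * (q r \<bullet> q r)) has_vector_derivative G r) (at r within {0..h})"
      unfolding has_vector_derivative_def G_def
      by (rule derivative_eq_intros dd refl | simp)+ (simp add: fun_eq_iff inner_simps algebra_simps inner_commute)
  qed (use h in simp)
  then have G: "(G has_integral 0) {0..h}" by simp
  let ?P = "\<lambda>r. r * norm (q r) ^ 2" and ?Q = "\<lambda>r. r * norm (q' r) ^ 2"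
  have i: "(?P has_integral integral {0..h} ?P) {0..h}" "(?Q has_integral integral {0..h} ?Q) {0..h}"
    "((\<lambda>r. norm (q r) ^ 2) has_integral integral {0..h} (\<lambda>r. norm (q r) ^ 2)) {0..h}"
    by (intro integrable_integral integrable_continuous_real continuous_intros cq c)+
  have rhs: "((\<lambda>r. 1 / h * G r + (3 / h * ?P r + h * ?Q r)) has_integral (1 / h * 0 + (3 / h * integral {0..h} ?P + h * integral {0..h} ?Q))) {0..h}"
    by (intro has_integral_add has_integral_mult_right G i)
  have "integral {0..h} (\<lambda>r. norm (q r) ^ 2) \<le> 1 / h * 0 + (3 / h * integral {0..h} ?P + h * integral {0..h} ?Q)"
  proof (rule has_integral_le[OF i(3) rhs])
    fix r assume r: "r \<in> {0..h}"
    let ?a = "norm (q r)" and ?b = "norm (q' r)"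
    have "\<bar>q r \<bullet> q' r\<bar> \<le> ?a * ?b" by (rule Cauchy_Schwarz_ineq2)
    then have "- (2 * (q r \<bullet> q' r)) \<le> 2 * (?a * ?b)" by linarith
    also have "2 * (?a * ?b) \<le> ?a\<^sup>2 / h + h * ?b\<^sup>2"
    proof -
      have "2 * (?a / sqrt h) * (sqrt h * ?b) \<le> (?a / sqrt h)\<^sup>2 + (sqrt h * ?b)\<^sup>2" by (rule sum_squares_bound)
      then show ?thesis using h by (simp add: power_divide power_mult_distrib)
    qed
    finally have *: "- (2 * (q r \<bullet> q' r)) \<le> ?a\<^sup>2 / h + h * ?b\<^sup>2" .
    have "r * (h - r) * (- (2 * (q r \<bullet> q' r))) \<le> r * (h - r) * (?a\<^sup>2 / h + h * ?b\<^sup>2)"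
      using r by (intro mult_left_mono[OF *]) auto
    also have "\<dots> \<le> r * h * (?a\<^sup>2 / h + h * ?b\<^sup>2)"
      using r h by (intro mult_right_mono mult_left_mono) auto
    also have "\<dots> = r * ?a\<^sup>2 + h * h * (r * ?b\<^sup>2)" using h by (simp add: algebra_simps)
    finally have "h * ?a\<^sup>2 \<le> G r + 2 * r * ?a\<^sup>2 + (r * ?a\<^sup>2 + h * h * (r * ?b\<^sup>2))"
      by (simp add: G_def dot_square_norm algebra_simps)
    then have "h * ?a\<^sup>2 \<le> h * (1 / h * G r + (3 / h * ?P r + h * ?Q r))" using h by (simp add: algebra_simps)
    then show "?a\<^sup>2 \<le> 1 / h * G r + (3 / h * ?P r + h * ?Q r)" using h by (simp only: mult_le_cancel_left_pos)
  qed
  then show ?thesis by simp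
qed

text \<open>Integration over radius and angle without the Jacobian, which is written into the
  integrand where it belongs. The stretch defect of rays has to be integrated without it.\<close>

definition DI :: "real \<Rightarrow> real \<Rightarrow> (real \<Rightarrow> real \<Rightarrow> real) \<Rightarrow> real" where
  "DI a b F = integral {a..b} (\<lambda>r. integral {0..2*pi} (\<lambda>t. F r t))"

abbreviation cont2 :: "real \<Rightarrow> real \<Rightarrow> (real \<Rightarrow> real \<Rightarrow> 'a::topological_space) \<Rightarrow> bool" where
  "cont2 a b F \<equiv> continuous_on ({a..b} \<times> {0..2*pi}) (\<lambda>p. F (fst p) (snd p))"

lemma cont2_inner:
  fixes F :: "real \<Rightarrow> real \<Rightarrow> real"
  assumes "cont2 a b F"
  shows "continuous_on {a..b} (\<lambda>r. integral {0..2*pi} (\<lambda>t. F r t))"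
    "r \<in> {a..b} \<Longrightarrow> continuous_on {0..2*pi} (\<lambda>t. F r t)"
    "continuous_on {0..2*pi} (\<lambda>t. integral {a..b} (\<lambda>r. F r t))"
    "t \<in> {0..2*pi} \<Longrightarrow> continuous_on {a..b} (\<lambda>r. F r t)"
proof -
  show "continuous_on {a..b} (\<lambda>r. integral {0..2*pi} (\<lambda>t. F r t))"
    using integral_continuous_on_param[of "{a..b}" 0 "2*pi" F] assms by (simp add: case_prod_beta')
  show "r \<in> {a..b} \<Longrightarrow> continuous_on {0..2*pi} (\<lambda>t. F r t)"
    by (rule continuous_on_compose2[OF assms, of _ "\<lambda>t. (r, t)", simplified]) (auto intro!: continuous_intros)
  have "continuous_on ({0..2*pi} \<times> {a..b}) (\<lambda>p. F (snd p) (fst p))"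
    by (rule continuous_on_compose2[OF assms, of _ "\<lambda>p. (snd p, fst p)", simplified]) (auto intro!: continuous_intros)
  then show "continuous_on {0..2*pi} (\<lambda>t. integral {a..b} (\<lambda>r. F r t))"
    using integral_continuous_on_param[of "{0..2*pi}" a b "\<lambda>t r. F r t"] by (simp add: case_prod_beta')
  show "t \<in> {0..2*pi} \<Longrightarrow> continuous_on {a..b} (\<lambda>r. F r t)"
    by (rule continuous_on_compose2[OF assms, of _ "\<lambda>r. (r, t)", simplified]) (auto intro!: continuous_intros)
qed

lemma DI_swap: "cont2 a b F \<Longrightarrow> DI a b F = integral {0..2*pi} (\<lambda>t. integral {a..b} (\<lambda>r. F r t))"
  using integral_swap_continuous[of a 0 b "2*pi" F] by (simp add: DI_def case_prod_beta' cbox_Pair_eq)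

lemma DI_mono:
  assumes "cont2 a b F" "cont2 a b G" "\<And>r t. r \<in> {a..b} \<Longrightarrow> t \<in> {0..2*pi} \<Longrightarrow> F r t \<le> G r t"
  shows "DI a b F \<le> DI a b G"
  unfolding DI_def
  by (intro integral_le integrable_continuous_real cont2_inner(1)[OF assms(1)] cont2_inner(1)[OF assms(2)]
      cont2_inner(2)[OF assms(1)] cont2_inner(2)[OF assms(2)] assms(3))

lemma DI_cong: "(\<And>r t. r \<in> {a..b} \<Longrightarrow> t \<in> {0..2*pi} \<Longrightarrow> F r t = G r t) \<Longrightarrow> DI a b F = DI a b G"
  unfolding DI_def by (intro integral_cong) auto

lemma DI_add:
  assumes "cont2 a b F" "cont2 a b G"
  shows "DI a b (\<lambda>r t. F r t + G r t) = DI a b F + DI a b G"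
proof -
  have "DI a b (\<lambda>r t. F r t + G r t) = integral {a..b} (\<lambda>r. integral {0..2*pi} (F r) + integral {0..2*pi} (G r))"
    unfolding DI_def
    by (intro integral_cong Henstock_Kurzweil_Integration.integral_add integrable_continuous_real cont2_inner(2)[OF assms(1)] cont2_inner(2)[OF assms(2)])
  also have "\<dots> = DI a b F + DI a b G" unfolding DI_def
    by (intro Henstock_Kurzweil_Integration.integral_add integrable_continuous_real cont2_inner(1)[OF assms(1)] cont2_inner(1)[OF assms(2)])
  finally show ?thesis .
qed

lemma DI_cmult: "DI a b (\<lambda>r t. c * F r t) = c * DI a b F"
  unfolding DI_def by simp

lemma DI_radial: "DI a b (\<lambda>r t. F r) = 2 * pi * integral {a..b} F"
  unfolding DI_def by simp

lemma cont2_sub: "cont2 a b F \<Longrightarrow> a \<le> c \<Longrightarrow> d \<le> b \<Longrightarrow> cont2 c d F"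
  by (erule continuous_on_subset) auto

lemma DI_split:
  assumes "cont2 a b F" "a \<le> c" "c \<le> b"
  shows "DI a b F = DI a c F + DI c b F"
  unfolding DI_def
  using Henstock_Kurzweil_Integration.integral_combine[OF assms(2,3) integrable_continuous_real[OF cont2_inner(1)[OF assms(1)]]] by simp

lemma DI_nonneg:
  assumes "cont2 a b F" "\<And>r t. r \<in> {a..b} \<Longrightarrow> t \<in> {0..2*pi} \<Longrightarrow> 0 \<le> F r t"
  shows "0 \<le> DI a b F"
  using DI_mono[of a b "\<lambda>_ _. 0" F] assms by (simp add: DI_def)

lemma DI_subinterval:
  assumes c: "cont2 a b F" and n: "\<And>r t. r \<in> {a..b} \<Longrightarrow> t \<in> {0..2*pi} \<Longrightarrow> 0 \<le> F r t" and "a \<le> c" "c \<le> d" "d \<le> b"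
  shows "DI c d F \<le> DI a b F"
proof -
  have "DI a b F = DI a c F + (DI c d F + DI d b F)"
    using DI_split[OF c, of c] DI_split[OF cont2_sub[OF c, of c b], of d] assms(3-5) by simp
  moreover have "0 \<le> DI a c F" "0 \<le> DI d b F" using assms by (auto intro!: DI_nonneg cont2_sub[OF c])
  ultimately show ?thesis by simp
qed

text \<open>Mollified maps meet the boundary condition only approximately, and \<open>\<eta>\<close>
  bounds that error uniformly. The condition at the origin is exact, since a constant can be
  subtracted.\<close>

locale smooth_map = unit_curve g g1 g2 g3 for g g1 g2 g3 +
  fixes \<rho> :: real and Y D D2 and \<eta> :: real
  assumes C: "C2on \<rho> Y D D2" and rho: "\<rho> > 1" and Y0: "Y 0 = 0" and eta: "\<And>t. norm (Y (circ t) - g t) \<le> \<eta>"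
begin

text \<open>Here \<open>ptn\<close> is the derivative along the unit tangent and not in the angle,
  so the angle derivative of the map is \<open>r *\<^sub>R ptn r t\<close>. \<open>A\<close> is the
  second derivative along that direction held fixed; the turning of the frame shows up in
  \<open>D_angular\<close> as the extra term \<open>- pr r t\<close>.\<close>

definition pr where "pr r t = (\<Sum>i\<in>UNIV. circ t $ i *\<^sub>R D (r *\<^sub>R circ t) i)"
definition ptn where "ptn r t = (\<Sum>i\<in>UNIV. circ' t $ i *\<^sub>R D (r *\<^sub>R circ t) i)"
definition prr where "prr r t = dir2 (circ t) (D2 (r *\<^sub>R circ t))"
definition A where "A r t = dir2 (circ' t) (D2 (r *\<^sub>R circ t))"
definition MM where "MM = DI 0 1 (\<lambda>r t. r * memb (D (r *\<^sub>R circ t)))"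
definition BB where "BB = DI 0 1 (\<lambda>r t. r * bend (D2 (r *\<^sub>R circ t)))"

lemma in_ball: "0 \<le> r \<Longrightarrow> r \<le> 1 \<Longrightarrow> r *\<^sub>R circ t \<in> ball 0 \<rho>"
  using rho by simp

lemma D_radial:
  assumes "0 \<le> r" "r \<le> 1"
  shows "((\<lambda>r. Y (r *\<^sub>R circ t)) has_vector_derivative pr r t) (at r)"
    "((\<lambda>r. pr r t) has_vector_derivative prr r t) (at r)"
proof -
  note b = in_ball[OF assms, of t]
  have p: "((\<lambda>r. r *\<^sub>R circ t) has_derivative (\<lambda>h. h *\<^sub>R circ t)) (at r)" by (auto intro!: derivative_eq_intros)
  have a: "(Y has_derivative (\<lambda>w. \<Sum>k\<in>UNIV. w $ k *\<^sub>R D (r *\<^sub>R circ t) k)) (at (r *\<^sub>R circ t))"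
    and a2: "((\<lambda>x. D x i) has_derivative (\<lambda>w. \<Sum>k\<in>UNIV. w $ k *\<^sub>R D2 (r *\<^sub>R circ t) i k)) (at (r *\<^sub>R circ t))" for i
    using C b by (auto simp: C2on_def)
  show "((\<lambda>r. Y (r *\<^sub>R circ t)) has_vector_derivative pr r t) (at r)"
    using has_derivative_compose[OF p a] by (simp add: has_vector_derivative_def scaleR_sum_right pr_def)
  have d: "((\<lambda>r. D (r *\<^sub>R circ t) i) has_vector_derivative (\<Sum>k\<in>UNIV. circ t $ k *\<^sub>R D2 (r *\<^sub>R circ t) i k)) (at r)" for i
    using has_derivative_compose[OF p a2] by (simp add: has_vector_derivative_def scaleR_sum_right)
  show "((\<lambda>r. pr r t) has_vector_derivative prr r t) (at r)"
    unfolding pr_def prr_def dir2_def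
    by (rule derivative_eq_intros d refl)+ (simp add: scaleR_sum_right)
qed

lemma D_angular:
  assumes "0 \<le> r" "r \<le> 1"
  shows "((\<lambda>t. Y (r *\<^sub>R circ t)) has_vector_derivative (r *\<^sub>R ptn r t)) (at t)"
    "((\<lambda>t. ptn r t) has_vector_derivative (r *\<^sub>R A r t - pr r t)) (at t)"
proof -
  note b = in_ball[OF assms, of t]
  have p: "((\<lambda>t. r *\<^sub>R circ t) has_derivative (\<lambda>h. h *\<^sub>R (r *\<^sub>R circ' t))) (at t)"
    using has_derivative_scaleR_right[OF circ_has_derivative(1)[unfolded has_vector_derivative_def], of r t UNIV] by (simp add: mult.commute)
  have a: "(Y has_derivative (\<lambda>w. \<Sum>k\<in>UNIV. w $ k *\<^sub>R D (r *\<^sub>R circ t) k)) (at (r *\<^sub>R circ t))"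
    and a2: "((\<lambda>x. D x i) has_derivative (\<lambda>w. \<Sum>k\<in>UNIV. w $ k *\<^sub>R D2 (r *\<^sub>R circ t) i k)) (at (r *\<^sub>R circ t))" for i
    using C b by (auto simp: C2on_def)
  show "((\<lambda>t. Y (r *\<^sub>R circ t)) has_vector_derivative (r *\<^sub>R ptn r t)) (at t)"
    using has_derivative_compose[OF p a] by (simp add: has_vector_derivative_def scaleR_sum_right ptn_def mult_ac)
  have d: "((\<lambda>t. D (r *\<^sub>R circ t) i) has_vector_derivative (\<Sum>k\<in>UNIV. (r * circ' t $ k) *\<^sub>R D2 (r *\<^sub>R circ t) i k)) (at t)" for i
    using has_derivative_compose[OF p a2] by (simp add: has_vector_derivative_def scaleR_sum_right mult_ac)
  have c: "((\<lambda>t. circ' t $ i) has_real_derivative (- circ t $ i)) (at t)" for i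
    using bounded_linear.has_vector_derivative[OF bounded_linear_vec_nth circ_has_derivative(2)[of t UNIV], of i]
    by (simp add: has_real_derivative_iff_has_vector_derivative)
  have "((\<lambda>t. \<Sum>i\<in>UNIV. circ' t $ i *\<^sub>R D (r *\<^sub>R circ t) i) has_vector_derivative
      (\<Sum>i\<in>UNIV. circ' t $ i *\<^sub>R (\<Sum>k\<in>UNIV. (r * circ' t $ k) *\<^sub>R D2 (r *\<^sub>R circ t) i k) + (- circ t $ i) *\<^sub>R D (r *\<^sub>R circ t) i)) (at t)"
    by (intro has_vector_derivative_sum has_vector_derivative_scaleR c d)
  then show "((\<lambda>t. ptn r t) has_vector_derivative (r *\<^sub>R A r t - pr r t)) (at t)"
    by (simp add: ptn_def A_def pr_def dir2_def sum.distrib sum_negf scaleR_sum_right sum_subtractf mult_ac)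
qed

lemma cont2_comp:
  assumes "continuous_on (ball 0 \<rho>) F"
  shows "cont2 0 1 (\<lambda>r t. F (r *\<^sub>R circ t))"
  by (rule continuous_on_compose2[OF assms]) (use rho in \<open>auto intro!: continuous_intros simp: less_le_trans\<close>)

lemma cont2_jet: "cont2 0 1 (\<lambda>r t. Y (r *\<^sub>R circ t))" "cont2 0 1 (\<lambda>r t. D (r *\<^sub>R circ t) i)" "cont2 0 1 (\<lambda>r t. D2 (r *\<^sub>R circ t) i j)"
  by (rule cont2_comp[OF C2on_continuous(1)[OF C]] cont2_comp[OF C2on_continuous(2)[OF C]] cont2_comp[OF C2on_continuous(3)[OF C]])+

lemma continuous_circ_snd: "continuous_on S (\<lambda>p::real\<times>real. circ (snd p) $ i)" "continuous_on S (\<lambda>p::real\<times>real. circ' (snd p) $ i)"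
  by (intro continuous_intros)+

lemma cont2_pr: "cont2 0 1 pr" "cont2 0 1 ptn" "cont2 0 1 prr" "cont2 0 1 A"
  unfolding pr_def ptn_def prr_def A_def dir2_def by (intro continuous_intros continuous_circ_snd cont2_jet)+

lemma cont2_energy: "cont2 0 1 (\<lambda>r t. memb (D (r *\<^sub>R circ t)))" "cont2 0 1 (\<lambda>r t. bend (D2 (r *\<^sub>R circ t)))"
  unfolding memb_def bend_def by (intro continuous_intros cont2_jet)+

lemma MM_nonneg: "MM \<ge> 0" unfolding MM_def
  by (intro DI_nonneg continuous_intros cont2_energy) (auto simp: memb_nonneg)

lemma BB_nonneg: "BB \<ge> 0" unfolding BB_def
  by (intro DI_nonneg continuous_intros cont2_energy) (auto simp: bend_nonneg)

lemma radial_defect_memb: "((norm (pr r t))\<^sup>2 - 1)\<^sup>2 \<le> memb (D (r *\<^sub>R circ t))"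
  unfolding pr_def by (rule memb_radial) simp

lemma prr_bend: "norm (prr r t) ^ 2 \<le> bend (D2 (r *\<^sub>R circ t))" "norm (A r t) ^ 2 \<le> bend (D2 (r *\<^sub>R circ t))"
  unfolding prr_def A_def bend_def by (rule dir2_norm, simp)+

definition KK where "KK = DI 0 1 (\<lambda>r t. norm (pr r t - g t) ^ 2)"

lemma cont2_g: "cont2 a b (\<lambda>r t. g t)" by (intro continuous_intros)

text \<open>Along each ray the map runs from 0 to nearly the unit vector \<open>g t\<close>, so the
  radial integral of \<open>pr r t \<bullet> g t\<close> is 1 up to \<open>\<eta>\<close>. Expanding
  the square then trades the quadratic distance to \<open>g\<close> for the linear stretch defect
  \<open>norm (pr r t) ^ 2 - 1\<close>: a ray that must span a unit distance cannot bend without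
  being stretched.\<close>

lemma KK_le_defect: "KK \<le> DI 0 1 (\<lambda>r t. norm (pr r t) ^ 2 - 1) + 4 * pi * \<eta>"
proof -
  have c1: "cont2 0 1 (\<lambda>r t. norm (pr r t) ^ 2 - 1)" by (intro continuous_intros cont2_pr)
  have c2: "cont2 0 1 (\<lambda>r t. 2 - 2 * (pr r t \<bullet> g t))" by (intro continuous_intros cont2_pr)
  have c3: "cont2 0 1 (\<lambda>r t. pr r t \<bullet> g t)" by (intro continuous_intros cont2_pr)
  have "KK = DI 0 1 (\<lambda>r t. (norm (pr r t) ^ 2 - 1) + (2 - 2 * (pr r t \<bullet> g t)))" unfolding KK_def
  proof (rule DI_cong)
    fix r t
    have "g t \<bullet> g t = 1" using gu(1)[of t] by (simp add: dot_square_norm)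
    then show "norm (pr r t - g t) ^ 2 = (norm (pr r t) ^ 2 - 1) + (2 - 2 * (pr r t \<bullet> g t))"
      by (simp add: power2_norm_eq_inner inner_simps inner_commute)
  qed
  also have "\<dots> = DI 0 1 (\<lambda>r t. norm (pr r t) ^ 2 - 1) + DI 0 1 (\<lambda>r t. 2 - 2 * (pr r t \<bullet> g t))" by (rule DI_add[OF c1 c2])
  also have "DI 0 1 (\<lambda>r t. 2 - 2 * (pr r t \<bullet> g t)) = integral {0..2*pi} (\<lambda>t. integral {0..1} (\<lambda>r. 2 - 2 * (pr r t \<bullet> g t)))"
    by (rule DI_swap[OF c2])
  also have "\<dots> \<le> integral {0..2*pi} (\<lambda>t. 2 * \<eta>)"
  proof (rule integral_le)
    show "(\<lambda>t. integral {0..1} (\<lambda>r. 2 - 2 * (pr r t \<bullet> g t))) integrable_on {0..2*pi}"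
      by (rule integrable_continuous_real[OF cont2_inner(3)[OF c2]])
    fix t assume t: "t \<in> {0..2*pi}"
    have "((\<lambda>r. 2 - 2 * (pr r t \<bullet> g t)) has_integral ((2 * 1 - 2 * (Y (1 *\<^sub>R circ t) \<bullet> g t)) - (2 * 0 - 2 * (Y (0 *\<^sub>R circ t) \<bullet> g t)))) {0..1}"
    proof (rule fundamental_theorem_of_calculus)
      fix r :: real assume r: "r \<in> {0..1}"
      have "((\<lambda>r. Y (r *\<^sub>R circ t) \<bullet> g t) has_vector_derivative (pr r t \<bullet> g t)) (at r)"
        using D_radial(1)[of r t] r by (intro bounded_linear.has_vector_derivative[OF bounded_linear_inner_left]) auto
      then have d: "((\<lambda>r. Y (r *\<^sub>R circ t) \<bullet> g t) has_real_derivative (pr r t \<bullet> g t)) (at r)"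
        by (simp add: has_real_derivative_iff_has_vector_derivative)
      have "((\<lambda>r. 2 * r - 2 * (Y (r *\<^sub>R circ t) \<bullet> g t)) has_real_derivative 2 * 1 - 2 * (pr r t \<bullet> g t)) (at r)"
        by (intro DERIV_diff DERIV_cmult DERIV_ident d)
      then show "((\<lambda>r. 2 * r - 2 * (Y (r *\<^sub>R circ t) \<bullet> g t)) has_vector_derivative 2 - 2 * (pr r t \<bullet> g t)) (at r within {0..1})"
        by (simp add: has_real_derivative_iff_has_vector_derivative has_vector_derivative_at_within)
    qed simp
    then have e: "integral {0..1} (\<lambda>r. 2 - 2 * (pr r t \<bullet> g t)) = 2 - 2 * (Y (circ t) \<bullet> g t)"
      using Y0 by (simp add: integral_unique)
    have "1 - Y (circ t) \<bullet> g t = (g t - Y (circ t)) \<bullet> g t" using gu(1)[of t] by (simp add: inner_diff_left dot_square_norm)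
    also have "\<dots> \<le> norm (g t - Y (circ t)) * norm (g t)" by (rule norm_cauchy_schwarz)
    also have "\<dots> \<le> \<eta>" using eta[of t] gu(1)[of t] by (simp add: norm_minus_commute)
    finally show "integral {0..1} (\<lambda>r. 2 - 2 * (pr r t \<bullet> g t)) \<le> 2 * \<eta>" unfolding e by simp
  qed (rule integrable_continuous_real, rule continuous_on_const)
  also have "\<dots> = 4 * pi * \<eta>" by simp
  finally show ?thesis by simp
qed

text \<open>Young's inequality with the weights \<open>r / h\<close> and \<open>h / r\<close>: the
  first meets the membrane term, which carries the factor \<open>r\<close>, and the second
  integrates to \<open>ln (1 / h)\<close>. Down to \<open>r = 0\<close> that logarithm would be
  infinite, hence the separate treatment of the disc of radius \<open>h\<close>.\<close>

lemma defect_outer: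
  assumes h: "0 < h" "h \<le> 1"
  shows "DI h 1 (\<lambda>r t. norm (pr r t) ^ 2 - 1) \<le> MM / (2 * h) + pi * h * ln (1 / h)"
proof -
  have c: "cont2 h 1 F" if "cont2 0 1 F" for F :: "real \<Rightarrow> real \<Rightarrow> 'b::topological_space" using that h by (rule_tac cont2_sub) auto
  have c1: "cont2 h 1 (\<lambda>r t. norm (pr r t) ^ 2 - 1)" by (rule c) (intro continuous_intros cont2_pr)
  have c2: "cont2 h 1 (\<lambda>r t. 1 / (2 * h) * (r * memb (D (r *\<^sub>R circ t))))" by (rule c) (intro continuous_intros cont2_energy)
  have c3: "cont2 h 1 (\<lambda>r t. h / 2 * (1 / r))" using h by (intro continuous_intros) auto
  have "DI h 1 (\<lambda>r t. norm (pr r t) ^ 2 - 1) \<le> DI h 1 (\<lambda>r t. 1 / (2 * h) * (r * memb (D (r *\<^sub>R circ t))) + h / 2 * (1 / r))"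
  proof (rule DI_mono[OF c1])
    show "cont2 h 1 (\<lambda>r t. 1 / (2 * h) * (r * memb (D (r *\<^sub>R circ t))) + h / 2 * (1 / r))" using c2 c3 by (rule continuous_on_add)
    fix r t assume r: "r \<in> {h..1}"
    then have r0: "r > 0" using h by auto
    let ?f = "norm (pr r t) ^ 2 - 1"
    have "2 * (sqrt (r / h) * ?f) * sqrt (h / r) \<le> (sqrt (r / h) * ?f)\<^sup>2 + (sqrt (h / r))\<^sup>2" by (rule sum_squares_bound)
    moreover have "sqrt (r / h) * sqrt (h / r) = 1" using r0 h by (simp flip: real_sqrt_mult)
    moreover have "2 * (sqrt (r / h) * ?f) * sqrt (h / r) = 2 * ?f * (sqrt (r / h) * sqrt (h / r))" by (simp only: mult_ac)
    moreover have "(sqrt (r / h) * ?f)\<^sup>2 = r / h * ?f\<^sup>2" "(sqrt (h / r))\<^sup>2 = h / r" using r0 h by (simp_all add: power_mult_distrib)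
    moreover have "r / h * ?f\<^sup>2 \<le> r / h * memb (D (r *\<^sub>R circ t))" using r0 h radial_defect_memb by (intro mult_left_mono) auto
    ultimately have "2 * ?f \<le> r / h * memb (D (r *\<^sub>R circ t)) + h / r" by simp
    then show "?f \<le> 1 / (2 * h) * (r * memb (D (r *\<^sub>R circ t))) + h / 2 * (1 / r)" using h by (simp add: field_simps)
  qed
  also have "\<dots> = 1 / (2 * h) * DI h 1 (\<lambda>r t. r * memb (D (r *\<^sub>R circ t))) + h / 2 * DI h 1 (\<lambda>r t. 1 / r)"
    unfolding DI_add[OF c2 c3] DI_cmult ..
  also have "DI h 1 (\<lambda>r t. 1 / r) = 2 * pi * ln (1 / h)"
  proof -
    have "((\<lambda>r. 1 / r) has_integral (ln 1 - ln h)) {h..1}"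
      by (rule fundamental_theorem_of_calculus) (use h in \<open>auto intro!: derivative_eq_intros simp: has_real_derivative_iff_has_vector_derivative[symmetric]\<close>)
    then show ?thesis unfolding DI_radial using h by (simp add: integral_unique ln_div)
  qed
  also have "DI h 1 (\<lambda>r t. r * memb (D (r *\<^sub>R circ t))) \<le> MM" unfolding MM_def
    using h by (intro DI_subinterval continuous_intros cont2_energy) (auto simp: memb_nonneg)
  finally show ?thesis using h by (simp add: mult_left_mono divide_right_mono mult_ac)
qed

text \<open>\<open>hardy_interval\<close> supplies the missing weight \<open>r\<close> for the
  radial derivative, and its term with \<open>prr\<close> is paid by \<open>h\<close> times the
  bending energy. Dropping the -1 at the start costs only a multiple of \<open>h\<close> on so small
  a disc.\<close>

lemma defect_inner:
  assumes h: "0 < h" "h \<le> 1"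
  shows "DI 0 h (\<lambda>r t. norm (pr r t) ^ 2 - 1) \<le> 3 / 2 * MM / h + 9 / 2 * pi * h + h * BB"
proof -
  have c: "cont2 0 h F" if "cont2 0 1 F" for F :: "real \<Rightarrow> real \<Rightarrow> 'b::topological_space" using that h by (rule_tac cont2_sub) auto
  have c0: "cont2 0 h (\<lambda>r t. norm (pr r t) ^ 2)" "cont2 0 h (\<lambda>r t. norm (pr r t) ^ 2 - 1)"
    by (rule c, intro continuous_intros cont2_pr)+
  have c1: "cont2 0 h (\<lambda>r t. r * norm (pr r t) ^ 2)" "cont2 0 h (\<lambda>r t. r * norm (prr r t) ^ 2)"
    by (rule c, intro continuous_intros cont2_pr)+
  have "DI 0 h (\<lambda>r t. norm (pr r t) ^ 2 - 1) \<le> DI 0 h (\<lambda>r t. norm (pr r t) ^ 2)" by (rule DI_mono[OF c0(2,1)]) simp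
  also have "\<dots> = integral {0..2*pi} (\<lambda>t. integral {0..h} (\<lambda>r. norm (pr r t) ^ 2))" by (rule DI_swap[OF c0(1)])
  also have "\<dots> \<le> integral {0..2*pi} (\<lambda>t. 3 / h * integral {0..h} (\<lambda>r. r * norm (pr r t) ^ 2) + h * integral {0..h} (\<lambda>r. r * norm (prr r t) ^ 2))"
  proof (rule integral_le)
    show "(\<lambda>t. integral {0..h} (\<lambda>r. norm (pr r t) ^ 2)) integrable_on {0..2*pi}" by (rule integrable_continuous_real[OF cont2_inner(3)[OF c0(1)]])
    show "(\<lambda>t. 3 / h * integral {0..h} (\<lambda>r. r * norm (pr r t) ^ 2) + h * integral {0..h} (\<lambda>r. r * norm (prr r t) ^ 2)) integrable_on {0..2*pi}"
      by (intro integrable_continuous_real continuous_on_add continuous_on_mult continuous_on_const cont2_inner(3)[OF c1(1)] cont2_inner(3)[OF c1(2)])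
    fix t assume t: "t \<in> {0..2*pi}"
    show "integral {0..h} (\<lambda>r. norm (pr r t) ^ 2) \<le> 3 / h * integral {0..h} (\<lambda>r. r * norm (pr r t) ^ 2) + h * integral {0..h} (\<lambda>r. r * norm (prr r t) ^ 2)"
    proof (rule hardy_interval[OF h(1)])
      show "((\<lambda>r. pr r t) has_vector_derivative prr r t) (at r within {0..h})" if "r \<in> {0..h}" for r
        using D_radial(2)[of r t] that h by (auto intro: has_vector_derivative_at_within)
      have "continuous_on {0..1} (\<lambda>r. prr r t)" by (rule continuous_on_compose2[OF cont2_pr(3), of _ "\<lambda>r. (r, t)", simplified]) (use t in \<open>auto intro!: continuous_intros\<close>)
      then show "continuous_on {0..h} (\<lambda>r. prr r t)" using h by (auto elim: continuous_on_subset)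
    qed
  qed
  also have "\<dots> = 3 / h * DI 0 h (\<lambda>r t. r * norm (pr r t) ^ 2) + h * DI 0 h (\<lambda>r t. r * norm (prr r t) ^ 2)"
    unfolding DI_swap[OF c1(1)] DI_swap[OF c1(2)]
    by (subst Henstock_Kurzweil_Integration.integral_add) (use h in \<open>auto intro!: integrable_continuous_real continuous_intros cont2_inner(3)[OF c1(1)] cont2_inner(3)[OF c1(2)]\<close>)
  also have "\<dots> \<le> 3 / h * (MM / 2 + 3 / 2 * pi * h\<^sup>2) + h * BB"
  proof (intro add_mono mult_left_mono)
    have c2: "cont2 0 h (\<lambda>r t. 1 / 2 * (r * memb (D (r *\<^sub>R circ t))))" by (rule c) (intro continuous_intros cont2_energy)
    have c3: "cont2 0 h (\<lambda>r t. 3 / 2 * r)" by (intro continuous_intros)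
    have "DI 0 h (\<lambda>r t. r * norm (pr r t) ^ 2) \<le> DI 0 h (\<lambda>r t. 1 / 2 * (r * memb (D (r *\<^sub>R circ t))) + 3 / 2 * r)"
    proof (rule DI_mono[OF c1(1)])
      show "cont2 0 h (\<lambda>r t. 1 / 2 * (r * memb (D (r *\<^sub>R circ t))) + 3 / 2 * r)" using c2 c3 by (rule continuous_on_add)
      fix r t assume r: "r \<in> {0..h}"
      let ?f = "norm (pr r t) ^ 2 - 1"
      have "2 * ?f * 1 \<le> ?f\<^sup>2 + 1\<^sup>2" by (rule sum_squares_bound)
      then have "norm (pr r t) ^ 2 \<le> 1 / 2 * memb (D (r *\<^sub>R circ t)) + 3 / 2" using radial_defect_memb[of r t] by simp
      then have "r * norm (pr r t) ^ 2 \<le> r * (1 / 2 * memb (D (r *\<^sub>R circ t)) + 3 / 2)" using r by (intro mult_left_mono) auto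
      then show "r * norm (pr r t) ^ 2 \<le> 1 / 2 * (r * memb (D (r *\<^sub>R circ t))) + 3 / 2 * r" by (simp add: algebra_simps)
    qed
    also have "\<dots> = 1 / 2 * DI 0 h (\<lambda>r t. r * memb (D (r *\<^sub>R circ t))) + 3 / 2 * DI 0 h (\<lambda>r t. r)" unfolding DI_add[OF c2 c3] DI_cmult ..
    also have "DI 0 h (\<lambda>r t. r) = pi * h\<^sup>2" unfolding DI_radial using ident_has_integral[of 0 h] h by (simp add: integral_unique)
    also have "DI 0 h (\<lambda>r t. r * memb (D (r *\<^sub>R circ t))) \<le> MM" unfolding MM_def
      using h by (intro DI_subinterval continuous_intros cont2_energy) (auto simp: memb_nonneg)
    finally show "DI 0 h (\<lambda>r t. r * norm (pr r t) ^ 2) \<le> MM / 2 + 3 / 2 * pi * h\<^sup>2" by simp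
    have c4: "cont2 0 h (\<lambda>r t. r * bend (D2 (r *\<^sub>R circ t)))" by (rule c) (intro continuous_intros cont2_energy)
    have "DI 0 h (\<lambda>r t. r * norm (prr r t) ^ 2) \<le> DI 0 h (\<lambda>r t. r * bend (D2 (r *\<^sub>R circ t)))"
      by (rule DI_mono[OF c1(2) c4]) (auto intro!: mult_left_mono prr_bend)
    also have "\<dots> \<le> BB" unfolding BB_def using h by (intro DI_subinterval continuous_intros cont2_energy) (auto simp: bend_nonneg)
    finally show "DI 0 h (\<lambda>r t. r * norm (prr r t) ^ 2) \<le> BB" .
  qed (use h in auto)
  also have "\<dots> = 3 / 2 * MM / h + 9 / 2 * pi * h + h * BB" using h by (simp add: power2_eq_square field_simps)
  finally show ?thesis .
qed

text \<open>For an energy of order \<open>h\<^sup>2 * ln (1 / h)\<close>,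
  \<open>\<eta> \<le> h\<close> and \<open>ln (1 / h) \<ge> 1\<close>, every term on the right is at
  most a multiple of \<open>h * ln (1 / h)\<close>.\<close>

lemma KK_bound:
  assumes h: "0 < h" "h \<le> 1"
  shows "KK \<le> 2 * MM / h + h * BB + pi * h * ln (1 / h) + 9 / 2 * pi * h + 4 * pi * \<eta>"
proof -
  have c1: "cont2 0 1 (\<lambda>r t. norm (pr r t) ^ 2 - 1)" by (intro continuous_intros cont2_pr)
  have "KK \<le> DI 0 h (\<lambda>r t. norm (pr r t) ^ 2 - 1) + DI h 1 (\<lambda>r t. norm (pr r t) ^ 2 - 1) + 4 * pi * \<eta>"
    using KK_le_defect DI_split[OF c1, of h] h by simp
  moreover have "3 / 2 * MM / h + MM / (2 * h) = 2 * MM / h" using h by (simp add: field_simps)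
  ultimately show ?thesis using defect_inner[OF h] defect_outer[OF h] by linarith
qed

end

section \<open>The bending energy on circles\<close>

lemma inner_am_gm: "2 * (u \<bullet> v) \<le> c * norm u ^ 2 + norm v ^ 2 / c" if "c > 0" for u v :: "'a::real_inner"
proof -
  have "0 \<le> norm (c *\<^sub>R u - v) ^ 2" by simp
  also have "\<dots> = c * (c * norm u ^ 2 - 2 * (u \<bullet> v)) + norm v ^ 2"
    unfolding power2_norm_eq_inner by (simp add: inner_simps inner_commute algebra_simps)
  finally have "2 * (u \<bullet> v) * c \<le> (c * norm u ^ 2 + norm v ^ 2 / c) * c" using that by (simp add: algebra_simps)
  then show ?thesis using that by (simp only: mult_le_cancel_right_pos)
qed

text \<open>With \<open>d = a - (1/r) *\<^sub>R k\<close> the right-hand side is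
  \<open>norm k ^ 2 / r + 2 * (k \<bullet> d) + r * norm d ^ 2\<close>, and the cross term has no
  sign. Through \<open>wtt\<close> it becomes the exact derivative
  \<open>k' \<bullet> wt + k \<bullet> wtt\<close> minus \<open>k' \<bullet> wt\<close>, up to a
  term in \<open>wr\<close>. Young's inequality turns \<open>k' \<bullet> wt\<close> into
  \<open>wt \<bullet> wt\<close>, which the second exact derivative
  \<open>wt \<bullet> wt + w \<bullet> wtt\<close> exchanges for \<open>w \<bullet> wtt\<close>. The
  parameter \<open>s\<close> is the Young weight of this exchange, \<open>R\<close> that of the
  terms with \<open>wr\<close>.\<close>

lemma bending_pointwise:
  fixes a k k' w wt wr wtt :: "'a::real_inner"
  assumes r: "r > 0" and s: "s > 0" and R: "R > 0" and wtt: "wtt = r\<^sup>2 *\<^sub>R (a - (1/r) *\<^sub>R k) - r *\<^sub>R wr"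
  shows "norm k ^ 2 / r + 2 / r\<^sup>2 * (k' \<bullet> wt + k \<bullet> wtt) - 1 / (r ^ 4 * s) * (wt \<bullet> wt + w \<bullet> wtt) - s * norm k' ^ 2
     - (1 / (4 * r ^ 5 * s\<^sup>2) + R / (2 * r ^ 6 * s\<^sup>2)) * norm w ^ 2 - R / r\<^sup>2 * norm k ^ 2 - 3 / (2 * R) * norm wr ^ 2 \<le> r * norm a ^ 2"
proof -
  define d where "d = a - (1/r) *\<^sub>R k"
  have a: "a = d + (1/r) *\<^sub>R k" by (simp add: d_def)
  have e1: "r * norm a ^ 2 = norm k ^ 2 / r + 2 * (k \<bullet> d) + r * norm d ^ 2"
    unfolding a power2_norm_eq_inner using r by (simp add: inner_simps inner_commute field_simps power2_eq_square)
  have e2: "2 / r\<^sup>2 * (k \<bullet> wtt) = 2 * (k \<bullet> d) - 2 / r * (k \<bullet> wr)"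
    unfolding wtt d_def[symmetric] using r by (simp add: inner_simps field_simps power2_eq_square)
  have e3: "1 / (r ^ 4 * s) * (w \<bullet> wtt) = 1 / (r\<^sup>2 * s) * (w \<bullet> d) - 1 / (r ^ 3 * s) * (w \<bullet> wr)"
    unfolding wtt d_def[symmetric] using r s by (simp add: inner_simps field_simps eval_nat_numeral)
  have A: "2 / r\<^sup>2 * (k' \<bullet> wt) \<le> s * norm k' ^ 2 + 1 / (r ^ 4 * s) * (wt \<bullet> wt)"
  proof -
    have "1 / r\<^sup>2 * (2 * (k' \<bullet> wt)) \<le> 1 / r\<^sup>2 * ((s * r\<^sup>2) * norm k' ^ 2 + norm wt ^ 2 / (s * r\<^sup>2))"
      using r s by (intro mult_left_mono inner_am_gm) auto
    also have "\<dots> = s * norm k' ^ 2 + 1 / (r ^ 4 * s) * (wt \<bullet> wt)"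
      unfolding power2_norm_eq_inner using r s by (simp add: field_simps eval_nat_numeral)
    finally show ?thesis by simp
  qed
  \<comment> \<open>Here the leftover square \<open>r * norm d ^ 2\<close> is spent; it is the only
    control of \<open>wtt\<close>.\<close>
  have B: "1 / (r\<^sup>2 * s) * (- (w \<bullet> d)) \<le> r * norm d ^ 2 + 1 / (4 * r ^ 5 * s\<^sup>2) * norm w ^ 2"
  proof -
    have "1 / (2 * r\<^sup>2 * s) * (2 * (d \<bullet> (- w))) \<le> 1 / (2 * r\<^sup>2 * s) * ((2 * r ^ 3 * s) * norm d ^ 2 + norm (- w) ^ 2 / (2 * r ^ 3 * s))"
      using r s by (intro mult_left_mono inner_am_gm) auto
    also have "\<dots> = r * norm d ^ 2 + 1 / (4 * r ^ 5 * s\<^sup>2) * norm w ^ 2"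
      using r s by (simp add: field_simps eval_nat_numeral)
    finally show ?thesis by (simp add: inner_commute)
  qed
  have Cc: "1 / (r ^ 3 * s) * (w \<bullet> wr) \<le> R / (2 * r ^ 6 * s\<^sup>2) * norm w ^ 2 + 1 / (2 * R) * norm wr ^ 2"
  proof -
    have "1 / (2 * r ^ 3 * s) * (2 * (w \<bullet> wr)) \<le> 1 / (2 * r ^ 3 * s) * ((R / (r ^ 3 * s)) * norm w ^ 2 + norm wr ^ 2 / (R / (r ^ 3 * s)))"
      using r s R by (intro mult_left_mono inner_am_gm) auto
    also have "\<dots> = R / (2 * r ^ 6 * s\<^sup>2) * norm w ^ 2 + 1 / (2 * R) * norm wr ^ 2"
      using r s R by (simp add: field_simps eval_nat_numeral)
    finally show ?thesis by simp
  qed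
  have Dd: "2 / r * (- (k \<bullet> wr)) \<le> R / r\<^sup>2 * norm k ^ 2 + 1 / R * norm wr ^ 2"
  proof -
    have "1 / r * (2 * ((- k) \<bullet> wr)) \<le> 1 / r * ((R / r) * norm (- k) ^ 2 + norm wr ^ 2 / (R / r))"
      using r R by (intro mult_left_mono inner_am_gm) auto
    also have "\<dots> = R / r\<^sup>2 * norm k ^ 2 + 1 / R * norm wr ^ 2"
      using r R by (simp add: field_simps eval_nat_numeral)
    finally show ?thesis by simp
  qed
  have f: "3 / (2 * R) * norm wr ^ 2 = 1 / R * norm wr ^ 2 + 1 / (2 * R) * norm wr ^ 2" using R by (simp add: field_simps)
  show ?thesis unfolding e1 f distrib_left distrib_right e2 e3 using A B Cc Dd by (simp add: algebra_simps)
qed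

context smooth_map
begin

definition w where "w r t = Y (r *\<^sub>R circ t) - r *\<^sub>R g t"

lemma cont2_w: "cont2 0 1 w" unfolding w_def by (intro continuous_intros cont2_jet)

lemma cont2_radial_defect: "cont2 0 1 (\<lambda>r t. norm (pr r t - g t) ^ 2)" by (intro continuous_intros cont2_pr)

lemma slice_cont: "cont2 0 1 F \<Longrightarrow> r \<in> {0..1} \<Longrightarrow> continuous_on {0..2*pi} (F r)" for F :: "real \<Rightarrow> real \<Rightarrow> 'b::topological_space"
  by (rule continuous_on_compose2[of _ "\<lambda>p. F (fst p) (snd p)" _ "\<lambda>t. (r, t)", simplified]) (auto intro!: continuous_intros)

lemma slice_cont': "cont2 0 1 F \<Longrightarrow> t \<in> {0..2*pi} \<Longrightarrow> continuous_on {0..1} (\<lambda>r. F r t)" for F :: "real \<Rightarrow> real \<Rightarrow> 'b::topological_space"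
  by (rule continuous_on_compose2[of _ "\<lambda>p. F (fst p) (snd p)" _ "\<lambda>r. (r, t)", simplified]) (auto intro!: continuous_intros)

text \<open>\<open>w\<close> is the integral of \<open>pr - g\<close> from the origin, where the map
  and the cone both vanish; Cauchy-Schwarz on an interval of length \<open>r\<close> gives the
  factor \<open>r\<close>. Relative to the squared size \<open>r\<^sup>2\<close> of the cone the
  bound is small exactly when \<open>r\<close> is large compared with \<open>KK\<close>.\<close>

lemma w_bound:
  assumes r: "r \<in> {0..1}"
  shows "integral {0..2*pi} (\<lambda>t. norm (w r t) ^ 2) \<le> r * KK"
proof -
  have "integral {0..2*pi} (\<lambda>t. norm (w r t) ^ 2) \<le> integral {0..2*pi} (\<lambda>t. r * integral {0..1} (\<lambda>\<sigma>. norm (pr \<sigma> t - g t) ^ 2))"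
  proof (rule integral_le)
    show "(\<lambda>t. norm (w r t) ^ 2) integrable_on {0..2*pi}" by (intro integrable_continuous_real continuous_intros slice_cont[OF cont2_w r])
    show "(\<lambda>t. r * integral {0..1} (\<lambda>\<sigma>. norm (pr \<sigma> t - g t) ^ 2)) integrable_on {0..2*pi}"
      by (intro integrable_continuous_real continuous_intros cont2_inner(3)[OF cont2_radial_defect])
    fix t assume t: "t \<in> {0..2*pi}"
    have c: "continuous_on {0..1} (\<lambda>\<sigma>. pr \<sigma> t - g t)" by (intro continuous_intros slice_cont'[OF cont2_pr(1) t])
    have c': "continuous_on {0..r} (\<lambda>\<sigma>. pr \<sigma> t - g t)" using r by (intro continuous_on_subset[OF c]) auto
    have "((\<lambda>\<sigma>. pr \<sigma> t - g t) has_integral (w r t - w 0 t)) {0..r}"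
    proof (rule fundamental_theorem_of_calculus)
      fix \<sigma> assume s: "\<sigma> \<in> {0..r}"
      have "((\<lambda>\<sigma>. Y (\<sigma> *\<^sub>R circ t) - \<sigma> *\<^sub>R g t) has_vector_derivative (pr \<sigma> t - 1 *\<^sub>R g t)) (at \<sigma> within {0..r})"
        using s r by (intro has_vector_derivative_diff has_vector_derivative_at_within[OF D_radial(1)]) (auto intro!: derivative_eq_intros)
      then show "((\<lambda>\<sigma>. w \<sigma> t) has_vector_derivative (pr \<sigma> t - g t)) (at \<sigma> within {0..r})" by (simp add: w_def)
    qed (use r in auto)
    then have "w r t = integral {0..r} (\<lambda>\<sigma>. pr \<sigma> t - g t)" using Y0 by (simp add: integral_unique w_def)
    then have "norm (w r t) ^ 2 \<le> r * integral {0..r} (\<lambda>\<sigma>. norm (pr \<sigma> t - g t) ^ 2)"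
      using integral_norm_square_le[OF _ c'] r by simp
    also have "\<dots> \<le> r * integral {0..1} (\<lambda>\<sigma>. norm (pr \<sigma> t - g t) ^ 2)"
      using r by (intro mult_left_mono integral_subset_le integrable_continuous_real continuous_intros c c') auto
    finally show "norm (w r t) ^ 2 \<le> r * integral {0..1} (\<lambda>\<sigma>. norm (pr \<sigma> t - g t) ^ 2)" .
  qed
  also have "\<dots> = r * KK" unfolding KK_def DI_swap[OF cont2_radial_defect] by simp
  finally show ?thesis .
qed

text \<open>The two exact derivatives in \<open>bending_pointwise\<close> integrate to 0 by
  periodicity in \<open>t\<close>. The first of them differentiates \<open>kap\<close>, which brings
  in \<open>g3\<close>.\<close>

lemma bending_slice:
  assumes r: "0 < r" "r \<le> 1" and s: "s > 0" and R: "R > 0"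
    and N: "\<And>t. t \<in> {0..2*pi} \<Longrightarrow> norm (kap t) \<le> N" "\<And>t. t \<in> {0..2*pi} \<Longrightarrow> norm (g3 t + g1 t) \<le> N"
  shows "kk / r - 2 * pi * N\<^sup>2 * s - (1 / (4 * r ^ 5 * s\<^sup>2) + R / (2 * r ^ 6 * s\<^sup>2)) * (r * KK) - 2 * pi * N\<^sup>2 * (R / r\<^sup>2)
      - 3 / (2 * R) * integral {0..2*pi} (\<lambda>t. norm (pr r t - g t) ^ 2) \<le> integral {0..2*pi} (\<lambda>t. r * norm (A r t) ^ 2)"
proof -
  have r01: "r \<in> {0..1}" "0 \<le> r" using r by auto
  define wr where "wr = (\<lambda>t. pr r t - g t)"
  define wt where "wt = (\<lambda>t. r *\<^sub>R ptn r t - r *\<^sub>R g1 t)"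
  define wtt where "wtt = (\<lambda>t. r *\<^sub>R (r *\<^sub>R A r t - pr r t) - r *\<^sub>R g2 t)"
  define k' where "k' = (\<lambda>t. g3 t + g1 t)"
  have dw: "(w r has_vector_derivative wt t) (at t)" for t unfolding w_def wt_def
    by (intro has_vector_derivative_diff D_angular(1) r01 r(2) bounded_linear.has_vector_derivative[OF bounded_linear_scaleR_right] gd)
  have dwt: "(wt has_vector_derivative wtt t) (at t)" for t unfolding wt_def wtt_def
    by (intro has_vector_derivative_diff bounded_linear.has_vector_derivative[OF bounded_linear_scaleR_right] D_angular(2) r01 r(2) gd)
  have dk: "(kap has_vector_derivative k' t) (at t)" for t unfolding kap_def k'_def
    by (intro has_vector_derivative_add gd)
  have p0: "w r (2*pi) = w r 0" "wt (2*pi) = wt 0" "kap (2*pi) = kap 0"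
    by (simp_all add: w_def wt_def ptn_def kap_def circ_periodic per0)
  have inner_d: "((\<lambda>t. u t \<bullet> v t) has_vector_derivative (u' t \<bullet> v t + u t \<bullet> v' t)) (at t within S)"
    if "(u has_vector_derivative u' t) (at t)" "(v has_vector_derivative v' t) (at t)" for u v u' v' :: "real \<Rightarrow> real^3" and t S
    using bounded_bilinear.has_vector_derivative[OF bounded_bilinear_inner that, THEN has_vector_derivative_at_within] by (simp add: add.commute)
  let ?G1 = "\<lambda>t. k' t \<bullet> wt t + kap t \<bullet> wtt t" and ?G2 = "\<lambda>t. wt t \<bullet> wt t + w r t \<bullet> wtt t"
  have G1: "(?G1 has_integral 0) {0..2*pi}"
    using fundamental_theorem_of_calculus[of 0 "2*pi" "\<lambda>t. kap t \<bullet> wt t" ?G1] inner_d[where u=kap and v=wt and u'=k' and v'=wtt, OF dk dwt] p0 by simp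
  have G2: "(?G2 has_integral 0) {0..2*pi}"
    using fundamental_theorem_of_calculus[of 0 "2*pi" "\<lambda>t. w r t \<bullet> wt t" ?G2] inner_d[where u="w r" and v=wt and u'=wt and v'=wtt, OF dw dwt] p0 by simp
  let ?W = "\<lambda>t. norm (w r t) ^ 2" and ?V = "\<lambda>t. norm (pr r t - g t) ^ 2" and ?K = "\<lambda>t. norm (kap t) ^ 2"
  have kc: "continuous_on {0..2*pi} kap" unfolding kap_def by (intro continuous_intros)
  have iW: "(?W has_integral integral {0..2*pi} ?W) {0..2*pi}" "(?V has_integral integral {0..2*pi} ?V) {0..2*pi}" "(?K has_integral kk) {0..2*pi}"
    "((\<lambda>t. r * norm (A r t) ^ 2) has_integral integral {0..2*pi} (\<lambda>t. r * norm (A r t) ^ 2)) {0..2*pi}"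
    unfolding kk_def
    by (intro integrable_integral integrable_continuous_real continuous_intros kc slice_cont[OF cont2_w r01(1)] slice_cont[OF cont2_pr(1) r01(1)] slice_cont[OF cont2_pr(4) r01(1)])+
  have ic: "((\<lambda>t. c) has_integral (2 * pi * c)) {0..2*pi}" for c :: real using has_integral_const_real[of c 0 "2*pi"] by simp
  define \<alpha> where "\<alpha> = 1 / (4 * r ^ 5 * s\<^sup>2) + R / (2 * r ^ 6 * s\<^sup>2)"
  have \<alpha>: "\<alpha> \<ge> 0" using r R by (simp add: \<alpha>_def)
  have "((\<lambda>t. 1 / r * ?K t + 2 / r\<^sup>2 * ?G1 t - 1 / (r ^ 4 * s) * ?G2 t - s * N\<^sup>2 - \<alpha> * ?W t - R / r\<^sup>2 * N\<^sup>2 - 3 / (2 * R) * ?V t)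
     has_integral (1 / r * kk + 2 / r\<^sup>2 * 0 - 1 / (r ^ 4 * s) * 0 - 2 * pi * (s * N\<^sup>2) - \<alpha> * integral {0..2*pi} ?W - 2 * pi * (R / r\<^sup>2 * N\<^sup>2) - 3 / (2 * R) * integral {0..2*pi} ?V)) {0..2*pi}"
    by (intro has_integral_diff has_integral_add has_integral_mult_right G1 G2 iW ic)
  then have "1 / r * kk + 2 / r\<^sup>2 * 0 - 1 / (r ^ 4 * s) * 0 - 2 * pi * (s * N\<^sup>2) - \<alpha> * integral {0..2*pi} ?W - 2 * pi * (R / r\<^sup>2 * N\<^sup>2) - 3 / (2 * R) * integral {0..2*pi} ?V
      \<le> integral {0..2*pi} (\<lambda>t. r * norm (A r t) ^ 2)"
  proof (rule has_integral_le[OF _ iW(4)])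
    fix t assume t: "t \<in> {0..2*pi}"
    have e: "wtt t = r\<^sup>2 *\<^sub>R (A r t - (1/r) *\<^sub>R kap t) - r *\<^sub>R (pr r t - g t)"
      using r by (simp add: wtt_def kap_def algebra_simps power2_eq_square)
    have n1: "norm (kap t) ^ 2 \<le> N\<^sup>2" "norm (k' t) ^ 2 \<le> N\<^sup>2" using N[OF t] by (auto intro!: power_mono simp: k'_def)
    have "s * norm (k' t) ^ 2 \<le> s * N\<^sup>2" "R / r\<^sup>2 * norm (kap t) ^ 2 \<le> R / r\<^sup>2 * N\<^sup>2"
      by (rule mult_left_mono[OF n1(2)], use s in simp, rule mult_left_mono[OF n1(1)], use R in simp)
    with bending_pointwise[OF r(1) s R e, of "k' t" "wt t" "w r t"]
    show "1 / r * ?K t + 2 / r\<^sup>2 * ?G1 t - 1 / (r ^ 4 * s) * ?G2 t - s * N\<^sup>2 - \<alpha> * ?W t - R / r\<^sup>2 * N\<^sup>2 - 3 / (2 * R) * ?V t \<le> r * norm (A r t) ^ 2"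
      unfolding \<alpha>_def by simp
  qed
  moreover have "\<alpha> * integral {0..2*pi} ?W \<le> \<alpha> * (r * KK)" by (rule mult_left_mono[OF w_bound[OF r01(1)] \<alpha>])
  ultimately show ?thesis unfolding \<alpha>_def[symmetric] by (simp add: mult_ac)
qed

text \<open>The weight \<open>s = (R / r) powr (1/4) / r\<close> in \<open>bending_slice\<close> keeps both the error \<open>s N\<^sup>2\<close> and the error
  proportional to \<open>KK / s\<^sup>2\<close> integrable against a bound independent of \<open>R\<close>.\<close>

lemma bending_slice_q:
  assumes r: "0 < R" "R \<le> r" "r \<le> 1" and N: "\<And>t. t \<in> {0..2*pi} \<Longrightarrow> norm (kap t) \<le> N" "\<And>t. t \<in> {0..2*pi} \<Longrightarrow> norm (g3 t + g1 t) \<le> N"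
    and K: "KK \<le> K2 * R" "K2 \<ge> 0"
  shows "kk / r - (4 * pi * N\<^sup>2 + 3 / 4 * K2) * ((R / r) powr (1/4) / r)
      - 3 / (2 * R) * integral {0..2*pi} (\<lambda>t. norm (pr r t - g t) ^ 2) \<le> integral {0..2*pi} (\<lambda>t. r * norm (A r t) ^ 2)"
proof -
  define q where "q = (R / r) powr (1/4)"
  have r0: "r > 0" using r by simp
  have q: "q > 0" "q \<le> 1" using r r0 powr_mono2[of "1/4" "R/r" 1] by (auto simp: q_def)
  have q4: "q ^ 4 = R / r" using r r0 by (simp add: q_def powr_power)
  have Re: "R = q ^ 4 * r" using q4 r0 by simp
  define c where "c = integral {0..2*pi} (\<lambda>t. norm (pr r t - g t) ^ 2)"
  have KK: "r * KK \<le> K2 * q ^ 4 * r\<^sup>2" using K(1) r0 mult_left_mono[of KK "K2 * R" r] Re by (simp add: power2_eq_square mult_ac)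
  have s: "q / r > 0" using q r0 by simp
  note B = bending_slice[OF r0 r(3) s r(1) N]
  have al: "1 / (4 * r ^ 5 * (q / r)\<^sup>2) + R / (2 * r ^ 6 * (q / r)\<^sup>2) = (1 / (4 * q\<^sup>2) + q\<^sup>2 / 2) / r ^ 3"
    unfolding Re using q r0 by (simp add: field_simps eval_nat_numeral)
  have "(1 / (4 * r ^ 5 * (q / r)\<^sup>2) + R / (2 * r ^ 6 * (q / r)\<^sup>2)) * (r * KK) \<le> (1 / (4 * q\<^sup>2) + q\<^sup>2 / 2) / r ^ 3 * (K2 * q ^ 4 * r\<^sup>2)"
    unfolding al using KK r0 q by (intro mult_left_mono) auto
  also have "\<dots> = K2 * (q\<^sup>2 / 4 + q ^ 6 / 2) / r" using r0 q by (simp add: field_simps eval_nat_numeral)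
  also have "\<dots> \<le> K2 * (q / 4 + q / 2) / r"
    using r0 q K(2) power_decreasing[of 1 2 q] power_decreasing[of 1 6 q] by (intro divide_right_mono mult_left_mono add_mono) auto
  also have "\<dots> = 3 / 4 * K2 * (q / r)" by simp
  finally have 1: "(1 / (4 * r ^ 5 * (q / r)\<^sup>2) + R / (2 * r ^ 6 * (q / r)\<^sup>2)) * (r * KK) \<le> 3 / 4 * K2 * (q / r)" .
  have "R / r\<^sup>2 = q ^ 4 / r" unfolding Re using r0 by (simp add: power2_eq_square)
  also have "\<dots> \<le> q / r" using r0 q power_decreasing[of 1 4 q] by (intro divide_right_mono) auto
  finally have "2 * pi * N\<^sup>2 * (R / r\<^sup>2) \<le> 2 * pi * N\<^sup>2 * (q / r)" by (intro mult_left_mono) auto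
  moreover have "(4 * pi * N\<^sup>2 + 3 / 4 * K2) * (q / r) = 2 * pi * N\<^sup>2 * (q / r) + 2 * pi * N\<^sup>2 * (q / r) + 3 / 4 * K2 * (q / r)" by (simp add: algebra_simps)
  ultimately show ?thesis using B 1 unfolding q_def[symmetric] by linarith
qed

text \<open>At most 4, independently of \<open>R\<close>: the extra factor
  \<open>(R / r) powr (1/4)\<close> removes the logarithmic divergence of
  \<open>1 / r\<close>.\<close>

lemma integral_powr_quarter:
  fixes R :: real
  assumes R: "0 < R" "R \<le> 1"
  shows "((\<lambda>r. (R / r) powr (1/4) / r) has_integral (4 - 4 * R powr (1/4))) {R..1}"
proof -
  have "((\<lambda>r. (R / r) powr (1/4) / r) has_integral (- 4 * (R / 1) powr (1/4) - (- 4 * (R / R) powr (1/4)))) {R..1}"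
  proof (rule fundamental_theorem_of_calculus[OF R(2)])
    fix r assume "r \<in> {R..1}"
    then have r: "r > 0" using R by auto
    have "((\<lambda>r. - 4 * (R / r) powr (1/4)) has_real_derivative (R / r) powr (1/4) / r) (at r within {R..1})"
    proof -
      have "(R / r) powr (1/4) = (R / r) powr 1 * (R / r) powr (- (3/4))" by (subst powr_add[symmetric]) simp
      then have "r * (R / r) powr (1/4) = R * (R / r) powr (- (3/4))" using r R by simp
      then show ?thesis using r R by (auto intro!: derivative_eq_intros simp: field_simps power2_eq_square)
    qed
    then show "((\<lambda>r. - 4 * (R / r) powr (1/4)) has_vector_derivative (R / r) powr (1/4) / r) (at r within {R..1})"
      by (simp add: has_real_derivative_iff_has_vector_derivative)
  qed
  then show ?thesis using R by simp
qed

text \<open>The slice estimate integrated over \<open>R \<le> r \<le> 1\<close>. Its last term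
  becomes \<open>3 / (2 * R)\<close> times at most \<open>KK\<close>, which is bounded only because
  \<open>KK \<le> K2 * R\<close>; this prevents a choice of \<open>R\<close> much smaller than
  \<open>KK\<close>.\<close>

lemma BB_lower:
  assumes R: "0 < R" "R \<le> 1" and N: "\<And>t. t \<in> {0..2*pi} \<Longrightarrow> norm (kap t) \<le> N" "\<And>t. t \<in> {0..2*pi} \<Longrightarrow> norm (g3 t + g1 t) \<le> N"
    and K: "KK \<le> K2 * R" "K2 \<ge> 0"
  shows "kk * ln (1 / R) - 4 * (4 * pi * N\<^sup>2 + 3 / 4 * K2) - 3 / 2 * K2 \<le> BB"
proof -
  define C0 where "C0 = 4 * pi * N\<^sup>2 + 3 / 4 * K2"
  have C0: "C0 \<ge> 0" using K(2) by (simp add: C0_def)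
  let ?c = "\<lambda>r. integral {0..2*pi} (\<lambda>t. norm (pr r t - g t) ^ 2)"
  have cA: "cont2 R 1 (\<lambda>r t. r * norm (A r t) ^ 2)" by (rule cont2_sub[where a=0 and b=1]) (use R in \<open>auto intro!: continuous_intros cont2_pr\<close>)
  have cB: "cont2 R 1 (\<lambda>r t. r * bend (D2 (r *\<^sub>R circ t)))" by (rule cont2_sub[where a=0 and b=1]) (use R in \<open>auto intro!: continuous_intros cont2_energy\<close>)
  have ccR: "cont2 R 1 (\<lambda>r t. norm (pr r t - g t) ^ 2)" by (rule cont2_sub[OF cont2_radial_defect]) (use R in auto)
  have lnI: "((\<lambda>r. 1 / r) has_integral (ln 1 - ln R)) {R..1}"
    by (rule fundamental_theorem_of_calculus) (use R in \<open>auto intro!: derivative_eq_intros simp: has_real_derivative_iff_has_vector_derivative[symmetric]\<close>)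
  have cI: "(?c has_integral DI R 1 (\<lambda>r t. norm (pr r t - g t) ^ 2)) {R..1}"
    unfolding DI_def by (intro integrable_integral integrable_continuous_real cont2_inner(1)[OF ccR])
  have aI: "((\<lambda>r. integral {0..2*pi} (\<lambda>t. r * norm (A r t) ^ 2)) has_integral DI R 1 (\<lambda>r t. r * norm (A r t) ^ 2)) {R..1}"
    unfolding DI_def by (intro integrable_integral integrable_continuous_real cont2_inner(1)[OF cA])
  have "((\<lambda>r. kk * (1 / r) - C0 * ((R / r) powr (1/4) / r) - 3 / (2 * R) * ?c r) has_integral
      (kk * (ln 1 - ln R) - C0 * (4 - 4 * R powr (1/4)) - 3 / (2 * R) * DI R 1 (\<lambda>r t. norm (pr r t - g t) ^ 2))) {R..1}"
    by (intro has_integral_diff has_integral_mult_right lnI cI integral_powr_quarter R)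
  then have "kk * (ln 1 - ln R) - C0 * (4 - 4 * R powr (1/4)) - 3 / (2 * R) * DI R 1 (\<lambda>r t. norm (pr r t - g t) ^ 2) \<le> DI R 1 (\<lambda>r t. r * norm (A r t) ^ 2)"
  proof (rule has_integral_le[OF _ aI])
    fix r assume "r \<in> {R..1}"
    then show "kk * (1 / r) - C0 * ((R / r) powr (1/4) / r) - 3 / (2 * R) * ?c r \<le> integral {0..2*pi} (\<lambda>t. r * norm (A r t) ^ 2)"
      using bending_slice_q[OF R(1) _ _ N K, of r] by (simp add: C0_def)
  qed
  also have "\<dots> \<le> DI R 1 (\<lambda>r t. r * bend (D2 (r *\<^sub>R circ t)))"
    by (rule DI_mono[OF cA cB]) (use R in \<open>auto intro!: mult_left_mono prr_bend\<close>)
  also have "\<dots> \<le> BB" unfolding BB_def using R by (intro DI_subinterval continuous_intros cont2_energy) (auto simp: bend_nonneg)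
  finally have 1: "kk * (ln 1 - ln R) - C0 * (4 - 4 * R powr (1/4)) - 3 / (2 * R) * DI R 1 (\<lambda>r t. norm (pr r t - g t) ^ 2) \<le> BB" .
  have "DI R 1 (\<lambda>r t. norm (pr r t - g t) ^ 2) \<le> K2 * R"
    using DI_subinterval[OF cont2_radial_defect, of R 1] R K(1) unfolding KK_def by auto
  then have "3 / (2 * R) * DI R 1 (\<lambda>r t. norm (pr r t - g t) ^ 2) \<le> 3 / (2 * R) * (K2 * R)" using R by (intro mult_left_mono) auto
  also have "\<dots> = 3 / 2 * K2" using R by simp
  finally have 2: "3 / (2 * R) * DI R 1 (\<lambda>r t. norm (pr r t - g t) ^ 2) \<le> 3 / 2 * K2" .
  have 3: "C0 * (4 - 4 * R powr (1/4)) \<le> 4 * C0" using C0 by (simp add: algebra_simps)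
  have "kk * (ln 1 - ln R) = kk * ln (1 / R)" using R by (simp add: ln_div)
  then show ?thesis using 1 2 3 unfolding C0_def[symmetric] by linarith
qed

text \<open>Rests on the a priori energy bound \<open>E\<close>, under which \<open>KK\<close> has
  the size of \<open>R = h * ln (1 / h)\<close>. In \<open>K2\<close> the part \<open>2 * K1\<close>
  comes from the energy, and \<open>10 * pi\<close> rounds up the sum of \<open>pi\<close>,
  \<open>9 / 2 * pi\<close> and \<open>4 * pi\<close> from \<open>KK_bound\<close>.\<close>

lemma lower_smooth:
  assumes h: "0 < h" "h \<le> 1" and L: "ln (1 / h) \<ge> 1" and e: "\<eta> \<le> h"
    and N: "\<And>t. t \<in> {0..2*pi} \<Longrightarrow> norm (kap t) \<le> N" "\<And>t. t \<in> {0..2*pi} \<Longrightarrow> norm (g3 t + g1 t) \<le> N"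
    and E: "MM + h\<^sup>2 * BB \<le> h\<^sup>2 * (K1 * ln (1 / h))" and K1: "K1 \<ge> 0"
    and K2: "K2 = 2 * K1 + 10 * pi"
  shows "h\<^sup>2 * (kk * (ln (1 / h) - ln (ln (1 / h))) - 4 * (4 * pi * N\<^sup>2 + 3 / 4 * K2) - 3 / 2 * K2) \<le> MM + h\<^sup>2 * BB"
proof -
  define L where "L = ln (1 / h)"
  have L1: "L \<ge> 1" using L by (simp add: L_def)
  define R where "R = h * L"
  have R0: "R > 0" using h L1 by (simp add: R_def)
  have "L \<le> 1 / h - 1" unfolding L_def using h by (intro ln_le_minus_one) auto
  then have R1: "R \<le> 1" using h unfolding R_def by (simp add: field_simps)
  have hE: "2 * MM / h + h * BB \<le> 2 * h * (K1 * L)"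
  proof -
    have "(2 * MM / h + h * BB) * h \<le> 2 * (MM + h\<^sup>2 * BB)" using h BB_nonneg by (simp add: field_simps power2_eq_square)
    also have "\<dots> \<le> (2 * h * (K1 * L)) * h" using E by (simp add: L_def power2_eq_square mult_ac)
    finally show ?thesis using h by (simp add: mult_ac)
  qed
  have "KK \<le> 2 * h * (K1 * L) + pi * h * L + 9 / 2 * pi * h + 4 * pi * h"
  proof -
    have "4 * pi * \<eta> \<le> 4 * pi * h" by (rule mult_left_mono[OF e]) simp
    then show ?thesis using KK_bound[OF h] hE unfolding L_def[symmetric] by linarith
  qed
  also have "\<dots> \<le> K2 * R"
  proof -
    have "pi * h * 1 \<le> pi * h * L" using h L1 by (intro mult_left_mono) auto
    then have "9 / 2 * pi * h + 4 * pi * h \<le> 9 * (pi * h * L)" using h by simp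
    then show ?thesis unfolding K2 R_def by (simp add: algebra_simps)
  qed
  finally have K: "KK \<le> K2 * R" .
  have "kk * ln (1 / R) - 4 * (4 * pi * N\<^sup>2 + 3 / 4 * K2) - 3 / 2 * K2 \<le> BB"
    by (rule BB_lower[OF R0 R1 N K]) (use K1 in \<open>simp_all add: K2\<close>)
  moreover have "ln (1 / R) = L - ln L"
  proof -
    have "ln (1 / R) = - ln R" using R0 by (simp add: ln_div)
    also have "ln R = ln h + ln L" using h L1 by (simp add: R_def ln_mult)
    also have "ln h = - L" using h by (simp add: L_def ln_div)
    finally show ?thesis by simp
  qed
  ultimately have "h\<^sup>2 * (kk * (L - ln L) - 4 * (4 * pi * N\<^sup>2 + 3 / 4 * K2) - 3 / 2 * K2) \<le> h\<^sup>2 * BB" by (intro mult_left_mono) auto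
  then show ?thesis using MM_nonneg unfolding L_def[symmetric] by linarith
qed

end

section \<open>The competitor\<close>

definition arg2 :: "real^2 \<Rightarrow> real" where "arg2 x = (SOME t. x = norm x *\<^sub>R circ t)"

text \<open>An arbitrary choice of the angle is harmless, since \<open>ang\<close> is applied to periodic functions only.\<close>

definition ang :: "(real \<Rightarrow> 'a) \<Rightarrow> real^2 \<Rightarrow> 'a" where "ang G x = G (arg2 x)"

section \<open>Calculus of functions of the angle\<close>

lemma polar_decomp:
  fixes x :: "real^2"
  obtains t where "x = norm x *\<^sub>R circ t"
proof (cases "x = 0")
  case False
  then have "norm ((1 / norm x) *\<^sub>R x) = 1" by simp
  then obtain t where "(1 / norm x) *\<^sub>R x = circ t" by (rule unit_is_circ)
  then have "norm x *\<^sub>R circ t = x" using False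
    by (simp flip: \<open>(1 / norm x) *\<^sub>R x = circ t\<close>)
  then have "x = norm x *\<^sub>R circ t" by (rule sym)
  then show ?thesis by (rule that)
qed (use that in simp)

lemma arg2: "x = norm x *\<^sub>R circ (arg2 x)"
  unfolding arg2_def by (rule someI_ex, rule polar_decomp[of x]) blast

lemma periodic_int:
  fixes G :: "real \<Rightarrow> 'a"
  assumes "\<And>t. G (t + 2 * pi) = G t"
  shows "G (t + 2 * pi * of_int n) = G t"
proof (induction n rule: int_induct[where k=0])
  case (step1 i)
  have "G (t + 2 * pi * of_int (i + 1)) = G ((t + 2 * pi * of_int i) + 2 * pi)" by (simp add: algebra_simps)
  then show ?case using step1 assms by simp
next
  case (step2 i)
  have "G (t + 2 * pi * of_int i) = G ((t + 2 * pi * of_int (i - 1)) + 2 * pi)" by (simp add: algebra_simps)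
  then show ?case using step2 assms by simp
qed simp

lemma circ_eq_imp:
  assumes "\<And>t. G (t + 2 * pi) = G t" "circ s = circ t"
  shows "G s = G t"
proof -
  have "sin s = sin t \<and> cos s = cos t" using assms(2) circ_nth by metis
  then obtain n :: int where "s = t + 2 * pi * n" using sin_cos_eq_iff by blast
  then show ?thesis using periodic_int[of G t n, OF assms(1)] by simp
qed

lemma ang_circ:
  assumes "\<And>t. G (t + 2 * pi) = G t" "r > 0"
  shows "ang G (r *\<^sub>R circ t) = G t"
proof -
  have "r *\<^sub>R circ t = r *\<^sub>R circ (arg2 (r *\<^sub>R circ t))" using arg2[of "r *\<^sub>R circ t"] assms(2) by simp
  then have "circ (arg2 (r *\<^sub>R circ t)) = circ t" using assms(2) by simp
  then show ?thesis unfolding ang_def by (rule circ_eq_imp[of G, OF assms(1)])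
qed

text \<open>In the half-plane around \<open>circ t0\<close> the arctangent gives a smooth branch of
  the angle, whereas \<open>arg2\<close> need not even be continuous.\<close>

lemma local_angle:
  assumes "x \<bullet> circ t0 > 0"
  shows "x = norm x *\<^sub>R circ (t0 + arctan ((x \<bullet> circ' t0) / (x \<bullet> circ t0)))"
proof -
  define a b where "a = x \<bullet> circ t0" and "b = x \<bullet> circ' t0"
  define u where "u = b / a"
  have a: "a > 0" using assms by (simp add: a_def)
  have sc: "(cos t0)\<^sup>2 + (sin t0)\<^sup>2 = 1" by simp
  have xe: "x = a *\<^sub>R circ t0 + b *\<^sub>R circ' t0"
  proof -
    have "a * cos t0 - b * sin t0 = x $ 1 * ((cos t0)\<^sup>2 + (sin t0)\<^sup>2)" "a * sin t0 + b * cos t0 = x $ 2 * ((cos t0)\<^sup>2 + (sin t0)\<^sup>2)"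
      unfolding a_def b_def inner_vec_def sum_2 circ_nth inner_real_def by algebra+
    then show ?thesis unfolding sc by (simp add: vec_eq_iff forall_2)
  qed
  have n2: "(norm x)\<^sup>2 = a\<^sup>2 + b\<^sup>2"
    unfolding power2_norm_eq_inner by (subst (1 2) xe) (simp add: inner_simps power2_eq_square)
  have n: "norm x = a * sqrt (1 + u\<^sup>2)"
  proof -
    have "norm x = sqrt (a\<^sup>2 * (1 + u\<^sup>2))" using n2 a by (simp add: u_def power_divide distrib_left real_sqrt_unique)
    then show ?thesis using a by (simp add: real_sqrt_mult)
  qed
  have s0: "sqrt (1 + u\<^sup>2) > 0" by (simp add: add_pos_nonneg)
  have c: "circ (t0 + arctan u) = cos (arctan u) *\<^sub>R circ t0 + sin (arctan u) *\<^sub>R circ' t0"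
    by (simp add: vec_eq_iff forall_2 cos_add sin_add)
  have "norm x *\<^sub>R circ (t0 + arctan u) = a *\<^sub>R circ t0 + (a * u) *\<^sub>R circ' t0"
    unfolding c n using s0 by (simp add: cos_arctan sin_arctan scaleR_add_right)
  also have "a * u = b" using a by (simp add: u_def)
  finally have "norm x *\<^sub>R circ (t0 + arctan u) = x" unfolding xe[symmetric] .
  then show ?thesis unfolding u_def a_def b_def by (rule sym)
qed

text \<open>Near the point, \<open>ang G\<close> agrees with \<open>G\<close> composed with the
  smooth branch of \<open>local_angle\<close>; periodicity makes the difference between the two
  angles invisible.\<close>

lemma ang_has_derivative:
  fixes G :: "real \<Rightarrow> 'a::real_normed_vector" and G' :: 'a
  assumes per: "\<And>t. G (t + 2 * pi) = G t" and d: "(G has_vector_derivative G') (at t0)" and r: "r > 0"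
  shows "(ang G has_derivative (\<lambda>v. ((v \<bullet> circ' t0) / r) *\<^sub>R G')) (at (r *\<^sub>R circ t0))"
proof -
  let ?x = "r *\<^sub>R circ t0"
  let ?th = "\<lambda>x. t0 + arctan ((x \<bullet> circ' t0) / (x \<bullet> circ t0))"
  have o: "open {x. x \<bullet> circ t0 > 0}" by (intro open_Collect_less continuous_intros)
  have i: "((\<lambda>x::real^2. x \<bullet> c) has_derivative (\<lambda>v. v \<bullet> c)) (at y)" for c y
    by (rule bounded_linear_imp_has_derivative) (rule bounded_linear_inner_left)
  have "((\<lambda>x. (x \<bullet> circ' t0) / (x \<bullet> circ t0)) has_derivative (\<lambda>v. (v \<bullet> circ' t0) / r)) (at ?x)"
    using has_derivative_divide'[OF i[of "circ' t0" ?x] i[of "circ t0" ?x]] r by (simp add: power2_eq_square)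
  note u = this
  have at: "(arctan has_derivative (\<lambda>h. h)) (at ((?x \<bullet> circ' t0) / (?x \<bullet> circ t0)))"
  proof -
    have "(arctan has_derivative (\<lambda>h. h)) (at 0)"
      using DERIV_arctan[of 0] unfolding has_field_derivative_def by (rule has_derivative_eq_rhs) (simp add: fun_eq_iff)
    then show ?thesis by simp
  qed
  have th: "(?th has_derivative (\<lambda>v. 0 + (v \<bullet> circ' t0) / r)) (at ?x)"
    by (rule has_derivative_add[OF has_derivative_const has_derivative_compose[OF u at]])
  have "(G has_derivative (\<lambda>h. h *\<^sub>R G')) (at (?th ?x))" using d by (simp add: has_vector_derivative_def)
  from has_derivative_compose[OF th this]
  have "((\<lambda>x. G (?th x)) has_derivative (\<lambda>v. ((v \<bullet> circ' t0) / r) *\<^sub>R G')) (at ?x)" by simp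
  then show ?thesis
  proof (rule has_derivative_transform_within_open[OF _ o])
    show "?x \<in> {x. x \<bullet> circ t0 > 0}" using r by simp
    fix x assume "x \<in> {x. x \<bullet> circ t0 > 0}"
    then have x: "x \<bullet> circ t0 > 0" by simp
    then have "x \<noteq> 0" by auto
    then have "norm x > 0" by simp
    from ang_circ[of G, OF per this, of "?th x"] show "G (?th x) = ang G x" using local_angle[OF x] by simp
  qed
qed

lemma ang_continuous:
  fixes G :: "real \<Rightarrow> 'a::topological_space"
  assumes per: "\<And>t. G (t + 2 * pi) = G t" and c: "continuous_on UNIV G"
  shows "continuous_on (- {0}) (ang G)"
proof (rule continuous_at_imp_continuous_on)
  show "\<forall>x\<in>- {0}. isCont (ang G) x"
  proof
    fix y :: "real^2" assume y: "y \<in> - {0}"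
    obtain t0 where t0: "y = norm y *\<^sub>R circ t0" by (rule polar_decomp)
    have "y \<bullet> circ t0 = norm y" by (subst t0) simp
    then have pos: "y \<bullet> circ t0 > 0" using y by simp
    let ?S = "{x. x \<bullet> circ t0 > 0}"
    have o: "open ?S" by (intro open_Collect_less continuous_intros)
    have "continuous_on ?S (\<lambda>x. G (t0 + arctan ((x \<bullet> circ' t0) / (x \<bullet> circ t0))))"
      by (rule continuous_on_compose2[OF c]) (auto intro!: continuous_intros)
    moreover have "continuous_on ?S (\<lambda>x. G (t0 + arctan ((x \<bullet> circ' t0) / (x \<bullet> circ t0)))) \<longleftrightarrow> continuous_on ?S (ang G)"
    proof (rule continuous_on_cong[OF refl])
      fix x assume "x \<in> ?S"
      then have x: "x \<bullet> circ t0 > 0" by simp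
      then have "x \<noteq> 0" by auto
      then have "norm x > 0" by simp
      from ang_circ[of G, OF per this, of "t0 + arctan ((x \<bullet> circ' t0) / (x \<bullet> circ t0))"]
      show "G (t0 + arctan ((x \<bullet> circ' t0) / (x \<bullet> circ t0))) = ang G x" using local_angle[OF x] by simp
    qed
    ultimately show "isCont (ang G) y" using o pos by (simp add: continuous_on_eq_continuous_at)
  qed
qed

text \<open>Written in coordinates through \<open>circ\<close> and \<open>circ'\<close>, so that
  each partial derivative is again a sum of products of a radial and an angular function. The lemma
  can thus be applied to its own output, which gives the second derivatives.\<close>

lemma radial_ang_has_derivative:
  fixes G :: "real \<Rightarrow> 'a::real_normed_vector" and \<phi> :: "real \<Rightarrow> real"
  assumes per: "\<And>t. G (t + 2 * pi) = G t" and d: "(G has_vector_derivative G') (at t0)" and r: "r > 0"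
    and f: "(\<phi> has_real_derivative \<phi>') (at r)"
  shows "((\<lambda>x. \<phi> (norm x) *\<^sub>R ang G x) has_derivative (\<lambda>v. \<Sum>j\<in>UNIV. v $ j *\<^sub>R (\<phi>' *\<^sub>R (circ t0 $ j *\<^sub>R G t0) + (\<phi> r / r) *\<^sub>R (circ' t0 $ j *\<^sub>R G')))) (at (r *\<^sub>R circ t0))"
proof -
  let ?x = "r *\<^sub>R circ t0"
  have x0: "?x \<noteq> 0" using r by (metis norm_circ(1) norm_zero scaleR_eq_0_iff less_irrefl zero_neq_one)
  have n: "norm ?x = r" using r by simp
  have "(norm has_derivative (\<lambda>v. circ t0 \<bullet> v)) (at ?x)"
    using has_derivative_norm[OF x0] r by (simp add: sgn_div_norm inner_commute)
  moreover have "(\<phi> has_derivative (\<lambda>h. h * \<phi>')) (at (norm ?x))"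
    using f unfolding n has_field_derivative_def by (rule has_derivative_eq_rhs) (simp add: fun_eq_iff mult.commute)
  ultimately have p: "((\<lambda>x. \<phi> (norm x)) has_derivative (\<lambda>v. (circ t0 \<bullet> v) * \<phi>')) (at ?x)" by (rule has_derivative_compose)
  have "((\<lambda>x. \<phi> (norm x) *\<^sub>R ang G x) has_derivative (\<lambda>v. \<phi> (norm ?x) *\<^sub>R (((v \<bullet> circ' t0) / r) *\<^sub>R G') + ((circ t0 \<bullet> v) * \<phi>') *\<^sub>R ang G ?x)) (at ?x)"
    by (rule has_derivative_scaleR[OF p ang_has_derivative[OF per d r]])
  moreover have "(\<lambda>v. \<phi> (norm ?x) *\<^sub>R (((v \<bullet> circ' t0) / r) *\<^sub>R G') + ((circ t0 \<bullet> v) * \<phi>') *\<^sub>R ang G ?x)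
     = (\<lambda>v. \<Sum>j\<in>UNIV. v $ j *\<^sub>R (\<phi>' *\<^sub>R (circ t0 $ j *\<^sub>R G t0) + (\<phi> r / r) *\<^sub>R (circ' t0 $ j *\<^sub>R G')))"
  proof
    fix v
    have g: "(\<Sum>j\<in>UNIV. v $ j *\<^sub>R (a *\<^sub>R (c $ j *\<^sub>R X) + b *\<^sub>R (c' $ j *\<^sub>R Z))) = (a * (c \<bullet> v)) *\<^sub>R X + (b * (v \<bullet> c')) *\<^sub>R Z"
      for a b :: real and c c' :: "real^2" and X Z :: 'a
      by (simp add: inner_vec_def sum_2 algebra_simps)
    show "\<phi> (norm ?x) *\<^sub>R (((v \<bullet> circ' t0) / r) *\<^sub>R G') + ((circ t0 \<bullet> v) * \<phi>') *\<^sub>R ang G ?x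
      = (\<Sum>j\<in>UNIV. v $ j *\<^sub>R (\<phi>' *\<^sub>R (circ t0 $ j *\<^sub>R G t0) + (\<phi> r / r) *\<^sub>R (circ' t0 $ j *\<^sub>R G')))"
      unfolding g n ang_circ[of G, OF per r] by (simp add: mult.commute)
  qed
  ultimately show ?thesis by simp
qed

section \<open>A radial profile that smooths the vertex\<close>

lemma max0_sq_deriv: "((\<lambda>s::real. (max 0 s)\<^sup>2) has_real_derivative 2 * max 0 s) (at s)"
proof -
  have "((\<lambda>h. \<bar>((max 0 (s + h))\<^sup>2 - (max 0 s)\<^sup>2) / h - 2 * max 0 s\<bar>) \<longlongrightarrow> 0) (at 0)"
  proof (rule Lim_null_comparison)
    show "\<forall>\<^sub>F h in at 0. norm \<bar>((max 0 (s + h))\<^sup>2 - (max 0 s)\<^sup>2) / h - 2 * max 0 s\<bar> \<le> \<bar>h\<bar>"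
      unfolding eventually_at
    proof (intro exI[of _ 1] conjI ballI impI)
      fix h :: real assume h: "h \<noteq> 0 \<and> dist h 0 < 1"
      have "((max 0 (s + h))\<^sup>2 - (max 0 s)\<^sup>2) / h - 2 * max 0 s = ((max 0 (s + h))\<^sup>2 - (max 0 s)\<^sup>2 - 2 * max 0 s * h) / h"
        using h by (simp add: field_simps)
      also have "\<bar>\<dots>\<bar> \<le> h\<^sup>2 / \<bar>h\<bar>" unfolding abs_divide using h by (intro divide_right_mono max0_sq_taylor) auto
      also have "\<dots> = \<bar>h\<bar>" using h by (simp add: power2_eq_square abs_if)
      finally show "norm \<bar>((max 0 (s + h))\<^sup>2 - (max 0 s)\<^sup>2) / h - 2 * max 0 s\<bar> \<le> \<bar>h\<bar>" by simp
    qed simp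
    show "((\<lambda>h::real. \<bar>h\<bar>) \<longlongrightarrow> 0) (at 0)" by (rule tendsto_eq_intros refl | simp)+
  qed
  then have "((\<lambda>h. ((max 0 (s + h))\<^sup>2 - (max 0 s)\<^sup>2) / h - 2 * max 0 s) \<longlongrightarrow> 0) (at 0)" by (simp add: tendsto_rabs_zero_iff)
  then show ?thesis unfolding DERIV_def by (rule LIM_zero_cancel)
qed

lemma max0_cube_deriv: "((\<lambda>s::real. (max 0 s) ^ 3) has_real_derivative 3 * (max 0 s)\<^sup>2) (at s)"
proof -
  have e: "(\<lambda>s::real. (max 0 s) ^ 3) = (\<lambda>s. s * (max 0 s)\<^sup>2)" by (auto simp: fun_eq_iff max_def power2_eq_square power3_eq_cube)
  have m: "s * max 0 s = (max 0 s)\<^sup>2" by (auto simp: max_def power2_eq_square)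
  show ?thesis unfolding e by (rule DERIV_cong[OF DERIV_mult[OF DERIV_ident max0_sq_deriv]]) (use m in \<open>simp add: mult_ac\<close>)
qed

text \<open>The profile equals $6r^3-8r^4+3r^5$ on $[0,1]$ and $r$ on $[1,\infty)$; it is $C^2$.\<close>

definition \<phi>0 :: "real \<Rightarrow> real" where "\<phi>0 r = r - (max 0 (1 - r)) ^ 3 * (r + 3 * r\<^sup>2)"
definition \<phi>1 :: "real \<Rightarrow> real" where "\<phi>1 r = 1 + 3 * (max 0 (1 - r))\<^sup>2 * (r + 3 * r\<^sup>2) - (max 0 (1 - r)) ^ 3 * (1 + 6 * r)"
definition \<phi>2 :: "real \<Rightarrow> real" where "\<phi>2 r = - 6 * max 0 (1 - r) * (r + 3 * r\<^sup>2) + 6 * (max 0 (1 - r))\<^sup>2 * (1 + 6 * r) - 6 * (max 0 (1 - r)) ^ 3"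

lemma \<phi>_deriv: "(\<phi>0 has_real_derivative \<phi>1 r) (at r)" "(\<phi>1 has_real_derivative \<phi>2 r) (at r)"
proof -
  have l: "((\<lambda>r::real. 1 - r) has_real_derivative - 1) (at r)" by (auto intro!: derivative_eq_intros)
  have m2: "((\<lambda>r::real. (max 0 (1 - r))\<^sup>2) has_real_derivative - (2 * max 0 (1 - r))) (at r)"
    using DERIV_chain2[OF max0_sq_deriv l] by simp
  have m3: "((\<lambda>r::real. (max 0 (1 - r)) ^ 3) has_real_derivative - (3 * (max 0 (1 - r))\<^sup>2)) (at r)"
    using DERIV_chain2[OF max0_cube_deriv l] by simp
  have p1: "((\<lambda>r::real. r + 3 * r\<^sup>2) has_real_derivative 1 + 6 * r) (at r)" by (auto intro!: derivative_eq_intros)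
  have p2: "((\<lambda>r::real. 1 + 6 * r) has_real_derivative 6) (at r)" by (auto intro!: derivative_eq_intros)
  show "(\<phi>0 has_real_derivative \<phi>1 r) (at r)" unfolding \<phi>0_def[abs_def] \<phi>1_def
    by (rule DERIV_cong[OF DERIV_diff[OF DERIV_ident DERIV_mult[OF m3 p1]]]) (simp add: algebra_simps)
  show "(\<phi>1 has_real_derivative \<phi>2 r) (at r)" unfolding \<phi>1_def[abs_def] \<phi>2_def
    by (rule DERIV_cong[OF DERIV_diff[OF DERIV_add[OF DERIV_const DERIV_mult[OF DERIV_cmult[OF m2, of 3] p1]] DERIV_mult[OF m3 p2]]]) (simp add: algebra_simps)
qed

lemma \<phi>_cont: "continuous_on A \<phi>2" unfolding \<phi>2_def[abs_def] by (intro continuous_intros)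

lemma \<phi>_ge1: "r \<ge> 1 \<Longrightarrow> \<phi>0 r = r" "r \<ge> 1 \<Longrightarrow> \<phi>1 r = 1" "r \<ge> 1 \<Longrightarrow> \<phi>2 r = 0"
  by (simp_all add: \<phi>0_def \<phi>1_def \<phi>2_def)

text \<open>The factor \<open>1 + 3 * r\<close> starts the expansion of the inverse cube of
  \<open>1 - r\<close>, so subtracting \<open>(1 - r) ^ 3 * (r + 3 * r\<^sup>2)\<close> from
  \<open>r\<close> cancels all orders below \<open>r ^ 3\<close>. A zero of order 3 makes the
  product with a function of the angle twice continuously differentiable at the origin.\<close>

lemma \<phi>_le1:
  assumes "0 \<le> r" "r \<le> 1"
  shows "\<phi>0 r = r ^ 3 * (6 - 8 * r + 3 * r\<^sup>2)" "\<phi>1 r = r\<^sup>2 * (18 - 32 * r + 15 * r\<^sup>2)" "\<phi>2 r = r * (36 - 96 * r + 60 * r\<^sup>2)"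
proof -
  have m: "max 0 (1 - r) = 1 - r" using assms by simp
  show "\<phi>0 r = r ^ 3 * (6 - 8 * r + 3 * r\<^sup>2)" "\<phi>1 r = r\<^sup>2 * (18 - 32 * r + 15 * r\<^sup>2)" "\<phi>2 r = r * (36 - 96 * r + 60 * r\<^sup>2)"
    unfolding \<phi>0_def \<phi>1_def \<phi>2_def m by (simp_all add: power2_eq_square power3_eq_cube algebra_simps)
qed

lemma \<phi>_bounds:
  assumes "0 \<le> r" "r \<le> 1"
  shows "\<bar>\<phi>0 r\<bar> \<le> 200 * r ^ 3" "\<bar>\<phi>1 r\<bar> \<le> 200 * r\<^sup>2" "\<bar>\<phi>2 r\<bar> \<le> 200 * r"
proof -
  have p: "0 \<le> r\<^sup>2" "r\<^sup>2 \<le> 1" using assms by (auto intro: power_le_one)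
  have "\<bar>6 - 8 * r + 3 * r\<^sup>2\<bar> \<le> 200" "\<bar>18 - 32 * r + 15 * r\<^sup>2\<bar> \<le> 200" "\<bar>36 - 96 * r + 60 * r\<^sup>2\<bar> \<le> 200"
    by (rule abs_leI; use p assms in linarith)+
  then show "\<bar>\<phi>0 r\<bar> \<le> 200 * r ^ 3" "\<bar>\<phi>1 r\<bar> \<le> 200 * r\<^sup>2" "\<bar>\<phi>2 r\<bar> \<le> 200 * r"
    unfolding \<phi>_le1[OF assms] abs_mult using assms p by (auto intro!: mult_mono simp: mult.commute[of 200])
qed

section \<open>Weak derivatives and energy of classical maps\<close>

lemma has_derivative_zero_quadratic:
  fixes f :: "'a::real_normed_vector \<Rightarrow> 'b::real_normed_vector"
  assumes "f 0 = 0" "\<And>x. norm x \<le> 1 \<Longrightarrow> norm (f x) \<le> K * norm x ^ 2"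
  shows "(f has_derivative (\<lambda>_. 0)) (at 0)"
proof -
  have "((\<lambda>h. norm (f (0 + h) - f 0 - 0) / norm h) \<longlongrightarrow> 0) (at 0)"
  proof (rule Lim_null_comparison)
    show "\<forall>\<^sub>F h in at 0. norm (norm (f (0 + h) - f 0 - 0) / norm h) \<le> K * norm h"
      unfolding eventually_at using assms
      by (intro exI[of _ 1]) (auto simp: dist_norm field_simps power2_eq_square)
    show "((\<lambda>h. K * norm h) \<longlongrightarrow> 0) (at (0::'a))" by (rule tendsto_eq_intros refl | simp)+
  qed
  then show ?thesis unfolding has_derivative_at by simp
qed

text \<open>\<open>F\<close> is arbitrary outside \<open>U\<close>, but there the product vanishes
  on an open set; continuity is glued from the two open sets \<open>U\<close> and
  \<open>- K\<close>.\<close>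

lemma continuous_on_compact_support_mult:
  fixes F :: "real^2 \<Rightarrow> 'b::real_normed_vector"
  assumes q: "continuous_on UNIV q" and K: "compact K" "K \<subseteq> U" "open U" and z: "\<And>x. x \<notin> K \<Longrightarrow> q x = 0" and F: "continuous_on U F"
  shows "continuous_on UNIV (\<lambda>x. q x *\<^sub>R F x)"
proof -
  have "continuous_on U (\<lambda>x. q x *\<^sub>R F x)" by (intro continuous_intros F continuous_on_subset[OF q]) auto
  moreover have "continuous_on (- K) (\<lambda>x. q x *\<^sub>R F x)"
    by (rule continuous_on_eq[of _ "\<lambda>_. 0"]) (auto simp: z)
  ultimately have "continuous_on (U \<union> - K) (\<lambda>x. q x *\<^sub>R F x)"
    using K by (intro continuous_on_open_Un) (auto simp: compact_imp_closed open_Compl)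
  moreover have "U \<union> - K = UNIV" using K(2) by auto
  ultimately show ?thesis by simp
qed

lemma test_fun_pdiff_support:
  assumes "compact K" "\<And>x. x \<notin> K \<Longrightarrow> \<phi> x = 0" "x \<notin> K"
  shows "pdiff \<phi> i x = 0"
proof -
  have "(\<phi> has_derivative (\<lambda>_. 0)) (at x)"
    by (rule has_derivative_transform_within_open[of "\<lambda>_. 0" _ _ UNIV "- K"])
       (use assms in \<open>auto simp: compact_imp_closed open_Compl\<close>)
  then show ?thesis unfolding pdiff_def by (simp add: frechet_derivative_at[symmetric])
qed

lemma integrable_continuous_support:
  fixes H :: "real^2 \<Rightarrow> 'b::{banach,second_countable_topology}"
  assumes "continuous_on UNIV H" "compact K" "\<And>x. x \<notin> K \<Longrightarrow> H x = 0"
  shows "integrable lborel H"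
proof -
  have "integrable lborel (\<lambda>x. indicator K x *\<^sub>R H x)"
    by (rule borel_integrable_compact) (use assms in \<open>auto intro: continuous_on_subset\<close>)
  then show ?thesis by (rule back_subst[of "integrable lborel"]) (use assms(3) in \<open>auto simp: fun_eq_iff indicator_def\<close>)
qed

text \<open>The derivative of the product of \<open>\<phi>\<close> and \<open>F\<close> integrates
  to 0 along each line in direction \<open>i\<close>, since the product has compact support; Fubini
  does the rest. All integrands vanish outside the support, so values of \<open>F\<close> beyond its
  ball do no harm.\<close>

lemma weak_pdiff_classical:
  fixes F :: "real^2 \<Rightarrow> real^3"
  assumes r: "r > 1" and d: "\<And>x. x \<in> ball 0 r \<Longrightarrow> (F has_derivative (\<lambda>v. \<Sum>j\<in>UNIV. v $ j *\<^sub>R G x j)) (at x)"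
    and c: "continuous_on (ball 0 r) (\<lambda>x. G x i)"
  shows "weak_pdiff (ball 0 1) F i (\<lambda>x. G x i)"
  unfolding weak_pdiff_disc
proof (intro allI impI)
  fix \<phi> assume t: "test_fun (ball 0 1) \<phi>"
  then obtain K where K: "compact K" "K \<subseteq> ball 0 1" and z: "\<And>x. x \<notin> K \<Longrightarrow> \<phi> x = 0" unfolding test_fun_def by blast
  have diff: "\<phi> differentiable (at x)" and cp: "continuous_on UNIV (pdiff \<phi> i)" for x using t by (auto simp: test_fun_def)
  have sub: "ball 0 1 \<subseteq> ball (0::real^2) r" using r by auto
  have cF: "continuous_on (ball 0 1) F" by (rule has_derivative_continuous_on[OF has_derivative_at_withinI[OF d]]) (use sub in auto)
  have cG: "continuous_on (ball 0 1) (\<lambda>x. G x i)" by (rule continuous_on_subset[OF c sub])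
  have cphi: "continuous_on UNIV \<phi>" using diff by (simp add: differentiable_imp_continuous_within continuous_on_eq_continuous_within)
  have pz: "pdiff \<phi> i x = 0" if "x \<notin> K" for x by (rule test_fun_pdiff_support[of K \<phi>, OF K(1) z that])
  let ?H1 = "\<lambda>x. pdiff \<phi> i x *\<^sub>R F x" and ?H2 = "\<lambda>x. \<phi> x *\<^sub>R G x i"
  have c1: "continuous_on UNIV ?H1" by (rule continuous_on_compact_support_mult[OF cp K _ pz cF]) auto
  have c2: "continuous_on UNIV ?H2" by (rule continuous_on_compact_support_mult[OF cphi K _ z cG]) auto
  have i1: "integrable lborel ?H1" by (rule integrable_continuous_support[OF c1 K(1)]) (simp add: pz)
  have i2: "integrable lborel ?H2" by (rule integrable_continuous_support[OF c2 K(1)]) (simp add: z)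
  let ?H = "\<lambda>x. ?H1 x + ?H2 x"
  have iH: "integrable lborel ?H" using i1 i2 by simp
  have inner: "(\<integral>s. ?H (pt i s t) \<partial>lborel) = 0" for t
  proof -
    have cpt: "continuous_on UNIV (\<lambda>s. pt i s t)"
    proof -
      have "continuous_on UNIV (\<lambda>s. if k = i then s else t)" for k by (cases "k = i") (auto intro!: continuous_intros)
      then show ?thesis unfolding pt_def by (rule continuous_on_vec_lambda)
    qed
    have out: "pt i s t \<notin> K" if "\<bar>s\<bar> \<ge> 1" for s
    proof
      assume "pt i s t \<in> K"
      then have "norm (pt i s t) < 1" using K by auto
      moreover have "\<bar>pt i s t $ i\<bar> \<le> norm (pt i s t)" by (rule component_le_norm_cart)
      ultimately show False using that by (simp add: pt_nth)
    qed
    have "(\<integral>s. indicator {-1..1} s *\<^sub>R ?H (pt i s t) \<partial>lborel) = \<phi> (pt i 1 t) *\<^sub>R F (pt i 1 t) - \<phi> (pt i (-1) t) *\<^sub>R F (pt i (-1) t)"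
    proof (rule integral_FTC_Icc)
      fix s :: real
      have p: "((\<lambda>s. pt i s t) has_derivative (\<lambda>h. axis i h)) (at s)"
      proof -
        have "(\<lambda>s. pt i s t) = (\<lambda>s. axis i s + pt i 0 t)" by (auto simp: fun_eq_iff vec_eq_iff pt_nth axis_def)
        moreover have "((\<lambda>s. axis i s + pt i 0 t) has_derivative (\<lambda>h. axis i h + 0)) (at s)"
        proof (intro derivative_intros bounded_linear_imp_has_derivative)
          show "bounded_linear (axis i :: real \<Rightarrow> real^2)"
            unfolding linear_conv_bounded_linear[symmetric] by (rule linearI) (auto simp: vec_eq_iff axis_def)
        qed
        ultimately show ?thesis by simp
      qed
      show "((\<lambda>s. \<phi> (pt i s t) *\<^sub>R F (pt i s t)) has_vector_derivative ?H (pt i s t)) (at s within {-1..1})"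
      proof (cases "pt i s t \<in> K")
        case True
        then have b: "pt i s t \<in> ball 0 r" using K(2) sub by blast
        have fd: "(\<phi> has_derivative (frechet_derivative \<phi> (at (pt i s t)))) (at (pt i s t))" using diff frechet_derivative_works by blast
        have lin: "linear (frechet_derivative \<phi> (at (pt i s t)))" using diff by (rule linear_frechet_derivative)
        have ax: "axis i h = h *\<^sub>R axis i (1::real)" for h by (simp add: vec_eq_iff axis_def)
        have "((\<lambda>s. \<phi> (pt i s t)) has_derivative (\<lambda>h. h * pdiff \<phi> i (pt i s t))) (at s)"
          using has_derivative_compose[OF p fd] by (subst (asm) ax) (simp add: linear_cmul[OF lin] pdiff_def)
        moreover have "((\<lambda>s. F (pt i s t)) has_derivative (\<lambda>h. h *\<^sub>R G (pt i s t) i)) (at s)"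
          using has_derivative_compose[OF p d[OF b]] by (simp add: sum_scaleR_axis)
        ultimately have "((\<lambda>s. \<phi> (pt i s t) *\<^sub>R F (pt i s t)) has_derivative (\<lambda>h. \<phi> (pt i s t) *\<^sub>R (h *\<^sub>R G (pt i s t) i) + (h * pdiff \<phi> i (pt i s t)) *\<^sub>R F (pt i s t))) (at s)"
          by (rule has_derivative_scaleR)
        then have "((\<lambda>s. \<phi> (pt i s t) *\<^sub>R F (pt i s t)) has_vector_derivative ?H (pt i s t)) (at s)"
          unfolding has_vector_derivative_def by (rule has_derivative_eq_rhs) (auto simp: algebra_simps)
        then show ?thesis by (rule has_vector_derivative_at_within)
      next
        case False
        \<comment> \<open>Off the support the product vanishes on a whole neighbourhood, so its
          derivative is 0 whatever \<open>F\<close> does there.\<close>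
        have o: "open ((\<lambda>s. pt i s t) -` (- K))" using K(1) cpt by (intro continuous_open_vimage[OF _ _]) (auto simp: continuous_on_eq_continuous_at compact_imp_closed open_Compl)
        have "((\<lambda>s. \<phi> (pt i s t) *\<^sub>R F (pt i s t)) has_derivative (\<lambda>h. 0)) (at s)"
          by (rule has_derivative_transform_within_open[OF has_derivative_const o]) (use False z in auto)
        moreover have "?H (pt i s t) = 0" using False z pz by simp
        ultimately have "((\<lambda>s. \<phi> (pt i s t) *\<^sub>R F (pt i s t)) has_vector_derivative ?H (pt i s t)) (at s)" by (simp add: has_vector_derivative_def)
        then show ?thesis by (rule has_vector_derivative_at_within)
      qed
    next
      show "continuous_on {-1..1} (\<lambda>s. ?H (pt i s t))"
        using continuous_on_compose2[OF continuous_on_add[OF c1 c2] cpt] by (rule continuous_on_subset) auto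
    qed simp
    also have "\<dots> = 0" using z[OF out, of 1] z[OF out, of "-1"] by simp
    also have "(\<lambda>s. indicator {-1..1} s *\<^sub>R ?H (pt i s t)) = (\<lambda>s. ?H (pt i s t))"
    proof
      fix s
      show "indicator {-1..1} s *\<^sub>R ?H (pt i s t) = ?H (pt i s t)"
        using z[OF out[of s]] pz[OF out[of s]] by (cases "s \<in> {-1..1}") auto
    qed
    finally show ?thesis .
  qed
  have iP: "integrable (lborel \<Otimes>\<^sub>M lborel) (\<lambda>p. ?H (pt i (fst p) (snd p)))"
    using iH by (subst (asm) lborel_pt[of i], subst (asm) integrable_distr_eq) (auto simp: lborel_prod)
  have "(\<integral>x. ?H x \<partial>lborel) = (\<integral>p. ?H (pt i (fst p) (snd p)) \<partial>(lborel \<Otimes>\<^sub>M lborel))"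
    using borel_measurable_integrable[OF iH] by (subst lborel_pt[of i], subst integral_distr) (auto simp: lborel_prod)
  also have "\<dots> = (\<integral>t. (\<integral>s. ?H (pt i s t) \<partial>lborel) \<partial>lborel)"
    using lborel_pair.integral_snd[of "\<lambda>s t. ?H (pt i s t)"] iP by (simp add: case_prod_beta')
  also have "\<dots> = 0" unfolding inner by simp
  finally have "(\<integral>x. ?H1 x \<partial>lborel) = - (\<integral>x. ?H2 x \<partial>lborel)" using i1 i2 by (simp add: add_eq_0_iff)
  moreover have "(\<integral>x. ?H1 x \<partial>disc) = (\<integral>x. ?H1 x \<partial>lborel)" "(\<integral>x. ?H2 x \<partial>disc) = (\<integral>x. ?H2 x \<partial>lborel)"
    using borel_measurable_continuous_onI[OF c1] borel_measurable_continuous_onI[OF c2] K(2)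
    by (auto intro!: integral_disc_lborel simp: z pz subset_eq)
  ultimately show "(\<integral>x. pdiff \<phi> i x *\<^sub>R F x \<partial>disc) = - (\<integral>x. \<phi> x *\<^sub>R G x i \<partial>disc)" by simp
qed

text \<open>\<open>polar_integral\<close> with inner radius 0; the missing origin is a null
  set.\<close>

lemma disc_polar:
  fixes F :: "real^2 \<Rightarrow> real"
  assumes c: "continuous_on (cball 0 1) F"
  shows "integrable disc F" "integral\<^sup>L disc F = DI 0 1 (\<lambda>r t. r * F (r *\<^sub>R circ t))"
proof -
  have c': "continuous_on {x. 0 \<le> norm x \<and> norm x \<le> 1} F" using c by (simp add: cball_def)
  define f where "f = (\<lambda>x. indicator (annulus 0 1) x *\<^sub>R F x)"
  have fm: "f \<in> borel_measurable borel" "integrable lborel f" using polar_integral(1)[OF order_refl c'] by (auto simp: f_def)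
  have f0: "f x = 0" if "x \<notin> ball 0 1" for x using that by (auto simp: f_def annulus_def indicator_def)
  have ae: "AE x in disc. f x = F x"
  proof -
    have "AE x in lborel. x \<noteq> (0::real^2)" by (rule AE_lborel_singleton)
    then have "AE x in lebesgue. x \<noteq> (0::real^2)" by (rule AE_completion)
    then show ?thesis unfolding AE_disc_iff by eventually_elim (auto simp: f_def annulus_def)
  qed
  have Fm: "F \<in> borel_measurable disc"
    by (rule continuous_imp_measurable_on_sets_lebesgue) (auto intro: continuous_on_subset[OF c])
  have fmd: "f \<in> borel_measurable disc" using fm(1) by (intro measurable_restrict_space1 measurable_completion) simp
  show "integrable disc F"
    using integral_disc_lborel(2)[OF fm(1) f0] fm(2) integrable_cong_AE[OF fmd Fm ae] by simp
  have "integral\<^sup>L disc F = integral\<^sup>L disc f" by (rule integral_cong_AE[OF Fm fmd]) (use ae in \<open>auto elim: AE_mp\<close>)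
  also have "\<dots> = integral\<^sup>L lborel f" by (rule integral_disc_lborel(1)[OF fm(1) f0])
  also have "\<dots> = DI 0 1 (\<lambda>r t. r * F (r *\<^sub>R circ t))"
    unfolding f_def DI_def by (rule polar_integral(2)[OF order_refl c'])
  finally show "integral\<^sup>L disc F = DI 0 1 (\<lambda>r t. r * F (r *\<^sub>R circ t))" .
qed

lemma C2on_W22:
  assumes C: "C2on r Y D D2" and r: "r > 1"
  shows "W22 (ball 0 1) Y D D2"
proof -
  have sub: "cball 0 1 \<subseteq> ball (0::real^2) r" using r by auto
  note c = C2on_continuous[OF C, THEN continuous_on_subset, OF sub]
  have L2: "L2_on (ball 0 1) F" if "continuous_on (cball 0 1) F" for F :: "real^2 \<Rightarrow> real^3"
    unfolding L2_on_disc
    by (intro conjI disc_polar(1) continuous_intros that continuous_imp_measurable_on_sets_lebesgue continuous_on_subset[OF that]) auto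
  have d1: "(Y has_derivative (\<lambda>v. \<Sum>j\<in>UNIV. v $ j *\<^sub>R D x j)) (at x)" if "x \<in> ball 0 r" for x
    using C that by (auto simp: C2on_def)
  have d2: "((\<lambda>x. D x i) has_derivative (\<lambda>v. \<Sum>j\<in>UNIV. v $ j *\<^sub>R D2 x i j)) (at x)" if "x \<in> ball 0 r" for x i
    using C that by (auto simp: C2on_def)
  show ?thesis unfolding W22_def
    by (intro conjI allI L2 c weak_pdiff_classical[OF r d1] weak_pdiff_classical[OF r d2] C2on_continuous[OF C])
qed

lemma energy_disc: "energy h Dy D2y = (\<integral>x. memb (Dy x) + h\<^sup>2 * bend (D2y x) \<partial>disc)"
  unfolding energy_def LINT_disc memb_def bend_def ..

lemma C2on_energy:
  assumes C: "C2on r Y D D2" and r: "r > 1"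
  shows "integrable disc (\<lambda>x. memb (D x))" "integrable disc (\<lambda>x. bend (D2 x))"
    "energy h D D2 = DI 0 1 (\<lambda>r t. r * memb (D (r *\<^sub>R circ t))) + h\<^sup>2 * DI 0 1 (\<lambda>r t. r * bend (D2 (r *\<^sub>R circ t)))"
proof -
  have sub: "cball 0 1 \<subseteq> ball (0::real^2) r" using r by auto
  note c = C2on_continuous[OF C, THEN continuous_on_subset, OF sub]
  have m: "continuous_on (cball 0 1) (\<lambda>x. memb (D x))" unfolding memb_def by (intro continuous_intros c)
  have b: "continuous_on (cball 0 1) (\<lambda>x. bend (D2 x))" unfolding bend_def by (intro continuous_intros c)
  show i: "integrable disc (\<lambda>x. memb (D x))" "integrable disc (\<lambda>x. bend (D2 x))" by (rule disc_polar(1)[OF m], rule disc_polar(1)[OF b])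
  show "energy h D D2 = DI 0 1 (\<lambda>r t. r * memb (D (r *\<^sub>R circ t))) + h\<^sup>2 * DI 0 1 (\<lambda>r t. r * bend (D2 (r *\<^sub>R circ t)))"
    unfolding energy_disc using i by (simp add: disc_polar(2)[OF m] disc_polar(2)[OF b])
qed

text \<open>This rescaling keeps first derivatives and multiplies second derivatives by
  \<open>1 / h\<close>. It shrinks a smoothed vertex of size 1 to size \<open>h\<close> and leaves a
  1-homogeneous map unchanged.\<close>

lemma C2on_scale:
  assumes h: "h > 0" and C: "C2on (r / h) Y D D2"
  shows "C2on r (\<lambda>x. h *\<^sub>R Y ((1/h) *\<^sub>R x)) (\<lambda>x. D ((1/h) *\<^sub>R x)) (\<lambda>x i j. (1/h) *\<^sub>R D2 ((1/h) *\<^sub>R x) i j)"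
proof -
  have inb: "(1/h) *\<^sub>R x \<in> ball 0 (r / h)" if "x \<in> ball 0 r" for x :: "real^2" using that h by (simp add: divide_strict_right_mono)
  have s: "((\<lambda>x::real^2. (1/h) *\<^sub>R x) has_derivative (\<lambda>v. (1/h) *\<^sub>R v)) (at x)" for x by (auto intro!: derivative_eq_intros)
  show ?thesis unfolding C2on_def
  proof (intro conjI ballI allI)
    fix x :: "real^2" assume x: "x \<in> ball 0 r"
    have "(Y has_derivative (\<lambda>v. \<Sum>j\<in>UNIV. v $ j *\<^sub>R D ((1/h) *\<^sub>R x) j)) (at ((1/h) *\<^sub>R x))" using C inb[OF x] by (auto simp: C2on_def)
    from has_derivative_scaleR_right[OF has_derivative_compose[OF s this], of h]
    show "((\<lambda>x. h *\<^sub>R Y ((1/h) *\<^sub>R x)) has_derivative (\<lambda>v. \<Sum>j\<in>UNIV. v $ j *\<^sub>R D ((1/h) *\<^sub>R x) j)) (at x)"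
      using h by (simp add: scaleR_sum_right)
  next
    fix i and x :: "real^2" assume x: "x \<in> ball 0 r"
    have "((\<lambda>x. D x i) has_derivative (\<lambda>v. \<Sum>j\<in>UNIV. v $ j *\<^sub>R D2 ((1/h) *\<^sub>R x) i j)) (at ((1/h) *\<^sub>R x))" using C inb[OF x] by (auto simp: C2on_def)
    from has_derivative_compose[OF s this]
    show "((\<lambda>x. D ((1/h) *\<^sub>R x) i) has_derivative (\<lambda>v. \<Sum>j\<in>UNIV. v $ j *\<^sub>R ((1/h) *\<^sub>R D2 ((1/h) *\<^sub>R x) i j))) (at x)"
      by (simp add: mult.commute)
  next
    fix i j
    show "continuous_on (ball 0 r) (\<lambda>x. (1/h) *\<^sub>R D2 ((1/h) *\<^sub>R x) i j)"
      by (intro continuous_intros continuous_on_compose2[OF C2on_continuous(3)[OF C]]) (use inb in auto)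
  qed
qed

context unit_curve
begin

text \<open>The partial derivatives of \<open>\<phi> (norm x) *\<^sub>R ang g x\<close>. At the origin the convention \<open>x / 0 = 0\<close> gives the value \<open>0\<close> when
  \<open>\<phi>\<close>, \<open>\<phi>'\<close>, \<open>\<phi>''\<close> vanish there, which is the case for the profile above.\<close>

definition D1 :: "(real \<Rightarrow> real) \<Rightarrow> (real \<Rightarrow> real) \<Rightarrow> real^2 \<Rightarrow> 2 \<Rightarrow> real^3" where
  "D1 \<phi> \<phi>' x i = \<phi>' (norm x) *\<^sub>R ang (\<lambda>t. circ t $ i *\<^sub>R g t) x + (\<phi> (norm x) / norm x) *\<^sub>R ang (\<lambda>t. circ' t $ i *\<^sub>R g1 t) x"

definition DD :: "(real \<Rightarrow> real) \<Rightarrow> (real \<Rightarrow> real) \<Rightarrow> (real \<Rightarrow> real) \<Rightarrow> real^2 \<Rightarrow> 2 \<Rightarrow> 2 \<Rightarrow> real^3" where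
  "DD \<phi> \<phi>' \<phi>'' x i j =
     \<phi>'' (norm x) *\<^sub>R ang (\<lambda>t. circ t $ j *\<^sub>R (circ t $ i *\<^sub>R g t)) x
   + (\<phi>' (norm x) / norm x) *\<^sub>R ang (\<lambda>t. circ' t $ j *\<^sub>R (circ' t $ i *\<^sub>R g t + circ t $ i *\<^sub>R g1 t)) x
   + (\<phi>' (norm x) / norm x - \<phi> (norm x) / (norm x)\<^sup>2) *\<^sub>R ang (\<lambda>t. circ t $ j *\<^sub>R (circ' t $ i *\<^sub>R g1 t)) x
   + (\<phi> (norm x) / norm x / norm x) *\<^sub>R ang (\<lambda>t. circ' t $ j *\<^sub>R (- circ t $ i *\<^sub>R g1 t + circ' t $ i *\<^sub>R g2 t)) x"

lemma circ_per [simp]: "circ (t + 2 * pi) = circ t" "circ' (t + 2 * pi) = circ' t"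
  by (simp_all add: circ_def circ'_def)

lemma circ_nth_deriv:
  "((\<lambda>t. circ t $ i) has_real_derivative circ' t $ i) (at t)" "((\<lambda>t. circ' t $ i) has_real_derivative - circ t $ i) (at t)"
  using bounded_linear.has_vector_derivative[OF bounded_linear_vec_nth circ_has_derivative(1)[of t UNIV], of i]
    bounded_linear.has_vector_derivative[OF bounded_linear_vec_nth circ_has_derivative(2)[of t UNIV], of i]
  by (simp_all add: has_real_derivative_iff_has_vector_derivative)

lemma D1_deriv:
  assumes x: "x \<noteq> 0" and f: "(\<phi> has_real_derivative \<phi>' (norm x)) (at (norm x))"
  shows "((\<lambda>x. \<phi> (norm x) *\<^sub>R ang g x) has_derivative (\<lambda>v. \<Sum>j\<in>UNIV. v $ j *\<^sub>R D1 \<phi> \<phi>' x j)) (at x)"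
proof -
  obtain t where t: "x = norm x *\<^sub>R circ t" by (rule polar_decomp)
  have r: "norm x > 0" using x by simp
  define r where "r = norm x"
  have a: "ang (\<lambda>t. circ t $ i *\<^sub>R g t) (r *\<^sub>R circ t) = circ t $ i *\<^sub>R g t"
    "ang (\<lambda>t. circ' t $ i *\<^sub>R g1 t) (r *\<^sub>R circ t) = circ' t $ i *\<^sub>R g1 t" for i
    using r by (auto intro!: ang_circ simp: r_def gper per)
  have xe: "x = r *\<^sub>R circ t" using t by (simp add: r_def)
  have nr: "norm (r *\<^sub>R circ t) = r" using r by (simp add: r_def)
  have rp: "r > 0" using r by (simp add: r_def)
  show ?thesis unfolding xe D1_def a nr
    by (rule radial_ang_has_derivative[OF gper gd(1) rp]) (use f in \<open>simp add: r_def\<close>)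
qed

lemma DD_deriv:
  assumes x: "x \<noteq> 0" and f: "(\<phi> has_real_derivative \<phi>' (norm x)) (at (norm x))" "(\<phi>' has_real_derivative \<phi>'' (norm x)) (at (norm x))"
  shows "((\<lambda>x. D1 \<phi> \<phi>' x i) has_derivative (\<lambda>v. \<Sum>j\<in>UNIV. v $ j *\<^sub>R DD \<phi> \<phi>' \<phi>'' x i j)) (at x)"
proof -
  obtain t where t: "x = norm x *\<^sub>R circ t" by (rule polar_decomp)
  define r where "r = norm x"
  have rp: "r > 0" using x by (simp add: r_def)
  have xe: "x = r *\<^sub>R circ t" using t by (simp add: r_def)
  have nr: "norm (r *\<^sub>R circ t) = r" using rp by simp
  let ?G1 = "\<lambda>t. circ t $ i *\<^sub>R g t" and ?G2 = "\<lambda>t. circ' t $ i *\<^sub>R g1 t"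
  have p: "?G1 (t + 2 * pi) = ?G1 t" "?G2 (t + 2 * pi) = ?G2 t" for t by (simp_all add: gper per)
  have d1: "(?G1 has_vector_derivative (circ' t $ i *\<^sub>R g t + circ t $ i *\<^sub>R g1 t)) (at t)"
    using has_vector_derivative_scaleR[OF circ_nth_deriv(1) gd(1)] by (simp add: add.commute)
  have d2: "(?G2 has_vector_derivative (- circ t $ i *\<^sub>R g1 t + circ' t $ i *\<^sub>R g2 t)) (at t)"
    using has_vector_derivative_scaleR[OF circ_nth_deriv(2) gd(2)] by (simp add: add.commute)
  have f1: "(\<phi>' has_real_derivative \<phi>'' r) (at r)" using f by (simp add: r_def)
  have f2: "((\<lambda>r. \<phi> r / r) has_real_derivative (\<phi>' r / r - \<phi> r / r\<^sup>2)) (at r)"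
    using f(1) rp by (auto intro!: derivative_eq_intros simp: r_def[symmetric] field_simps power2_eq_square)
  have a: "ang (\<lambda>t. circ t $ j *\<^sub>R (circ t $ i *\<^sub>R g t)) (r *\<^sub>R circ t) = circ t $ j *\<^sub>R (circ t $ i *\<^sub>R g t)"
    "ang (\<lambda>t. circ' t $ j *\<^sub>R (circ' t $ i *\<^sub>R g t + circ t $ i *\<^sub>R g1 t)) (r *\<^sub>R circ t) = circ' t $ j *\<^sub>R (circ' t $ i *\<^sub>R g t + circ t $ i *\<^sub>R g1 t)"
    "ang (\<lambda>t. circ t $ j *\<^sub>R (circ' t $ i *\<^sub>R g1 t)) (r *\<^sub>R circ t) = circ t $ j *\<^sub>R (circ' t $ i *\<^sub>R g1 t)"
    "ang (\<lambda>t. circ' t $ j *\<^sub>R (- circ t $ i *\<^sub>R g1 t + circ' t $ i *\<^sub>R g2 t)) (r *\<^sub>R circ t) = circ' t $ j *\<^sub>R (- circ t $ i *\<^sub>R g1 t + circ' t $ i *\<^sub>R g2 t)" for j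
    by (rule ang_circ, simp add: gper per, rule rp)+
  have "((\<lambda>x. D1 \<phi> \<phi>' x i) has_derivative (\<lambda>v. (\<Sum>j\<in>UNIV. v $ j *\<^sub>R (\<phi>'' r *\<^sub>R (circ t $ j *\<^sub>R ?G1 t) + (\<phi>' r / r) *\<^sub>R (circ' t $ j *\<^sub>R (circ' t $ i *\<^sub>R g t + circ t $ i *\<^sub>R g1 t))))
     + (\<Sum>j\<in>UNIV. v $ j *\<^sub>R ((\<phi>' r / r - \<phi> r / r\<^sup>2) *\<^sub>R (circ t $ j *\<^sub>R ?G2 t) + (\<phi> r / r / r) *\<^sub>R (circ' t $ j *\<^sub>R (- circ t $ i *\<^sub>R g1 t + circ' t $ i *\<^sub>R g2 t)))))) (at (r *\<^sub>R circ t))"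
    unfolding D1_def
    by (rule has_derivative_add[OF radial_ang_has_derivative[OF p(1) d1 rp f1] radial_ang_has_derivative[OF p(2) d2 rp f2]])
  then show ?thesis unfolding xe
    by (rule has_derivative_eq_rhs) (simp only: DD_def a nr fun_eq_iff sum.distrib[symmetric] scaleR_add_right[symmetric] add.assoc simp_thms)
qed

section \<open>The smoothed cone at unit scale and its energy after rescaling\<close>

definition Yc where "Yc x = \<phi>0 (norm x) *\<^sub>R ang g x"
abbreviation "Dc \<equiv> D1 \<phi>0 \<phi>1"
abbreviation "D2c \<equiv> DD \<phi>0 \<phi>1 \<phi>2"

lemma g2_bounded: obtains N where "N \<ge> 0" "\<And>t. norm (g2 t) \<le> N"
proof -
  have "compact (g2 ` {0..2*pi})" by (rule compact_continuous_image, intro continuous_intros, simp)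
  then obtain N where N: "\<And>x. x \<in> g2 ` {0..2*pi} \<Longrightarrow> norm x \<le> N" using compact_imp_bounded bounded_iff by metis
  have "norm (g2 t) \<le> max 0 N" for t
  proof -
    obtain s where s: "0 \<le> s" "s < 2 * pi" "circ t = circ s" using unit_is_circ[of "circ t"] by auto
    have "g2 t = g2 s" by (rule circ_eq_imp[of g2, OF per(2) s(3)])
    then show ?thesis using N[of "g2 s"] s by simp
  qed
  then show ?thesis using that[of "max 0 N"] by simp
qed

lemma abs_circ: "\<bar>circ t $ i\<bar> \<le> 1" "\<bar>circ' t $ i\<bar> \<le> 1"
  using component_le_norm_cart[of "circ t" i] component_le_norm_cart[of "circ' t" i] by simp_all

text \<open>The polar formulas say nothing about differentiability at the origin. Quadratic decay
  gives it, with derivative 0, for the map and for its gradient.\<close>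

lemma Dc_bound:
  assumes "norm x \<le> 1"
  shows "norm (Yc x) \<le> 200 * norm x ^ 2" "norm (Dc x i) \<le> 400 * norm x ^ 2"
proof -
  let ?r = "norm x"
  have r: "0 \<le> ?r" "?r \<le> 1" using assms by auto
  have "norm (Yc x) \<le> 200 * ?r ^ 3" using \<phi>_bounds(1)[OF r] by (simp add: Yc_def ang_def gu)
  also have "\<dots> \<le> 200 * ?r ^ 2" using r by (intro mult_left_mono power_decreasing) auto
  finally show "norm (Yc x) \<le> 200 * norm x ^ 2" .
  have s: "norm (a *\<^sub>R (c *\<^sub>R X)) \<le> \<bar>a\<bar>" if "\<bar>c\<bar> \<le> 1" "norm X = 1" for a c and X :: "real^3"
    using that by (simp add: abs_mult mult_left_le)
  have "norm (Dc x i) \<le> \<bar>\<phi>1 ?r\<bar> + \<bar>\<phi>0 ?r / ?r\<bar>"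
    unfolding D1_def ang_def
    by (intro order_trans[OF norm_triangle_ineq] add_mono s abs_circ gu)
  also have "\<bar>\<phi>0 ?r / ?r\<bar> \<le> 200 * ?r ^ 2"
  proof (cases "?r = 0")
    case False
    then have "\<bar>\<phi>0 ?r / ?r\<bar> \<le> 200 * ?r ^ 3 / ?r" using \<phi>_bounds(1)[OF r] r by (auto simp: abs_divide intro!: divide_right_mono)
    then show ?thesis using False by (simp add: power2_eq_square power3_eq_cube)
  qed simp
  finally show "norm (Dc x i) \<le> 400 * norm x ^ 2" using \<phi>_bounds(2)[OF r] by simp
qed

text \<open>Each of the four terms in \<open>DD\<close> carries a radial coefficient of order
  \<open>r\<close>, which makes the second derivatives continuous at the origin.\<close>

lemma D2c_bound: obtains K where "\<And>x i j. norm x \<le> 1 \<Longrightarrow> norm (D2c x i j) \<le> K * norm x"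
proof -
  obtain N where N: "N \<ge> 0" "\<And>t. norm (g2 t) \<le> N" by (rule g2_bounded) blast
  have "norm (D2c x i j) \<le> (200 + 400 + 400 + 200 * (1 + N)) * norm x" if "norm x \<le> 1" for x i j
  proof -
    let ?r = "norm x"
    have r: "0 \<le> ?r" "?r \<le> 1" using that by auto
    have q: "\<bar>\<phi>1 ?r / ?r\<bar> \<le> 200 * ?r" "\<bar>\<phi>0 ?r / ?r\<^sup>2\<bar> \<le> 200 * ?r" "\<bar>\<phi>0 ?r / ?r / ?r\<bar> \<le> 200 * ?r"
    proof -
      show 1: "\<bar>\<phi>1 ?r / ?r\<bar> \<le> 200 * ?r"
      proof (cases "?r = 0")
        case False
        then have "\<bar>\<phi>1 ?r / ?r\<bar> \<le> 200 * ?r ^ 2 / ?r" using \<phi>_bounds(2)[OF r] r by (auto simp: abs_divide intro!: divide_right_mono)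
        then show ?thesis using False by (simp add: power2_eq_square)
      qed simp
      show 2: "\<bar>\<phi>0 ?r / ?r\<^sup>2\<bar> \<le> 200 * ?r"
      proof (cases "?r = 0")
        case False
        then have "\<bar>\<phi>0 ?r / ?r\<^sup>2\<bar> \<le> 200 * ?r ^ 3 / ?r\<^sup>2" using \<phi>_bounds(1)[OF r] r by (auto simp: abs_divide intro!: divide_right_mono)
        then show ?thesis using False by (simp add: power2_eq_square power3_eq_cube)
      qed simp
      then show "\<bar>\<phi>0 ?r / ?r / ?r\<bar> \<le> 200 * ?r" by (simp add: power2_eq_square)
    qed
    have u: "norm (circ t $ j *\<^sub>R (circ t $ i *\<^sub>R g t)) \<le> 1" "norm (circ' t $ j *\<^sub>R (circ' t $ i *\<^sub>R g t + circ t $ i *\<^sub>R g1 t)) \<le> 2"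
      "norm (circ t $ j *\<^sub>R (circ' t $ i *\<^sub>R g1 t)) \<le> 1" "norm (circ' t $ j *\<^sub>R (- circ t $ i *\<^sub>R g1 t + circ' t $ i *\<^sub>R g2 t)) \<le> 1 + N" for t
    proof -
      have m: "norm (c *\<^sub>R X) \<le> B" if "\<bar>c\<bar> \<le> 1" "norm X \<le> B" for c B and X :: "real^3"
      proof -
        have "\<bar>c\<bar> * norm X \<le> 1 * B" using that by (intro mult_mono) auto
        then show ?thesis by simp
      qed
      have g: "norm (g t) \<le> 1" "norm (g1 t) \<le> 1" using gu[of t] by auto
      have mc: "\<bar>- circ t $ i\<bar> \<le> 1" using abs_circ by simp
      show "norm (circ t $ j *\<^sub>R (circ t $ i *\<^sub>R g t)) \<le> 1" by (intro m abs_circ g)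
      show "norm (circ t $ j *\<^sub>R (circ' t $ i *\<^sub>R g1 t)) \<le> 1" by (intro m abs_circ g)
      have "norm (circ' t $ i *\<^sub>R g t + circ t $ i *\<^sub>R g1 t) \<le> 1 + 1" by (intro order_trans[OF norm_triangle_ineq] add_mono m abs_circ g)
      then show "norm (circ' t $ j *\<^sub>R (circ' t $ i *\<^sub>R g t + circ t $ i *\<^sub>R g1 t)) \<le> 2" by (intro m abs_circ) simp
      show "norm (circ' t $ j *\<^sub>R (- circ t $ i *\<^sub>R g1 t + circ' t $ i *\<^sub>R g2 t)) \<le> 1 + N"
        by (rule m[OF abs_circ(2)], rule order_trans[OF norm_triangle_ineq], rule add_mono, rule m[OF mc g(2)], rule m[OF abs_circ(2) N(2)])
    qed
    have s: "norm (c *\<^sub>R X) \<le> C * B" if "\<bar>c\<bar> \<le> C" "norm X \<le> B" for c B C and X :: "real^3"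
      using mult_mono[OF that] that by (auto intro: order_trans[OF abs_ge_zero])
    have "\<bar>\<phi>1 ?r / ?r - \<phi>0 ?r / ?r\<^sup>2\<bar> \<le> 400 * ?r" using q(1,2) by linarith
    then have "norm (D2c x i j) \<le> (200 * ?r) * 1 + (200 * ?r) * 2 + (400 * ?r) * 1 + (200 * ?r) * (1 + N)"
      unfolding DD_def ang_def
      by (intro order_trans[OF norm_triangle_ineq] add_mono s u \<phi>_bounds(3)[OF r] q)
    then show ?thesis by (simp add: algebra_simps)
  qed
  then show ?thesis by (rule that)
qed

lemma zero_vals: "Yc 0 = 0" "Dc 0 i = 0" "D2c 0 i j = 0"
  using \<phi>_le1[of 0] by (simp_all add: Yc_def D1_def DD_def)

lemma ang_cont: "\<lbrakk>\<And>t. G (t + 2 * pi) = G t; continuous_on UNIV G; x \<noteq> 0\<rbrakk> \<Longrightarrow> isCont (ang G) x" for G :: "real \<Rightarrow> real^3"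
  using ang_continuous[of G] continuous_on_eq_continuous_at[OF open_Compl[OF closed_singleton], of 0 "ang G"] by blast

lemma C2on_Yc: "C2on r Yc Dc D2c"
  unfolding C2on_def
proof (intro conjI ballI allI)
  fix x :: "real^2"
  show "(Yc has_derivative (\<lambda>v. \<Sum>i\<in>UNIV. v $ i *\<^sub>R Dc x i)) (at x)"
  proof (cases "x = 0")
    case True
    show ?thesis unfolding True zero_vals using has_derivative_zero_quadratic[of Yc 200] Dc_bound(1) by (simp add: zero_vals)
  next
    case False
    then show ?thesis unfolding Yc_def[abs_def] by (rule D1_deriv) (rule \<phi>_deriv)
  qed
next
  fix i and x :: "real^2"
  show "((\<lambda>x. Dc x i) has_derivative (\<lambda>v. \<Sum>j\<in>UNIV. v $ j *\<^sub>R D2c x i j)) (at x)"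
  proof (cases "x = 0")
    case True
    show ?thesis unfolding True zero_vals using has_derivative_zero_quadratic[of "\<lambda>x. Dc x i" 400] Dc_bound(2) by (simp add: zero_vals)
  next
    case False
    then show ?thesis by (rule DD_deriv) (rule \<phi>_deriv)+
  qed
next
  fix i j
  have cc: "continuous_on UNIV (\<lambda>t. circ t $ i)" "continuous_on UNIV (\<lambda>t. circ' t $ i)" for i by (intro continuous_intros)+
  have "isCont (\<lambda>x. D2c x i j) x" for x
  proof (cases "x = 0")
    case True
    obtain K where K: "\<And>x. norm x \<le> 1 \<Longrightarrow> norm (D2c x i j) \<le> K * norm x" by (rule D2c_bound) blast
    have "((\<lambda>x. D2c x i j) \<longlongrightarrow> 0) (at 0)"
    proof (rule Lim_null_comparison)
      show "\<forall>\<^sub>F x in at 0. norm (D2c x i j) \<le> K * norm x" unfolding eventually_at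
        using K by (intro exI[of _ 1]) (auto simp: dist_norm)
      show "((\<lambda>x. K * norm x) \<longlongrightarrow> 0) (at (0::real^2))" by (rule tendsto_eq_intros refl | simp)+
    qed
    then show ?thesis unfolding True isCont_def zero_vals .
  next
    case False
    have ph: "isCont \<phi>0 (norm x)" "isCont \<phi>1 (norm x)" "isCont \<phi>2 (norm x)"
      using DERIV_isCont[OF \<phi>_deriv(1)] DERIV_isCont[OF \<phi>_deriv(2)] \<phi>_cont[of UNIV] by (auto simp: continuous_on_eq_continuous_at)
    have ph': "isCont (\<lambda>x. \<phi>0 (norm x)) x" "isCont (\<lambda>x. \<phi>1 (norm x)) x" "isCont (\<lambda>x. \<phi>2 (norm x)) x"
      using isCont_o2[of x norm, OF _ ph(1)] isCont_o2[of x norm, OF _ ph(2)] isCont_o2[of x norm, OF _ ph(3)] by (auto intro!: continuous_intros)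
    have an: "isCont (ang (\<lambda>t. circ t $ j *\<^sub>R (circ t $ i *\<^sub>R g t))) x" "isCont (ang (\<lambda>t. circ' t $ j *\<^sub>R (circ' t $ i *\<^sub>R g t + circ t $ i *\<^sub>R g1 t))) x"
      "isCont (ang (\<lambda>t. circ t $ j *\<^sub>R (circ' t $ i *\<^sub>R g1 t))) x" "isCont (ang (\<lambda>t. circ' t $ j *\<^sub>R (- circ t $ i *\<^sub>R g1 t + circ' t $ i *\<^sub>R g2 t))) x"
      by (rule ang_cont[OF _ _ False], simp add: gper per, intro continuous_intros cc)+
    show ?thesis unfolding DD_def using False by (intro continuous_intros ph' an) auto
  qed
  then show "continuous_on (ball 0 r) (\<lambda>x. D2c x i j)" by (simp add: continuous_at_imp_continuous_on)
qed

lemma kap_periodic: "kap (t + 2 * pi) = kap t" by (simp add: kap_def gper per)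

text \<open>Where the profile is the identity to second order, the radial and mixed second
  derivatives cancel and the angular terms combine to \<open>kap\<close>. Asking only for values of
  the profile at one radius lets this cover both the smoothed profile from radius 1 on and the exact
  cone.\<close>

lemma DD_linear:
  assumes r: "r > 0" and f: "\<phi> r = r" "\<phi>' r = 1" "\<phi>'' r = 0"
  shows "D1 \<phi> \<phi>' (r *\<^sub>R circ t) i = circ t $ i *\<^sub>R g t + circ' t $ i *\<^sub>R g1 t"
    "DD \<phi> \<phi>' \<phi>'' (r *\<^sub>R circ t) i j = ((circ' t $ i * circ' t $ j) / r) *\<^sub>R kap t"
proof -
  have nr: "norm (r *\<^sub>R circ t) = r" using r by simp
  have a: "ang (\<lambda>t. circ t $ i *\<^sub>R g t) (r *\<^sub>R circ t) = circ t $ i *\<^sub>R g t"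
    "ang (\<lambda>t. circ' t $ i *\<^sub>R g1 t) (r *\<^sub>R circ t) = circ' t $ i *\<^sub>R g1 t"
    "ang (\<lambda>t. circ t $ j *\<^sub>R (circ t $ i *\<^sub>R g t)) (r *\<^sub>R circ t) = circ t $ j *\<^sub>R (circ t $ i *\<^sub>R g t)"
    "ang (\<lambda>t. circ' t $ j *\<^sub>R (circ' t $ i *\<^sub>R g t + circ t $ i *\<^sub>R g1 t)) (r *\<^sub>R circ t) = circ' t $ j *\<^sub>R (circ' t $ i *\<^sub>R g t + circ t $ i *\<^sub>R g1 t)"
    "ang (\<lambda>t. circ t $ j *\<^sub>R (circ' t $ i *\<^sub>R g1 t)) (r *\<^sub>R circ t) = circ t $ j *\<^sub>R (circ' t $ i *\<^sub>R g1 t)"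
    "ang (\<lambda>t. circ' t $ j *\<^sub>R (- circ t $ i *\<^sub>R g1 t + circ' t $ i *\<^sub>R g2 t)) (r *\<^sub>R circ t) = circ' t $ j *\<^sub>R (- circ t $ i *\<^sub>R g1 t + circ' t $ i *\<^sub>R g2 t)"
    by (rule ang_circ, simp add: gper per, rule r)+
  show "D1 \<phi> \<phi>' (r *\<^sub>R circ t) i = circ t $ i *\<^sub>R g t + circ' t $ i *\<^sub>R g1 t" unfolding D1_def a nr f using r by simp
  have z: "1 / r - r / r\<^sup>2 = 0" "r / r / r = 1 / r" using r by (simp_all add: power2_eq_square)
  show "DD \<phi> \<phi>' \<phi>'' (r *\<^sub>R circ t) i j = ((circ' t $ i * circ' t $ j) / r) *\<^sub>R kap t"
    unfolding DD_def a nr f z kap_def by (simp add: algebra_simps)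
qed

lemma g_orth: "g t \<bullet> g1 t = 0"
proof -
  have "((\<lambda>t. g t \<bullet> g t) has_vector_derivative (g t \<bullet> g1 t + g1 t \<bullet> g t)) (at t)"
    by (rule bounded_bilinear.has_vector_derivative[OF bounded_bilinear_inner gd(1) gd(1)])
  moreover have "(\<lambda>t. g t \<bullet> g t) = (\<lambda>_. 1)" using gu(1) by (simp add: dot_square_norm fun_eq_iff)
  ultimately have "((\<lambda>_. 1::real) has_vector_derivative (g t \<bullet> g1 t + g1 t \<bullet> g t)) (at t)" by simp
  from vector_derivative_unique_at[OF this has_vector_derivative_const] show ?thesis by (simp add: inner_commute)
qed

text \<open>\<open>g t\<close>, \<open>g1 t\<close> and \<open>circ t\<close>,
  \<open>circ' t\<close> are orthonormal pairs, so the gradient of the cone preserves inner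
  products.\<close>

lemma memb_cone: "memb (\<lambda>i. circ t $ i *\<^sub>R g t + circ' t $ i *\<^sub>R g1 t) = 0"
proof -
  have n: "g t \<bullet> g t = 1" "g1 t \<bullet> g1 t = 1" "g t \<bullet> g1 t = 0" "g1 t \<bullet> g t = 0"
    using gu[of t] g_orth[of t] by (simp_all add: dot_square_norm inner_commute)
  have "(circ t $ i *\<^sub>R g t + circ' t $ i *\<^sub>R g1 t) \<bullet> (circ t $ j *\<^sub>R g t + circ' t $ j *\<^sub>R g1 t) = (if i = j then 1 else 0)" for i j
    using exhaust_2[of i] exhaust_2[of j] n by (auto simp: inner_simps power2_eq_square[symmetric])
  then show ?thesis by (simp add: memb_def)
qed

lemma bend_cone: "bend (\<lambda>i j. ((circ' t $ i * circ' t $ j) / r) *\<^sub>R kap t) = norm (kap t) ^ 2 / r\<^sup>2"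
proof -
  have "bend (\<lambda>i j. ((circ' t $ i * circ' t $ j) / r) *\<^sub>R kap t) = (\<Sum>i\<in>UNIV. \<Sum>j\<in>UNIV. (circ' t $ i)\<^sup>2 * (circ' t $ j)\<^sup>2 * (norm (kap t) ^ 2 / r\<^sup>2))"
    unfolding bend_def by (intro sum.cong refl) (simp add: power_mult_distrib power_divide)
  also have "\<dots> = (\<Sum>i\<in>UNIV. (circ' t $ i)\<^sup>2) * (\<Sum>j\<in>UNIV. (circ' t $ j)\<^sup>2) * (norm (kap t) ^ 2 / r\<^sup>2)"
    by (simp only: sum_2 distrib_left distrib_right add.assoc)
  also have "(\<Sum>i\<in>UNIV. (circ' t $ i)\<^sup>2) = 1" by (simp add: sum_2)
  finally show ?thesis by simp
qed

text \<open>Inside radius \<open>h\<close> the gradient is bounded and the second derivatives are of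
  order \<open>1 / h\<close>, so this disc costs a multiple of \<open>h\<^sup>2\<close>. Outside,
  the competitor is the exact cone, whose only cost is the bending \<open>kk / r\<close> integrated
  over \<open>h \<le> r \<le> 1\<close>.\<close>

lemma upper_bound:
  obtains C3 where "\<And>h. 0 < h \<Longrightarrow> h < 1 \<Longrightarrow> energy h (\<lambda>x. Dc ((1/h) *\<^sub>R x)) (\<lambda>x i j. (1/h) *\<^sub>R D2c ((1/h) *\<^sub>R x) i j) \<le> h\<^sup>2 * (kk * ln (1 / h) + C3)"
proof -
  note c = C2on_continuous[OF C2on_Yc]
  have "compact ((\<lambda>x. memb (Dc x)) ` cball 0 1)" "compact ((\<lambda>x. bend (D2c x)) ` cball 0 1)"
    unfolding memb_def bend_def
    by (rule compact_continuous_image, intro continuous_intros continuous_on_subset[OF c(2)[of 2]] continuous_on_subset[OF c(3)[of 2]], auto)+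
  then obtain a b where ab: "\<And>x. x \<in> (\<lambda>x. memb (Dc x)) ` cball 0 1 \<Longrightarrow> norm x \<le> a" "\<And>x. x \<in> (\<lambda>x. bend (D2c x)) ` cball 0 1 \<Longrightarrow> norm x \<le> b"
    using compact_imp_bounded bounded_iff by metis
  have "energy h (\<lambda>x. Dc ((1/h) *\<^sub>R x)) (\<lambda>x i j. (1/h) *\<^sub>R D2c ((1/h) *\<^sub>R x) i j) \<le> h\<^sup>2 * (kk * ln (1 / h) + pi * (a + b))" if h: "0 < h" "h < 1" for h
  proof -
    have C: "C2on 2 (\<lambda>x. h *\<^sub>R Yc ((1/h) *\<^sub>R x)) (\<lambda>x. Dc ((1/h) *\<^sub>R x)) (\<lambda>x i j. (1/h) *\<^sub>R D2c ((1/h) *\<^sub>R x) i j)"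
      by (rule C2on_scale[OF h(1) C2on_Yc])
    have two: "(1::real) < 2" by simp
    have bs: "bend (\<lambda>i j. (1/h) *\<^sub>R D2c x i j) = bend (D2c x) / h\<^sup>2" for x
      unfolding bend_def by (simp add: power_mult_distrib power_divide sum_divide_distrib)
    have cF: "cont2 0 1 (\<lambda>r t. F (r *\<^sub>R circ t))" if "continuous_on (ball 0 2) F" for F :: "real^2 \<Rightarrow> real"
      by (rule continuous_on_compose2[OF that]) (auto intro!: continuous_intros)
    note cC = C2on_continuous[OF C]
    have c1: "cont2 0 1 (\<lambda>r t. r * memb (Dc ((1/h) *\<^sub>R (r *\<^sub>R circ t))))"
      by (intro continuous_intros cF[of "\<lambda>x. memb (Dc ((1/h) *\<^sub>R x))"]) (unfold memb_def, intro continuous_intros cC)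
    have c2: "cont2 0 1 (\<lambda>r t. h\<^sup>2 * (r * bend (\<lambda>i j. (1/h) *\<^sub>R D2c ((1/h) *\<^sub>R (r *\<^sub>R circ t)) i j)))"
      by (intro continuous_intros cF[of "\<lambda>x. bend (\<lambda>i j. (1/h) *\<^sub>R D2c ((1/h) *\<^sub>R x) i j)"]) (unfold bend_def, intro continuous_intros cC)
    let ?F = "\<lambda>r t. r * memb (Dc ((1/h) *\<^sub>R (r *\<^sub>R circ t))) + h\<^sup>2 * (r * bend (\<lambda>i j. (1/h) *\<^sub>R D2c ((1/h) *\<^sub>R (r *\<^sub>R circ t)) i j))"
    have c12: "cont2 0 1 ?F" using c1 c2 by (rule continuous_on_add)
    have "energy h (\<lambda>x. Dc ((1/h) *\<^sub>R x)) (\<lambda>x i j. (1/h) *\<^sub>R D2c ((1/h) *\<^sub>R x) i j) = DI 0 1 ?F"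
      unfolding C2on_energy(3)[OF C two] DI_add[OF c1 c2] DI_cmult by simp
    also have "\<dots> = DI 0 h ?F + DI h 1 ?F" by (rule DI_split[OF c12]) (use h in auto)
    finally have split: "energy h (\<lambda>x. Dc ((1/h) *\<^sub>R x)) (\<lambda>x i j. (1/h) *\<^sub>R D2c ((1/h) *\<^sub>R x) i j) = DI 0 h ?F + DI h 1 ?F" .
    have "DI 0 h ?F \<le> DI 0 h (\<lambda>r t. (a + b) * r)"
    proof (rule DI_mono)
      show "cont2 0 h ?F" by (rule cont2_sub[OF c12]) (use h in auto)
      show "cont2 0 h (\<lambda>r t. (a + b) * r)" by (intro continuous_intros)
      fix r t assume r: "r \<in> {0..h}"
      have "(1/h) *\<^sub>R (r *\<^sub>R circ t) \<in> cball 0 1" using r h by simp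
      then have m: "memb (Dc ((1/h) *\<^sub>R (r *\<^sub>R circ t))) \<le> a" "bend (D2c ((1/h) *\<^sub>R (r *\<^sub>R circ t))) \<le> b"
        using ab(1)[OF imageI] ab(2)[OF imageI] by (force simp: abs_le_iff)+
      have "?F r t = r * memb (Dc ((1/h) *\<^sub>R (r *\<^sub>R circ t))) + r * bend (D2c ((1/h) *\<^sub>R (r *\<^sub>R circ t)))" unfolding bs using h by simp
      also have "\<dots> \<le> r * a + r * b" using r m by (intro add_mono mult_left_mono) auto
      finally show "?F r t \<le> (a + b) * r" by (simp add: algebra_simps)
    qed
    also have "DI 0 h (\<lambda>r t. (a + b) * r) = h\<^sup>2 * (pi * (a + b))"
    proof -
      have "((\<lambda>r::real. r) has_integral (h\<^sup>2 - 0\<^sup>2) / 2) {0..h}" by (rule ident_has_integral) (use h in auto)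
      then have "integral {0..h} (\<lambda>r. r) = h\<^sup>2 / 2" by (simp add: integral_unique)
      then have "DI 0 h (\<lambda>r t. r) = pi * h\<^sup>2" unfolding DI_radial by simp
      then show ?thesis unfolding DI_cmult by simp
    qed
    finally have inner: "DI 0 h ?F \<le> h\<^sup>2 * (pi * (a + b))" .
    have "DI h 1 ?F = DI h 1 (\<lambda>r t. h\<^sup>2 * (1 / r * norm (kap t) ^ 2))"
    proof (rule DI_cong)
      fix r t assume "r \<in> {h..1}"
      then have r: "r / h \<ge> 1" "r > 0" using h by auto
      then have rh: "r / h > 0" by linarith
      have e: "(1/h) *\<^sub>R (r *\<^sub>R circ t) = (r / h) *\<^sub>R circ t" by simp
      note L = DD_linear[where \<phi>=\<phi>0 and \<phi>'=\<phi>1 and \<phi>''=\<phi>2, OF rh \<phi>_ge1[OF r(1)], of t]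
      have 1: "memb (Dc ((1/h) *\<^sub>R (r *\<^sub>R circ t))) = 0" unfolding e using memb_cone[of t] by (simp add: L(1)[abs_def] memb_def L(1))
      have 2: "bend (D2c ((1/h) *\<^sub>R (r *\<^sub>R circ t))) = norm (kap t) ^ 2 / (r / h)\<^sup>2" unfolding e using bend_cone[of t "r/h"] by (simp add: bend_def L(2))
      show "?F r t = h\<^sup>2 * (1 / r * norm (kap t) ^ 2)" unfolding bs 1 2 using h r by (simp add: power2_eq_square)
    qed
    also have "\<dots> = h\<^sup>2 * (kk * ln (1 / h))"
    proof -
      have "((\<lambda>r. 1 / r) has_integral (ln 1 - ln h)) {h..1}"
        by (rule fundamental_theorem_of_calculus) (use h in \<open>auto intro!: derivative_eq_intros simp: has_real_derivative_iff_has_vector_derivative[symmetric]\<close>)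
      from has_integral_mult_left[OF this, of kk] have "integral {h..1} (\<lambda>r. 1 / r * kk) = ln (1 / h) * kk" using h by (simp add: integral_unique ln_div)
      then show ?thesis unfolding DI_cmult DI_def by (simp add: kk_def mult.commute)
    qed
    finally have outer: "DI h 1 ?F = h\<^sup>2 * (kk * ln (1 / h))" .
    show ?thesis unfolding split outer using inner by (simp add: distrib_left)
  qed
  then show ?thesis by (rule that)
qed

lemma competitor_admissible:
  assumes \<gamma>: "\<And>t. \<gamma> (circ t) = g t" and h: "0 < h" "h < 1"
  shows "admissible \<gamma> (\<lambda>x. h *\<^sub>R Yc ((1/h) *\<^sub>R x)) (\<lambda>x. Dc ((1/h) *\<^sub>R x)) (\<lambda>x i j. (1/h) *\<^sub>R D2c ((1/h) *\<^sub>R x) i j)"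
proof -
  have C: "C2on 2 (\<lambda>x. h *\<^sub>R Yc ((1/h) *\<^sub>R x)) (\<lambda>x. Dc ((1/h) *\<^sub>R x)) (\<lambda>x i j. (1/h) *\<^sub>R D2c ((1/h) *\<^sub>R x) i j)"
    by (rule C2on_scale[OF h(1) C2on_Yc])
  show ?thesis unfolding admissible_def
  proof (intro conjI ballI)
    show "W22 (ball 0 1) (\<lambda>x. h *\<^sub>R Yc ((1/h) *\<^sub>R x)) (\<lambda>x. Dc ((1/h) *\<^sub>R x)) (\<lambda>x i j. (1/h) *\<^sub>R D2c ((1/h) *\<^sub>R x) i j)"
      by (rule C2on_W22[OF C]) simp
    show "continuous_on (cball 0 1) (\<lambda>x. h *\<^sub>R Yc ((1/h) *\<^sub>R x))" by (rule continuous_on_subset[OF C2on_continuous(1)[OF C]]) auto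
    show "h *\<^sub>R Yc ((1/h) *\<^sub>R 0) = 0" by (simp add: zero_vals)
    fix x :: "real^2" assume "x \<in> sphere 0 1"
    then have "norm x = 1" by simp
    then obtain t where t: "x = circ t" by (rule unit_is_circ)
    have "ang g ((1/h) *\<^sub>R circ t) = g t" by (rule ang_circ[of g, OF gper]) (use h in simp)
    then show "h *\<^sub>R Yc ((1/h) *\<^sub>R x) = \<gamma> x" unfolding t using h \<phi>_ge1(1)[of "1/h"] by (simp add: Yc_def \<gamma>)
  qed
qed

text \<open>The bending density of the cone is \<open>norm (kap t) ^ 2 / r\<^sup>2\<close>; with the
  Jacobian \<open>r\<close> it integrates over \<open>1/2 \<le> r \<le> 1\<close> to
  \<open>ln 2 * kk\<close>, which the prefactor of \<open>C1const\<close> normalises.\<close>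

lemma C1const_eq:
  assumes \<gamma>: "\<And>t. \<gamma> (circ t) = g t"
  shows "C1const \<gamma> = kk"
proof -
  have cone: "cone \<gamma> x = norm x *\<^sub>R ang g x" for x
  proof (cases "x = 0")
    case False
    have "x /\<^sub>R norm x = circ (arg2 x)" using False arg2[of x] by (metis norm_eq_zero scaleR_scaleR left_inverse scaleR_one)
    then show ?thesis by (simp add: cone_def ang_def \<gamma>)
  qed (simp add: cone_def)
  let ?i = "\<lambda>r::real. r" and ?o = "\<lambda>r::real. 1::real" and ?z = "\<lambda>r::real. 0::real"
  have p1: "pdiff (cone \<gamma>) i x = D1 ?i ?o x i" if "x \<noteq> 0" for x i
  proof -
    have "(cone \<gamma> has_derivative (\<lambda>v. \<Sum>j\<in>UNIV. v $ j *\<^sub>R D1 ?i ?o x j)) (at x)"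
      unfolding cone[abs_def] by (rule D1_deriv[OF that]) (rule DERIV_ident)
    then show ?thesis unfolding pdiff_def by (simp add: frechet_derivative_at[symmetric] sum_scaleR_axis)
  qed
  have p2: "pdiff (pdiff (cone \<gamma>) i) j x = DD ?i ?o ?z x i j" if "x \<noteq> 0" for x i j
  proof -
    have "((\<lambda>x. D1 ?i ?o x i) has_derivative (\<lambda>v. \<Sum>j\<in>UNIV. v $ j *\<^sub>R DD ?i ?o ?z x i j)) (at x)"
      by (rule DD_deriv[OF that]) (auto intro!: derivative_eq_intros)
    then have "(pdiff (cone \<gamma>) i has_derivative (\<lambda>v. \<Sum>j\<in>UNIV. v $ j *\<^sub>R DD ?i ?o ?z x i j)) (at x)"
      by (rule has_derivative_transform_within_open[of _ _ _ _ "- {0}"]) (use that p1 in \<open>auto simp: open_delete\<close>)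
    then show ?thesis unfolding pdiff_def[of "pdiff (cone \<gamma>) i"] by (simp add: frechet_derivative_at[symmetric] sum_scaleR_axis)
  qed
  define F where "F = (\<lambda>x. norm (ang kap x) ^ 2 / (norm x)\<^sup>2)"
  have Fx: "(\<Sum>i\<in>UNIV. \<Sum>j\<in>UNIV. (norm (pdiff (pdiff (cone \<gamma>) i) j x))\<^sup>2) = F x" if "x \<noteq> 0" for x
  proof -
    obtain t where t: "x = norm x *\<^sub>R circ t" by (rule polar_decomp)
    define r where "r = norm x"
    have r: "r > 0" using that by (simp add: r_def)
    have x: "x = r *\<^sub>R circ t" using t by (simp add: r_def)
    have "(\<Sum>i\<in>UNIV. \<Sum>j\<in>UNIV. (norm (pdiff (pdiff (cone \<gamma>) i) j x))\<^sup>2) = bend (\<lambda>i j. DD ?i ?o ?z x i j)" unfolding bend_def p2[OF that] ..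
    also have "\<dots> = norm (kap t) ^ 2 / r\<^sup>2" unfolding x DD_linear(2)[of r ?i ?o ?z, OF r refl refl refl] by (rule bend_cone)
    also have "\<dots> = F x" unfolding F_def x ang_circ[of kap, OF kap_periodic r] using r by simp
    finally show ?thesis .
  qed
  have cF: "continuous_on (- {0}) F" unfolding F_def
    by (intro continuous_intros ang_continuous kap_periodic) (auto simp: kap_def intro!: continuous_intros)
  have cF': "continuous_on {x. 1/2 \<le> norm x \<and> norm x \<le> 1} F" by (rule continuous_on_subset[OF cF]) auto
  let ?S = "ball 0 1 - ball (0::real^2) (1/2)"
  have m1: "(\<lambda>x. indicator ?S x *\<^sub>R F x) \<in> borel_measurable borel"
    by (rule borel_measurable_continuous_on_indicator) (auto intro: continuous_on_subset[OF cF])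
  have m2: "(\<lambda>x. indicator (annulus (1/2) 1) x *\<^sub>R F x) \<in> borel_measurable borel"
    using polar_integral(1)[OF _ cF'] by auto
  have "(LINT x:?S|lebesgue. \<Sum>i\<in>UNIV. \<Sum>j\<in>UNIV. (norm (pdiff (pdiff (cone \<gamma>) i) j x))\<^sup>2) = (\<integral>x. indicator ?S x *\<^sub>R F x \<partial>lebesgue)"
    unfolding set_lebesgue_integral_def
  proof (rule Bochner_Integration.integral_cong[OF refl])
    fix x :: "real^2"
    show "indicator ?S x *\<^sub>R (\<Sum>i\<in>UNIV. \<Sum>j\<in>UNIV. (norm (pdiff (pdiff (cone \<gamma>) i) j x))\<^sup>2) = indicator ?S x *\<^sub>R F x"
      by (cases "x = 0") (simp_all add: Fx)
  qed
  also have "\<dots> = (\<integral>x. indicator ?S x *\<^sub>R F x \<partial>lborel)" by (rule integral_completion) (use m1 in simp)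
  \<comment> \<open>The half-open annulus contains the inner circle and the open one does not; the
    circle is a null set.\<close>
  also have "\<dots> = (\<integral>x. indicator (annulus (1/2) 1) x *\<^sub>R F x \<partial>lborel)"
  proof (rule integral_cong_AE)
    have "sphere (0::real^2) (1/2) \<in> null_sets lebesgue" using negligible_sphere negligible_iff_null_sets by blast
    then have "AE x in lebesgue. x \<notin> sphere (0::real^2) (1/2)" by (rule AE_not_in)
    then have "AE x in lborel. x \<notin> sphere (0::real^2) (1/2)" by (simp add: AE_completion_iff)
    then show "AE x in lborel. indicator ?S x *\<^sub>R F x = indicator (annulus (1/2) 1) x *\<^sub>R F x"
      by eventually_elim (auto simp: indicator_def annulus_def)
  qed (use m1 m2 in auto)
  also have "\<dots> = integral {1/2..1} (\<lambda>r. integral {0..2*pi} (\<lambda>t. r * F (r *\<^sub>R circ t)))"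
    by (rule polar_integral(2)[OF _ cF']) simp
  also have "\<dots> = integral {1/2..1} (\<lambda>r. 1 / r * kk)"
  proof (rule integral_cong)
    fix r :: real assume "r \<in> {1/2..1}"
    then have r: "r > 0" by auto
    have "integral {0..2*pi} (\<lambda>t. r * F (r *\<^sub>R circ t)) = integral {0..2*pi} (\<lambda>t. 1 / r * norm (kap t) ^ 2)"
      unfolding F_def ang_circ[of kap, OF kap_periodic r] using r by (intro integral_cong) (simp add: power2_eq_square)
    then show "integral {0..2*pi} (\<lambda>t. r * F (r *\<^sub>R circ t)) = 1 / r * kk" by (simp add: kk_def)
  qed
  also have "\<dots> = ln 2 * kk"
  proof -
    have "((\<lambda>r. 1 / r) has_integral (ln 1 - ln (1/2))) {1/2..1::real}"
      by (rule fundamental_theorem_of_calculus) (auto intro!: derivative_eq_intros simp: has_real_derivative_iff_has_vector_derivative[symmetric])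
    then have "((\<lambda>r. 1 / r * kk) has_integral (ln 1 - ln (1/2)) * kk) {1/2..1::real}" by (rule has_integral_mult_left)
    then show ?thesis by (simp add: integral_unique ln_div)
  qed
  finally show ?thesis unfolding C1const_def by simp
qed

end

section \<open>Existence of minimizers\<close>

text \<open>The inequality \<open>u \<le> (1/2) ^ n + 2 ^ n * u\<^sup>2\<close> converts squares
  into first powers on a finite measure space. The first powers are summable in \<open>n\<close>, so
  almost everywhere the increments form an absolutely convergent series.\<close>

lemma nn_integral_square_AE_Cauchy:
  fixes f :: "nat \<Rightarrow> 'a \<Rightarrow> 'b::{banach,second_countable_topology}"
  assumes fin: "finite_measure M" and m[measurable]: "\<And>n. f n \<in> borel_measurable M"
    and C: "\<And>n. (\<integral>\<^sup>+x. ennreal (norm (f (Suc n) x - f n x) ^ 2) \<partial>M) \<le> ennreal ((1/4) ^ n)"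
  shows "AE x in M. convergent (\<lambda>n. f n x)"
proof -
  define \<mu> where "\<mu> = measure M (space M)"
  have mu: "emeasure M (space M) = ennreal \<mu>" unfolding \<mu>_def using fin by (simp add: finite_measure.emeasure_eq_measure)
  have mu0: "\<mu> \<ge> 0" by (simp add: \<mu>_def)
  let ?d = "\<lambda>n x. norm (f (Suc n) x - f n x)"
  have b: "(\<integral>\<^sup>+x. ennreal (?d n x) \<partial>M) \<le> ennreal ((\<mu> + 1) * (1/2) ^ n)" for n
  proof -
    have "(\<integral>\<^sup>+x. ennreal (?d n x) \<partial>M) \<le> (\<integral>\<^sup>+x. ennreal ((1/2) ^ n) + ennreal (2 ^ n) * ennreal (?d n x ^ 2) \<partial>M)"
    proof (rule nn_integral_mono)
      fix x
      let ?u = "?d n x"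
      have "?u \<le> (1/2) ^ n + 2 ^ n * ?u\<^sup>2"
      proof (cases "?u \<le> (1/2) ^ n")
        case False
        then have "(1/2) ^ n * ?u \<le> ?u * ?u" by (intro mult_right_mono) auto
        then have "2 ^ n * ((1/2) ^ n * ?u) \<le> 2 ^ n * (?u * ?u)" by (intro mult_left_mono) auto
        moreover have "2 ^ n * ((1/2) ^ n * ?u) = ?u" by (simp add: power_one_over)
        ultimately show ?thesis by (simp add: power2_eq_square add_increasing)
      qed (simp add: add_increasing2)
      then have "ennreal ?u \<le> ennreal ((1/2) ^ n + 2 ^ n * ?u\<^sup>2)" by (rule ennreal_leI)
      also have "\<dots> = ennreal ((1/2) ^ n) + ennreal (2 ^ n) * ennreal (?u ^ 2)" by (subst ennreal_plus, simp, simp, subst ennreal_mult, simp_all)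
      finally show "ennreal ?u \<le> \<dots>" .
    qed
    also have "\<dots> = ennreal ((1/2) ^ n) * ennreal \<mu> + ennreal (2 ^ n) * (\<integral>\<^sup>+x. ennreal (?d n x ^ 2) \<partial>M)"
      by (subst nn_integral_add, simp, simp, subst nn_integral_cmult, simp) (simp add: mu)
    also have "\<dots> \<le> ennreal ((1/2) ^ n) * ennreal \<mu> + ennreal (2 ^ n) * ennreal ((1/4) ^ n)"
      by (intro add_left_mono mult_left_mono C) simp
    also have "\<dots> = ennreal ((1/2) ^ n * \<mu> + 2 ^ n * (1/4) ^ n)" using mu0 by (simp add: ennreal_mult ennreal_plus)
    also have "(1/2) ^ n * \<mu> + 2 ^ n * (1/4) ^ n = (\<mu> + 1) * (1/2) ^ n"
    proof -
      have "2 ^ n * (1/4) ^ n = (1/2 :: real) ^ n" by (simp flip: power_mult_distrib)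
      then show ?thesis by (simp add: algebra_simps)
    qed
    finally show ?thesis .
  qed
  have "(\<integral>\<^sup>+x. (\<Sum>n. ennreal (?d n x)) \<partial>M) = (\<Sum>n. \<integral>\<^sup>+x. ennreal (?d n x) \<partial>M)" by (rule nn_integral_suminf) measurable
  also have "\<dots> \<le> (\<Sum>n. ennreal ((\<mu> + 1) * (1/2) ^ n))" by (intro suminf_le b) auto
  also have "\<dots> = ennreal (\<Sum>n. (\<mu> + 1) * (1/2) ^ n)" using mu0 by (intro suminf_ennreal2) (auto intro!: summable_mult summable_geometric)
  also have "\<dots> < \<infinity>" by simp
  finally have "AE x in M. (\<Sum>n. ennreal (?d n x)) \<noteq> \<infinity>" by (intro nn_integral_PInf_AE) auto
  then show ?thesis
  proof eventually_elim
    case (elim x)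
    then have "summable (\<lambda>n. ?d n x)" by (intro summable_suminf_not_top) auto
    then have "summable (\<lambda>n. f (Suc n) x - f n x)" by (rule summable_norm_cancel)
    then have "convergent (\<lambda>n. \<Sum>k<n. f (Suc k) x - f k x)" by (simp add: summable_iff_convergent)
    then have "convergent (\<lambda>n. f n x - f 0 x)" by (simp add: sum_lessThan_telescope[of "\<lambda>k. f k x"])
    then have "convergent (\<lambda>n. (f n x - f 0 x) + f 0 x)" by (intro convergent_add convergent_const)
    then show ?case by simp
  qed
qed

text \<open>The Riesz-Fischer argument: a rapidly Cauchy subsequence converges almost everywhere,
  and Fatou's lemma turns this into convergence in mean square of the whole sequence.\<close>

lemma L2_complete:
  fixes f :: "nat \<Rightarrow> 'a \<Rightarrow> 'b::{banach,second_countable_topology}"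
  assumes fin: "finite_measure M" and m[measurable]: "\<And>n. f n \<in> borel_measurable M"
    and C: "\<And>e. e > 0 \<Longrightarrow> \<exists>N. \<forall>m\<ge>N. \<forall>n\<ge>N. (\<integral>\<^sup>+x. ennreal (norm (f m x - f n x) ^ 2) \<partial>M) \<le> ennreal e"
  obtains g and s :: "nat \<Rightarrow> nat" where "g \<in> borel_measurable M" "strict_mono s" "AE x in M. (\<lambda>n. f (s n) x) \<longlonglongrightarrow> g x"
    "\<And>e. e > 0 \<Longrightarrow> \<exists>N. \<forall>n\<ge>N. (\<integral>\<^sup>+x. ennreal (norm (f n x - g x) ^ 2) \<partial>M) \<le> ennreal e"
proof -
  have "\<exists>s. \<forall>k. (\<forall>m\<ge>s k. \<forall>n\<ge>s k. (\<integral>\<^sup>+x. ennreal (norm (f m x - f n x) ^ 2) \<partial>M) \<le> ennreal ((1/4) ^ k)) \<and> s k < s (Suc k)"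
  proof (rule dependent_nat_choice)
    show "\<exists>x. \<forall>m\<ge>x. \<forall>n\<ge>x. (\<integral>\<^sup>+xa. ennreal (norm (f m xa - f n xa) ^ 2) \<partial>M) \<le> ennreal ((1/4) ^ 0)" using C[of 1] by simp
    fix x k
    obtain N where N: "\<forall>m\<ge>N. \<forall>n\<ge>N. (\<integral>\<^sup>+x. ennreal (norm (f m x - f n x) ^ 2) \<partial>M) \<le> ennreal ((1/4) ^ Suc k)" using C[of "(1/4) ^ Suc k"] by auto
    show "\<exists>y. (\<forall>m\<ge>y. \<forall>n\<ge>y. (\<integral>\<^sup>+x. ennreal (norm (f m x - f n x) ^ 2) \<partial>M) \<le> ennreal ((1/4) ^ Suc k)) \<and> x < y"
      by (rule exI[of _ "max N (Suc x)"]) (use N in auto)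
  qed
  then obtain s :: "nat \<Rightarrow> nat" where s: "\<And>k m n. m \<ge> s k \<Longrightarrow> n \<ge> s k \<Longrightarrow> (\<integral>\<^sup>+x. ennreal (norm (f m x - f n x) ^ 2) \<partial>M) \<le> ennreal ((1/4) ^ k)" and s2: "\<And>k. s k < s (Suc k)"
    by blast
  have sm: "strict_mono s" using s2 by (simp add: strict_mono_Suc_iff)
  have ae: "AE x in M. convergent (\<lambda>n. f (s n) x)"
    by (rule nn_integral_square_AE_Cauchy[OF fin]) (auto intro!: s less_imp_le[OF s2])
  define g where "g = (\<lambda>x. lim (\<lambda>n. f (s n) x))"
  have gm[measurable]: "g \<in> borel_measurable M" unfolding g_def by (rule borel_measurable_lim_metric) simp
  have gl: "AE x in M. (\<lambda>n. f (s n) x) \<longlonglongrightarrow> g x" using ae unfolding g_def by eventually_elim (simp add: convergent_LIMSEQ_iff)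
  have "\<exists>N. \<forall>n\<ge>N. (\<integral>\<^sup>+x. ennreal (norm (f n x - g x) ^ 2) \<partial>M) \<le> ennreal e" if e: "e > 0" for e
  proof -
    obtain N where N: "\<And>m n. m \<ge> N \<Longrightarrow> n \<ge> N \<Longrightarrow> (\<integral>\<^sup>+x. ennreal (norm (f m x - f n x) ^ 2) \<partial>M) \<le> ennreal e" using C[OF e] by blast
    have "(\<integral>\<^sup>+x. ennreal (norm (f n x - g x) ^ 2) \<partial>M) \<le> ennreal e" if n: "n \<ge> N" for n
    proof (rule nn_integral_Fatou_bound[where f="\<lambda>k x. norm (f n x - f (s k) x) ^ 2"])
      show "AE x in M. (\<lambda>k. norm (f n x - f (s k) x) ^ 2) \<longlonglongrightarrow> norm (f n x - g x) ^ 2"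
        using gl by eventually_elim (intro tendsto_intros)
      show "\<forall>\<^sub>F k in sequentially. (\<integral>\<^sup>+x. ennreal (norm (f n x - f (s k) x) ^ 2) \<partial>M) \<le> ennreal e"
        using n seq_suble[OF sm] by (intro eventually_sequentiallyI[of N] N) (auto intro: order_trans)
    qed measurable
    then show ?thesis by blast
  qed
  then show ?thesis using that[OF gm sm gl] by blast
qed

lemma L2_imp_integrable_disc:
  fixes f :: "real^2 \<Rightarrow> 'b::{banach,second_countable_topology}"
  assumes "f \<in> borel_measurable disc" "integrable disc (\<lambda>x. norm (f x) ^ 2)"
  shows "integrable disc f"
proof (rule Bochner_Integration.integrable_bound[where f="\<lambda>x. 1 + norm (f x) ^ 2"])
  have "integrable disc (\<lambda>x. 1 :: real)" by (rule finite_measure.integrable_const[OF finite_measure_disc])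
  then show "integrable disc (\<lambda>x. 1 + norm (f x) ^ 2)" using assms(2) by simp
  have "norm (f x) \<le> norm (1 + norm (f x) ^ 2)" for x
  proof -
    have "2 * norm (f x) * 1 \<le> norm (f x) ^ 2 + 1\<^sup>2" by (rule sum_squares_bound)
    then have "norm (f x) \<le> 1 + norm (f x) ^ 2" using norm_ge_zero[of "f x"] unfolding one_power2 mult_1_right by linarith
    then show ?thesis by (simp add: abs_of_nonneg)
  qed
  then show "AE x in disc. norm (f x) \<le> norm (1 + norm (f x) ^ 2)" by simp
qed (rule assms)

section \<open>Linear combinations and limits of weak derivatives\<close>

lemma test_fun_bounded:
  assumes t: "test_fun (ball 0 1) \<phi>"
  obtains K where "K \<ge> 0" "\<And>x. \<bar>\<phi> x\<bar> \<le> K" "\<And>x i. \<bar>pdiff \<phi> i x\<bar> \<le> K" "\<phi> \<in> borel_measurable disc" "\<And>i. pdiff \<phi> i \<in> borel_measurable disc"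
proof -
  obtain S where S: "compact S" and z: "\<And>x. x \<notin> S \<Longrightarrow> \<phi> x = 0" using t unfolding test_fun_def by blast
  have diff: "\<phi> differentiable (at x)" and cp: "continuous_on UNIV (pdiff \<phi> i)" for x i using t by (auto simp: test_fun_def)
  have cphi: "continuous_on UNIV \<phi>" using diff by (simp add: differentiable_imp_continuous_within continuous_on_eq_continuous_within)
  have bd: "\<exists>K. \<forall>x. \<bar>q x\<bar> \<le> K" if "continuous_on UNIV q" "\<And>x. x \<notin> S \<Longrightarrow> q x = 0" for q :: "real^2 \<Rightarrow> real"
  proof -
    have "compact (q ` S)" using that(1) S by (intro compact_continuous_image) (auto intro: continuous_on_subset)
    then obtain K where K: "\<And>y. y \<in> q ` S \<Longrightarrow> norm y \<le> K" using compact_imp_bounded bounded_iff by metis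
    have "\<bar>q x\<bar> \<le> max 0 K" for x using K[of "q x"] that(2)[of x] by (cases "x \<in> S") auto
    then show ?thesis by blast
  qed
  have pz: "pdiff \<phi> i x = 0" if "x \<notin> S" for x i by (rule test_fun_pdiff_support[of S \<phi>, OF S z that])
  obtain K0 where K0: "\<And>x. \<bar>\<phi> x\<bar> \<le> K0" using bd[OF cphi z] by blast
  obtain K1 where K1: "\<And>x. \<bar>pdiff \<phi> 1 x\<bar> \<le> K1" using bd[OF cp pz] by blast
  obtain K2 where K2: "\<And>x. \<bar>pdiff \<phi> 2 x\<bar> \<le> K2" using bd[OF cp pz] by blast
  show ?thesis
  proof (rule that[of "max 0 (max K0 (max K1 K2))"])
    show "\<bar>\<phi> x\<bar> \<le> max 0 (max K0 (max K1 K2))" for x using K0[of x] by simp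
    show "\<bar>pdiff \<phi> i x\<bar> \<le> max 0 (max K0 (max K1 K2))" for x i using exhaust_2[of i] K1[of x] K2[of x] by auto
  qed (auto intro!: borel_disc borel_measurable_continuous_onI cphi cp)
qed

lemma bounded_mult_integrable_disc:
  fixes f :: "real^2 \<Rightarrow> 'b::{banach,second_countable_topology}"
  assumes q: "q \<in> borel_measurable disc" "\<And>x. \<bar>q x\<bar> \<le> K" and f: "integrable disc f"
  shows "integrable disc (\<lambda>x. q x *\<^sub>R f x)"
proof (rule Bochner_Integration.integrable_bound[where f="\<lambda>x. K *\<^sub>R f x"])
  show "AE x in disc. norm (q x *\<^sub>R f x) \<le> norm (K *\<^sub>R f x)"
    using order_trans[OF q(2) abs_ge_self] by (auto intro!: mult_right_mono)
  have [measurable]: "f \<in> borel_measurable disc" using f by auto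
  show "(\<lambda>x. q x *\<^sub>R f x) \<in> borel_measurable disc" using q(1) by measurable
qed (use f in simp)

lemma L2_on_lincomb:
  fixes f g :: "real^2 \<Rightarrow> 'b::{banach,second_countable_topology}"
  assumes "L2_on (ball 0 1) f" "L2_on (ball 0 1) g"
  shows "L2_on (ball 0 1) (\<lambda>x. a *\<^sub>R f x + b *\<^sub>R g x)"
proof -
  have m[measurable]: "f \<in> borel_measurable disc" "g \<in> borel_measurable disc" and i: "integrable disc (\<lambda>x. norm (f x) ^ 2)" "integrable disc (\<lambda>x. norm (g x) ^ 2)"
    using assms by (auto simp: L2_on_disc)
  have "integrable disc (\<lambda>x. norm (a *\<^sub>R f x + b *\<^sub>R g x) ^ 2)"
  proof (rule Bochner_Integration.integrable_bound[where f="\<lambda>x. 2 * a\<^sup>2 * norm (f x) ^ 2 + 2 * b\<^sup>2 * norm (g x) ^ 2"])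
    show "integrable disc (\<lambda>x. 2 * a\<^sup>2 * norm (f x) ^ 2 + 2 * b\<^sup>2 * norm (g x) ^ 2)" using i by simp
    have "norm (norm (a *\<^sub>R f x + b *\<^sub>R g x) ^ 2) \<le> norm (2 * a\<^sup>2 * norm (f x) ^ 2 + 2 * b\<^sup>2 * norm (g x) ^ 2)" for x
      using power2_norm_add_le[of "a *\<^sub>R f x" "b *\<^sub>R g x"] by (simp add: power_mult_distrib abs_of_nonneg)
    then show "AE x in disc. norm (norm (a *\<^sub>R f x + b *\<^sub>R g x) ^ 2) \<le> norm (2 * a\<^sup>2 * norm (f x) ^ 2 + 2 * b\<^sup>2 * norm (g x) ^ 2)" by simp
  qed measurable
  then show ?thesis unfolding L2_on_disc by simp
qed

lemma weak_pdiff_lincomb: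
  assumes L: "L2_on (ball 0 1) f" "L2_on (ball 0 1) g" "L2_on (ball 0 1) f'" "L2_on (ball 0 1) g'"
    and w: "weak_pdiff (ball 0 1) f i f'" "weak_pdiff (ball 0 1) g i g'"
  shows "weak_pdiff (ball 0 1) (\<lambda>x. a *\<^sub>R f x + b *\<^sub>R g x) i (\<lambda>x. a *\<^sub>R f' x + b *\<^sub>R g' x)"
  unfolding weak_pdiff_disc
proof (intro allI impI)
  fix \<phi> assume t: "test_fun (ball 0 1) \<phi>"
  then obtain K where K: "\<And>x. \<bar>\<phi> x\<bar> \<le> K" "\<And>x i. \<bar>pdiff \<phi> i x\<bar> \<le> K" and m: "\<phi> \<in> borel_measurable disc" "\<And>i. pdiff \<phi> i \<in> borel_measurable disc"
    by (rule test_fun_bounded) blast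
  have L1: "integrable disc u" if "L2_on (ball 0 1) u" for u :: "real^2 \<Rightarrow> real^3" using that unfolding L2_on_disc by (metis L2_imp_integrable_disc)
  note B1 = bounded_mult_integrable_disc[OF m(2) K(2) L1] and B2 = bounded_mult_integrable_disc[OF m(1) K(1) L1]
  have lin: "(\<integral>x. q x *\<^sub>R (a *\<^sub>R u x + b *\<^sub>R v x) \<partial>disc) = a *\<^sub>R (\<integral>x. q x *\<^sub>R u x \<partial>disc) + b *\<^sub>R (\<integral>x. q x *\<^sub>R v x \<partial>disc)"
    if i: "integrable disc (\<lambda>x. q x *\<^sub>R u x)" "integrable disc (\<lambda>x. q x *\<^sub>R v x)" for q :: "real^2 \<Rightarrow> real" and u v :: "real^2 \<Rightarrow> real^3"
  proof -
    have "(\<lambda>x. q x *\<^sub>R (a *\<^sub>R u x + b *\<^sub>R v x)) = (\<lambda>x. a *\<^sub>R (q x *\<^sub>R u x) + b *\<^sub>R (q x *\<^sub>R v x))" by (auto simp: fun_eq_iff algebra_simps)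
    then show ?thesis using i by (simp del: scaleR_scaleR)
  qed
  show "(\<integral>x. pdiff \<phi> i x *\<^sub>R (a *\<^sub>R f x + b *\<^sub>R g x) \<partial>disc) = - (\<integral>x. \<phi> x *\<^sub>R (a *\<^sub>R f' x + b *\<^sub>R g' x) \<partial>disc)"
    using w t L by (simp add: lin B1 B2 weak_pdiff_disc)
qed

lemma W22_lincomb:
  assumes "W22 (ball 0 1) y D D2" "W22 (ball 0 1) y' D' D2'"
  shows "W22 (ball 0 1) (\<lambda>x. a *\<^sub>R y x + b *\<^sub>R y' x) (\<lambda>x i. a *\<^sub>R D x i + b *\<^sub>R D' x i) (\<lambda>x i j. a *\<^sub>R D2 x i j + b *\<^sub>R D2' x i j)"
  using assms unfolding W22_def by (intro conjI allI L2_on_lincomb weak_pdiff_lincomb) auto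

text \<open>The integral of the difference is estimated through
  \<open>u \<le> c + u\<^sup>2 / c\<close>, which passes from the mean square to the mean on a set
  of finite measure.\<close>

lemma L2_bounded_mult_tendsto:
  fixes f :: "nat \<Rightarrow> real^2 \<Rightarrow> real^3"
  assumes q: "q \<in> borel_measurable disc" "\<And>x. \<bar>q x\<bar> \<le> K" and f: "\<And>n. L2_on (ball 0 1) (f n)" "L2_on (ball 0 1) g"
    and l: "\<And>e. e > 0 \<Longrightarrow> \<exists>N. \<forall>n\<ge>N. (\<integral>\<^sup>+x. ennreal (norm (f n x - g x) ^ 2) \<partial>disc) \<le> ennreal e"
  shows "(\<lambda>n. \<integral>x. q x *\<^sub>R f n x \<partial>disc) \<longlonglongrightarrow> (\<integral>x. q x *\<^sub>R g x \<partial>disc)"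
proof (rule LIMSEQ_I)
  fix r :: real assume r: "r > 0"
  have K0: "K \<ge> 0" using q(2)[of 0] by linarith
  define \<mu> where "\<mu> = measure disc (space disc)"
  have mu0: "\<mu> \<ge> 0" by (simp add: \<mu>_def)
  \<comment> \<open>With this \<open>c\<close> the constant part contributes at most
    \<open>r / 2\<close>; \<open>e\<close> below is then chosen so that the square part contributes
    at most \<open>r / 4\<close>.\<close>
  define c where "c = r / (2 * (K + 1) * (\<mu> + 1))"
  have c: "c > 0" using r K0 mu0 by (simp add: c_def add_nonneg_pos)
  define e where "e = c * r / (4 * (K + 1))"
  have e: "e > 0" using c r K0 by (simp add: e_def add_nonneg_pos)
  have L1: "integrable disc u" if "L2_on (ball 0 1) u" for u :: "real^2 \<Rightarrow> real^3" using that unfolding L2_on_disc by (metis L2_imp_integrable_disc)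
  obtain N where N: "\<And>n. n \<ge> N \<Longrightarrow> (\<integral>\<^sup>+x. ennreal (norm (f n x - g x) ^ 2) \<partial>disc) \<le> ennreal e" using l[OF e] by blast
  have "norm ((\<integral>x. q x *\<^sub>R f n x \<partial>disc) - (\<integral>x. q x *\<^sub>R g x \<partial>disc)) < r" if n: "n \<ge> N" for n
  proof -
    have d: "L2_on (ball 0 1) (\<lambda>x. f n x - g x)" using L2_on_lincomb[OF f(1)[of n] f(2), of 1 "-1"] by simp
    then have di: "integrable disc (\<lambda>x. norm (f n x - g x) ^ 2)" "integrable disc (\<lambda>x. norm (f n x - g x))"
      using L1[OF d] by (auto simp: L2_on_disc)
    have "ennreal (\<integral>x. norm (f n x - g x) ^ 2 \<partial>disc) \<le> ennreal e" using N[OF n] nn_integral_eq_integral[OF di(1)] by simp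
    then have ie: "(\<integral>x. norm (f n x - g x) ^ 2 \<partial>disc) \<le> e" using e by simp
    have ci: "integrable disc (\<lambda>x. c)" by (rule finite_measure.integrable_const[OF finite_measure_disc])
    have "(\<integral>x. q x *\<^sub>R f n x \<partial>disc) - (\<integral>x. q x *\<^sub>R g x \<partial>disc) = (\<integral>x. q x *\<^sub>R (f n x - g x) \<partial>disc)"
      unfolding scaleR_diff_right using bounded_mult_integrable_disc[OF q L1[OF f(1)]] bounded_mult_integrable_disc[OF q L1[OF f(2)]] by simp
    also have "norm \<dots> \<le> (\<integral>x. norm (q x *\<^sub>R (f n x - g x)) \<partial>disc)" by (rule integral_norm_bound)
    also have "\<dots> \<le> (\<integral>x. K * (c + 1 / c * norm (f n x - g x) ^ 2) \<partial>disc)"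
    proof (rule integral_mono)
      show "integrable disc (\<lambda>x. norm (q x *\<^sub>R (f n x - g x)))" by (intro integrable_norm bounded_mult_integrable_disc[OF q L1[OF d]])
      show "integrable disc (\<lambda>x. K * (c + 1 / c * norm (f n x - g x) ^ 2))"
        by (intro integrable_mult_right Bochner_Integration.integrable_add ci di)
      fix x
      let ?u = "norm (f n x - g x)"
      have "?u \<le> c + 1 / c * ?u\<^sup>2"
      proof (cases "?u \<le> c")
        case False
        then have "c * ?u \<le> ?u * ?u" by (intro mult_right_mono) auto
        then have "?u \<le> 1 / c * ?u\<^sup>2" using c by (simp add: pos_le_divide_eq power2_eq_square mult.commute)
        then show ?thesis using c by simp
      qed (use c in \<open>simp add: add_increasing2\<close>)
      then have "\<bar>q x\<bar> * ?u \<le> K * (c + 1 / c * ?u\<^sup>2)" using q(2)[of x] K0 by (intro mult_mono) auto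
      then show "norm (q x *\<^sub>R (f n x - g x)) \<le> K * (c + 1 / c * norm (f n x - g x) ^ 2)" by simp
    qed
    also have "\<dots> = K * (c * \<mu> + 1 / c * (\<integral>x. norm (f n x - g x) ^ 2 \<partial>disc))"
    proof -
      have "(\<integral>x. c + 1 / c * norm (f n x - g x) ^ 2 \<partial>disc) = (\<integral>x. c \<partial>disc) + (\<integral>x. 1 / c * norm (f n x - g x) ^ 2 \<partial>disc)"
        by (rule Bochner_Integration.integral_add[OF ci integrable_mult_right[OF di(1)]])
      then show ?thesis by (simp add: \<mu>_def mult.commute)
    qed
    also have "\<dots> \<le> K * (c * \<mu> + 1 / c * e)" using ie c K0 by (intro mult_left_mono add_left_mono) auto
    also have "\<dots> \<le> (K + 1) * (c * (\<mu> + 1) + 1 / c * e)" using c e K0 mu0 by (intro mult_mono add_mono) auto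
    also have "\<dots> = r / 2 + r / 4"
    proof -
      have cancel: "a * (r / (2 * a * b) * b) = r / 2" "a * (1 / c * (c * r / (4 * a))) = r / 4" if "a > 0" "b > 0" for a b :: real
        using that c by (auto simp: field_simps)
      have "(K + 1) * (c * (\<mu> + 1)) = r / 2" "(K + 1) * (1 / c * e) = r / 4" unfolding e_def using cancel[of "K + 1" "\<mu> + 1"] K0 mu0 by (auto simp: c_def)
      then show ?thesis by (simp add: distrib_left)
    qed
    also have "\<dots> < r" using r by simp
    finally show ?thesis .
  qed
  then show "\<exists>no. \<forall>n\<ge>no. norm ((\<integral>x. q x *\<^sub>R f n x \<partial>disc) - (\<integral>x. q x *\<^sub>R g x \<partial>disc)) < r" by blast
qed

text \<open>Test functions and their derivatives are bounded, so both sides of the defining identity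
  pass to the limit in mean square.\<close>

lemma weak_pdiff_limit:
  fixes f f' :: "nat \<Rightarrow> real^2 \<Rightarrow> real^3"
  assumes w: "\<And>n. weak_pdiff (ball 0 1) (f n) i (f' n)"
    and L: "\<And>n. L2_on (ball 0 1) (f n)" "L2_on (ball 0 1) g" "\<And>n. L2_on (ball 0 1) (f' n)" "L2_on (ball 0 1) g'"
    and l: "\<And>e. e > 0 \<Longrightarrow> \<exists>N. \<forall>n\<ge>N. (\<integral>\<^sup>+x. ennreal (norm (f n x - g x) ^ 2) \<partial>disc) \<le> ennreal e"
      "\<And>e. e > 0 \<Longrightarrow> \<exists>N. \<forall>n\<ge>N. (\<integral>\<^sup>+x. ennreal (norm (f' n x - g' x) ^ 2) \<partial>disc) \<le> ennreal e"
  shows "weak_pdiff (ball 0 1) g i g'"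
  unfolding weak_pdiff_disc
proof (intro allI impI)
  fix \<phi> assume t: "test_fun (ball 0 1) \<phi>"
  then obtain K where K: "\<And>x. \<bar>\<phi> x\<bar> \<le> K" "\<And>x i. \<bar>pdiff \<phi> i x\<bar> \<le> K" and m: "\<phi> \<in> borel_measurable disc" "\<And>i. pdiff \<phi> i \<in> borel_measurable disc"
    by (rule test_fun_bounded) blast
  have 1: "(\<lambda>n. \<integral>x. pdiff \<phi> i x *\<^sub>R f n x \<partial>disc) \<longlonglongrightarrow> (\<integral>x. pdiff \<phi> i x *\<^sub>R g x \<partial>disc)"
    by (rule L2_bounded_mult_tendsto[OF m(2) K(2) L(1,2) l(1)])
  have 2: "(\<lambda>n. - (\<integral>x. \<phi> x *\<^sub>R f' n x \<partial>disc)) \<longlonglongrightarrow> - (\<integral>x. \<phi> x *\<^sub>R g' x \<partial>disc)"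
    by (intro tendsto_minus L2_bounded_mult_tendsto[OF m(1) K(1) L(3,4) l(2)])
  have "(\<integral>x. pdiff \<phi> i x *\<^sub>R f n x \<partial>disc) = - (\<integral>x. \<phi> x *\<^sub>R f' n x \<partial>disc)" for n using w t by (simp add: weak_pdiff_disc)
  with 1 2 show "(\<integral>x. pdiff \<phi> i x *\<^sub>R g x \<partial>disc) = - (\<integral>x. \<phi> x *\<^sub>R g' x \<partial>disc)" using LIMSEQ_unique by simp
qed

section \<open>Perturbation of the membrane and bending densities\<close>

definition quart :: "(2 \<Rightarrow> real^3) \<Rightarrow> real" where "quart d = (\<Sum>i\<in>UNIV. norm (d i) ^ 4)"

lemma quart_nonneg: "0 \<le> quart d" by (simp add: quart_def sum_nonneg)

lemma memb_2: "memb d = (norm (d 1) ^ 2 - 1)\<^sup>2 + (norm (d 2) ^ 2 - 1)\<^sup>2 + 2 * (d 1 \<bullet> d 2)\<^sup>2"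
  by (simp add: memb_def sum_2 power2_norm_eq_inner inner_commute)

lemma memb_le_quart: "memb d \<le> 4 * quart d + 4"
proof -
  let ?p = "norm (d 1) ^ 2" and ?q = "norm (d 2) ^ 2"
  have c: "(d 1 \<bullet> d 2)\<^sup>2 \<le> ?p * ?q" using Cauchy_Schwarz_ineq[of "d 1" "d 2"] by (simp add: power2_norm_eq_inner)
  have pq: "2 * (?p * ?q) \<le> ?p\<^sup>2 + ?q\<^sup>2" using sum_squares_bound[of ?p ?q] by simp
  have s: "(a - 1)\<^sup>2 \<le> 2 * a\<^sup>2 + 2" for a :: real using zero_le_power2[of "a + 1"] by (simp add: power2_eq_square algebra_simps)
  have "quart d = ?p\<^sup>2 + ?q\<^sup>2" by (simp add: quart_def sum_2)
  moreover have "memb d \<le> (2 * ?p\<^sup>2 + 2) + (2 * ?q\<^sup>2 + 2) + 2 * (?p * ?q)" unfolding memb_2 using c s[of ?p] s[of ?q] by linarith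
  moreover have "0 \<le> ?p\<^sup>2" "0 \<le> ?q\<^sup>2" by simp_all
  ultimately show ?thesis using pq by linarith
qed

text \<open>Coercivity from \<open>a\<^sup>2 \<le> 2 * (a - 1)\<^sup>2 + 2\<close>: bounded membrane
  energy bounds the gradient in L^4.\<close>

lemma quart_le_memb: "quart d \<le> 2 * memb d + 4"
proof -
  have s: "a\<^sup>2 \<le> 2 * (a - 1)\<^sup>2 + 2" for a :: real using zero_le_power2[of "a - 2"] by (simp add: power2_eq_square algebra_simps)
  have q: "quart d = (norm (d 1) ^ 2)\<^sup>2 + (norm (d 2) ^ 2)\<^sup>2" by (simp add: quart_def sum_2)
  have "u + v \<le> 2 * (a + b + 2 * c) + 4" if "u \<le> 2 * a + 2" "v \<le> 2 * b + 2" "0 \<le> c" for u v a b c :: real using that unfolding distrib_left by linarith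
  from this[OF s s zero_le_power2] show ?thesis unfolding memb_2 q .
qed

lemma square_add_le_weighted: "(a + b)\<^sup>2 \<le> (1 + \<theta>) * a\<^sup>2 + (1 + 1 / \<theta>) * b\<^sup>2" if "\<theta> > 0" for a b \<theta> :: real
proof -
  have "2 * (sqrt \<theta> * a) * (b / sqrt \<theta>) \<le> (sqrt \<theta> * a)\<^sup>2 + (b / sqrt \<theta>)\<^sup>2" by (rule sum_squares_bound)
  then have "2 * a * b \<le> \<theta> * a\<^sup>2 + b\<^sup>2 / \<theta>" using that by (simp add: power_mult_distrib power_divide)
  then show ?thesis by (simp add: power2_sum algebra_simps)
qed

text \<open>Takes the place of convexity. Young's inequality splits each product of \<open>d\<close>
  with \<open>e - d\<close> into a small multiple of the fourth power of \<open>d\<close> and a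
  large multiple of the fourth power of the difference, and the latter disappears under L^4
  convergence. Summation over the four index pairs turns 3 and 6 into 12 and 24; the term
  \<open>\<theta> * memb d\<close> raises 12 to 16.\<close>

lemma memb_perturb:
  assumes t: "0 < \<theta>" "\<theta> \<le> 1"
  shows "memb e \<le> memb d + 16 * \<theta> * (1 + quart d) + 24 / \<theta> ^ 3 * quart (\<lambda>i. e i - d i)"
proof -
  define \<delta> where "\<delta> = (\<lambda>i. e i - d i)"
  let ?a = "\<lambda>i. norm (d i)" and ?b = "\<lambda>i. norm (\<delta> i)"
  have trm: "(e i \<bullet> e j - k)\<^sup>2 \<le> (1 + \<theta>) * (d i \<bullet> d j - k)\<^sup>2 + (3 * \<theta> * (?a i ^ 4 + ?a j ^ 4) + 6 / \<theta> ^ 3 * (?b i ^ 4 + ?b j ^ 4))" for i j k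
  proof -
    define P where "P = d i \<bullet> \<delta> j + \<delta> i \<bullet> d j + \<delta> i \<bullet> \<delta> j"
    have e: "e i \<bullet> e j - k = (d i \<bullet> d j - k) + P" by (simp add: P_def \<delta>_def inner_diff_left inner_diff_right inner_commute)
    have sq3: "(u + v + w)\<^sup>2 \<le> 3 * (u\<^sup>2 + v\<^sup>2 + w\<^sup>2)" for u v w :: real
      using sum_squares_bound[of u v] sum_squares_bound[of u w] sum_squares_bound[of v w] by (simp add: power2_eq_square algebra_simps)
    have cs: "(u \<bullet> v)\<^sup>2 \<le> norm u ^ 2 * norm v ^ 2" for u v :: "real^3" using Cauchy_Schwarz_ineq[of u v] by (simp add: power2_norm_eq_inner)
    have am: "u\<^sup>2 * v\<^sup>2 \<le> (\<theta>\<^sup>2 * u ^ 4 + v ^ 4 / \<theta>\<^sup>2) / 2" for u v :: real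
    proof -
      have "2 * (\<theta> * u\<^sup>2) * (v\<^sup>2 / \<theta>) \<le> (\<theta> * u\<^sup>2)\<^sup>2 + (v\<^sup>2 / \<theta>)\<^sup>2" by (rule sum_squares_bound)
      then show ?thesis using t by (simp add: power_mult_distrib power_divide)
    qed
    have am2: "u\<^sup>2 * v\<^sup>2 \<le> (u ^ 4 / \<theta>\<^sup>2 + v ^ 4 / \<theta>\<^sup>2) / 2" for u v :: real
    proof -
      have 1: "2 * u\<^sup>2 * v\<^sup>2 \<le> (u\<^sup>2)\<^sup>2 + (v\<^sup>2)\<^sup>2" by (rule sum_squares_bound)
      have "\<theta>\<^sup>2 \<le> 1" using t by (simp add: power_le_one)
      then have 2: "x ^ 4 \<le> x ^ 4 / \<theta>\<^sup>2" for x :: real using t by (simp add: pos_le_divide_eq mult_left_le)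
      show ?thesis using 1 2[of u] 2[of v] by simp
    qed
    have "P\<^sup>2 \<le> 3 * (?a i ^ 2 * ?b j ^ 2 + ?b i ^ 2 * ?a j ^ 2 + ?b i ^ 2 * ?b j ^ 2)"
      unfolding P_def by (rule order_trans[OF sq3]) (intro mult_left_mono add_mono cs, simp)
    also have "\<dots> \<le> 3 * (\<theta>\<^sup>2 * (?a i ^ 4 + ?a j ^ 4) / 2 + (?b i ^ 4 + ?b j ^ 4) / \<theta>\<^sup>2)"
      using am[of "?a i" "?b j"] am[of "?a j" "?b i"] am2[of "?b i" "?b j"] by (simp add: algebra_simps add_divide_distrib)
    finally have P: "P\<^sup>2 \<le> 3 * (\<theta>\<^sup>2 * (?a i ^ 4 + ?a j ^ 4) / 2 + (?b i ^ 4 + ?b j ^ 4) / \<theta>\<^sup>2)" .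
    have "1 + 1 / \<theta> \<le> 2 / \<theta>" using t by (simp add: field_simps)
    then have "(1 + 1 / \<theta>) * P\<^sup>2 \<le> 2 / \<theta> * (3 * (\<theta>\<^sup>2 * (?a i ^ 4 + ?a j ^ 4) / 2 + (?b i ^ 4 + ?b j ^ 4) / \<theta>\<^sup>2))"
      using P t by (intro mult_mono) auto
    also have "\<dots> = 3 * \<theta> * (?a i ^ 4 + ?a j ^ 4) + 6 / \<theta> ^ 3 * (?b i ^ 4 + ?b j ^ 4)"
      using t by (simp add: power2_eq_square power3_eq_cube divide_simps)
    finally show ?thesis unfolding e using square_add_le_weighted[OF t(1), of "d i \<bullet> d j - k" P] by linarith
  qed
  have "memb e \<le> (\<Sum>i\<in>UNIV. \<Sum>j\<in>UNIV. (1 + \<theta>) * (d i \<bullet> d j - (if i = j then 1 else 0))\<^sup>2 + (3 * \<theta> * (?a i ^ 4 + ?a j ^ 4) + 6 / \<theta> ^ 3 * (?b i ^ 4 + ?b j ^ 4)))"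
    unfolding memb_def by (intro sum_mono trm)
  also have "\<dots> = (1 + \<theta>) * memb d + (12 * \<theta> * quart d + 24 / \<theta> ^ 3 * quart \<delta>)"
    by (simp add: sum.distrib memb_def quart_def sum_2 algebra_simps add_divide_distrib)
  finally have "memb e \<le> memb d + \<theta> * memb d + (12 * \<theta> * quart d + 24 / \<theta> ^ 3 * quart \<delta>)" by (simp add: distrib_right)
  moreover have "\<theta> * memb d \<le> \<theta> * (4 * quart d + 4)" using t memb_le_quart by (intro mult_left_mono) auto
  moreover have "0 \<le> \<theta>" using t by simp
  ultimately show ?thesis unfolding \<delta>_def by (simp add: algebra_simps)
qed

lemma bend_perturb:
  assumes "0 < \<theta>"
  shows "bend e \<le> (1 + \<theta>) * bend d + (1 + 1 / \<theta>) * bend (\<lambda>i j. e i j - d i j)"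
proof -
  have "(norm (e i j))\<^sup>2 \<le> (1 + \<theta>) * (norm (d i j))\<^sup>2 + (1 + 1 / \<theta>) * (norm (e i j - d i j))\<^sup>2" for i j
  proof -
    have "(norm (e i j))\<^sup>2 \<le> (norm (d i j) + norm (e i j - d i j))\<^sup>2" using norm_triangle_ineq[of "d i j" "e i j - d i j"] by (intro power_mono) auto
    then show ?thesis using square_add_le_weighted[OF assms, of "norm (d i j)" "norm (e i j - d i j)"] by linarith
  qed
  then have "bend e \<le> (\<Sum>i\<in>UNIV. \<Sum>j\<in>UNIV. (1 + \<theta>) * (norm (d i j))\<^sup>2 + (1 + 1 / \<theta>) * (norm (e i j - d i j))\<^sup>2)" unfolding bend_def by (intro sum_mono)
  also have "\<dots> = (1 + \<theta>) * bend d + (1 + 1 / \<theta>) * bend (\<lambda>i j. e i j - d i j)"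
    by (simp only: bend_def sum.distrib sum_distrib_left)
  finally show ?thesis .
qed

lemma bend_midpoint: "bend (\<lambda>i j. (1/2) *\<^sub>R a i j + (1/2) *\<^sub>R b i j) = bend a / 2 + bend b / 2 - bend (\<lambda>i j. a i j - b i j) / 4"
proof -
  have "(norm ((1/2) *\<^sub>R u + (1/2) *\<^sub>R v))\<^sup>2 = (norm u)\<^sup>2 / 2 + (norm v)\<^sup>2 / 2 - (norm (u - v))\<^sup>2 / 4" for u v :: "real^3"
    by (simp add: power2_norm_eq_inner inner_add_left inner_add_right inner_diff_left inner_diff_right inner_commute field_simps)
  then show ?thesis unfolding bend_def by (simp add: sum.distrib sum_subtractf sum_divide_distrib)
qed

text \<open>The midpoint differs from either end by half the difference; the estimates
  \<open>memb_perturb\<close> from the two ends are averaged.\<close>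

lemma memb_midpoint:
  assumes t: "0 < \<theta>" "\<theta> \<le> 1"
  shows "memb (\<lambda>i. (1/2) *\<^sub>R d i + (1/2) *\<^sub>R e i) \<le> memb d / 2 + memb e / 2 + 8 * \<theta> * (2 + quart d + quart e) + 24 / \<theta> ^ 3 * quart (\<lambda>i. d i - e i)"
proof -
  let ?m = "\<lambda>i. (1/2) *\<^sub>R d i + (1/2) *\<^sub>R e i"
  have half: "?m i - d i = (1/2) *\<^sub>R (e i - d i)" "?m i - e i = (1/2) *\<^sub>R (d i - e i)" for i
    by (simp_all add: vec_eq_iff field_simps)
  have q: "quart (\<lambda>i. (1/2) *\<^sub>R f i) \<le> quart f" for f by (simp add: quart_def sum_mono power_mult_distrib power_one_over)
  have sym: "quart (\<lambda>i. e i - d i) = quart (\<lambda>i. d i - e i)" by (simp add: quart_def norm_minus_commute)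
  have c: "24 / \<theta> ^ 3 \<ge> 0" using t by simp
  have "memb ?m \<le> memb d + 16 * \<theta> * (1 + quart d) + 24 / \<theta> ^ 3 * quart (\<lambda>i. d i - e i)"
    using memb_perturb[OF t, of ?m d] mult_left_mono[OF q[of "\<lambda>i. e i - d i"] c] unfolding half sym by linarith
  moreover have "memb ?m \<le> memb e + 16 * \<theta> * (1 + quart e) + 24 / \<theta> ^ 3 * quart (\<lambda>i. d i - e i)"
    using memb_perturb[OF t, of ?m e] mult_left_mono[OF q[of "\<lambda>i. d i - e i"] c] unfolding half by linarith
  ultimately show ?thesis by (simp add: algebra_simps)
qed

text \<open>A Bochner integral of a nonintegrable function is 0 by convention, so
  \<open>energy\<close> is meaningful only when its integrand is integrable. \<open>W4\<close> and
  \<open>H2\<close> guarantee this for the membrane and the bending part. \<open>W22\<close>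
  contains the second condition, while the first has to be derived.\<close>

definition W4 :: "(real^2 \<Rightarrow> 2 \<Rightarrow> real^3) \<Rightarrow> bool" where
  "W4 D \<longleftrightarrow> (\<forall>i. (\<lambda>x. D x i) \<in> borel_measurable disc) \<and> integrable disc (\<lambda>x. quart (D x))"
definition H2 :: "(real^2 \<Rightarrow> 2 \<Rightarrow> 2 \<Rightarrow> real^3) \<Rightarrow> bool" where
  "H2 D \<longleftrightarrow> (\<forall>i j. L2_on (ball 0 1) (\<lambda>x. D x i j))"
abbreviation area :: real where "area \<equiv> measure disc (space disc)"

lemma quart_add_le: "quart (\<lambda>i. a i + b i) \<le> 8 * quart a + 8 * quart b"
  unfolding quart_def sum_distrib_left sum.distrib[symmetric] by (intro sum_mono norm_sum_power4)

lemma quart_scale: "quart (\<lambda>i. c *\<^sub>R a i) = c ^ 4 * quart a"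
  by (simp add: quart_def power_mult_distrib sum_distrib_left)

lemma borel_measurable_quart:
  assumes "\<And>i. (\<lambda>x. D x i) \<in> borel_measurable M"
  shows "(\<lambda>x. quart (D x)) \<in> borel_measurable M"
  using assms unfolding quart_def by measurable

lemma borel_measurable_memb:
  assumes [measurable]: "\<And>i. (\<lambda>x. D x i) \<in> borel_measurable M"
  shows "(\<lambda>x. memb (D x)) \<in> borel_measurable M"
  unfolding memb_def by measurable

lemma integrable_const_disc: "integrable disc (\<lambda>x. c :: real)"
  by (rule finite_measure.integrable_const[OF finite_measure_disc])

lemma W4_lincomb:
  assumes D: "W4 D" and E: "W4 E"
  shows "W4 (\<lambda>x i. a *\<^sub>R D x i + b *\<^sub>R E x i)"
proof -
  have m[measurable]: "\<And>i. (\<lambda>x. D x i) \<in> borel_measurable disc" "\<And>i. (\<lambda>x. E x i) \<in> borel_measurable disc" using D E by (auto simp: W4_def)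
  have ml: "(\<lambda>x. a *\<^sub>R D x i + b *\<^sub>R E x i) \<in> borel_measurable disc" for i by measurable
  have "integrable disc (\<lambda>x. quart (\<lambda>i. a *\<^sub>R D x i + b *\<^sub>R E x i))"
  proof (rule Bochner_Integration.integrable_bound[where f="\<lambda>x. 8 * (a ^ 4 * quart (D x)) + 8 * (b ^ 4 * quart (E x))"])
    show "integrable disc (\<lambda>x. 8 * (a ^ 4 * quart (D x)) + 8 * (b ^ 4 * quart (E x)))" using D E by (simp add: W4_def)
    show "(\<lambda>x. quart (\<lambda>i. a *\<^sub>R D x i + b *\<^sub>R E x i)) \<in> borel_measurable disc" by (rule borel_measurable_quart[OF ml])
    have "norm (quart (\<lambda>i. a *\<^sub>R D x i + b *\<^sub>R E x i)) \<le> norm (8 * (a ^ 4 * quart (D x)) + 8 * (b ^ 4 * quart (E x)))" for x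
      using quart_add_le[of "\<lambda>i. a *\<^sub>R D x i" "\<lambda>i. b *\<^sub>R E x i"] by (simp add: quart_scale quart_nonneg abs_of_nonneg)
    then show "AE x in disc. norm (quart (\<lambda>i. a *\<^sub>R D x i + b *\<^sub>R E x i)) \<le> norm (8 * (a ^ 4 * quart (D x)) + 8 * (b ^ 4 * quart (E x)))" by simp
  qed
  then show ?thesis using ml by (simp add: W4_def)
qed

lemma W4_diff: "W4 D \<Longrightarrow> W4 E \<Longrightarrow> W4 (\<lambda>x i. D x i - E x i)"
  using W4_lincomb[of D E 1 "-1"] by simp

lemma W4_memb:
  assumes "W4 D" shows "integrable disc (\<lambda>x. memb (D x))"
proof (rule Bochner_Integration.integrable_bound[where f="\<lambda>x. 4 * quart (D x) + 4"])
  show "integrable disc (\<lambda>x. 4 * quart (D x) + 4)" using assms integrable_const_disc by (simp add: W4_def)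
  show "(\<lambda>x. memb (D x)) \<in> borel_measurable disc" using assms by (intro borel_measurable_memb) (simp add: W4_def)
  show "AE x in disc. norm (memb (D x)) \<le> norm (4 * quart (D x) + 4)"
    by (simp add: memb_nonneg quart_nonneg abs_of_nonneg memb_le_quart)
qed

lemma H2_lincomb: "H2 D \<Longrightarrow> H2 E \<Longrightarrow> H2 (\<lambda>x i j. a *\<^sub>R D x i j + b *\<^sub>R E x i j)"
  unfolding H2_def by (intro allI L2_on_lincomb) auto

lemma H2_diff: "H2 D \<Longrightarrow> H2 E \<Longrightarrow> H2 (\<lambda>x i j. D x i j - E x i j)"
  using H2_lincomb[of D E 1 "-1"] by simp

lemma H2_bend: "H2 D \<Longrightarrow> integrable disc (\<lambda>x. bend (D x))"
  unfolding H2_def bend_def by (intro Bochner_Integration.integrable_sum) (simp add: L2_on_disc)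

lemma energy_split:
  assumes "W4 D" "H2 D2"
  shows "energy h D D2 = (\<integral>x. memb (D x) \<partial>disc) + h\<^sup>2 * (\<integral>x. bend (D2 x) \<partial>disc)"
  unfolding energy_disc using W4_memb[OF assms(1)] H2_bend[OF assms(2)] by simp

lemma energy_nonneg: "0 \<le> energy h D D2"
  unfolding energy_disc by (rule integral_nonneg_AE) (simp add: memb_nonneg bend_nonneg)

lemma integral_memb_perturb:
  assumes t: "0 < \<theta>" "\<theta> \<le> 1" and D: "W4 D" and E: "W4 E"
  shows "(\<integral>x. memb (E x) \<partial>disc) \<le> (\<integral>x. memb (D x) \<partial>disc) + 16 * \<theta> * (area + (\<integral>x. quart (D x) \<partial>disc)) + 24 / \<theta> ^ 3 * (\<integral>x. quart (\<lambda>i. E x i - D x i) \<partial>disc)"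
proof -
  have i: "integrable disc (\<lambda>x. memb (D x))" "integrable disc (\<lambda>x. quart (D x))" "integrable disc (\<lambda>x. quart (\<lambda>i. E x i - D x i))"
    using W4_memb[OF D] D W4_diff[OF E D] by (auto simp: W4_def)
  have "(\<integral>x. memb (E x) \<partial>disc) \<le> (\<integral>x. memb (D x) + 16 * \<theta> * (1 + quart (D x)) + 24 / \<theta> ^ 3 * quart (\<lambda>i. E x i - D x i) \<partial>disc)"
    using i by (intro integral_mono W4_memb[OF E] memb_perturb t Bochner_Integration.integrable_add integrable_mult_right integrable_const_disc)
  also have "\<dots> = (\<integral>x. memb (D x) \<partial>disc) + 16 * \<theta> * (area + (\<integral>x. quart (D x) \<partial>disc)) + 24 / \<theta> ^ 3 * (\<integral>x. quart (\<lambda>i. E x i - D x i) \<partial>disc)"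
    using i integrable_const_disc[of 1] by (simp add: mult.commute)
  finally show ?thesis .
qed

lemma integral_bend_perturb:
  assumes t: "0 < \<theta>" and D: "H2 D" and E: "H2 E"
  shows "(\<integral>x. bend (E x) \<partial>disc) \<le> (1 + \<theta>) * (\<integral>x. bend (D x) \<partial>disc) + (1 + 1 / \<theta>) * (\<integral>x. bend (\<lambda>i j. E x i j - D x i j) \<partial>disc)"
proof -
  have "(\<integral>x. bend (E x) \<partial>disc) \<le> (\<integral>x. (1 + \<theta>) * bend (D x) + (1 + 1 / \<theta>) * bend (\<lambda>i j. E x i j - D x i j) \<partial>disc)"
    by (intro integral_mono bend_perturb t Bochner_Integration.integrable_add integrable_mult_right H2_bend H2_diff D E)
  also have "\<dots> = (1 + \<theta>) * (\<integral>x. bend (D x) \<partial>disc) + (1 + 1 / \<theta>) * (\<integral>x. bend (\<lambda>i j. E x i j - D x i j) \<partial>disc)"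
    using H2_bend[OF D] H2_bend[OF H2_diff[OF E D]] by simp
  finally show ?thesis .
qed

lemma integral_quart_le_memb:
  assumes D: "W4 D"
  shows "(\<integral>x. quart (D x) \<partial>disc) \<le> 2 * (\<integral>x. memb (D x) \<partial>disc) + 4 * area"
proof -
  have "(\<integral>x. quart (D x) \<partial>disc) \<le> (\<integral>x. 2 * memb (D x) + 4 \<partial>disc)"
    using D by (intro integral_mono quart_le_memb Bochner_Integration.integrable_add integrable_mult_right integrable_const_disc W4_memb) (simp_all add: W4_def)
  also have "\<dots> = 2 * (\<integral>x. memb (D x) \<partial>disc) + 4 * area" using W4_memb[OF D] integrable_const_disc[of 4] by simp
  finally show ?thesis .
qed

lemma integral_energy_midpoint:
  assumes t: "0 < \<theta>" "\<theta> \<le> 1" and D: "W4 D" "H2 D2" and E: "W4 E" "H2 E2"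
  shows "energy h (\<lambda>x i. (1/2) *\<^sub>R D x i + (1/2) *\<^sub>R E x i) (\<lambda>x i j. (1/2) *\<^sub>R D2 x i j + (1/2) *\<^sub>R E2 x i j)
    \<le> energy h D D2 / 2 + energy h E E2 / 2 + 8 * \<theta> * (2 * area + (\<integral>x. quart (D x) \<partial>disc) + (\<integral>x. quart (E x) \<partial>disc))
      + 24 / \<theta> ^ 3 * (\<integral>x. quart (\<lambda>i. D x i - E x i) \<partial>disc) - h\<^sup>2 / 4 * (\<integral>x. bend (\<lambda>i j. D2 x i j - E2 x i j) \<partial>disc)"
proof -
  have i: "integrable disc (\<lambda>x. memb (D x))" "integrable disc (\<lambda>x. quart (D x))" "integrable disc (\<lambda>x. memb (E x))" "integrable disc (\<lambda>x. quart (E x))"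
     "integrable disc (\<lambda>x. quart (\<lambda>i. D x i - E x i))"
    using W4_memb D E W4_diff[OF D(1) E(1)] by (auto simp: W4_def)
  have j: "integrable disc (\<lambda>x. bend (D2 x))" "integrable disc (\<lambda>x. bend (E2 x))" "integrable disc (\<lambda>x. bend (\<lambda>i j. D2 x i j - E2 x i j))"
    by (intro H2_bend H2_diff D E)+
  have "(\<integral>x. memb (\<lambda>i. (1/2) *\<^sub>R D x i + (1/2) *\<^sub>R E x i) \<partial>disc) \<le> (\<integral>x. memb (D x) / 2 + memb (E x) / 2 + 8 * \<theta> * (2 + quart (D x) + quart (E x)) + 24 / \<theta> ^ 3 * quart (\<lambda>i. D x i - E x i) \<partial>disc)"
    using i by (intro integral_mono W4_memb W4_lincomb D E memb_midpoint t Bochner_Integration.integrable_add integrable_mult_right integrable_const_disc Bochner_Integration.integrable_divide)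
  also have "\<dots> = (\<integral>x. memb (D x) \<partial>disc) / 2 + (\<integral>x. memb (E x) \<partial>disc) / 2 + 8 * \<theta> * (2 * area + (\<integral>x. quart (D x) \<partial>disc) + (\<integral>x. quart (E x) \<partial>disc)) + 24 / \<theta> ^ 3 * (\<integral>x. quart (\<lambda>i. D x i - E x i) \<partial>disc)"
    using i integrable_const_disc[of 2] by (simp add: mult.commute)
  finally have 1: "(\<integral>x. memb (\<lambda>i. (1/2) *\<^sub>R D x i + (1/2) *\<^sub>R E x i) \<partial>disc) \<le> \<dots>" .
  have 2: "(\<integral>x. bend (\<lambda>i j. (1/2) *\<^sub>R D2 x i j + (1/2) *\<^sub>R E2 x i j) \<partial>disc) = (\<integral>x. bend (D2 x) \<partial>disc) / 2 + (\<integral>x. bend (E2 x) \<partial>disc) / 2 - (\<integral>x. bend (\<lambda>i j. D2 x i j - E2 x i j) \<partial>disc) / 4"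
    unfolding bend_midpoint using j by simp
  show ?thesis unfolding energy_split[OF W4_lincomb[OF D(1) E(1)] H2_lincomb[OF D(2) E(2)]] energy_split[OF D] energy_split[OF E] 2
    using 1 by (simp add: algebra_simps add_divide_distrib diff_divide_distrib)
qed

lemma H2_integral_bound:
  assumes "H2 D"
  shows "(\<integral>\<^sup>+x. ennreal (norm (D x i j) ^ 2) \<partial>disc) \<le> ennreal (\<integral>x. bend (D x) \<partial>disc)"
proof -
  have "(\<integral>\<^sup>+x. ennreal (norm (D x i j) ^ 2) \<partial>disc) \<le> (\<integral>\<^sup>+x. ennreal (bend (D x)) \<partial>disc)"
  proof (intro nn_integral_mono ennreal_leI)
    fix x
    have "norm (D x i j) ^ 2 \<le> (\<Sum>j\<in>UNIV. norm (D x i j) ^ 2)" by (rule member_le_sum) auto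
    also have "\<dots> \<le> bend (D x)" unfolding bend_def by (rule member_le_sum[of i]) (auto intro: sum_nonneg)
    finally show "norm (D x i j) ^ 2 \<le> bend (D x)" .
  qed
  also have "\<dots> = ennreal (\<integral>x. bend (D x) \<partial>disc)" by (rule nn_integral_eq_integral[OF H2_bend[OF assms]]) (simp add: bend_nonneg)
  finally show ?thesis .
qed

lemma W22_H2: "W22 (ball 0 1) y D D2 \<Longrightarrow> H2 D2"
  by (simp add: W22_def H2_def)

text \<open>\<open>gn_weak\<close> in both directions. Each pure second derivative is bounded by the
  whole bending density, so the constant doubles from 144 to 288.\<close>

lemma gn_quart:
  assumes w: "W22 (ball 0 1) w Dw D2w" and wc: "continuous_on (cball 0 1) w"
    and z: "\<And>x. x \<in> sphere 0 1 \<Longrightarrow> w x = 0" and M: "\<And>x. x \<in> cball 0 1 \<Longrightarrow> norm (w x) \<le> M"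
  shows "W4 Dw" "(\<integral>x. quart (Dw x) \<partial>disc) \<le> 288 * M\<^sup>2 * (\<integral>x. bend (D2w x) \<partial>disc)"
proof -
  let ?B = "\<integral>x. bend (D2w x) \<partial>disc"
  have B: "?B \<ge> 0" by (rule integral_nonneg_AE) (simp add: bend_nonneg)
  have m[measurable]: "\<And>i. (\<lambda>x. Dw x i) \<in> borel_measurable disc" using w by (auto simp: W22_def L2_on_disc)
  have i: "(\<integral>\<^sup>+x. ennreal (norm (Dw x i) ^ 4) \<partial>disc) \<le> ennreal (144 * M\<^sup>2 * ?B)" for i
  proof -
    have "(\<integral>\<^sup>+x. ennreal (norm (Dw x i) ^ 4) \<partial>disc) \<le> ennreal (144 * M\<^sup>2) * (\<integral>\<^sup>+x. ennreal (norm (D2w x i i) ^ 2) \<partial>disc)" by (rule gn_weak[OF w wc z M])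
    also have "\<dots> \<le> ennreal (144 * M\<^sup>2) * ennreal ?B" by (intro mult_left_mono H2_integral_bound W22_H2[OF w]) simp
    also have "\<dots> = ennreal (144 * M\<^sup>2 * ?B)" by (simp add: ennreal_mult B)
    finally show ?thesis .
  qed
  have q: "(\<integral>\<^sup>+x. ennreal (quart (Dw x)) \<partial>disc) \<le> ennreal (288 * M\<^sup>2 * ?B)"
  proof -
    have "(\<integral>\<^sup>+x. ennreal (quart (Dw x)) \<partial>disc) = (\<integral>\<^sup>+x. ennreal (norm (Dw x 1) ^ 4) + ennreal (norm (Dw x 2) ^ 4) \<partial>disc)"
      by (intro nn_integral_cong) (simp add: quart_def sum_2 ennreal_plus)
    also have "\<dots> = (\<integral>\<^sup>+x. ennreal (norm (Dw x 1) ^ 4) \<partial>disc) + (\<integral>\<^sup>+x. ennreal (norm (Dw x 2) ^ 4) \<partial>disc)" by (rule nn_integral_add) measurable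
    also have "\<dots> \<le> ennreal (144 * M\<^sup>2 * ?B) + ennreal (144 * M\<^sup>2 * ?B)" by (intro add_mono i)
    also have "\<dots> = ennreal (288 * M\<^sup>2 * ?B)" using B by (simp flip: ennreal_plus)
    finally show ?thesis .
  qed
  have mq: "(\<lambda>x. quart (Dw x)) \<in> borel_measurable disc" by (rule borel_measurable_quart[OF m])
  have fin: "(\<integral>\<^sup>+x. ennreal (norm (quart (Dw x))) \<partial>disc) < \<infinity>" using q by (simp add: quart_nonneg abs_of_nonneg) (use le_less_trans ennreal_less_top in blast)
  have int: "integrable disc (\<lambda>x. quart (Dw x))" by (rule integrableI_bounded[OF mq fin])
  then show "W4 Dw" using m by (simp add: W4_def)
  have "ennreal (\<integral>x. quart (Dw x) \<partial>disc) \<le> ennreal (288 * M\<^sup>2 * ?B)"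
    using q nn_integral_eq_integral[OF int] by (simp add: quart_nonneg)
  moreover have "288 * M\<^sup>2 * ?B \<ge> 0" using B by simp
  ultimately show "(\<integral>x. quart (Dw x) \<partial>disc) \<le> 288 * M\<^sup>2 * ?B" by simp
qed

lemma C2on_W4:
  assumes C: "C2on r Y D D2" and r: "r > 1"
  shows "W4 D"
proof -
  have sub: "cball 0 1 \<subseteq> ball (0::real^2) r" using r by auto
  have "continuous_on (cball 0 1) (\<lambda>x. quart (D x))" unfolding quart_def
    by (intro continuous_intros continuous_on_subset[OF C2on_continuous(2)[OF C] sub])
  then show ?thesis using disc_polar(1) C2on_disc_measurable(2)[OF C r] by (simp add: W4_def)
qed

lemma W22_diff: "W22 (ball 0 1) y D D2 \<Longrightarrow> W22 (ball 0 1) y' D' D2' \<Longrightarrow> W22 (ball 0 1) (\<lambda>x. y x - y' x) (\<lambda>x i. D x i - D' x i) (\<lambda>x i j. D2 x i j - D2' x i j)"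
  using W22_lincomb[of y D D2 y' D' D2' 1 "-1"] by simp

lemma W4_integrable_power4:
  assumes "W4 D" shows "integrable disc (\<lambda>x. norm (D x i) ^ 4)"
proof (rule Bochner_Integration.integrable_bound[where f="\<lambda>x. quart (D x)"])
  have [measurable]: "(\<lambda>x. D x i) \<in> borel_measurable disc" using assms by (simp add: W4_def)
  show "(\<lambda>x. norm (D x i) ^ 4) \<in> borel_measurable disc" by measurable
  have "norm (D x i) ^ 4 \<le> quart (D x)" for x unfolding quart_def by (rule member_le_sum) auto
  then show "AE x in disc. norm (norm (D x i) ^ 4) \<le> norm (quart (D x))" by (simp add: quart_nonneg)
qed (use assms in \<open>simp add: W4_def\<close>)

text \<open>Morrey's inequality for mollifications, passed to the limit. The two splittings of a
  fourth power cost 8 each, whence 64, and the 1 added to \<open>I\<close> leaves room for the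
  mollification error.\<close>

lemma W22_morrey:
  assumes w: "W22 (ball 0 1) y Dy D2y" and yc: "continuous_on (cball 0 1) y" and D: "W4 Dy"
    and I: "(\<integral>x. quart (Dy x) \<partial>disc) \<le> I" and x: "norm x \<le> 1" "norm x' \<le> 1"
  shows "norm (y x - y x') \<le> (4 + 64 * (64 * (I + 1)) / pi) * sqrt (norm (x - x'))"
proof -
  have I0: "0 \<le> (\<integral>x. quart (Dy x) \<partial>disc)" by (rule integral_nonneg_AE) (simp add: quart_nonneg)
  then have I1: "I \<ge> 0" using I by linarith
  obtain r Y D D2 where r: "\<And>n::nat. r n > 1" and C: "\<And>n. C2on (r n) (Y n) (D n) (D2 n)"
    and U: "uniform_limit (cball 0 1) Y y sequentially"
    and L4: "\<And>i. integrable disc (\<lambda>x. norm (Dy x i) ^ 4) \<Longrightarrow> (\<lambda>n. \<integral>\<^sup>+x. ennreal (norm (D n x i - Dy x i) ^ 4) \<partial>disc) \<longlonglongrightarrow> 0"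
    by (rule W22_approx[OF w yc]) blast
  have m[measurable]: "(\<lambda>x. Dy x i) \<in> borel_measurable disc" "(\<lambda>x. D n x i) \<in> borel_measurable disc" for i n
    using D C2on_disc_measurable(2)[OF C r] by (simp_all add: W4_def)
  have mq: "(\<lambda>x. quart (Dy x)) \<in> borel_measurable disc" by (rule borel_measurable_quart) simp
  have ev: "\<forall>\<^sub>F n in sequentially. (\<integral>\<^sup>+x. ennreal (norm (D n x i - Dy x i) ^ 4) \<partial>disc) < ennreal (1/2)" for i
    by (rule order_tendstoD(2)[OF L4[OF W4_integrable_power4[OF D]]]) (rule ennreal_lessI[of "1/2" 0, unfolded ennreal_0], simp_all)
  have "\<forall>\<^sub>F n in sequentially. norm (Y n x - Y n x') \<le> (4 + 64 * (64 * (I + 1)) / pi) * sqrt (norm (x - x'))"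
    using ev[of 1] ev[of 2]
  proof eventually_elim
    case (elim n)
    have pw: "gsum (D n) x ^ 4 \<le> 64 * quart (Dy x) + (64 * norm (D n x 1 - Dy x 1) ^ 4 + 64 * norm (D n x 2 - Dy x 2) ^ 4)" for x
      using gsum_pow4[of "D n" x] norm_sum_power4[of "Dy x 1" "D n x 1 - Dy x 1"] norm_sum_power4[of "Dy x 2" "D n x 2 - Dy x 2"]
      by (simp add: quart_def sum_2)
    have "(\<integral>\<^sup>+y. ennreal (indicator (ball 0 1) y * gsum (D n) y ^ 4) \<partial>lborel) = (\<integral>\<^sup>+y. ennreal (gsum (D n) y ^ 4) \<partial>disc)" by (rule nn_integral_disc[symmetric])
    also have "\<dots> \<le> (\<integral>\<^sup>+x. 64 * ennreal (quart (Dy x)) + (64 * ennreal (norm (D n x 1 - Dy x 1) ^ 4) + 64 * ennreal (norm (D n x 2 - Dy x 2) ^ 4)) \<partial>disc)"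
    proof (rule nn_integral_mono)
      fix x
      have "ennreal (gsum (D n) x ^ 4) \<le> ennreal (64 * quart (Dy x) + (64 * norm (D n x 1 - Dy x 1) ^ 4 + 64 * norm (D n x 2 - Dy x 2) ^ 4))" by (rule ennreal_leI[OF pw])
      also have "\<dots> = 64 * ennreal (quart (Dy x)) + (64 * ennreal (norm (D n x 1 - Dy x 1) ^ 4) + 64 * ennreal (norm (D n x 2 - Dy x 2) ^ 4))"
        by (simp add: ennreal_plus ennreal_mult quart_nonneg)
      finally show "ennreal (gsum (D n) x ^ 4) \<le> \<dots>" .
    qed
    also have "\<dots> = 64 * (\<integral>\<^sup>+x. ennreal (quart (Dy x)) \<partial>disc) + (64 * (\<integral>\<^sup>+x. ennreal (norm (D n x 1 - Dy x 1) ^ 4) \<partial>disc) + 64 * (\<integral>\<^sup>+x. ennreal (norm (D n x 2 - Dy x 2) ^ 4) \<partial>disc))"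
      using mq by (simp add: nn_integral_add nn_integral_cmult)
    also have "(\<integral>\<^sup>+x. ennreal (quart (Dy x)) \<partial>disc) = ennreal (\<integral>x. quart (Dy x) \<partial>disc)"
      by (rule nn_integral_eq_integral) (use D in \<open>simp_all add: W4_def quart_nonneg\<close>)
    also have "64 * ennreal (\<integral>x. quart (Dy x) \<partial>disc) + (64 * (\<integral>\<^sup>+x. ennreal (norm (D n x 1 - Dy x 1) ^ 4) \<partial>disc) + 64 * (\<integral>\<^sup>+x. ennreal (norm (D n x 2 - Dy x 2) ^ 4) \<partial>disc))
      \<le> 64 * ennreal I + (64 * ennreal (1/2) + 64 * ennreal (1/2))"
      using elim by (intro add_mono mult_left_mono ennreal_leI I) auto
    also have "\<dots> = ennreal (64 * I + (64 * (1/2) + 64 * (1/2)))"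
      using I1 by (simp only: ennreal_plus ennreal_mult ennreal_numeral mult_nonneg_nonneg zero_le_numeral add_nonneg_nonneg zero_le_divide_1_iff)
    also have "64 * I + (64 * (1/2) + 64 * (1/2)) = 64 * (I + 1)" by simp
    finally show ?case by (intro morrey[OF C r x]) (use I1 in auto)
  qed
  moreover have "(\<lambda>n. norm (Y n x - Y n x')) \<longlonglongrightarrow> norm (y x - y x')"
    using x by (intro tendsto_intros tendsto_uniform_limitI[OF U]) auto
  ultimately show ?thesis by (intro tendsto_upperbound) auto
qed

lemma L2_Cauchy_limit:
  fixes f :: "nat \<Rightarrow> real^2 \<Rightarrow> real^3"
  assumes f: "\<And>n. L2_on (ball 0 1) (f n)"
    and C: "\<And>e. e > 0 \<Longrightarrow> \<exists>N. \<forall>m\<ge>N. \<forall>n\<ge>N. (\<integral>\<^sup>+x. ennreal (norm (f m x - f n x) ^ 2) \<partial>disc) \<le> ennreal e"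
  shows "\<exists>g. L2_on (ball 0 1) g \<and> (\<forall>e>0. \<exists>N. \<forall>n\<ge>N. (\<integral>\<^sup>+x. ennreal (norm (f n x - g x) ^ 2) \<partial>disc) \<le> ennreal e)"
proof -
  have fm: "f n \<in> borel_measurable disc" "integrable disc (\<lambda>x. norm (f n x) ^ 2)" for n using f by (auto simp: L2_on_disc)
  show ?thesis
  proof (rule L2_complete[OF finite_measure_disc fm(1) C])
    fix g and s :: "nat \<Rightarrow> nat" assume g: "g \<in> borel_measurable disc"
      and l: "\<And>e. e > 0 \<Longrightarrow> \<exists>N. \<forall>n\<ge>N. (\<integral>\<^sup>+x. ennreal (norm (f n x - g x) ^ 2) \<partial>disc) \<le> ennreal e"
    obtain N where N: "(\<integral>\<^sup>+x. ennreal (norm (f N x - g x) ^ 2) \<partial>disc) \<le> ennreal 1" using l[of 1] by auto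
    have "(\<integral>\<^sup>+x. ennreal (norm (g x) ^ 2) \<partial>disc) \<le> 2 * (\<integral>\<^sup>+x. ennreal (norm (f N x) ^ 2) \<partial>disc) + 2 * (\<integral>\<^sup>+x. ennreal (norm (g x - f N x) ^ 2) \<partial>disc)"
      by (rule nn_integral_square_add_le[OF g fm(1)])
    also have "\<dots> < \<infinity>"
    proof -
      have "(\<integral>\<^sup>+x. ennreal (norm (f N x) ^ 2) \<partial>disc) = ennreal (\<integral>x. norm (f N x) ^ 2 \<partial>disc)" by (rule nn_integral_eq_integral[OF fm(2)]) simp
      moreover have "(\<integral>\<^sup>+x. ennreal (norm (g x - f N x) ^ 2) \<partial>disc) < \<infinity>" using N by (simp add: norm_minus_commute le_less_trans)
      ultimately show ?thesis by (simp add: ennreal_mult_less_top)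
    qed
    finally have fin: "(\<integral>\<^sup>+x. ennreal (norm (norm (g x) ^ 2)) \<partial>disc) < \<infinity>" by simp
    have "integrable disc (\<lambda>x. norm (g x) ^ 2)" by (rule integrableI_bounded[OF _ fin]) (use g in measurable)
    then show "\<exists>g. L2_on (ball 0 1) g \<and> (\<forall>e>0. \<exists>N. \<forall>n\<ge>N. (\<integral>\<^sup>+x. ennreal (norm (f n x - g x) ^ 2) \<partial>disc) \<le> ennreal e)"
      using g l unfolding L2_on_disc by blast
  qed
qed

lemma continuous_L2_on:
  fixes f :: "real^2 \<Rightarrow> real^3"
  assumes "continuous_on (cball 0 1) f"
  shows "L2_on (ball 0 1) f"
proof -
  have "f \<in> borel_measurable disc" by (rule continuous_imp_measurable_on_sets_lebesgue[OF continuous_on_subset[OF assms]]) auto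
  moreover have "integrable disc (\<lambda>x. norm (f x) ^ 2)" by (rule disc_polar(1)) (intro continuous_intros assms)
  ultimately show ?thesis by (simp add: L2_on_disc)
qed

text \<open>Both arguments are sequences because there are two uses: a fixed limit against a
  minimizing sequence, and mollifications against a fixed map. First \<open>\<theta>\<close> is
  chosen, to make the terms with the uniform bounds \<open>I\<close> and \<open>J\<close> small, and
  only then \<open>n\<close>, since the remaining constants blow up as \<open>\<theta>\<close> tends
  to 0.\<close>

lemma energy_upper_semicontinuous:
  assumes W: "\<And>n. W4 (D n)" "\<And>n. H2 (D2 n)" "\<And>n. W4 (E n)" "\<And>n. H2 (E2 n)"
    and B: "\<And>n::nat. (\<integral>x. quart (D n x) \<partial>disc) \<le> I" "\<And>n. (\<integral>x. bend (D2 n x) \<partial>disc) \<le> J"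
    and l: "(\<lambda>n. \<integral>x. quart (\<lambda>i. E n x i - D n x i) \<partial>disc) \<longlonglongrightarrow> 0" "(\<lambda>n. \<integral>x. bend (\<lambda>i j. E2 n x i j - D2 n x i j) \<partial>disc) \<longlonglongrightarrow> 0"
    and e: "e > 0"
  shows "\<forall>\<^sub>F n in sequentially. energy h (E n) (E2 n) \<le> energy h (D n) (D2 n) + e"
proof -
  define c where "c = 16 * (area + I) + h\<^sup>2 * J"
  have I0: "I \<ge> 0" by (rule order_trans[OF integral_nonneg_AE B(1)]) (simp add: quart_nonneg)
  have J0: "J \<ge> 0" by (rule order_trans[OF integral_nonneg_AE B(2)]) (simp add: bend_nonneg)
  have c0: "c \<ge> 0" using I0 J0 by (simp add: c_def)
  define \<theta> where "\<theta> = min 1 (e / (2 * (c + 1)))"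
  have t: "0 < \<theta>" "\<theta> \<le> 1" using e c0 by (simp_all add: \<theta>_def)
  have tc: "c * \<theta> \<le> e / 2"
  proof -
    have "c * \<theta> \<le> (c + 1) * (e / (2 * (c + 1)))" using c0 t by (intro mult_mono) (simp_all add: \<theta>_def)
    also have "\<dots> = e / 2" using c0 by (simp add: field_simps)
    finally show ?thesis .
  qed
  let ?Q = "\<lambda>n. \<integral>x. quart (\<lambda>i. E n x i - D n x i) \<partial>disc" and ?S = "\<lambda>n. \<integral>x. bend (\<lambda>i j. E2 n x i j - D2 n x i j) \<partial>disc"
  have "(\<lambda>n. 24 / \<theta> ^ 3 * ?Q n + h\<^sup>2 * (1 + 1 / \<theta>) * ?S n) \<longlonglongrightarrow> 24 / \<theta> ^ 3 * 0 + h\<^sup>2 * (1 + 1 / \<theta>) * 0" by (intro tendsto_add tendsto_mult_left l)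
  then have "\<forall>\<^sub>F n in sequentially. 24 / \<theta> ^ 3 * ?Q n + h\<^sup>2 * (1 + 1 / \<theta>) * ?S n < e / 2" by (rule order_tendstoD(2)) (use e in simp)
  then show ?thesis
  proof eventually_elim
    case (elim n)
    have "16 * \<theta> * (area + (\<integral>x. quart (D n x) \<partial>disc)) \<le> 16 * \<theta> * (area + I)" using t B(1)[of n] by (intro mult_left_mono add_left_mono) auto
    moreover have "h\<^sup>2 * (\<integral>x. bend (E2 n x) \<partial>disc) \<le> h\<^sup>2 * ((1 + \<theta>) * (\<integral>x. bend (D2 n x) \<partial>disc) + (1 + 1 / \<theta>) * ?S n)"
      by (intro mult_left_mono integral_bend_perturb t W) simp
    moreover have "h\<^sup>2 * (\<theta> * (\<integral>x. bend (D2 n x) \<partial>disc)) \<le> h\<^sup>2 * (\<theta> * J)" using t B(2)[of n] by (intro mult_left_mono) auto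
    moreover note integral_memb_perturb[OF t W(1)[of n] W(3)[of n]]
    ultimately show ?case unfolding energy_split[OF W(3,4)] energy_split[OF W(1,2)] using elim tc by (simp add: c_def algebra_simps)
  qed
qed

text \<open>A fixed C^2 extension of the boundary data. Subtracting it from an admissible map
  produces the zero boundary values that the interpolation inequality requires.\<close>

locale boundary_ext =
  fixes \<gamma> :: "real^2 \<Rightarrow> real^3" and r0 Y0 D0 D20
  assumes C: "C2on r0 Y0 D0 D20" and r0: "r0 > 1" and bd: "\<And>x. x \<in> sphere 0 1 \<Longrightarrow> Y0 x = \<gamma> x"
begin

lemma Y0_cont: "continuous_on (cball 0 1) Y0"
  by (rule continuous_on_subset[OF C2on_continuous(1)[OF C]]) (use r0 in auto)

text \<open>With this, the energy of every admissible map is a genuine integral and not the default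
  value 0, so no map can undercut the minimum by a nonintegrable membrane density.\<close>

lemma admissible_W4:
  assumes "admissible \<gamma> y D D2"
  shows "W4 D"
proof -
  have y: "W22 (ball 0 1) y D D2" "continuous_on (cball 0 1) y" "\<And>x. x \<in> sphere 0 1 \<Longrightarrow> y x = \<gamma> x" using assms by (auto simp: admissible_def)
  have c: "continuous_on (cball 0 1) (\<lambda>x. y x - Y0 x)" by (intro continuous_intros y Y0_cont)
  have "compact ((\<lambda>x. y x - Y0 x) ` cball 0 1)" by (intro compact_continuous_image c) simp
  then obtain M where M: "\<And>z. z \<in> (\<lambda>x. y x - Y0 x) ` cball 0 1 \<Longrightarrow> norm z \<le> M" using compact_imp_bounded bounded_iff by metis
  have "W4 (\<lambda>x i. D x i - D0 x i)"
    by (rule gn_quart(1)[OF W22_diff[OF y(1) C2on_W22[OF C r0]] c, of M]) (use y(3) bd M in auto)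
  from W4_lincomb[OF this C2on_W4[OF C r0], of 1 1] show ?thesis by simp
qed

lemma admissible_H2: "admissible \<gamma> y D D2 \<Longrightarrow> H2 D2"
  by (auto simp: admissible_def intro: W22_H2)

text \<open>The boundary values of two admissible maps cancel in the difference, so
  \<open>gn_quart\<close> applies to it directly.\<close>

lemma admissible_quart_diff:
  assumes y: "admissible \<gamma> y D D2" and y': "admissible \<gamma> y' D' D2'" and M: "\<And>x. x \<in> cball 0 1 \<Longrightarrow> norm (y x - y' x) \<le> M"
  shows "(\<integral>x. quart (\<lambda>i. D x i - D' x i) \<partial>disc) \<le> 288 * M\<^sup>2 * (\<integral>x. bend (\<lambda>i j. D2 x i j - D2' x i j) \<partial>disc)"
  by (rule gn_quart(2)[OF W22_diff, of y D D2 y' D' D2'])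
     (use y y' M in \<open>auto simp: admissible_def intro!: continuous_intros\<close>)

lemma admissible_midpoint:
  assumes "admissible \<gamma> y D D2" "admissible \<gamma> y' D' D2'"
  shows "admissible \<gamma> (\<lambda>x. (1/2) *\<^sub>R y x + (1/2) *\<^sub>R y' x) (\<lambda>x i. (1/2) *\<^sub>R D x i + (1/2) *\<^sub>R D' x i) (\<lambda>x i j. (1/2) *\<^sub>R D2 x i j + (1/2) *\<^sub>R D2' x i j)"
  using assms unfolding admissible_def by (auto intro!: W22_lincomb continuous_intros simp flip: scaleR_add_left)

text \<open>The midpoint of two almost minimizers is admissible. Uniform closeness makes their gradients close in \<open>L\<^sup>4\<close>, so the nonconvex
  membrane term hardly changes, and the parallelogram identity for the bending term forces the second derivatives to be close in \<open>L\<^sup>2\<close>.\<close>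

lemma minimizing_sequence_limit:
  assumes h: "h > 0" and adm: "\<And>n. admissible \<gamma> (y n) (D n) (D2 n)"
    and inf: "\<And>y D D2. admissible \<gamma> y D D2 \<Longrightarrow> m \<le> energy h D D2"
    and B: "\<And>n. energy h (D n) (D2 n) \<le> B"
    and m: "\<And>e. e > 0 \<Longrightarrow> \<exists>N. \<forall>n\<ge>N. energy h (D n) (D2 n) \<le> m + e"
    and Yc: "continuous_on (cball 0 1) Y"
    and U: "\<And>e. 0 < e \<Longrightarrow> \<exists>N. \<forall>n\<ge>N::nat. \<forall>x\<in>cball 0 1. norm (y n x - Y x) < e"
  shows "\<exists>G H. admissible \<gamma> Y G H \<and> energy h G H \<le> m"
proof -
  note w4 = admissible_W4[OF adm] and h2 = admissible_H2[OF adm]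
  have adm': "W22 (ball 0 1) (y n) (D n) (D2 n)" "continuous_on (cball 0 1) (y n)" "\<And>x. x \<in> sphere 0 1 \<Longrightarrow> y n x = \<gamma> x" "y n 0 = 0" for n
    using adm[of n] by (auto simp: admissible_def)
  have nn: "0 \<le> (\<integral>x. memb (E x) \<partial>disc)" "0 \<le> (\<integral>x. bend (E2 x) \<partial>disc)" "0 \<le> (\<integral>x. quart (E x) \<partial>disc)" for E E2
    by (rule integral_nonneg_AE, simp add: memb_nonneg bend_nonneg quart_nonneg)+
  define I where "I = 2 * B + 4 * area"
  define J where "J = B / h\<^sup>2"
  have BI: "(\<integral>x. quart (D n x) \<partial>disc) \<le> I" for n
  proof -
    have "0 \<le> h\<^sup>2 * (\<integral>x. bend (D2 n x) \<partial>disc)" using nn by simp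
    then have "(\<integral>x. memb (D n x) \<partial>disc) \<le> B" using B[of n] unfolding energy_split[OF w4 h2] by linarith
    then show ?thesis using integral_quart_le_memb[OF w4[of n]] by (simp add: I_def)
  qed
  have BJ: "(\<integral>x. bend (D2 n x) \<partial>disc) \<le> J" for n
  proof -
    have "h\<^sup>2 * (\<integral>x. bend (D2 n x) \<partial>disc) \<le> B" using B[of n] nn(1)[of "D n"] unfolding energy_split[OF w4 h2] by linarith
    then show ?thesis using h by (simp add: J_def pos_le_divide_eq mult.commute)
  qed
  have I0: "I \<ge> 0" using nn(3) BI order_trans by blast
  have J0: "J \<ge> 0" using nn(2) BJ order_trans by blast
  let ?Q = "\<lambda>m n. \<integral>x. quart (\<lambda>i. D m x i - D n x i) \<partial>disc" and ?S = "\<lambda>m n. \<integral>x. bend (\<lambda>i j. D2 m x i j - D2 n x i j) \<partial>disc"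
  \<comment> \<open>Only a bound, not yet smallness: it is what the interpolation inequality needs
    in order to turn uniform closeness into a Cauchy property of the gradients.\<close>
  have S4: "?S k n \<le> 4 * J" for k n
  proof -
    have "?S k n \<le> (\<integral>x. 2 * bend (D2 k x) + 2 * bend (D2 n x) \<partial>disc)"
    proof (rule integral_mono)
      show "integrable disc (\<lambda>x. bend (\<lambda>i j. D2 k x i j - D2 n x i j))" "integrable disc (\<lambda>x. 2 * bend (D2 k x) + 2 * bend (D2 n x))"
        by (intro H2_bend H2_diff h2 Bochner_Integration.integrable_add integrable_mult_right)+
      show "bend (\<lambda>i j. D2 k x i j - D2 n x i j) \<le> 2 * bend (D2 k x) + 2 * bend (D2 n x)" for x
        using bend_nonneg[of "\<lambda>i j. (1/2) *\<^sub>R D2 k x i j + (1/2) *\<^sub>R D2 n x i j"] unfolding bend_midpoint by simp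
    qed
    also have "\<dots> = 2 * (\<integral>x. bend (D2 k x) \<partial>disc) + 2 * (\<integral>x. bend (D2 n x) \<partial>disc)"
      using H2_bend[OF h2[of k]] H2_bend[OF h2[of n]] by simp
    finally show ?thesis using BJ[of k] BJ[of n] by linarith
  qed
  have Qs: "\<exists>N. \<forall>k\<ge>N. \<forall>n\<ge>N. ?Q k n \<le> e" if e: "e > 0" for e
  proof -
    define c where "c = 288 * (4 * J) + 1"
    have c: "c > 0" using J0 by (simp add: c_def)
    define \<delta> where "\<delta> = sqrt (e / c)"
    have d: "\<delta> > 0" "\<delta>\<^sup>2 = e / c" using e c by (simp_all add: \<delta>_def)
    have "\<delta> / 2 > 0" using d by simp
    then obtain N where N: "\<And>n x. n \<ge> N \<Longrightarrow> x \<in> cball 0 1 \<Longrightarrow> norm (y n x - Y x) < \<delta> / 2" using U by blast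
    have "?Q k n \<le> e" if kn: "k \<ge> N" "n \<ge> N" for k n
    proof -
      have "norm (y k x - y n x) \<le> \<delta>" if "x \<in> cball 0 1" for x
        using norm_triangle_ineq4[of "y k x - Y x" "y n x - Y x"] N[OF kn(1) that] N[OF kn(2) that] by simp
      then have "?Q k n \<le> 288 * \<delta>\<^sup>2 * ?S k n" by (rule admissible_quart_diff[OF adm adm])
      also have "\<dots> \<le> 288 * \<delta>\<^sup>2 * (4 * J)" by (intro mult_left_mono S4) simp
      also have "\<dots> \<le> e" unfolding d(2) using e c by (simp add: c_def pos_divide_le_eq algebra_simps)
      finally show ?thesis .
    qed
    then show ?thesis by blast
  qed
  have Ss: "\<exists>N. \<forall>k\<ge>N. \<forall>n\<ge>N. ?S k n \<le> e" if e: "e > 0" for e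
  proof -
    \<comment> \<open>Three errors of size \<open>\<eta>\<close> arise below, from near minimality,
      from the term with \<open>\<theta>\<close> and from the term with \<open>?Q\<close>; together
      they equal \<open>h\<^sup>2 / 4 * e\<close>.\<close>
    define \<eta> where "\<eta> = h\<^sup>2 * e / 12"
    have eta: "\<eta> > 0" using e h by (simp add: \<eta>_def)
    define c where "c = 8 * (2 * area + 2 * I) + 1"
    have c: "c > 0" using I0 by (simp add: c_def add_nonneg_pos)
    define \<theta> where "\<theta> = min 1 (\<eta> / c)"
    have t: "0 < \<theta>" "\<theta> \<le> 1" using eta c by (simp_all add: \<theta>_def)
    have tc: "8 * \<theta> * (2 * area + 2 * I) \<le> \<eta>"
    proof -
      have "8 * \<theta> * (2 * area + 2 * I) \<le> \<theta> * c" using t by (simp add: c_def algebra_simps)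
      also have "\<dots> \<le> \<eta> / c * c" using c by (intro mult_right_mono) (simp_all add: \<theta>_def)
      finally show ?thesis using c by simp
    qed
    obtain N1 where N1: "\<And>n. n \<ge> N1 \<Longrightarrow> energy h (D n) (D2 n) \<le> m + \<eta>" using m[OF eta] by blast
    have "\<eta> * \<theta> ^ 3 / 24 > 0" using eta t by simp
    then obtain N2 where N2: "\<And>k n. k \<ge> N2 \<Longrightarrow> n \<ge> N2 \<Longrightarrow> ?Q k n \<le> \<eta> * \<theta> ^ 3 / 24" using Qs by blast
    have "?S k n \<le> e" if kn: "k \<ge> max N1 N2" "n \<ge> max N1 N2" for k n
    proof -
      have "m \<le> energy h (\<lambda>x i. (1/2) *\<^sub>R D k x i + (1/2) *\<^sub>R D n x i) (\<lambda>x i j. (1/2) *\<^sub>R D2 k x i j + (1/2) *\<^sub>R D2 n x i j)"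
        by (rule inf[OF admissible_midpoint[OF adm adm]])
      also note integral_energy_midpoint[OF t w4[of k] h2[of k] w4[of n] h2[of n], of h]
      finally have 1: "m \<le> energy h (D k) (D2 k) / 2 + energy h (D n) (D2 n) / 2
          + 8 * \<theta> * (2 * area + (\<integral>x. quart (D k x) \<partial>disc) + (\<integral>x. quart (D n x) \<partial>disc)) + 24 / \<theta> ^ 3 * ?Q k n - h\<^sup>2 / 4 * ?S k n" .
      have 2: "8 * \<theta> * (2 * area + (\<integral>x. quart (D k x) \<partial>disc) + (\<integral>x. quart (D n x) \<partial>disc)) \<le> 8 * \<theta> * (2 * area + 2 * I)"
        using t BI[of k] BI[of n] by (intro mult_left_mono) auto
      have "24 / \<theta> ^ 3 * ?Q k n \<le> 24 / \<theta> ^ 3 * (\<eta> * \<theta> ^ 3 / 24)" using kn t by (intro mult_left_mono N2) auto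
      also have "\<dots> = \<eta>" using t by simp
      finally have "h\<^sup>2 / 4 * ?S k n \<le> 3 * \<eta>" using 1 2 tc N1[of k] N1[of n] kn by simp
      also have "\<dots> = h\<^sup>2 / 4 * e" by (simp add: \<eta>_def)
      finally show ?thesis using h by simp
    qed
    then show ?thesis by blast
  qed
  have LD: "L2_on (ball 0 1) (\<lambda>x. D n x i)" "L2_on (ball 0 1) (\<lambda>x. D2 n x i j)" for n i j
    using adm'(1)[of n] by (simp_all add: W22_def)
  have "\<exists>g. L2_on (ball 0 1) g \<and> (\<forall>e>0. \<exists>N. \<forall>n\<ge>N. (\<integral>\<^sup>+x. ennreal (norm (D n x i - g x) ^ 2) \<partial>disc) \<le> ennreal e)" for i
  proof (rule L2_Cauchy_limit[OF LD(1)])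
    fix e :: real assume e: "e > 0"
    \<comment> \<open>The splitting \<open>u\<^sup>2 \<le> s + u ^ 4 / s\<close> deduces the mean
      square Cauchy property from the one in L^4; each part is allotted
      \<open>e / 2\<close>.\<close>
    define s where "s = e / (2 * (area + 1))"
    have s: "s > 0" using e by (simp add: s_def add_nonneg_pos)
    have sa: "s * area \<le> e / 2"
    proof -
      have "s * area \<le> s * (area + 1)" using s by simp
      also have "\<dots> = e / 2"
      proof -
        have "e / (2 * a) * a = e / 2" if "a > 0" for a :: real using that by simp
        from this[of "area + 1", OF add_nonneg_pos] show ?thesis unfolding s_def by simp
      qed
      finally show ?thesis .
    qed
    have "e * s / 2 > 0" using e s by simp
    then obtain N where N: "\<And>k n. k \<ge> N \<Longrightarrow> n \<ge> N \<Longrightarrow> ?Q k n \<le> e * s / 2" using Qs by blast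
    have "(\<integral>\<^sup>+x. ennreal (norm (D k x i - D n x i) ^ 2) \<partial>disc) \<le> ennreal e" if kn: "k \<ge> N" "n \<ge> N" for k n
    proof -
      have qi: "integrable disc (\<lambda>x. quart (\<lambda>i. D k x i - D n x i))" using W4_diff[OF w4 w4] by (simp add: W4_def)
      have fi: "integrable disc (\<lambda>x. s + 1 / s * quart (\<lambda>i. D k x i - D n x i))"
        by (intro Bochner_Integration.integrable_add integrable_mult_right qi integrable_const_disc)
      have "(\<integral>\<^sup>+x. ennreal (norm (D k x i - D n x i) ^ 2) \<partial>disc) \<le> (\<integral>\<^sup>+x. ennreal (s + 1 / s * quart (\<lambda>i. D k x i - D n x i)) \<partial>disc)"
      proof (intro nn_integral_mono ennreal_leI)
        fix x
        let ?u = "norm (D k x i - D n x i)"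
        have "?u ^ 4 \<le> quart (\<lambda>i. D k x i - D n x i)" unfolding quart_def by (rule member_le_sum) auto
        then have q: "1 / s * ?u ^ 4 \<le> 1 / s * quart (\<lambda>i. D k x i - D n x i)" using s by (intro mult_left_mono) auto
        have "?u\<^sup>2 \<le> s + 1 / s * ?u ^ 4"
        proof (cases "?u\<^sup>2 \<le> s")
          case False
          then have "s * ?u\<^sup>2 \<le> ?u\<^sup>2 * ?u\<^sup>2" by (intro mult_right_mono) auto
          then have "?u\<^sup>2 \<le> 1 / s * ?u ^ 4" using s by (simp add: pos_le_divide_eq mult.commute flip: power_add)
          then show ?thesis using s by simp
        qed (use s in \<open>simp add: add_increasing2\<close>)
        with q show "?u\<^sup>2 \<le> s + 1 / s * quart (\<lambda>i. D k x i - D n x i)" by linarith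
      qed
      also have "\<dots> = ennreal (\<integral>x. s + 1 / s * quart (\<lambda>i. D k x i - D n x i) \<partial>disc)"
        by (rule nn_integral_eq_integral[OF fi]) (use s in \<open>simp add: quart_nonneg\<close>)
      also have "(\<integral>x. s + 1 / s * quart (\<lambda>i. D k x i - D n x i) \<partial>disc) = s * area + 1 / s * ?Q k n"
        using qi integrable_const_disc[of s] by (simp add: mult.commute)
      also have "ennreal (s * area + 1 / s * ?Q k n) \<le> ennreal e"
      proof (rule ennreal_leI)
        have "1 / s * ?Q k n \<le> 1 / s * (e * s / 2)" using s by (intro mult_left_mono N kn) auto
        also have "\<dots> = e / 2" using s by simp
        finally show "s * area + 1 / s * ?Q k n \<le> e" using sa by linarith
      qed
      finally show ?thesis .
    qed
    then show "\<exists>N. \<forall>k\<ge>N. \<forall>n\<ge>N. (\<integral>\<^sup>+x. ennreal (norm (D k x i - D n x i) ^ 2) \<partial>disc) \<le> ennreal e" by blast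
  qed
  then have "\<forall>i. \<exists>g. L2_on (ball 0 1) g \<and> (\<forall>e>0. \<exists>N. \<forall>n\<ge>N. (\<integral>\<^sup>+x. ennreal (norm (D n x i - g x) ^ 2) \<partial>disc) \<le> ennreal e)" ..
  then have "\<exists>G. \<forall>i. L2_on (ball 0 1) (G i) \<and> (\<forall>e>0. \<exists>N. \<forall>n\<ge>N. (\<integral>\<^sup>+x. ennreal (norm (D n x i - G i x) ^ 2) \<partial>disc) \<le> ennreal e)" by (rule choice)
  then obtain G where G: "\<And>i. L2_on (ball 0 1) (G i)" "\<And>i e. e > 0 \<Longrightarrow> \<exists>N. \<forall>n\<ge>N. (\<integral>\<^sup>+x. ennreal (norm (D n x i - G i x) ^ 2) \<partial>disc) \<le> ennreal e" by blast
  \<comment> \<open>The two indices are paired so that a single choice yields the whole array of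
    limits.\<close>
  have "\<exists>g. L2_on (ball 0 1) g \<and> (\<forall>e>0. \<exists>N. \<forall>n\<ge>N. (\<integral>\<^sup>+x. ennreal (norm (D2 n x (fst ij) (snd ij) - g x) ^ 2) \<partial>disc) \<le> ennreal e)" for ij
  proof (rule L2_Cauchy_limit[OF LD(2)])
    fix e :: real assume e: "e > 0"
    obtain N where N: "\<And>k n. k \<ge> N \<Longrightarrow> n \<ge> N \<Longrightarrow> ?S k n \<le> e" using Ss[OF e] by blast
    have "(\<integral>\<^sup>+x. ennreal (norm (D2 k x (fst ij) (snd ij) - D2 n x (fst ij) (snd ij)) ^ 2) \<partial>disc) \<le> ennreal e" if kn: "k \<ge> N" "n \<ge> N" for k n
      using H2_integral_bound[OF H2_diff[OF h2[of k] h2[of n]], of "fst ij" "snd ij"] ennreal_leI[OF N[OF kn]] by (rule order_trans)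
    then show "\<exists>N. \<forall>k\<ge>N. \<forall>n\<ge>N. (\<integral>\<^sup>+x. ennreal (norm (D2 k x (fst ij) (snd ij) - D2 n x (fst ij) (snd ij)) ^ 2) \<partial>disc) \<le> ennreal e" by blast
  qed
  then have "\<forall>ij. \<exists>g. L2_on (ball 0 1) g \<and> (\<forall>e>0. \<exists>N. \<forall>n\<ge>N. (\<integral>\<^sup>+x. ennreal (norm (D2 n x (fst ij) (snd ij) - g x) ^ 2) \<partial>disc) \<le> ennreal e)" ..
  then have "\<exists>H. \<forall>ij. L2_on (ball 0 1) (H ij) \<and> (\<forall>e>0. \<exists>N. \<forall>n\<ge>N. (\<integral>\<^sup>+x. ennreal (norm (D2 n x (fst ij) (snd ij) - H ij x) ^ 2) \<partial>disc) \<le> ennreal e)" by (rule choice)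
  then obtain H where H: "\<And>ij. L2_on (ball 0 1) (H ij)" "\<And>ij e. e > 0 \<Longrightarrow> \<exists>N. \<forall>n\<ge>N. (\<integral>\<^sup>+x. ennreal (norm (D2 n x (fst ij) (snd ij) - H ij x) ^ 2) \<partial>disc) \<le> ennreal e" by blast
  have H': "\<exists>N. \<forall>n\<ge>N. (\<integral>\<^sup>+x. ennreal (norm (D2 n x i j - H (i, j) x) ^ 2) \<partial>disc) \<le> ennreal e" if "e > 0" for i j e
    using H(2)[OF that, of "(i, j)"] by simp
  have YL: "L2_on (ball 0 1) Y" by (rule continuous_L2_on[OF Yc])
  have yL: "L2_on (ball 0 1) (y n)" for n by (rule continuous_L2_on[OF adm'(2)])
  have Y2: "\<exists>N. \<forall>n\<ge>N. (\<integral>\<^sup>+x. ennreal (norm (y n x - Y x) ^ 2) \<partial>disc) \<le> ennreal e" if e: "e > 0" for e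
  proof -
    define s where "s = sqrt (e / (area + 1))"
    have s: "s > 0" "s\<^sup>2 = e / (area + 1)" using e by (simp_all add: s_def add_nonneg_pos)
    obtain N where N: "\<And>n x. n \<ge> N \<Longrightarrow> x \<in> cball 0 1 \<Longrightarrow> norm (y n x - Y x) < s" using U[OF s(1)] by blast
    have "(\<integral>\<^sup>+x. ennreal (norm (y n x - Y x) ^ 2) \<partial>disc) \<le> ennreal e" if n: "n \<ge> N" for n
    proof -
      have "(\<integral>\<^sup>+x. ennreal (norm (y n x - Y x) ^ 2) \<partial>disc) \<le> (\<integral>\<^sup>+x. ennreal (s\<^sup>2) \<partial>disc)"
      proof (rule nn_integral_mono, rule ennreal_leI)
        fix x assume "x \<in> space disc"
        then have "norm (y n x - Y x) < s" by (intro N n) (auto simp: space_restrict_space)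
        then show "norm (y n x - Y x) ^ 2 \<le> s\<^sup>2" by (intro power_mono) auto
      qed
      also have "\<dots> = ennreal (\<integral>x. s\<^sup>2 \<partial>disc)" by (rule nn_integral_eq_integral[OF integrable_const_disc]) simp
      also have "(\<integral>x. s\<^sup>2 \<partial>disc) = area * s\<^sup>2" by simp
      also have "ennreal (area * s\<^sup>2) \<le> ennreal e"
      proof (rule ennreal_leI)
        have "area * s\<^sup>2 \<le> (area + 1) * s\<^sup>2" by (intro mult_right_mono) auto
        also have "\<dots> = e"
        proof -
          have "a * (e / a) = e" if "a > 0" for a :: real using that by simp
          from this[of "area + 1", OF add_nonneg_pos] show ?thesis unfolding s(2) by simp
        qed
        finally show "area * s\<^sup>2 \<le> e" .
      qed
      finally show ?thesis .
    qed
    then show ?thesis by blast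
  qed
  define G' where "G' = (\<lambda>x i. G i x)"
  define H' where "H' = (\<lambda>x i j. H (i, j) x)"
  have W: "W22 (ball 0 1) Y G' H'"
    unfolding W22_def
  proof (intro conjI allI)
    show "L2_on (ball 0 1) Y" by (rule YL)
    show "L2_on (ball 0 1) (\<lambda>x. G' x i)" for i unfolding G'_def by (rule G(1))
    show "L2_on (ball 0 1) (\<lambda>x. H' x i j)" for i j unfolding H'_def by (rule H(1))
    show "weak_pdiff (ball 0 1) Y i (\<lambda>x. G' x i)" for i unfolding G'_def
      by (rule weak_pdiff_limit[of y i "\<lambda>n x. D n x i"]) (use adm'(1) YL yL G LD Y2 in \<open>auto simp: W22_def\<close>)
    show "weak_pdiff (ball 0 1) (\<lambda>x. G' x i) j (\<lambda>x. H' x i j)" for i j unfolding G'_def H'_def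
      by (rule weak_pdiff_limit[of "\<lambda>n x. D n x i" j "\<lambda>n x. D2 n x i j"]) (use adm'(1) G H(1) LD H' in \<open>auto simp: W22_def\<close>)
  qed
  have pw: "(\<lambda>n. y n x) \<longlonglongrightarrow> Y x" if "x \<in> cball 0 1" for x
    by (rule LIMSEQ_I) (use U that in blast)
  have A: "admissible \<gamma> Y G' H'"
    unfolding admissible_def
  proof (intro conjI ballI)
    show "Y x = \<gamma> x" if "x \<in> sphere 0 1" for x
      using pw[of x] that adm'(3)[OF that] by (intro LIMSEQ_unique[of "\<lambda>n. y n x"]) auto
    show "Y 0 = 0" using pw[of 0] adm'(4) by (intro LIMSEQ_unique[of "\<lambda>n. y n 0"]) auto
  qed (rule W Yc)+
  note gw4 = admissible_W4[OF A] and gh2 = admissible_H2[OF A]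
  let ?S' = "\<lambda>n. \<integral>x. bend (\<lambda>i j. H' x i j - D2 n x i j) \<partial>disc"
  let ?Q' = "\<lambda>n. \<integral>x. quart (\<lambda>i. G' x i - D n x i) \<partial>disc"
  have c: "(\<lambda>n. \<integral>x. norm (H' x i j - D2 n x i j) ^ 2 \<partial>disc) \<longlonglongrightarrow> 0" for i j
  proof (rule LIMSEQ_I)
    fix r :: real assume r: "r > 0"
    obtain N where N: "\<And>n. n \<ge> N \<Longrightarrow> (\<integral>\<^sup>+x. ennreal (norm (D2 n x i j - H (i, j) x) ^ 2) \<partial>disc) \<le> ennreal (r/2)" using H'[of "r/2" i j] r by auto
    have "norm ((\<integral>x. norm (H' x i j - D2 n x i j) ^ 2 \<partial>disc) - 0) < r" if n: "n \<ge> N" for n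
    proof -
      have i: "integrable disc (\<lambda>x. norm (H' x i j - D2 n x i j) ^ 2)" using H2_diff[OF gh2 h2] by (simp add: H2_def L2_on_disc)
      have "ennreal (\<integral>x. norm (H' x i j - D2 n x i j) ^ 2 \<partial>disc) \<le> ennreal (r/2)"
        using N[OF n] nn_integral_eq_integral[OF i] by (simp add: H'_def norm_minus_commute)
      then have "(\<integral>x. norm (H' x i j - D2 n x i j) ^ 2 \<partial>disc) \<le> r / 2" using r by simp
      moreover have "0 \<le> (\<integral>x. norm (H' x i j - D2 n x i j) ^ 2 \<partial>disc)" by (rule integral_nonneg_AE) simp
      ultimately show ?thesis using r by simp
    qed
    then show "\<exists>no. \<forall>n\<ge>no. norm ((\<integral>x. norm (H' x i j - D2 n x i j) ^ 2 \<partial>disc) - 0) < r" by blast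
  qed
  have S0: "?S' \<longlonglongrightarrow> 0"
  proof -
    have "?S' n = (\<Sum>i\<in>UNIV. \<Sum>j\<in>UNIV. \<integral>x. norm (H' x i j - D2 n x i j) ^ 2 \<partial>disc)" for n
      using H2_diff[OF gh2 h2[of n]] unfolding bend_def H2_def L2_on_disc by simp
    moreover have "(\<lambda>n. \<Sum>i\<in>UNIV. \<Sum>j\<in>UNIV. \<integral>x. norm (H' x i j - D2 n x i j) ^ 2 \<partial>disc) \<longlonglongrightarrow> (\<Sum>i\<in>(UNIV::2 set). \<Sum>j\<in>(UNIV::2 set). 0)"
      by (intro tendsto_sum c)
    ultimately show ?thesis by simp
  qed
  \<comment> \<open>Distance 1 is enough now, since the second derivatives already converge.\<close>
  obtain N1 where N1: "\<And>n x. n \<ge> N1 \<Longrightarrow> x \<in> cball 0 1 \<Longrightarrow> norm (y n x - Y x) < 1" using U[OF zero_less_one] by blast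
  have Q0: "?Q' \<longlonglongrightarrow> 0"
  proof (rule tendsto_sandwich[of "\<lambda>n. 0" ?Q' sequentially "\<lambda>n. 288 * 1\<^sup>2 * ?S' n" 0])
    show "\<forall>\<^sub>F n in sequentially. ?Q' n \<le> 288 * 1\<^sup>2 * ?S' n"
      using N1 by (intro eventually_sequentiallyI[of N1] admissible_quart_diff[OF A adm]) (auto simp: norm_minus_commute less_imp_le)
    show "(\<lambda>n. 288 * 1\<^sup>2 * ?S' n) \<longlonglongrightarrow> 0" using tendsto_mult_left[OF S0, of 288] by simp
  qed (use nn in auto)
  have "energy h G' H' \<le> m + e" if e: "e > 0" for e
  proof -
    have "\<forall>\<^sub>F n in sequentially. energy h G' H' \<le> energy h (D n) (D2 n) + e / 2"
      by (rule energy_upper_semicontinuous[OF w4 h2 gw4 gh2 BI BJ Q0 S0]) (use e in simp)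
    moreover have "\<forall>\<^sub>F n in sequentially. energy h (D n) (D2 n) \<le> m + e / 2"
      using m[of "e/2"] e by (simp add: eventually_sequentially)
    ultimately have "\<forall>\<^sub>F n in sequentially. energy h G' H' \<le> m + e" by eventually_elim simp
    then show ?thesis by simp
  qed
  then have "energy h G' H' \<le> m" by (rule field_le_epsilon)
  with A show ?thesis by blast
qed

text \<open>The energy bound controls the gradients in L^4, so the maps are Hoelder continuous with
  exponent 1/2 and a common constant. The condition at the origin then bounds them uniformly, and a
  subsequence converges uniformly.\<close>

lemma minimizer_exists:
  assumes h: "h > 0" and ex: "admissible \<gamma> y0 Dy0 D2y0"
  shows "\<exists>y D D2. admissible \<gamma> y D D2 \<and> (\<forall>y' D' D2'. admissible \<gamma> y' D' D2' \<longrightarrow> energy h D D2 \<le> energy h D' D2')"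
proof -
  define S where "S = {energy h D D2 | y D D2. admissible \<gamma> y D D2}"
  define m where "m = Inf S"
  have bdd: "bdd_below S" by (rule bdd_belowI[of _ 0]) (auto simp: S_def energy_nonneg)
  have ne: "S \<noteq> {}" using ex by (auto simp: S_def)
  have inf: "m \<le> energy h D D2" if "admissible \<gamma> y D D2" for y D D2
    unfolding m_def by (rule cInf_lower[OF _ bdd]) (use that in \<open>auto simp: S_def\<close>)
  have "\<exists>p. admissible \<gamma> (fst p) (fst (snd p)) (snd (snd p)) \<and> energy h (fst (snd p)) (snd (snd p)) < m + 1 / real (Suc n)" for n
  proof -
    have "Inf S < m + 1 / real (Suc n)" by (simp add: m_def)
    then obtain z where z: "z \<in> S" "z < m + 1 / real (Suc n)" using cInf_lessD[OF ne] by blast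
    then obtain y D D2 where "z = energy h D D2" "admissible \<gamma> y D D2" unfolding S_def by blast
    then show ?thesis using z(2) by (intro exI[of _ "(y, D, D2)"]) simp
  qed
  then have "\<forall>n. \<exists>p. admissible \<gamma> (fst p) (fst (snd p)) (snd (snd p)) \<and> energy h (fst (snd p)) (snd (snd p)) < m + 1 / real (Suc n)" ..
  then have "\<exists>p. \<forall>n. admissible \<gamma> (fst (p n)) (fst (snd (p n))) (snd (snd (p n))) \<and> energy h (fst (snd (p n))) (snd (snd (p n))) < m + 1 / real (Suc n)" by (rule choice)
  then obtain p where p: "\<And>n. admissible \<gamma> (fst (p n)) (fst (snd (p n))) (snd (snd (p n)))" "\<And>n. energy h (fst (snd (p n))) (snd (snd (p n))) < m + 1 / real (Suc n)" by blast
  define y where "y = (\<lambda>n. fst (p n))"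
  define D where "D = (\<lambda>n. fst (snd (p n)))"
  define D2 where "D2 = (\<lambda>n. snd (snd (p n)))"
  have adm: "admissible \<gamma> (y n) (D n) (D2 n)" and en: "energy h (D n) (D2 n) < m + 1 / real (Suc n)" for n
    using p[of n] by (simp_all add: y_def D_def D2_def)
  define B where "B = m + 1"
  have B: "energy h (D n) (D2 n) \<le> B" for n
  proof -
    have "1 / real (Suc n) \<le> 1" by simp
    then show ?thesis using en[of n] unfolding B_def by linarith
  qed
  define I where "I = 2 * B + 4 * area"
  have BI: "(\<integral>x. quart (D n x) \<partial>disc) \<le> I" for n
  proof -
    have "0 \<le> (\<integral>x. bend (D2 n x) \<partial>disc)" by (rule integral_nonneg_AE) (simp add: bend_nonneg)
    then have "0 \<le> h\<^sup>2 * (\<integral>x. bend (D2 n x) \<partial>disc)" by simp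
    then have "(\<integral>x. memb (D n x) \<partial>disc) \<le> B" using B[of n] unfolding energy_split[OF admissible_W4[OF adm] admissible_H2[OF adm]] by linarith
    then show ?thesis using integral_quart_le_memb[OF admissible_W4[OF adm[of n]]] by (simp add: I_def)
  qed
  define K where "K = 4 + 64 * (64 * (I + 1)) / pi"
  have mor: "norm (y n x - y n x') \<le> K * sqrt (norm (x - x'))" if "norm x \<le> 1" "norm x' \<le> 1" for n x x'
    unfolding K_def by (rule W22_morrey[OF _ _ admissible_W4[OF adm] BI that]) (use adm[of n] in \<open>auto simp: admissible_def\<close>)
  have K0: "K > 0"
  proof -
    have "0 \<le> (\<integral>x. quart (D 0 x) \<partial>disc)" by (rule integral_nonneg_AE) (simp add: quart_nonneg)
    then have "I \<ge> 0" using BI[of 0] by linarith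
    then show ?thesis by (simp add: K_def add_pos_nonneg)
  qed
  have bound: "norm (y n x) \<le> K" if "x \<in> cball 0 1" for n x
  proof -
    have "norm (y n x - y n 0) \<le> K * sqrt (norm (x - 0))" by (rule mor) (use that in auto)
    also have "\<dots> \<le> K * 1" using K0 that by (intro mult_left_mono) auto
    finally show ?thesis using adm[of n] by (simp add: admissible_def)
  qed
  obtain Y and k :: "nat \<Rightarrow> nat" where Yc: "continuous_on (cball 0 1) Y" and k: "strict_mono k"
    and U: "\<And>e. 0 < e \<Longrightarrow> \<exists>N. \<forall>n x. n \<ge> N \<and> x \<in> cball 0 1 \<longrightarrow> norm (y (k n) x - Y x) < e"
  proof (rule Arzela_Ascoli[of "cball (0::real^2) 1" y K])
    fix x :: "real^2" and e :: real assume x: "x \<in> cball 0 1" and e: "0 < e"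
    show "\<exists>d>0. \<forall>n z. z \<in> cball 0 1 \<and> norm (x - z) < d \<longrightarrow> norm (y n x - y n z) < e"
    proof (intro exI[of _ "(e / K)\<^sup>2"] conjI allI impI)
      show "0 < (e / K)\<^sup>2" using e K0 by simp
      fix n z assume z: "z \<in> cball 0 1 \<and> norm (x - z) < (e / K)\<^sup>2"
      have "norm (y n x - y n z) \<le> K * sqrt (norm (x - z))" by (rule mor) (use x z in auto)
      also have "\<dots> < K * sqrt ((e / K)\<^sup>2)" using z K0 by (intro mult_strict_left_mono real_sqrt_less_mono) auto
      also have "\<dots> = e" using e K0 by simp
      finally show "norm (y n x - y n z) < e" .
    qed
  qed (use bound in auto)
  have "\<exists>G H. admissible \<gamma> Y G H \<and> energy h G H \<le> m"
  proof (rule minimizing_sequence_limit[of h "\<lambda>n. y (k n)" "\<lambda>n. D (k n)" "\<lambda>n. D2 (k n)" m B Y])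
    fix e :: real assume e: "e > 0"
    obtain N where N: "1 / real (Suc N) < e" using nat_approx_posE[OF e] .
    have "energy h (D (k n)) (D2 (k n)) \<le> m + e" if n: "n \<ge> N" for n
    proof -
      have "N \<le> k n" using n seq_suble[OF k, of n] by linarith
      then have "1 / real (Suc (k n)) \<le> 1 / real (Suc N)" by (intro divide_left_mono) auto
      then show ?thesis using en[of "k n"] N by linarith
    qed
    then show "\<exists>N. \<forall>n\<ge>N. energy h (D (k n)) (D2 (k n)) \<le> m + e" by blast
    show "\<exists>N. \<forall>n\<ge>N. \<forall>x\<in>cball 0 1. norm (y (k n) x - Y x) < e" using U[OF e] by blast
  qed (use h adm inf B Yc in auto)
  then show ?thesis using inf order_trans by meson
qed

end

section \<open>The two bounds\<close>

lemma nn_integral_tendsto_0_imp_integral: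
  fixes f :: "nat \<Rightarrow> 'a \<Rightarrow> real"
  assumes i: "\<And>n. integrable M (f n)" and p: "\<And>n x. 0 \<le> f n x" and l: "(\<lambda>n. \<integral>\<^sup>+x. ennreal (f n x) \<partial>M) \<longlonglongrightarrow> 0"
  shows "(\<lambda>n. \<integral>x. f n x \<partial>M) \<longlonglongrightarrow> 0"
proof -
  have "(\<integral>\<^sup>+x. ennreal (f n x) \<partial>M) = ennreal (\<integral>x. f n x \<partial>M)" for n by (rule nn_integral_eq_integral[OF i]) (simp add: p)
  then have "(\<lambda>n. ennreal (\<integral>x. f n x \<partial>M)) \<longlonglongrightarrow> ennreal 0" using l by simp
  then show ?thesis by (rule tendsto_ennrealD) (auto intro!: always_eventually integral_nonneg_AE simp: p)
qed

context unit_curve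
begin

text \<open>A mollification need not vanish at the origin. Subtracting its value there leaves the
  energy unchanged but shifts the boundary values; the two errors of at most \<open>h / 2\<close>
  give the tolerance \<open>h\<close> with which \<open>smooth_map\<close> is interpreted.\<close>

lemma lower_bound:
  assumes \<gamma>: "\<And>t. \<gamma> (circ t) = g t" and y: "admissible \<gamma> y Dy D2y" and D: "W4 Dy"
    and h: "0 < h" "h \<le> 1" and L: "ln (1 / h) \<ge> 1"
    and N: "\<And>t. t \<in> {0..2*pi} \<Longrightarrow> norm (kap t) \<le> N" "\<And>t. t \<in> {0..2*pi} \<Longrightarrow> norm (g3 t + g1 t) \<le> N"
    and E: "energy h Dy D2y \<le> h\<^sup>2 * (K * ln (1 / h))" and K: "K \<ge> 0" and K2: "K2 = 2 * (K + 1) + 10 * pi"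
  shows "h\<^sup>2 * (kk * (ln (1 / h) - ln (ln (1 / h))) - 4 * (4 * pi * N\<^sup>2 + 3 / 4 * K2) - 3 / 2 * K2) \<le> energy h Dy D2y"
proof (rule field_le_epsilon)
  fix e :: real assume e: "e > 0"
  have w: "W22 (ball 0 1) y Dy D2y" and yc: "continuous_on (cball 0 1) y" and yb: "\<And>x. x \<in> sphere 0 1 \<Longrightarrow> y x = \<gamma> x" and y0: "y 0 = 0"
    using y by (auto simp: admissible_def)
  obtain r Y Dn D2n where r: "\<And>n::nat. r n > 1" and C: "\<And>n. C2on (r n) (Y n) (Dn n) (D2n n)"
    and U: "uniform_limit (cball 0 1) Y y sequentially"
    and L2: "\<And>i j. (\<lambda>n. \<integral>\<^sup>+x. ennreal (norm (D2n n x i j - D2y x i j) ^ 2) \<partial>disc) \<longlonglongrightarrow> 0"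
    and L4: "\<And>i. integrable disc (\<lambda>x. norm (Dy x i) ^ 4) \<Longrightarrow> (\<lambda>n. \<integral>\<^sup>+x. ennreal (norm (Dn n x i - Dy x i) ^ 4) \<partial>disc) \<longlonglongrightarrow> 0"
    by (rule W22_approx[OF w yc]) blast
  have nW: "W4 (Dn n)" "H2 (D2n n)" for n using C2on_W4[OF C r] W22_H2[OF C2on_W22[OF C r]] by auto
  have h2: "H2 D2y" by (rule W22_H2[OF w])
  have i4: "integrable disc (\<lambda>x. norm (Dn n x i - Dy x i) ^ 4)" for n i by (rule W4_integrable_power4[OF W4_diff[OF nW(1) D]])
  have i2: "integrable disc (\<lambda>x. norm (D2n n x i j - D2y x i j) ^ 2)" for n i j using H2_diff[OF nW(2) h2] by (simp add: H2_def L2_on_disc)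
  have Q: "(\<lambda>n. \<integral>x. quart (\<lambda>i. Dn n x i - Dy x i) \<partial>disc) \<longlonglongrightarrow> 0"
  proof -
    have "(\<lambda>n. \<Sum>i\<in>UNIV. \<integral>x. norm (Dn n x i - Dy x i) ^ 4 \<partial>disc) \<longlonglongrightarrow> (\<Sum>i\<in>(UNIV::2 set). 0)"
      by (intro tendsto_sum nn_integral_tendsto_0_imp_integral i4 L4 W4_integrable_power4 D) simp
    then show ?thesis unfolding quart_def using i4 by simp
  qed
  have S: "(\<lambda>n. \<integral>x. bend (\<lambda>i j. D2n n x i j - D2y x i j) \<partial>disc) \<longlonglongrightarrow> 0"
  proof -
    have "(\<lambda>n. \<Sum>i\<in>UNIV. \<Sum>j\<in>UNIV. \<integral>x. norm (D2n n x i j - D2y x i j) ^ 2 \<partial>disc) \<longlonglongrightarrow> (\<Sum>i\<in>(UNIV::2 set). \<Sum>j\<in>(UNIV::2 set). 0)"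
      by (intro tendsto_sum nn_integral_tendsto_0_imp_integral i2 L2) simp
    then show ?thesis unfolding bend_def using i2 by simp
  qed
  \<comment> \<open>The allowance \<open>e\<close> serves the conclusion, the allowance
    \<open>h\<^sup>2\<close> the a priori bound: since \<open>ln (1 / h) \<ge> 1\<close> it only
    raises \<open>K\<close> to \<open>K + 1\<close>.\<close>
  have "min e (h\<^sup>2) > 0" using e h by simp
  then have "\<forall>\<^sub>F n in sequentially. energy h (Dn n) (D2n n) \<le> energy h Dy D2y + min e (h\<^sup>2)"
    by (rule energy_upper_semicontinuous[OF D h2 nW order_refl order_refl Q S])
  moreover have "\<forall>\<^sub>F n in sequentially. \<forall>x\<in>cball 0 1. dist (Y n x) (y x) < h / 2" by (rule uniform_limitD[OF U]) (use h in simp)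
  ultimately have "\<forall>\<^sub>F n in sequentially. energy h (Dn n) (D2n n) \<le> energy h Dy D2y + min e (h\<^sup>2) \<and> (\<forall>x\<in>cball 0 1. dist (Y n x) (y x) < h / 2)"
    by eventually_elim blast
  then obtain n where n: "energy h (Dn n) (D2n n) \<le> energy h Dy D2y + min e (h\<^sup>2)" "\<And>x. x \<in> cball 0 1 \<Longrightarrow> dist (Y n x) (y x) < h / 2"
    unfolding eventually_sequentially by blast
  define Z where "Z = (\<lambda>x. Y n x - Y n 0)"
  have CZ: "C2on (r n) Z (Dn n) (D2n n)"
    using C[of n] unfolding C2on_def Z_def by (auto intro: has_derivative_diff[OF _ has_derivative_const, simplified])
  interpret sm: smooth_map g g1 g2 g3 "r n" Z "Dn n" "D2n n" h
  proof
    show "C2on (r n) Z (Dn n) (D2n n)" by (rule CZ)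
    show "1 < r n" by (rule r)
    show "Z 0 = 0" by (simp add: Z_def)
    fix t
    have "norm ((Y n (circ t) - y (circ t)) - (Y n 0 - y 0)) \<le> h"
      using norm_triangle_ineq4[of "Y n (circ t) - y (circ t)" "Y n 0 - y 0"] n(2)[of "circ t"] n(2)[of 0] by (simp add: dist_norm)
    then show "norm (Z (circ t) - g t) \<le> h" using yb[of "circ t"] \<gamma>[of t] by (simp add: Z_def y0 algebra_simps)
  qed
  have en: "energy h (Dn n) (D2n n) = sm.MM + h\<^sup>2 * sm.BB" unfolding sm.MM_def sm.BB_def by (rule C2on_energy(3)[OF CZ r])
  have "h\<^sup>2 * 1 \<le> h\<^sup>2 * ln (1 / h)" using L by (intro mult_left_mono) auto
  then have "sm.MM + h\<^sup>2 * sm.BB \<le> h\<^sup>2 * ((K + 1) * ln (1 / h))" using n(1) E unfolding en by (simp add: algebra_simps)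
  from sm.lower_smooth[OF h L order_refl N this _ K2] K n(1)
  show "h\<^sup>2 * (kk * (ln (1 / h) - ln (ln (1 / h))) - 4 * (4 * pi * N\<^sup>2 + 3 / 4 * K2) - 3 / 2 * K2) \<le> energy h Dy D2y + e"
    unfolding en by simp
qed

end

theorem theorem1:
  fixes \<gamma> :: "real^2 \<Rightarrow> real^3"
  assumes "C3_circle \<gamma>"
    and "\<forall>x\<in>sphere 0 1. norm (\<gamma> x) = 1"
    and "\<forall>t. norm (vector_derivative (\<gamma> \<circ> circ) (at t)) = 1"
    and "\<not> (\<exists>n c. n \<noteq> 0 \<and> (\<forall>x\<in>sphere 0 1. n \<bullet> \<gamma> x = c))"
  shows "\<exists>C2 C3. \<exists>h0>0. \<forall>h. 0 < h \<and> h < h0 \<longrightarrow>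
    (\<exists>y Dy D2y. admissible \<gamma> y Dy D2y \<and>
       (\<forall>y' Dy' D2y'. admissible \<gamma> y' Dy' D2y' \<longrightarrow> energy h Dy D2y \<le> energy h Dy' D2y') \<and>
       C1const \<gamma> * ln (1/h) - C1const \<gamma> * ln (ln (1/h)) - C2 \<le> energy h Dy D2y / h\<^sup>2 \<and>
       energy h Dy D2y / h\<^sup>2 \<le> C1const \<gamma> * ln (1/h) + C3)"
proof -
  obtain g1 g2 g3 where gd: "\<And>t. ((\<gamma> \<circ> circ) has_vector_derivative g1 t) (at t)" "\<And>t. (g1 has_vector_derivative g2 t) (at t)"
    "\<And>t. (g2 has_vector_derivative g3 t) (at t)" and g3c: "continuous_on UNIV g3"
    using assms(1) unfolding C3_circle_def by blast
  interpret unit_curve "\<gamma> \<circ> circ" g1 g2 g3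
  proof
    show "(\<gamma> \<circ> circ) (t + 2 * pi) = (\<gamma> \<circ> circ) t" for t by (simp add: circ_def)
    show "norm ((\<gamma> \<circ> circ) t) = 1" for t using assms(2) by simp
    show "norm (g1 t) = 1" for t using assms(3) vector_derivative_at[OF gd(1)[of t]] by metis
  qed (rule gd g3c)+
  have \<gamma>: "\<gamma> (circ t) = (\<gamma> \<circ> circ) t" for t by simp
  note C1 = C1const_eq[of \<gamma>, OF \<gamma>]
  note adm = competitor_admissible[of \<gamma>, OF \<gamma>]
  obtain C3 where C3: "\<And>h. 0 < h \<Longrightarrow> h < 1 \<Longrightarrow> energy h (\<lambda>x. Dc ((1/h) *\<^sub>R x)) (\<lambda>x i j. (1/h) *\<^sub>R D2c ((1/h) *\<^sub>R x) i j) \<le> h\<^sup>2 * (kk * ln (1 / h) + C3)"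
    by (rule upper_bound) blast
  obtain N where N: "\<And>t. t \<in> {0..2*pi} \<Longrightarrow> norm (kap t) \<le> N" "\<And>t. t \<in> {0..2*pi} \<Longrightarrow> norm (g3 t + g1 t) \<le> N"
    by (rule kap_bound) blast
  \<comment> \<open>The competitor at scale 1/2 doubles as the smooth extension of the boundary
    data.\<close>
  have CY: "C2on 2 (\<lambda>x. (1/2) *\<^sub>R Yc ((1/(1/2)) *\<^sub>R x)) (\<lambda>x. Dc ((1/(1/2)) *\<^sub>R x)) (\<lambda>x i j. (1/(1/2)) *\<^sub>R D2c ((1/(1/2)) *\<^sub>R x) i j)"
    by (rule C2on_scale[OF _ C2on_Yc]) simp
  interpret boundary_ext \<gamma> 2 "\<lambda>x. (1/2) *\<^sub>R Yc ((1/(1/2)) *\<^sub>R x)" "\<lambda>x. Dc ((1/(1/2)) *\<^sub>R x)" "\<lambda>x i j. (1/(1/2)) *\<^sub>R D2c ((1/(1/2)) *\<^sub>R x) i j"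
    by unfold_locales (use CY adm[of "1/2"] in \<open>auto simp: admissible_def\<close>)
  \<comment> \<open>Absorbs the additive constant of the upper bound through
    \<open>ln (1 / h) \<ge> 1\<close>; the result is the energy bound that
    \<open>lower_bound\<close> assumes, with a constant independent of \<open>h\<close>.\<close>
  define K where "K = kk + \<bar>C3\<bar>"
  have K: "K \<ge> 0" using kk_nonneg by (simp add: K_def)
  define K2 where "K2 = 2 * (K + 1) + 10 * pi"
  define C2 where "C2 = 4 * (4 * pi * N\<^sup>2 + 3 / 4 * K2) + 3 / 2 * K2"
  have "\<exists>y Dy D2y. admissible \<gamma> y Dy D2y \<and>
       (\<forall>y' Dy' D2y'. admissible \<gamma> y' Dy' D2y' \<longrightarrow> energy h Dy D2y \<le> energy h Dy' D2y') \<and>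
       C1const \<gamma> * ln (1/h) - C1const \<gamma> * ln (ln (1/h)) - C2 \<le> energy h Dy D2y / h\<^sup>2 \<and>
       energy h Dy D2y / h\<^sup>2 \<le> C1const \<gamma> * ln (1/h) + C3" if h: "0 < h" "h < exp (-1)" for h
  proof -
    have "exp (-1) < (1::real)" by simp
    then have h1: "h < 1" using h by linarith
    \<comment> \<open>The threshold \<open>exp (-1)\<close> is chosen for this: the logarithm is at
      least 1, so lower-order constants can be absorbed into it.\<close>
    have "ln h < ln (exp (-1))" using h by (subst ln_less_cancel_iff) auto
    then have L: "ln (1 / h) \<ge> 1" using h by (simp add: ln_div)
    obtain y Dy D2y where y: "admissible \<gamma> y Dy D2y" and m: "\<And>y' D' D2'. admissible \<gamma> y' D' D2' \<Longrightarrow> energy h Dy D2y \<le> energy h D' D2'"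
      using minimizer_exists[OF h(1) adm[OF h(1) h1]] by blast
    have up: "energy h Dy D2y \<le> h\<^sup>2 * (kk * ln (1 / h) + C3)" by (rule order_trans[OF m[OF adm[OF h(1) h1]] C3[OF h(1) h1]])
    have "C3 \<le> \<bar>C3\<bar> * 1" by simp
    also have "\<dots> \<le> \<bar>C3\<bar> * ln (1 / h)" using L by (intro mult_left_mono) auto
    finally have "kk * ln (1 / h) + C3 \<le> K * ln (1 / h)" by (simp add: K_def distrib_right)
    then have "h\<^sup>2 * (kk * ln (1 / h) + C3) \<le> h\<^sup>2 * (K * ln (1 / h))" by (intro mult_left_mono) auto
    with up have E: "energy h Dy D2y \<le> h\<^sup>2 * (K * ln (1 / h))" by linarith
    note lo = lower_bound[of \<gamma>, OF \<gamma> y admissible_W4[OF y] h(1) less_imp_le[OF h1] L N E K K2_def]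
    have "kk * ln (1 / h) - kk * ln (ln (1 / h)) - C2 = kk * (ln (1 / h) - ln (ln (1 / h))) - 4 * (4 * pi * N\<^sup>2 + 3 / 4 * K2) - 3 / 2 * K2"
      by (simp add: C2_def right_diff_distrib)
    then have "kk * ln (1 / h) - kk * ln (ln (1 / h)) - C2 \<le> energy h Dy D2y / h\<^sup>2"
      using lo h by (simp only: pos_le_divide_eq zero_less_power mult.commute[of _ "h\<^sup>2"])
    moreover have "energy h Dy D2y / h\<^sup>2 \<le> kk * ln (1 / h) + C3"
      using up h by (simp add: pos_divide_le_eq mult.commute)
    ultimately show ?thesis using y m unfolding C1 by blast
  qed
  then show ?thesis by (intro exI[of _ C2] exI[of _ C3] exI[of _ "exp (-1)"] conjI) auto
qed

end
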